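(* Let $(M,\omega)$ be a symplectic manifold, $P\subset TM$ a real polarization, $\Phi:M\to M$ a symplectomorphism, and $(L,\nabla)\to M$ a prequantum line bundle. Let $\underline{\mathbb{C}}_M^\times$ be the sheaf of locally constant, non-vanishing complex-valued functions on $M$. If $\check{H}^1(M,\underline{\mathbb{C}}_M^\times)=0$, then $\Phi$ induces an isomorphism between the sheaf quantizations $$Q_{shf}(M,P,\nabla)\to Q_{shf}(M,\Phi^*P,\nabla).$$
   Context: Prequantum line bundle: a complex Hermitian line bundle $L\to M$ with a compatible connection (covariant derivative) $\nabla$ such that $curv(\nabla)=\omega$. Curvature convention: if $s$ is a non-vanishing local section and $\nabla s=i\alpha\otimes s$, then $curv(\nabla)=d\alpha$. Polarization: a (singular, real) polarization of $(M,\omega)$ is a smooth singular subbundle $P\subset TM$, i.e. a family of linear subspaces $P_x\subset T_xM$, possibly of varying dimension, such that each vector of $P_x$ is the value at $x$ of a smooth local section of $P$, whose sheaf of sections $\mathfrak{F}_P$ (smooth vector fields $X$ on $U$ with $X_x\in P_x$ for all $x \in U$) satisfies: (i) if $X,Y\in\mathfrak{F}_P$ then $[X,Y]\in\mathfrak{F}_P$; (ii) each $x\in M$ has an open neighbourhood $U$ and $X_1,\dots,X_k\in\mathfrak{F}_P(U)$ with $\mathfrak{F}_P(U)=\mathrm{span}_{C^\infty(U)}\{X_1,\dots,X_k\}$; (iii) there is an open dense subset $U\subset M$ such that $P_x\subset T_xM$ is Lagrangian for all $x\in U$. Pulled-back polarization: $(\Phi^*P)_x:=d_{\Phi(x)}\Phi^{-1}(P_{\Phi(x)})$;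 it is again a polarization. Sheaf of covariantly constant sections: for $U\subset M$ open, $\mathscr{S}_{(P,\nabla)}(U)=\{s\in\Gamma(U,L)\mid \nabla_Xs=0\ \text{for all } X\in\mathfrak{F}_P(U)\}$. Sheaf quantization: $Q_{shf}(M,P,\nabla)=\bigoplus_n\check{H}^n(M,\mathscr{S}_{(P,\nabla)})$, where $\check H^n$ is Čech cohomology. Lifts: a lift of $\Phi$ is a diffeomorphism $F:L\to L$ covering $\Phi$ (i.e. $\pi\circ F=\Phi\circ\pi$, where $\pi:L\to M$ is the projection) and restricting to linear isomorphisms $F_x:L_x\to L_{\Phi(x)}$. For $t\in\Gamma(\Phi^{-1}(U),L)$ put $(F_*t)(x)=F_{\Phi^{-1}(x)}(t(\Phi^{-1}(x)))$, and let $F^*\nabla$ be the connection determined by $F_*((F^*\nabla)_Xt)=\nabla_{\Phi_*X}(F_*t)$. Meaning of "$\Phi$ induces an isomorphism": there is a lift $F$ of $\Phi$ with $F^*\nabla=\nabla$ such that the isomorphism (of graded complex vector spaces) is the one obtained from the maps $s\mapsto (F_* )^{-1}s$, $\mathscr{S}_{(P,\nabla)}(U)\to\mathscr{S}_{(\Phi^*P,\nabla)}(\Phi^{-1}(U))$, applied to Čech cochains, a cochain on an open cover $\{U_j\}$ being sent to one on $\{\Phi^{-1}(U_j)\}$. *)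

theory Defs
  imports "HOL-Analysis.Analysis" "HOL-Algebra.Module" "HOL-Algebra.Elementary_Groups"
begin

section \<open>Smooth manifolds\<close>

text \<open>Manifolds are modelled on a finite-dimensional space of sort \<open>{real_inner, banach}\<close>.
  Unlike \<open>euclidean_space\<close>, this sort also admits the zero-dimensional space.
  On such a space, being \<open>C\<^sup>k\<close> can be tested on directional derivatives.\<close>

primrec Ck_on :: "nat \<Rightarrow> 'e::real_normed_vector set \<Rightarrow> ('e \<Rightarrow> 'b::real_normed_vector) \<Rightarrow> bool" where
  "Ck_on 0 S f \<longleftrightarrow> continuous_on S f"
| "Ck_on (Suc k) S f \<longleftrightarrow>
     (\<forall>x\<in>S. f differentiable (at x)) \<and> (\<forall>v. Ck_on k S (\<lambda>x. frechet_derivative f (at x) v))"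

definition smooth_on :: "'e::real_normed_vector set \<Rightarrow> ('e \<Rightarrow> 'b::real_normed_vector) \<Rightarrow> bool" where
  "smooth_on S f \<longleftrightarrow> open S \<and> (\<forall>k. Ck_on k S f)"

record ('a, 'e) mfd =
  mtop :: "'a topology"
  atlas :: "('a set \<times> ('a \<Rightarrow> 'e)) set"

abbreviation points :: "('a, 'e) mfd \<Rightarrow> 'a set" where
  "points M \<equiv> topspace (mtop M)"

definition smooth_manifold :: "('a, 'e::{real_inner,banach}) mfd \<Rightarrow> bool" where
  "smooth_manifold M \<longleftrightarrow>
     (\<exists>B::'e set. finite B \<and> span B = UNIV) \<and>
     Hausdorff_space (mtop M) \<and> second_countable (mtop M) \<and>
     (\<Union>(C, \<phi>)\<in>atlas M. C) = points M \<and>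
     (\<forall>(C, \<phi>)\<in>atlas M. openin (mtop M) C \<and> open (\<phi> ` C) \<and>
        homeomorphic_map (subtopology (mtop M) C) (top_of_set (\<phi> ` C)) \<phi>) \<and>
     (\<forall>(C, \<phi>)\<in>atlas M. \<forall>(D, \<psi>)\<in>atlas M. smooth_on (\<phi> ` (C \<inter> D)) (\<psi> \<circ> inv_into C \<phi>))"

definition smooth_fun ::
    "('a, 'e::{real_inner,banach}) mfd \<Rightarrow> 'a set \<Rightarrow> ('a \<Rightarrow> 'b::real_normed_vector) \<Rightarrow> bool" where
  "smooth_fun M U f \<longleftrightarrow> openin (mtop M) U \<and>
     (\<forall>(C, \<phi>)\<in>atlas M. smooth_on (\<phi> ` (U \<inter> C)) (f \<circ> inv_into C \<phi>))"

definition smooth_map ::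
    "('a, 'e::{real_inner,banach}) mfd \<Rightarrow> ('b, 'f::{real_inner,banach}) mfd \<Rightarrow> ('a \<Rightarrow> 'b) \<Rightarrow> bool" where
  "smooth_map M N F \<longleftrightarrow> continuous_map (mtop M) (mtop N) F \<and>
     (\<forall>(D, \<psi>)\<in>atlas N. smooth_fun M {x \<in> points M. F x \<in> D} (\<psi> \<circ> F))"

definition diffeo ::
    "('a, 'e::{real_inner,banach}) mfd \<Rightarrow> ('b, 'f::{real_inner,banach}) mfd \<Rightarrow> ('a \<Rightarrow> 'b) \<Rightarrow> bool" where
  "diffeo M N F \<longleftrightarrow> bij_betw F (points M) (points N) \<and>
     smooth_map M N F \<and> smooth_map N M (inv_into (points M) F)"

definition open_submfd :: "('a, 'e) mfd \<Rightarrow> 'a set \<Rightarrow> ('a, 'e) mfd" where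
  "open_submfd M U = \<lparr>mtop = subtopology (mtop M) U, atlas = (\<lambda>(C, \<phi>). (C \<inter> U, \<phi>)) ` atlas M\<rparr>"

definition prod_mfd :: "('a, 'e) mfd \<Rightarrow> ('b, 'f) mfd \<Rightarrow> ('a \<times> 'b, 'e \<times> 'f) mfd" where
  "prod_mfd M N = \<lparr>mtop = prod_topology (mtop M) (mtop N),
     atlas = {(C \<times> D, map_prod \<phi> \<psi>) | C \<phi> D \<psi>. (C, \<phi>) \<in> atlas M \<and> (D, \<psi>) \<in> atlas N}\<rparr>"

definition complex_mfd :: "(complex, complex) mfd" where
  "complex_mfd = \<lparr>mtop = euclidean, atlas = {(UNIV, id)}\<rparr>"


section \<open>Tangent vectors, vector fields and forms\<close>

text \<open>A tangent vector at \<open>x\<close> is a derivation at \<open>x\<close> on germs of smooth real functions. It is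
  represented as a functional on all functions, and it takes the value 0 on functions that are
  not smooth near \<open>x\<close>, so that equality of functionals is equality of tangent vectors.\<close>

type_synonym 'a tvec = "('a \<Rightarrow> real) \<Rightarrow> real"

definition smooth_near :: "('a, 'e::{real_inner,banach}) mfd \<Rightarrow> 'a \<Rightarrow> ('a \<Rightarrow> real) \<Rightarrow> bool" where
  "smooth_near M x f \<longleftrightarrow> (\<exists>U. x \<in> U \<and> smooth_fun M U f)"

definition tangent_space :: "('a, 'e::{real_inner,banach}) mfd \<Rightarrow> 'a \<Rightarrow> 'a tvec set" where
  "tangent_space M x = {v.
     (\<forall>f. \<not> smooth_near M x f \<longrightarrow> v f = 0) \<and>
     (\<forall>f g. smooth_near M x f \<longrightarrow> smooth_near M x g \<longrightarrow>
        (\<exists>U. openin (mtop M) U \<and> x \<in> U \<and> (\<forall>y\<in>U. f y = g y)) \<longrightarrow> v f = v g) \<and>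
     (\<forall>f g. smooth_near M x f \<longrightarrow> smooth_near M x g \<longrightarrow>
        v (\<lambda>y. f y + g y) = v f + v g \<and>
        v (\<lambda>y. f y * g y) = v f * g x + f x * v g) \<and>
     (\<forall>c f. smooth_near M x f \<longrightarrow> v (\<lambda>y. c * f y) = c * v f)}"

definition cderiv :: "'a tvec \<Rightarrow> ('a \<Rightarrow> complex) \<Rightarrow> complex" where
  "cderiv v g = Complex (v (\<lambda>y. Re (g y))) (v (\<lambda>y. Im (g y)))"

definition tangent_map ::
    "('a, 'e::{real_inner,banach}) mfd \<Rightarrow> ('b, 'f::{real_inner,banach}) mfd \<Rightarrow> ('a \<Rightarrow> 'b) \<Rightarrow> 'a
      \<Rightarrow> 'a tvec \<Rightarrow> 'b tvec" where
  "tangent_map M N F x v = (\<lambda>f. if smooth_near N (F x) f then v (f \<circ> F) else 0)"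

text \<open>Objects living over an open set \<open>U\<close> (vector fields, sections) are functions that are
  \<open>extensional\<close> on \<open>U\<close>; restriction to a smaller open set is \<open>restrict\<close>.\<close>

type_synonym 'a vfield = "'a \<Rightarrow> 'a tvec"

definition vector_fields :: "('a, 'e::{real_inner,banach}) mfd \<Rightarrow> 'a set \<Rightarrow> 'a vfield set" where
  "vector_fields M U = {X \<in> extensional U.
     (\<forall>x\<in>U. X x \<in> tangent_space M x) \<and>
     (\<forall>V f. openin (mtop M) V \<longrightarrow> V \<subseteq> U \<longrightarrow> smooth_fun M V f \<longrightarrow> smooth_fun M V (\<lambda>x. X x f))}"

definition vf_add :: "'a set \<Rightarrow> 'a vfield \<Rightarrow> 'a vfield \<Rightarrow> 'a vfield" where
  "vf_add U X Y = (\<lambda>x\<in>U. \<lambda>f. X x f + Y x f)"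

definition vf_scale :: "'a set \<Rightarrow> ('a \<Rightarrow> real) \<Rightarrow> 'a vfield \<Rightarrow> 'a vfield" where
  "vf_scale U g X = (\<lambda>x\<in>U. \<lambda>f. g x * X x f)"

definition lie_bracket ::
    "('a, 'e::{real_inner,banach}) mfd \<Rightarrow> 'a set \<Rightarrow> 'a vfield \<Rightarrow> 'a vfield \<Rightarrow> 'a vfield" where
  "lie_bracket M U X Y = (\<lambda>x\<in>U. \<lambda>f.
     if smooth_near M x f then X x (\<lambda>y. Y y f) - Y x (\<lambda>y. X y f) else 0)"

definition vf_push ::
    "('a, 'e::{real_inner,banach}) mfd \<Rightarrow> ('a \<Rightarrow> 'a) \<Rightarrow> 'a set \<Rightarrow> 'a vfield \<Rightarrow> 'a vfield" where
  "vf_push M \<Phi> U X = (\<lambda>y\<in>\<Phi> ` U.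
     let x = inv_into (points M) \<Phi> y in tangent_map M M \<Phi> x (X x))"

definition complex_one_form ::
    "('a, 'e::{real_inner,banach}) mfd \<Rightarrow> 'a set \<Rightarrow> ('a \<Rightarrow> 'a tvec \<Rightarrow> complex) \<Rightarrow> bool" where
  "complex_one_form M U \<alpha> \<longleftrightarrow>
     (\<forall>x\<in>U. \<forall>v\<in>tangent_space M x. \<forall>w\<in>tangent_space M x. \<forall>a b.
        \<alpha> x (\<lambda>f. a * v f + b * w f) = of_real a * \<alpha> x v + of_real b * \<alpha> x w) \<and>
     (\<forall>V X. openin (mtop M) V \<longrightarrow> V \<subseteq> U \<longrightarrow> X \<in> vector_fields M V \<longrightarrow>
        smooth_fun M V (\<lambda>x. \<alpha> x (X x)))"

text \<open>The value of \<open>d\<alpha>(X, Y)\<close> at a point \<open>x\<close> of \<open>U\<close>, for vector fields \<open>X\<close> and \<open>Y\<close> on \<open>U\<close>.\<close>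

definition ext_deriv1 ::
    "('a, 'e::{real_inner,banach}) mfd \<Rightarrow> 'a set \<Rightarrow> ('a \<Rightarrow> 'a tvec \<Rightarrow> complex)
      \<Rightarrow> 'a vfield \<Rightarrow> 'a vfield \<Rightarrow> 'a \<Rightarrow> complex" where
  "ext_deriv1 M U \<alpha> X Y x =
     cderiv (X x) (\<lambda>y. \<alpha> y (Y y)) - cderiv (Y x) (\<lambda>y. \<alpha> y (X y)) - \<alpha> x (lie_bracket M U X Y x)"

type_synonym 'a form2 = "'a \<Rightarrow> 'a tvec \<Rightarrow> 'a tvec \<Rightarrow> real"

definition two_form :: "('a, 'e::{real_inner,banach}) mfd \<Rightarrow> 'a form2 \<Rightarrow> bool" where
  "two_form M \<omega> \<longleftrightarrow>
     (\<forall>x\<in>points M. \<forall>u\<in>tangent_space M x. \<forall>v\<in>tangent_space M x. \<forall>w\<in>tangent_space M x. \<forall>a b.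
        \<omega> x (\<lambda>f. a * u f + b * v f) w = a * \<omega> x u w + b * \<omega> x v w \<and>
        \<omega> x v w = - \<omega> x w v) \<and>
     (\<forall>U X Y. openin (mtop M) U \<longrightarrow> X \<in> vector_fields M U \<longrightarrow> Y \<in> vector_fields M U \<longrightarrow>
        smooth_fun M U (\<lambda>x. \<omega> x (X x) (Y x)))"

definition ext_deriv2 ::
    "('a, 'e::{real_inner,banach}) mfd \<Rightarrow> 'a set \<Rightarrow> 'a form2
      \<Rightarrow> 'a vfield \<Rightarrow> 'a vfield \<Rightarrow> 'a vfield \<Rightarrow> 'a \<Rightarrow> real" where
  "ext_deriv2 M U \<omega> X Y Z x =
     X x (\<lambda>y. \<omega> y (Y y) (Z y)) - Y x (\<lambda>y. \<omega> y (X y) (Z y)) + Z x (\<lambda>y. \<omega> y (X y) (Y y))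
     - \<omega> x (lie_bracket M U X Y x) (Z x) + \<omega> x (lie_bracket M U X Z x) (Y x)
     - \<omega> x (lie_bracket M U Y Z x) (X x)"

definition symplectic_manifold :: "('a, 'e::{real_inner,banach}) mfd \<Rightarrow> 'a form2 \<Rightarrow> bool" where
  "symplectic_manifold M \<omega> \<longleftrightarrow> smooth_manifold M \<and> two_form M \<omega> \<and>
     (\<forall>x\<in>points M. \<forall>v\<in>tangent_space M x.
        (\<forall>w\<in>tangent_space M x. \<omega> x v w = 0) \<longrightarrow> v = (\<lambda>f. 0)) \<and>
     (\<forall>U X Y Z. openin (mtop M) U \<longrightarrow>
        X \<in> vector_fields M U \<longrightarrow> Y \<in> vector_fields M U \<longrightarrow> Z \<in> vector_fields M U \<longrightarrow>
        (\<forall>x\<in>U. ext_deriv2 M U \<omega> X Y Z x = 0))"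

definition symplectomorphism ::
    "('a, 'e::{real_inner,banach}) mfd \<Rightarrow> 'a form2 \<Rightarrow> ('a \<Rightarrow> 'a) \<Rightarrow> bool" where
  "symplectomorphism M \<omega> \<Phi> \<longleftrightarrow> diffeo M M \<Phi> \<and>
     (\<forall>x\<in>points M. \<forall>v\<in>tangent_space M x. \<forall>w\<in>tangent_space M x.
        \<omega> (\<Phi> x) (tangent_map M M \<Phi> x v) (tangent_map M M \<Phi> x w) = \<omega> x v w)"


section \<open>Polarizations\<close>

definition subbundle_sections ::
    "('a, 'e::{real_inner,banach}) mfd \<Rightarrow> ('a \<Rightarrow> 'a tvec set) \<Rightarrow> 'a set \<Rightarrow> 'a vfield set" where
  "subbundle_sections M P U = {X \<in> vector_fields M U. \<forall>x\<in>U. X x \<in> P x}"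

definition lagrangian ::
    "('a, 'e::{real_inner,banach}) mfd \<Rightarrow> 'a form2 \<Rightarrow> 'a \<Rightarrow> 'a tvec set \<Rightarrow> bool" where
  "lagrangian M \<omega> x S \<longleftrightarrow> {v \<in> tangent_space M x. \<forall>w\<in>S. \<omega> x v w = 0} = S"

definition polarization ::
    "('a, 'e::{real_inner,banach}) mfd \<Rightarrow> 'a form2 \<Rightarrow> ('a \<Rightarrow> 'a tvec set) \<Rightarrow> bool" where
  "polarization M \<omega> P \<longleftrightarrow>
     (\<forall>x\<in>points M. P x \<subseteq> tangent_space M x \<and> (\<lambda>f. 0) \<in> P x \<and>
        (\<forall>v\<in>P x. \<forall>w\<in>P x. \<forall>a b. (\<lambda>f. a * v f + b * w f) \<in> P x)) \<and>
     (\<forall>x\<in>points M. \<forall>v\<in>P x. \<exists>U. openin (mtop M) U \<and> x \<in> U \<and>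
        (\<exists>X\<in>subbundle_sections M P U. X x = v)) \<and>
     (\<forall>U. openin (mtop M) U \<longrightarrow>
        (\<forall>X\<in>subbundle_sections M P U. \<forall>Y\<in>subbundle_sections M P U.
           lie_bracket M U X Y \<in> subbundle_sections M P U)) \<and>
     (\<forall>x\<in>points M. \<exists>U. openin (mtop M) U \<and> x \<in> U \<and>
        (\<exists>Xs. finite Xs \<and> Xs \<subseteq> subbundle_sections M P U \<and>
           subbundle_sections M P U =
             {(\<lambda>y\<in>U. \<lambda>f. \<Sum>X\<in>Xs. g X y * X y f) | g. \<forall>X\<in>Xs. smooth_fun M U (g X)})) \<and>
     (\<exists>U. openin (mtop M) U \<and> (mtop M) closure_of U = points M \<and>
        (\<forall>x\<in>U. lagrangian M \<omega> x (P x)))"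

definition pullback_polarization ::
    "('a, 'e::{real_inner,banach}) mfd \<Rightarrow> ('a \<Rightarrow> 'a) \<Rightarrow> ('a \<Rightarrow> 'a tvec set) \<Rightarrow> 'a \<Rightarrow> 'a tvec set" where
  "pullback_polarization M \<Phi> P x =
     tangent_map M M (inv_into (points M) \<Phi>) (\<Phi> x) ` P (\<Phi> x)"


section \<open>Prequantum line bundles\<close>

definition complex_ring :: "complex ring" where
  "complex_ring = \<lparr>carrier = UNIV, mult = (*), one = 1, zero = 0, add = (+)\<rparr>"

text \<open>Complex vector spaces are modules over \<open>complex_ring\<close>. The fields \<open>mult\<close> and \<open>one\<close>,
  which the \<open>module\<close> record inherits from rings, play no role and are left unspecified.\<close>

record ('l, 'f, 'a) lbundle =
  total :: "('l, 'f) mfd"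
  proj :: "'l \<Rightarrow> 'a"
  fibre :: "'a \<Rightarrow> (complex, 'l) module"

definition complex_line_bundle ::
    "('a, 'e::{real_inner,banach}) mfd \<Rightarrow> ('l, 'f::{real_inner,banach}, 'a) lbundle \<Rightarrow> bool" where
  "complex_line_bundle M L \<longleftrightarrow>
     smooth_manifold (total L) \<and> smooth_map (total L) M (proj L) \<and>
     (\<forall>x\<in>points M. module complex_ring (fibre L x) \<and>
        carrier (fibre L x) = {l \<in> points (total L). proj L l = x}) \<and>
     (\<forall>x\<in>points M. \<exists>U \<psi>. openin (mtop M) U \<and> x \<in> U \<and>
        diffeo (open_submfd (total L) {l \<in> points (total L). proj L l \<in> U})
          (prod_mfd (open_submfd M U) complex_mfd) \<psi> \<and>
        (\<forall>y\<in>U. \<forall>l\<in>carrier (fibre L y). fst (\<psi> l) = y \<and>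
           (\<forall>m\<in>carrier (fibre L y). snd (\<psi> (l \<oplus>\<^bsub>fibre L y\<^esub> m)) = snd (\<psi> l) + snd (\<psi> m)) \<and>
           (\<forall>z. snd (\<psi> (z \<odot>\<^bsub>fibre L y\<^esub> l)) = z * snd (\<psi> l))))"

type_synonym ('a, 'l) sect = "'a \<Rightarrow> 'l"

definition sections ::
    "('a, 'e::{real_inner,banach}) mfd \<Rightarrow> ('l, 'f::{real_inner,banach}, 'a) lbundle \<Rightarrow> 'a set
      \<Rightarrow> (complex, ('a, 'l) sect) module" where
  "sections M L U = \<lparr>
     carrier = {s \<in> extensional U.
       (\<forall>x\<in>U. s x \<in> carrier (fibre L x)) \<and> smooth_map (open_submfd M U) (total L) s},
     mult = undefined, one = undefined,
     zero = (\<lambda>x\<in>U. \<zero>\<^bsub>fibre L x\<^esub>),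
     add = (\<lambda>s t. \<lambda>x\<in>U. s x \<oplus>\<^bsub>fibre L x\<^esub> t x),
     smult = (\<lambda>z s. \<lambda>x\<in>U. z \<odot>\<^bsub>fibre L x\<^esub> s x)\<rparr>"

definition fun_smult ::
    "('l, 'f, 'a) lbundle \<Rightarrow> 'a set \<Rightarrow> ('a \<Rightarrow> complex) \<Rightarrow> ('a, 'l) sect \<Rightarrow> ('a, 'l) sect" where
  "fun_smult L U g s = (\<lambda>x\<in>U. g x \<odot>\<^bsub>fibre L x\<^esub> s x)"

definition hermitian_metric ::
    "('a, 'e::{real_inner,banach}) mfd \<Rightarrow> ('l, 'f::{real_inner,banach}, 'a) lbundle
      \<Rightarrow> ('l \<Rightarrow> 'l \<Rightarrow> complex) \<Rightarrow> bool" where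
  "hermitian_metric M L h \<longleftrightarrow>
     (\<forall>x\<in>points M. \<forall>l\<in>carrier (fibre L x). \<forall>m\<in>carrier (fibre L x).
        (\<forall>k\<in>carrier (fibre L x). h (l \<oplus>\<^bsub>fibre L x\<^esub> m) k = h l k + h m k) \<and>
        (\<forall>z. h (z \<odot>\<^bsub>fibre L x\<^esub> l) m = z * h l m) \<and>
        h m l = cnj (h l m) \<and>
        (l \<noteq> \<zero>\<^bsub>fibre L x\<^esub> \<longrightarrow> Re (h l l) > 0)) \<and>
     (\<forall>U s t. openin (mtop M) U \<longrightarrow>
        s \<in> carrier (sections M L U) \<longrightarrow> t \<in> carrier (sections M L U) \<longrightarrow>
        smooth_fun M U (\<lambda>x. h (s x) (t x)))"

text \<open>A connection is given on all open sets \<open>U\<close> compatibly with restriction; \<open>D U X s\<close> is the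
  covariant derivative on \<open>U\<close> of the section \<open>s\<close> along the vector field \<open>X\<close>.\<close>

type_synonym ('a, 'l) conn = "'a set \<Rightarrow> 'a vfield \<Rightarrow> ('a, 'l) sect \<Rightarrow> ('a, 'l) sect"

definition connection ::
    "('a, 'e::{real_inner,banach}) mfd \<Rightarrow> ('l, 'f::{real_inner,banach}, 'a) lbundle
      \<Rightarrow> ('a, 'l) conn \<Rightarrow> bool" where
  "connection M L D \<longleftrightarrow> (\<forall>U. openin (mtop M) U \<longrightarrow>
     (\<forall>X\<in>vector_fields M U. \<forall>s\<in>carrier (sections M L U).
        D U X s \<in> carrier (sections M L U) \<and>
        (\<forall>V. openin (mtop M) V \<longrightarrow> V \<subseteq> U \<longrightarrow>
           restrict (D U X s) V = D V (restrict X V) (restrict s V)) \<and>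
        (\<forall>Y\<in>vector_fields M U.
           D U (vf_add U X Y) s = D U X s \<oplus>\<^bsub>sections M L U\<^esub> D U Y s) \<and>
        (\<forall>g. smooth_fun M U g \<longrightarrow>
           D U (vf_scale U g X) s = fun_smult L U (\<lambda>x. of_real (g x)) (D U X s)) \<and>
        (\<forall>t\<in>carrier (sections M L U).
           D U X (s \<oplus>\<^bsub>sections M L U\<^esub> t) = D U X s \<oplus>\<^bsub>sections M L U\<^esub> D U X t) \<and>
        (\<forall>g. smooth_fun M U g \<longrightarrow>
           D U X (fun_smult L U g s) =
             fun_smult L U (\<lambda>x. cderiv (X x) g) s \<oplus>\<^bsub>sections M L U\<^esub> fun_smult L U g (D U X s))))"

definition hermitian_compatible ::
    "('a, 'e::{real_inner,banach}) mfd \<Rightarrow> ('l, 'f::{real_inner,banach}, 'a) lbundle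
      \<Rightarrow> ('l \<Rightarrow> 'l \<Rightarrow> complex) \<Rightarrow> ('a, 'l) conn \<Rightarrow> bool" where
  "hermitian_compatible M L h D \<longleftrightarrow>
     (\<forall>U X s t. openin (mtop M) U \<longrightarrow> X \<in> vector_fields M U \<longrightarrow>
        s \<in> carrier (sections M L U) \<longrightarrow> t \<in> carrier (sections M L U) \<longrightarrow>
        (\<forall>x\<in>U. cderiv (X x) (\<lambda>y. h (s y) (t y)) = h (D U X s x) (t x) + h (s x) (D U X t x)))"

text \<open>Whenever \<open>D s = i\<alpha> \<otimes> s\<close> for a non-vanishing local section \<open>s\<close>, the curvature is \<open>d\<alpha>\<close>;
  since \<open>s\<close> need not have unit length, \<open>\<alpha>\<close> is complex valued.\<close>

definition has_curvature ::
    "('a, 'e::{real_inner,banach}) mfd \<Rightarrow> ('l, 'f::{real_inner,banach}, 'a) lbundle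
      \<Rightarrow> ('a, 'l) conn \<Rightarrow> 'a form2 \<Rightarrow> bool" where
  "has_curvature M L D \<omega> \<longleftrightarrow>
     (\<forall>U s \<alpha>. openin (mtop M) U \<longrightarrow>
        s \<in> carrier (sections M L U) \<longrightarrow> (\<forall>x\<in>U. s x \<noteq> \<zero>\<^bsub>fibre L x\<^esub>) \<longrightarrow>
        complex_one_form M U \<alpha> \<longrightarrow>
        (\<forall>V X. openin (mtop M) V \<longrightarrow> V \<subseteq> U \<longrightarrow> X \<in> vector_fields M V \<longrightarrow>
           D V X (restrict s V) = fun_smult L V (\<lambda>x. \<i> * \<alpha> x (X x)) s) \<longrightarrow>
        (\<forall>V X Y. openin (mtop M) V \<longrightarrow> V \<subseteq> U \<longrightarrow>
           X \<in> vector_fields M V \<longrightarrow> Y \<in> vector_fields M V \<longrightarrow>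
           (\<forall>x\<in>V. ext_deriv1 M V \<alpha> X Y x = of_real (\<omega> x (X x) (Y x)))))"

definition prequantum_line_bundle ::
    "('a, 'e::{real_inner,banach}) mfd \<Rightarrow> 'a form2 \<Rightarrow> ('l, 'f::{real_inner,banach}, 'a) lbundle
      \<Rightarrow> ('l \<Rightarrow> 'l \<Rightarrow> complex) \<Rightarrow> ('a, 'l) conn \<Rightarrow> bool" where
  "prequantum_line_bundle M \<omega> L h D \<longleftrightarrow>
     complex_line_bundle M L \<and> hermitian_metric M L h \<and>
     connection M L D \<and> hermitian_compatible M L h D \<and> has_curvature M L D \<omega>"


section \<open>Lifts\<close>

definition bundle_lift ::
    "('a, 'e::{real_inner,banach}) mfd \<Rightarrow> ('l, 'f::{real_inner,banach}, 'a) lbundle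
      \<Rightarrow> ('a \<Rightarrow> 'a) \<Rightarrow> ('l \<Rightarrow> 'l) \<Rightarrow> bool" where
  "bundle_lift M L \<Phi> F \<longleftrightarrow> diffeo (total L) (total L) F \<and>
     (\<forall>l\<in>points (total L). proj L (F l) = \<Phi> (proj L l)) \<and>
     (\<forall>x\<in>points M. bij_betw F (carrier (fibre L x)) (carrier (fibre L (\<Phi> x))) \<and>
        (\<forall>l\<in>carrier (fibre L x).
           (\<forall>m\<in>carrier (fibre L x). F (l \<oplus>\<^bsub>fibre L x\<^esub> m) = F l \<oplus>\<^bsub>fibre L (\<Phi> x)\<^esub> F m) \<and>
           (\<forall>z. F (z \<odot>\<^bsub>fibre L x\<^esub> l) = z \<odot>\<^bsub>fibre L (\<Phi> x)\<^esub> F l)))"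

definition preim :: "('a, 'e) mfd \<Rightarrow> ('a \<Rightarrow> 'a) \<Rightarrow> 'a set \<Rightarrow> 'a set" where
  "preim M \<Phi> U = {x \<in> points M. \<Phi> x \<in> U}"

text \<open>\<open>sect_push M \<Phi> F U\<close> is \<open>F\<^sub>*\<close> from sections over \<open>\<Phi>\<^sup>-\<^sup>1(U)\<close> to sections over \<open>U\<close>, and
  \<open>sect_pull M L \<Phi> F U\<close> is its inverse.\<close>

definition sect_push ::
    "('a, 'e) mfd \<Rightarrow> ('a \<Rightarrow> 'a) \<Rightarrow> ('l \<Rightarrow> 'l) \<Rightarrow> 'a set \<Rightarrow> ('a, 'l) sect \<Rightarrow> ('a, 'l) sect" where
  "sect_push M \<Phi> F U t = (\<lambda>x\<in>U. F (t (inv_into (points M) \<Phi> x)))"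

definition sect_pull ::
    "('a, 'e) mfd \<Rightarrow> ('l, 'f, 'a) lbundle \<Rightarrow> ('a \<Rightarrow> 'a) \<Rightarrow> ('l \<Rightarrow> 'l) \<Rightarrow> 'a set
      \<Rightarrow> ('a, 'l) sect \<Rightarrow> ('a, 'l) sect" where
  "sect_pull M L \<Phi> F U s = (\<lambda>x\<in>preim M \<Phi> U. inv_into (points (total L)) F (s (\<Phi> x)))"

definition pullback_connection ::
    "('a, 'e::{real_inner,banach}) mfd \<Rightarrow> ('l, 'f, 'a) lbundle \<Rightarrow> ('a \<Rightarrow> 'a) \<Rightarrow> ('l \<Rightarrow> 'l)
      \<Rightarrow> ('a, 'l) conn \<Rightarrow> ('a, 'l) conn" where
  "pullback_connection M L \<Phi> F D = (\<lambda>V X t.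
     sect_pull M L \<Phi> F (\<Phi> ` V) (D (\<Phi> ` V) (vf_push M \<Phi> V X) (sect_push M \<Phi> F (\<Phi> ` V) t)))"

definition same_connection ::
    "('a, 'e::{real_inner,banach}) mfd \<Rightarrow> ('l, 'f::{real_inner,banach}, 'a) lbundle
      \<Rightarrow> ('a, 'l) conn \<Rightarrow> ('a, 'l) conn \<Rightarrow> bool" where
  "same_connection M L D D' \<longleftrightarrow>
     (\<forall>U X s. openin (mtop M) U \<longrightarrow> X \<in> vector_fields M U \<longrightarrow> s \<in> carrier (sections M L U) \<longrightarrow>
        D U X s = D' U X s)"


section \<open>Cech cohomology\<close>

text \<open>Sheaves of abelian groups are given by their groups of sections \<open>G U\<close>, written
  multiplicatively, whose elements are functions extensional on \<open>U\<close>; the restriction maps are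
  restrictions of functions. An open cover is a set of open sets indexed by itself, and an
  \<open>n\<close>-cochain assigns a section over \<open>U\<^sub>0 \<inter> \<dots> \<inter> U\<^sub>n\<close> to every list \<open>[U\<^sub>0, \<dots>, U\<^sub>n]\<close> of
  members of the cover.\<close>

definition open_cover :: "'a topology \<Rightarrow> 'a set set \<Rightarrow> bool" where
  "open_cover T \<U> \<longleftrightarrow> (\<forall>U\<in>\<U>. openin T U) \<and> \<Union>\<U> = topspace T"

definition cech_index :: "nat \<Rightarrow> 'a set set \<Rightarrow> 'a set list set" where
  "cech_index n \<U> = {Us. length Us = Suc n \<and> set Us \<subseteq> \<U>}"

type_synonym ('a, 'b) cochain = "'a set list \<Rightarrow> 'a \<Rightarrow> 'b"

definition cech_cochains ::
    "('a set \<Rightarrow> ('a \<Rightarrow> 'b, 'm) monoid_scheme) \<Rightarrow> nat \<Rightarrow> 'a set set \<Rightarrow> ('a, 'b) cochain set" where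
  "cech_cochains G n \<U> = (\<Pi>\<^sub>E Us\<in>cech_index n \<U>. carrier (G (\<Inter>(set Us))))"

definition remove_nth :: "nat \<Rightarrow> 'x list \<Rightarrow> 'x list" where
  "remove_nth k xs = take k xs @ drop (Suc k) xs"

definition cech_coboundary ::
    "('a set \<Rightarrow> ('a \<Rightarrow> 'b, 'm) monoid_scheme) \<Rightarrow> nat \<Rightarrow> 'a set set
      \<Rightarrow> ('a, 'b) cochain \<Rightarrow> ('a, 'b) cochain" where
  "cech_coboundary G n \<U> c = (\<lambda>Us\<in>cech_index (Suc n) \<U>.
     let W = \<Inter>(set Us) in
     \<Otimes>\<^bsub>G W\<^esub>k\<in>{..Suc n}. restrict (c (remove_nth k Us)) W [^]\<^bsub>G W\<^esub> ((-1) ^ k :: int))"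

definition cech_one ::
    "('a set \<Rightarrow> ('a \<Rightarrow> 'b, 'm) monoid_scheme) \<Rightarrow> nat \<Rightarrow> 'a set set \<Rightarrow> ('a, 'b) cochain" where
  "cech_one G n \<U> = (\<lambda>Us\<in>cech_index n \<U>. \<one>\<^bsub>G (\<Inter>(set Us))\<^esub>)"

definition cech_mult ::
    "('a set \<Rightarrow> ('a \<Rightarrow> 'b, 'm) monoid_scheme) \<Rightarrow> nat \<Rightarrow> 'a set set
      \<Rightarrow> ('a, 'b) cochain \<Rightarrow> ('a, 'b) cochain \<Rightarrow> ('a, 'b) cochain" where
  "cech_mult G n \<U> c d = (\<lambda>Us\<in>cech_index n \<U>. c Us \<otimes>\<^bsub>G (\<Inter>(set Us))\<^esub> d Us)"

definition cech_coboundaries ::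
    "('a set \<Rightarrow> ('a \<Rightarrow> 'b, 'm) monoid_scheme) \<Rightarrow> nat \<Rightarrow> 'a set set \<Rightarrow> ('a, 'b) cochain set" where
  "cech_coboundaries G n \<U> = (case n of
     0 \<Rightarrow> {cech_one G 0 \<U>}
   | Suc m \<Rightarrow> cech_coboundary G m \<U> ` cech_cochains G m \<U>)"

definition cech_cocycles ::
    "'a topology \<Rightarrow> ('a set \<Rightarrow> ('a \<Rightarrow> 'b, 'm) monoid_scheme) \<Rightarrow> nat
      \<Rightarrow> ('a set set \<times> ('a, 'b) cochain) set" where
  "cech_cocycles T G n = {(\<U>, c). open_cover T \<U> \<and> c \<in> cech_cochains G n \<U> \<and>
     cech_coboundary G n \<U> c = cech_one G (Suc n) \<U>}"

definition refinement_map :: "'a set set \<Rightarrow> 'a set set \<Rightarrow> ('a set \<Rightarrow> 'a set) \<Rightarrow> bool" where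
  "refinement_map \<W> \<U> \<rho> \<longleftrightarrow> (\<forall>W\<in>\<W>. \<rho> W \<in> \<U> \<and> W \<subseteq> \<rho> W)"

definition cech_refine ::
    "nat \<Rightarrow> 'a set set \<Rightarrow> ('a set \<Rightarrow> 'a set) \<Rightarrow> ('a, 'b) cochain \<Rightarrow> ('a, 'b) cochain" where
  "cech_refine n \<W> \<rho> c = (\<lambda>Ws\<in>cech_index n \<W>. restrict (c (map \<rho> Ws)) (\<Inter>(set Ws)))"

text \<open>Cech cohomology is the direct limit over all open covers: cocycles on two covers are
  identified if they become cohomologous on a common refinement.\<close>

definition cech_rel ::
    "'a topology \<Rightarrow> ('a set \<Rightarrow> ('a \<Rightarrow> 'b, 'm) monoid_scheme) \<Rightarrow> nat
      \<Rightarrow> ('a set set \<times> ('a, 'b) cochain) rel" where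
  "cech_rel T G n = {((\<U>, c), (\<V>, d)).
     (\<U>, c) \<in> cech_cocycles T G n \<and> (\<V>, d) \<in> cech_cocycles T G n \<and>
     (\<exists>\<W> \<rho> \<sigma>. open_cover T \<W> \<and> refinement_map \<W> \<U> \<rho> \<and> refinement_map \<W> \<V> \<sigma> \<and>
        (\<exists>b\<in>cech_coboundaries G n \<W>.
           cech_refine n \<W> \<rho> c = cech_mult G n \<W> (cech_refine n \<W> \<sigma> d) b))}"

definition cech_class ::
    "'a topology \<Rightarrow> ('a set \<Rightarrow> ('a \<Rightarrow> 'b, 'm) monoid_scheme) \<Rightarrow> nat
      \<Rightarrow> 'a set set \<times> ('a, 'b) cochain \<Rightarrow> ('a set set \<times> ('a, 'b) cochain) set" where
  "cech_class T G n z = cech_rel T G n `` {z}"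

text \<open>Any two classes have representatives on the same cover, and the class of the product of
  such representatives does not depend on their choice, so all the sets in the union below are equal.\<close>

definition cech_group ::
    "'a topology \<Rightarrow> ('a set \<Rightarrow> ('a \<Rightarrow> 'b, 'm) monoid_scheme) \<Rightarrow> nat
      \<Rightarrow> ('a set set \<times> ('a, 'b) cochain) set monoid" where
  "cech_group T G n = \<lparr>
     carrier = cech_cocycles T G n // cech_rel T G n,
     mult = (\<lambda>A B. \<Union>{cech_class T G n (\<U>, cech_mult G n \<U> c d) | \<U> c d.
                        (\<U>, c) \<in> A \<and> (\<U>, d) \<in> B}),
     one = cech_class T G n ({topspace T}, cech_one G n {topspace T})\<rparr>"

type_synonym ('a, 'b) cech = "('a set set \<times> ('a, 'b) cochain) set"

text \<open>For a sheaf \<open>S\<close> of complex vector spaces, the cohomology is a complex vector space.\<close>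

definition cech_module ::
    "'a topology \<Rightarrow> ('a set \<Rightarrow> (complex, 'a \<Rightarrow> 'b) module) \<Rightarrow> nat
      \<Rightarrow> (complex, ('a, 'b) cech) module" where
  "cech_module T S n = (let G = (\<lambda>U. add_monoid (S U)) in \<lparr>
     carrier = carrier (cech_group T G n),
     mult = undefined, one = undefined,
     zero = \<one>\<^bsub>cech_group T G n\<^esub>,
     add = (\<otimes>\<^bsub>cech_group T G n\<^esub>),
     smult = (\<lambda>z A. \<Union>{cech_class T G n
                (\<U>, \<lambda>Us\<in>cech_index n \<U>. z \<odot>\<^bsub>S (\<Inter>(set Us))\<^esub> c Us) | \<U> c. (\<U>, c) \<in> A})\<rparr>)"

definition graded_sum :: "(nat \<Rightarrow> (complex, 'v) module) \<Rightarrow> (complex, nat \<Rightarrow> 'v) module" where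
  "graded_sum H = \<lparr>
     carrier = {q. (\<forall>n. q n \<in> carrier (H n)) \<and> finite {n. q n \<noteq> \<zero>\<^bsub>H n\<^esub>}},
     mult = undefined, one = undefined,
     zero = (\<lambda>n. \<zero>\<^bsub>H n\<^esub>),
     add = (\<lambda>p q n. p n \<oplus>\<^bsub>H n\<^esub> q n),
     smult = (\<lambda>z q n. z \<odot>\<^bsub>H n\<^esub> q n)\<rparr>"

definition graded_incl :: "(nat \<Rightarrow> (complex, 'v) module) \<Rightarrow> nat \<Rightarrow> 'v \<Rightarrow> nat \<Rightarrow> 'v" where
  "graded_incl H n v = (\<lambda>m. \<zero>\<^bsub>H m\<^esub>)(n := v)"

definition graded_iso ::
    "(nat \<Rightarrow> (complex, 'v) module) \<Rightarrow> (nat \<Rightarrow> (complex, 'w) module)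
      \<Rightarrow> ((nat \<Rightarrow> 'v) \<Rightarrow> (nat \<Rightarrow> 'w)) set" where
  "graded_iso H K = {T.
     bij_betw T (carrier (graded_sum H)) (carrier (graded_sum K)) \<and>
     (\<forall>p\<in>carrier (graded_sum H). \<forall>q\<in>carrier (graded_sum H).
        T (p \<oplus>\<^bsub>graded_sum H\<^esub> q) = T p \<oplus>\<^bsub>graded_sum K\<^esub> T q) \<and>
     (\<forall>z. \<forall>q\<in>carrier (graded_sum H). T (z \<odot>\<^bsub>graded_sum H\<^esub> q) = z \<odot>\<^bsub>graded_sum K\<^esub> T q) \<and>
     (\<forall>n. T ` graded_incl H n ` carrier (H n) = graded_incl K n ` carrier (K n))}"


section \<open>The sheaves and the quantization\<close>

definition locally_constant_units :: "'a topology \<Rightarrow> 'a set \<Rightarrow> ('a \<Rightarrow> complex) monoid" where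
  "locally_constant_units T U = \<lparr>
     carrier = {f \<in> extensional U. (\<forall>x\<in>U. f x \<noteq> 0) \<and>
       (\<forall>x\<in>U. \<exists>V. openin T V \<and> x \<in> V \<and> V \<subseteq> U \<and> (\<forall>y\<in>V. f y = f x))},
     mult = (\<lambda>f g. \<lambda>x\<in>U. f x * g x),
     one = (\<lambda>x\<in>U. 1)\<rparr>"

definition cov_const_sections ::
    "('a, 'e::{real_inner,banach}) mfd \<Rightarrow> ('l, 'f::{real_inner,banach}, 'a) lbundle
      \<Rightarrow> ('a \<Rightarrow> 'a tvec set) \<Rightarrow> ('a, 'l) conn \<Rightarrow> 'a set \<Rightarrow> (complex, ('a, 'l) sect) module" where
  "cov_const_sections M L P D U = (sections M L U)\<lparr>carrier :=
     {s \<in> carrier (sections M L U).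
        \<forall>X\<in>subbundle_sections M P U. D U X s = \<zero>\<^bsub>sections M L U\<^esub>}\<rparr>"

text \<open>The graded pieces of the sheaf quantization; the quantization is their \<open>graded_sum\<close>.\<close>

definition sheaf_quantization ::
    "('a, 'e::{real_inner,banach}) mfd \<Rightarrow> ('l, 'f::{real_inner,banach}, 'a) lbundle
      \<Rightarrow> ('a \<Rightarrow> 'a tvec set) \<Rightarrow> ('a, 'l) conn \<Rightarrow> nat \<Rightarrow> (complex, ('a, 'l) cech) module" where
  "sheaf_quantization M L P D n = cech_module (mtop M) (cov_const_sections M L P D) n"

definition quantization_class ::
    "('a, 'e::{real_inner,banach}) mfd \<Rightarrow> ('l, 'f::{real_inner,banach}, 'a) lbundle
      \<Rightarrow> ('a \<Rightarrow> 'a tvec set) \<Rightarrow> ('a, 'l) conn \<Rightarrow> nat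
      \<Rightarrow> 'a set set \<times> ('a, 'l) cochain \<Rightarrow> nat \<Rightarrow> ('a, 'l) cech" where
  "quantization_class M L P D n z =
     graded_incl (sheaf_quantization M L P D) n
       (cech_class (mtop M) (\<lambda>U. add_monoid (cov_const_sections M L P D U)) n z)"

text \<open>A cochain on \<open>\<U>\<close> is sent to the cochain on \<open>{\<Phi>\<^sup>-\<^sup>1(U) | U \<in> \<U>}\<close> whose value at
  \<open>[\<Phi>\<^sup>-\<^sup>1(U\<^sub>0), \<dots>, \<Phi>\<^sup>-\<^sup>1(U\<^sub>n)]\<close> is \<open>(F\<^sub>*)\<^sup>-\<^sup>1\<close> of the value at \<open>[U\<^sub>0, \<dots>, U\<^sub>n]\<close>; here
  \<open>U\<^sub>j\<close> is recovered from \<open>\<Phi>\<^sup>-\<^sup>1(U\<^sub>j)\<close> as its image under \<open>\<Phi>\<close>.\<close>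

definition cochain_pull ::
    "('a, 'e) mfd \<Rightarrow> ('l, 'f, 'a) lbundle \<Rightarrow> ('a \<Rightarrow> 'a) \<Rightarrow> ('l \<Rightarrow> 'l) \<Rightarrow> nat
      \<Rightarrow> 'a set set \<times> ('a, 'l) cochain \<Rightarrow> 'a set set \<times> ('a, 'l) cochain" where
  "cochain_pull M L \<Phi> F n = (\<lambda>(\<U>, c).
     (preim M \<Phi> ` \<U>,
      \<lambda>Vs\<in>cech_index n (preim M \<Phi> ` \<U>).
        let Us = map ((`) \<Phi>) Vs in sect_pull M L \<Phi> F (\<Inter>(set Us)) (c Us)))"

definition induces_isomorphism ::
    "('a, 'e::{real_inner,banach}) mfd \<Rightarrow> ('l, 'f::{real_inner,banach}, 'a) lbundle
      \<Rightarrow> ('a \<Rightarrow> 'a tvec set) \<Rightarrow> ('a, 'l) conn \<Rightarrow> ('a \<Rightarrow> 'a) \<Rightarrow> bool" where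
  "induces_isomorphism M L P D \<Phi> \<longleftrightarrow>
     (\<exists>F. bundle_lift M L \<Phi> F \<and>
        same_connection M L (pullback_connection M L \<Phi> F D) D \<and>
        (\<exists>T \<in> graded_iso (sheaf_quantization M L P D)
                (sheaf_quantization M L (pullback_polarization M \<Phi> P) D).
           \<forall>n. \<forall>z\<in>cech_cocycles (mtop M) (\<lambda>U. add_monoid (cov_const_sections M L P D U)) n.
             T (quantization_class M L P D n z) =
               quantization_class M L (pullback_polarization M \<Phi> P) D n
                 (cochain_pull M L \<Phi> F n z)))"

end

theory Submission
  imports Defs
begin

text \<open>
  Over a small open set \<open>U\<close>, choose non-vanishing sections \<open>s\<close> on \<open>U\<close> and \<open>s'\<close> on \<open>\<Phi> U\<close>
  with \<open>\<nabla> s = i\<alpha> \<otimes> s\<close> and \<open>\<nabla> s' = i\<alpha>' \<otimes> s'\<close>. Both \<open>\<alpha>\<close> and \<open>\<Phi>\<^sup>*\<alpha>'\<close> have differential \<open>\<omega>\<close>,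
  since \<open>\<Phi>\<close> preserves \<open>\<omega>\<close>, so by the Poincare lemma \<open>i(\<alpha> - \<Phi>\<^sup>*\<alpha>') = dg\<close>, and
  \<open>s \<mapsto> exp(g) s'\<close> is a lift of \<open>\<Phi>\<close> over \<open>U\<close> that preserves the connection. Two such lifts differ
  by a locally constant unit; the resulting cocycle is a coboundary by assumption, so the
  local lifts can be rescaled by locally constant functions to a global lift \<open>F\<close>. Pulling sections
  back along \<open>F\<close> is then an isomorphism between the sheaves of covariantly constant sections
  that covers \<open>\<Phi>\<close>, and it induces the isomorphism on Cech cohomology.
\<close>

section \<open>Smooth functions on a finite-dimensional space\<close>

text \<open>Three features of the encoding shape the argument. Model spaces may be zero-dimensional
  and carry no distinguished basis, so all coordinate work runs over a finite family that
  reconstructs every vector. The connection is an operator on vector fields and sections, not a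
  pointwise object, so a connection form has to be extracted from it by function-linearity along
  coordinate fields. Covariant constancy over \<open>U\<close> is tested only against sections of
  \<open>P\<close> over the same \<open>U\<close>; that restrictions stay covariantly constant
  therefore needs bump functions, and with them the Hausdorff property of the manifold.

  The local frames are not normalised, so \<alpha> and \<alpha>' are complex valued, exp(g) need not
  have modulus one, and the ratios of local lifts range over all non-zero complex numbers. This is
  why the obstruction lies in the sheaf of locally constant non-vanishing complex functions.
  Cohomology being a limit over covers, its vanishing makes the cocycle of ratios a coboundary only
  after a refinement, and the local lifts are corrected there.\<close>

definition frame :: "'e::real_inner set \<Rightarrow> bool" where
  "frame E \<longleftrightarrow> finite E \<and> (\<forall>x. (\<Sum>e\<in>E. (x \<bullet> e) *\<^sub>R e) = x)"

text \<open>Normalising the non-zero members of an orthogonal spanning family gives the expansion.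
  Only this reconstruction property is recorded; it makes sense for every model space, the
  zero-dimensional one with \<open>E = {}\<close> included.\<close>

lemma frame_exists:
  fixes B :: "'e::real_inner set"
  assumes "finite B" "span B = UNIV"
  shows "\<exists>E::'e set. frame E"
proof -
  obtain C where "finite C \<and> card C \<le> card B \<and> span C = span B \<and> pairwise orthogonal C"
    using basis_orthogonal[OF assms(1)] by blast
  then have C: "finite C" "span C = UNIV" "pairwise orthogonal C" using assms(2) by auto
  define E where "E = (\<lambda>c. c /\<^sub>R norm c) ` (C - {0})"
  have fin: "finite E" using C by (simp add: E_def)
  have inj: "inj_on (\<lambda>c. c /\<^sub>R norm c) (C - {0})"
  proof (rule inj_onI, rule ccontr)
    fix c d assume cd: "c \<in> C - {0}" "d \<in> C - {0}" "c /\<^sub>R norm c = d /\<^sub>R norm d" "c \<noteq> d"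
    then have "c \<bullet> d = 0" using C(3) unfolding pairwise_def orthogonal_def by auto
    then have "(c /\<^sub>R norm c) \<bullet> (d /\<^sub>R norm d) = 0" by simp
    then show False using cd by (simp add: inner_eq_zero_iff)
  qed
  have "(\<Sum>e\<in>E. (x \<bullet> e) *\<^sub>R e) = x" for x
  proof -
    have "x \<in> span C" using C by simp
    then show ?thesis
    proof (induction rule: Real_Vector_Spaces.span_induct)
      case base then show ?case by (auto simp: subspace_def inner_add_left scaleR_add_left
            sum.distrib scaleR_scaleR[symmetric] scaleR_right.sum[symmetric] simp del: scaleR_scaleR)
    next
      case (step c)
      have "(\<Sum>e\<in>E. (c \<bullet> e) *\<^sub>R e) = (\<Sum>d\<in>C-{0}. (c \<bullet> (d /\<^sub>R norm d)) *\<^sub>R (d /\<^sub>R norm d))"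
        unfolding E_def using inj by (simp add: sum.reindex)
      also have "\<dots> = (\<Sum>d\<in>C-{0}. if d = c then c else 0)"
      proof (intro sum.cong refl)
        fix d assume d: "d \<in> C - {0}"
        show "(c \<bullet> (d /\<^sub>R norm d)) *\<^sub>R (d /\<^sub>R norm d) = (if d = c then c else 0)"
        proof (cases "d = c")
          case True
          moreover have "inverse (norm d) * (norm d * norm d) * inverse (norm d) = 1"
            using d by (simp add: field_simps)
          ultimately show ?thesis by (simp add: dot_square_norm power2_eq_square)
        next
          case False
          then have "c \<bullet> d = 0" using C(3) step d unfolding pairwise_def orthogonal_def by auto
          then show ?thesis using False by simp
        qed
      qed
      \<comment> \<open>For \<open>c = 0\<close> no index matches, but then both sides
        vanish.\<close>
      also have "\<dots> = c" using step C(1) by (cases "c = 0") (auto simp: sum.delta)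
      finally show ?case .
    qed
  qed
  then show ?thesis using fin unfolding frame_def by blast
qed

lemma frame_finite: "frame E \<Longrightarrow> finite E"
  by (simp add: frame_def)

lemma frame_expand: "frame E \<Longrightarrow> (\<Sum>e\<in>E. (x \<bullet> e) *\<^sub>R e) = x"
  by (simp add: frame_def)

lemma frame_linear:
  assumes "frame E" "linear f"
  shows "f x = (\<Sum>e\<in>E. (x \<bullet> e) *\<^sub>R f e)"
  using arg_cong[OF frame_expand[OF assms(1), of x], of f] assms(2)
  by (simp add: linear_sum linear_scale)

section \<open>Calculus of maps of class C^k on open sets\<close>

lemma frechet_derivative_cong:
  assumes "open S" "x \<in> S" "\<And>y. y \<in> S \<Longrightarrow> f y = g y"
  shows "frechet_derivative f (at x) = frechet_derivative g (at x)"
proof -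
  have "(f has_derivative D) (at x) \<longleftrightarrow> (g has_derivative D) (at x)" for D
    using assms has_derivative_transform_within_open[of f D x UNIV S g]
      has_derivative_transform_within_open[of g D x UNIV S f] by metis
  then show ?thesis unfolding frechet_derivative_def by presburger
qed

lemma differentiable_cong:
  assumes "open S" "x \<in> S" "\<And>y. y \<in> S \<Longrightarrow> f y = g y" "f differentiable at x"
  shows "g differentiable at x"
  using assms has_derivative_transform_within_open[of f _ x UNIV S g]
  unfolding differentiable_def by metis

lemma Ck_on_cong:
  assumes "open S" "\<And>y. y \<in> S \<Longrightarrow> f y = g y" "Ck_on k S f"
  shows "Ck_on k S g"
  using assms
proof (induction k arbitrary: f g)
  case 0
  then show ?case using continuous_on_cong[of S S f g] by simp
next
  case (Suc k)
  have "Ck_on k S (\<lambda>x. frechet_derivative g (at x) v)" for v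
    by (rule Suc.IH[of "\<lambda>x. frechet_derivative f (at x) v"])
      (use Suc.prems frechet_derivative_cong[OF Suc.prems(1) _ Suc.prems(2)] in auto)
  then show ?case using Suc.prems differentiable_cong[OF Suc.prems(1) _ Suc.prems(2)] by simp
qed

lemma Ck_on_subset: "Ck_on k S f \<Longrightarrow> T \<subseteq> S \<Longrightarrow> Ck_on k T f"
  by (induction k arbitrary: f) (auto intro: continuous_on_subset)

lemma Ck_on_SucD: "Ck_on (Suc k) S f \<Longrightarrow> Ck_on k S f"
  by (induction k arbitrary: f)
    (auto simp: continuous_on_eq_continuous_within
      intro!: continuous_at_imp_continuous_at_within[OF differentiable_imp_continuous_within])

lemma Ck_on_local:
  assumes "\<And>x. x \<in> S \<Longrightarrow> \<exists>T. open T \<and> x \<in> T \<and> Ck_on k T f"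
  shows "Ck_on k S f"
  using assms
proof (induction k arbitrary: f)
  case 0
  show ?case
    unfolding Ck_on.simps continuous_on_eq_continuous_within
  proof
    fix x assume "x \<in> S"
    then obtain T where "open T" "x \<in> T" "continuous_on T f" using 0 by auto
    then show "continuous (at x within S) f"
      by (simp add: continuous_at_imp_continuous_at_within continuous_on_eq_continuous_at)
  qed
next
  case (Suc k)
  have "f differentiable at x" if "x \<in> S" for x using Suc.prems[OF that] by auto
  moreover have "Ck_on k S (\<lambda>x. frechet_derivative f (at x) v)" for v
    by (rule Suc.IH) (use Suc.prems in \<open>metis Ck_on.simps(2)\<close>)
  ultimately show ?case by simp
qed

text \<open>\<open>Ck_on\<close> speaks of \<open>frechet_derivative\<close>, while the rules of
  calculus produce \<open>has_derivative\<close> facts. Uniqueness of derivatives identifies the two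
  on \<open>S\<close>, and since \<open>S\<close> is open the identification survives further
  differentiation.\<close>

lemma Ck_on_SucI:
  assumes "open S" "\<And>x. x \<in> S \<Longrightarrow> (f has_derivative f' x) (at x)"
    "\<And>v. Ck_on k S (\<lambda>x. f' x v)"
  shows "Ck_on (Suc k) S f"
proof -
  have "Ck_on k S (\<lambda>x. frechet_derivative f (at x) v)" for v
    by (rule Ck_on_cong[OF assms(1) _ assms(3)[of v]]) (metis assms(2) frechet_derivative_at)
  then show ?thesis using assms(2) by (auto simp: differentiable_def)
qed

lemma Ck_on_has_derivative:
  "Ck_on (Suc k) S f \<Longrightarrow> x \<in> S \<Longrightarrow> (f has_derivative frechet_derivative f (at x)) (at x)"
  by (simp add: frechet_derivative_works[symmetric])

lemma Ck_on_frechet_derivative: "Ck_on (Suc k) S f \<Longrightarrow> Ck_on k S (\<lambda>x. frechet_derivative f (at x) v)"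
  by simp

lemma Ck_on_const [simp]: "Ck_on k S (\<lambda>x. c)"
proof (induction k arbitrary: c)
  case (Suc k)
  have "frechet_derivative (\<lambda>x. c) (at x) v = 0" for x :: 'a and v by simp
  then show ?case using Suc by simp
qed auto

lemma Ck_on_linear:
  assumes "bounded_linear h"
  shows "Ck_on k S h"
proof (cases k)
  case (Suc m)
  have D: "(h has_derivative h) (at x)" for x using assms bounded_linear_imp_has_derivative by blast
  then have "frechet_derivative h (at x) = h" for x using frechet_derivative_at by metis
  then show ?thesis using D Suc by (auto simp: differentiable_def)
qed (use assms linear_continuous_on in auto)

lemma Ck_on_linear_comp:
  assumes "bounded_linear h" "open S" "Ck_on k S f"
  shows "Ck_on k S (\<lambda>x. h (f x))"
  using assms
proof (induction k arbitrary: f)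
  case 0
  then show ?case using bounded_linear.continuous_on by auto
next
  case (Suc k)
  show ?case
    by (rule Ck_on_SucI[OF Suc.prems(2) bounded_linear.has_derivative[OF Suc.prems(1)
          Ck_on_has_derivative[OF Suc.prems(3)]] Suc.IH[OF Suc.prems(1,2)
          Ck_on_frechet_derivative[OF Suc.prems(3)]]])
qed

lemma Ck_on_add:
  assumes "open S" "Ck_on k S f" "Ck_on k S g"
  shows "Ck_on k S (\<lambda>x. f x + g x)"
  using assms
proof (induction k arbitrary: f g)
  case 0
  then show ?case by (auto intro: continuous_intros)
next
  case (Suc k)
  show ?case
    by (rule Ck_on_SucI[OF Suc.prems(1) has_derivative_add[OF Ck_on_has_derivative[OF Suc.prems(2)]
          Ck_on_has_derivative[OF Suc.prems(3)]] Suc.IH[OF Suc.prems(1)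
          Ck_on_frechet_derivative[OF Suc.prems(2)] Ck_on_frechet_derivative[OF Suc.prems(3)]]])
qed

lemma Ck_on_sum:
  assumes "open S" "\<And>i. i \<in> I \<Longrightarrow> Ck_on k S (f i)"
  shows "Ck_on k S (\<lambda>x. \<Sum>i\<in>I. f i x)"
  using assms(2)
  by (induction I rule: infinite_finite_induct) (auto intro: Ck_on_add[OF assms(1)])

lemma Ck_on_bilinear:
  assumes "bounded_bilinear q" "open S" "Ck_on k S f" "Ck_on k S g"
  shows "Ck_on k S (\<lambda>x. q (f x) (g x))"
  using assms
proof (induction k arbitrary: f g)
  case 0
  then show ?case using bounded_bilinear.continuous_on by auto
next
  case (Suc k)
  show ?case
  proof (rule Ck_on_SucI[where f' = "\<lambda>x v. q (f x) (frechet_derivative g (at x) v)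
        + q (frechet_derivative f (at x) v) (g x)"])
    fix x assume "x \<in> S"
    then show "((\<lambda>x. q (f x) (g x)) has_derivative (\<lambda>v. q (f x) (frechet_derivative g (at x) v)
        + q (frechet_derivative f (at x) v) (g x))) (at x)"
      by (intro bounded_bilinear.FDERIV Suc.prems(1) Ck_on_has_derivative[OF Suc.prems(3)]
          Ck_on_has_derivative[OF Suc.prems(4)])
  next
    fix v
    show "Ck_on k S (\<lambda>x. q (f x) (frechet_derivative g (at x) v)
        + q (frechet_derivative f (at x) v) (g x))"
      by (intro Ck_on_add Suc.IH Suc.prems(1,2) Ck_on_SucD[OF Suc.prems(3)] Ck_on_SucD[OF Suc.prems(4)]
          Ck_on_frechet_derivative[OF Suc.prems(3)] Ck_on_frechet_derivative[OF Suc.prems(4)])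
  qed (use Suc in auto)
qed

text \<open>In the chain rule the derivative of \<open>f\<close> is taken in the direction
  \<open>Dg(x) v\<close>, which varies with \<open>x\<close>, whereas the induction hypothesis
  covers fixed directions only. Expanding this direction in a frame leaves finitely many fixed
  directions with coefficients that depend on \<open>x\<close> in a C^k way.\<close>

lemma Ck_on_compose:
  fixes f :: "'m::real_inner \<Rightarrow> 'c::real_normed_vector" and E :: "'m set"
  assumes "frame E" "open S" "open T" "g ` S \<subseteq> T" "Ck_on k T f" "Ck_on k S g"
  shows "Ck_on k S (\<lambda>x. f (g x))"
  using assms
proof (induction k arbitrary: f)
  case 0
  then show ?case using continuous_on_compose2 by auto
next
  case (Suc k)
  let ?D = "\<lambda>x v. \<Sum>e\<in>E. (frechet_derivative g (at x) v \<bullet> e) *\<^sub>R frechet_derivative f (at (g x)) e"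
  show ?case
  proof (rule Ck_on_SucI[where f' = ?D])
    fix x assume x: "x \<in> S"
    have f: "(f has_derivative frechet_derivative f (at (g x))) (at (g x))"
      by (rule Ck_on_has_derivative[OF Suc.prems(5)]) (use x Suc.prems(4) in auto)
    have g: "(g has_derivative frechet_derivative g (at x)) (at x)"
      by (rule Ck_on_has_derivative[OF Suc.prems(6) x])
    have "?D x v = frechet_derivative f (at (g x)) (frechet_derivative g (at x) v)" for v
      by (rule frame_linear[OF assms(1) has_derivative_linear[OF f], symmetric])
    then show "((\<lambda>x. f (g x)) has_derivative ?D x) (at x)"
      using diff_chain_at[OF g f] by (simp add: o_def)
  next
    fix v
    have "Ck_on k S (\<lambda>x. frechet_derivative f (at (g x)) e)" for e
      by (rule Suc.IH[OF Suc.prems(1-4) Ck_on_frechet_derivative[OF Suc.prems(5)] Ck_on_SucD[OF Suc.prems(6)]])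
    moreover have "Ck_on k S (\<lambda>x. frechet_derivative g (at x) v \<bullet> e)" for e
      by (rule Ck_on_linear_comp[OF bounded_linear_inner_left]) (use Suc.prems in auto)
    ultimately show "Ck_on k S (\<lambda>x. ?D x v)"
      by (intro Ck_on_sum Ck_on_bilinear[OF bounded_bilinear_scaleR] Suc.prems)
  qed (use Suc in auto)
qed

section \<open>Smooth maps on open sets\<close>

lemma smooth_onD: "smooth_on S f \<Longrightarrow> open S" "smooth_on S f \<Longrightarrow> Ck_on k S f"
  by (auto simp: smooth_on_def)

lemma smooth_on_cong:
  "smooth_on S f \<Longrightarrow> (\<And>x. x \<in> S \<Longrightarrow> f x = g x) \<Longrightarrow> smooth_on S g"
  unfolding smooth_on_def using Ck_on_cong by blast

lemma smooth_on_subset: "smooth_on S f \<Longrightarrow> open T \<Longrightarrow> T \<subseteq> S \<Longrightarrow> smooth_on T f"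
  unfolding smooth_on_def using Ck_on_subset by blast

lemma smooth_on_local:
  assumes "\<And>x. x \<in> S \<Longrightarrow> \<exists>T. x \<in> T \<and> T \<subseteq> S \<and> smooth_on T f"
  shows "smooth_on S f"
  unfolding smooth_on_def
proof (intro conjI allI)
  have T: "\<exists>T. open T \<and> x \<in> T \<and> T \<subseteq> S \<and> Ck_on k T f" if "x \<in> S" for x k
    using assms[OF that] unfolding smooth_on_def by auto
  show "open S"
    by (subst open_subopen) (meson T)
  show "Ck_on k S f" for k
  proof (rule Ck_on_local)
    show "\<exists>T. open T \<and> x \<in> T \<and> Ck_on k T f" if "x \<in> S" for x using T[OF that, of k] by auto
  qed
qed

lemma smooth_on_const: "open S \<Longrightarrow> smooth_on S (\<lambda>x. c)"
  by (simp add: smooth_on_def)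

lemma smooth_on_linear: "bounded_linear h \<Longrightarrow> open S \<Longrightarrow> smooth_on S h"
  by (simp add: smooth_on_def Ck_on_linear)

lemma smooth_on_linear_comp: "bounded_linear h \<Longrightarrow> smooth_on S f \<Longrightarrow> smooth_on S (\<lambda>x. h (f x))"
  by (simp add: smooth_on_def Ck_on_linear_comp)

lemma smooth_on_add: "smooth_on S f \<Longrightarrow> smooth_on S g \<Longrightarrow> smooth_on S (\<lambda>x. f x + g x)"
  by (simp add: smooth_on_def Ck_on_add)

lemma smooth_on_bilinear:
  "bounded_bilinear q \<Longrightarrow> smooth_on S f \<Longrightarrow> smooth_on S g \<Longrightarrow> smooth_on S (\<lambda>x. q (f x) (g x))"
  by (simp add: smooth_on_def Ck_on_bilinear)

lemma smooth_on_sum: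
  "open S \<Longrightarrow> (\<And>i. i \<in> I \<Longrightarrow> smooth_on S (f i)) \<Longrightarrow> smooth_on S (\<lambda>x. \<Sum>i\<in>I. f i x)"
  by (simp add: smooth_on_def Ck_on_sum)

lemma smooth_on_Pair:
  assumes "smooth_on S f" "smooth_on S g"
  shows "smooth_on S (\<lambda>x. (f x, g x))"
proof -
  have "smooth_on S (\<lambda>x. (f x, 0) + (0, g x))"
    by (intro smooth_on_add smooth_on_linear_comp[OF _ assms(1)] smooth_on_linear_comp[OF _ assms(2)])
      (auto intro!: bounded_linear_Pair bounded_linear_ident bounded_linear_zero)
  then show ?thesis by simp
qed

lemma smooth_on_compose:
  fixes f :: "'m::real_inner \<Rightarrow> 'c::real_normed_vector"
  assumes "\<exists>E::'m set. frame E" "smooth_on T f" "smooth_on S g" "g ` S \<subseteq> T"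
  shows "smooth_on S (\<lambda>x. f (g x))"
proof -
  obtain E :: "'m set" where "frame E" using assms(1) by blast
  then show ?thesis
    using assms Ck_on_compose[of E S T g _ f] by (simp add: smooth_on_def)
qed

lemma smooth_on_imp_differentiable: "smooth_on S f \<Longrightarrow> x \<in> S \<Longrightarrow> f differentiable (at x)"
  unfolding smooth_on_def by (metis Ck_on.simps(2))

lemma smooth_on_has_derivative:
  "smooth_on S f \<Longrightarrow> x \<in> S \<Longrightarrow> (f has_derivative frechet_derivative f (at x)) (at x)"
  by (simp add: frechet_derivative_works[symmetric] smooth_on_imp_differentiable)

lemma smooth_on_frechet_derivative:
  "smooth_on S f \<Longrightarrow> smooth_on S (\<lambda>x. frechet_derivative f (at x) v)"
  unfolding smooth_on_def by (metis Ck_on.simps(2))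

lemma smooth_on_imp_continuous_on: "smooth_on S f \<Longrightarrow> continuous_on S f"
  unfolding smooth_on_def by (metis Ck_on.simps(1))

lemma smooth_onI_derivative:
  assumes "open S" "\<And>x. x \<in> S \<Longrightarrow> (f has_derivative f' x) (at x)" "\<And>v. smooth_on S (\<lambda>x. f' x v)"
  shows "smooth_on S f"
  unfolding smooth_on_def
proof (intro conjI allI)
  fix k
  have "Ck_on (Suc k) S f" by (rule Ck_on_SucI) (use assms in \<open>auto simp: smooth_on_def\<close>)
  then show "Ck_on k S f" by (rule Ck_on_SucD)
qed (fact assms)

lemma smooth_on_exp:
  "smooth_on UNIV (exp :: complex \<Rightarrow> complex)"
proof -
  have "Ck_on k UNIV (exp :: complex \<Rightarrow> complex)" for k
  proof (induction k)
    case (Suc k)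
    show ?case
      by (rule Ck_on_SucI[where f' = "\<lambda>x v. exp x * v"])
        (auto intro!: Ck_on_bilinear[OF bounded_bilinear_mult] Suc DERIV_exp[unfolded has_field_derivative_def])
  qed (auto intro: continuous_intros)
  then show ?thesis by (simp add: smooth_on_def)
qed

text \<open>The derivative is a product of two copies of the function itself, so the induction on
  the order closes without a larger family of functions.\<close>

lemma smooth_on_inverse:
  "smooth_on (- {0}) (inverse :: complex \<Rightarrow> complex)"
proof -
  have "Ck_on k (- {0}) (inverse :: complex \<Rightarrow> complex)" for k
  proof (induction k)
    case 0
    show ?case by (auto intro!: continuous_intros)
  next
    case (Suc k)
    show ?case
      by (rule Ck_on_SucI[where f' = "\<lambda>x v. - (inverse x * v * inverse x)"])
        (auto intro!: Ck_on_linear_comp[OF bounded_linear_minus[OF bounded_linear_ident]]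
          Ck_on_bilinear[OF bounded_bilinear_mult] Suc has_derivative_inverse')
  qed
  then show ?thesis by (simp add: smooth_on_def open_Compl)
qed

section \<open>The lemmas of Hadamard and Poincare\<close>

text \<open>A weighted average of \<open>h\<close> over the segment from \<open>p\<close> to
  \<open>x\<close>. Differentiating in \<open>x\<close> under the integral brings out a factor
  \<open>t\<close>, so the power \<open>t ^ m\<close> makes the family closed under differentiation.
  The case \<open>m = 0\<close> occurs in the lemmas of Hadamard and Poincare.\<close>

definition radial_integral :: "'e::real_normed_vector \<Rightarrow> nat \<Rightarrow> ('e \<Rightarrow> 'c::banach) \<Rightarrow> 'e \<Rightarrow> 'c" where
  "radial_integral p m h x = integral {0..1} (\<lambda>t. t ^ m *\<^sub>R h (p + t *\<^sub>R (x - p)))"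

lemma radial_in_ball:
  fixes p :: "'e::real_normed_vector"
  assumes "x \<in> ball p r" "t \<in> {0..1}"
  shows "p + t *\<^sub>R (x - p) \<in> ball p r"
proof -
  have "norm (t *\<^sub>R (x - p)) \<le> norm (x - p)" using assms(2) by (auto intro: mult_left_le_one_le)
  also have "\<dots> < r" using assms(1) by (simp add: dist_norm norm_minus_commute)
  finally show ?thesis by (simp add: dist_norm)
qed

lemma continuous_on_radial:
  fixes p :: "'e::real_normed_vector"
  assumes "continuous_on (ball p r) (h :: 'e \<Rightarrow> 'c::real_normed_vector)"
  shows "continuous_on (ball p r \<times> {0..1}) (\<lambda>(x, t::real). t ^ m *\<^sub>R h (p + t *\<^sub>R (x - p)))"
proof -
  have "continuous_on (ball p r \<times> {0..1}) (\<lambda>z. h (p + snd z *\<^sub>R (fst z - p)))"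
    by (rule continuous_on_compose2[OF assms])
      (auto intro!: continuous_intros radial_in_ball simp del: mem_ball)
  then show ?thesis by (auto simp: split_beta intro!: continuous_intros)
qed

lemma radial_integrable:
  fixes p :: "'e::real_normed_vector" and h :: "'e \<Rightarrow> 'c::banach"
  assumes "continuous_on (ball p r) h" "x \<in> ball p r"
  shows "(\<lambda>t. t ^ m *\<^sub>R h (p + t *\<^sub>R (x - p))) integrable_on {0..1}"
  by (intro integrable_continuous_real continuous_intros continuous_on_compose2[OF assms(1)])
    (use assms in \<open>auto intro: radial_in_ball\<close>)

text \<open>Differentiation under the integral sign. The Leibniz rule wants the derivative of the
  integrand as a continuous family of bounded operators, whereas smoothness of \<open>h\<close>
  gives continuity of directional derivatives only.\<close>

lemma radial_integral_has_derivative: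
  fixes p :: "'e::{real_inner,banach}" and E :: "'e set" and h :: "'e \<Rightarrow> 'c::banach"
  assumes E: "frame E" and h: "smooth_on (ball p r) h" and x: "x \<in> ball p r"
  shows "(radial_integral p m h has_derivative
    (\<lambda>v. radial_integral p (Suc m) (\<lambda>y. frechet_derivative h (at y) v) x)) (at x)"
proof -
  let ?D = "\<lambda>e y. frechet_derivative h (at y) e"
  \<comment> \<open>The derivative of \<open>h\<close> as a finite sum of rank-one operators, one
    for each frame vector; continuity in the operator norm then follows from continuity of the
    directional derivatives.\<close>
  define A where "A y = (\<Sum>e\<in>E. blinfun_scaleR_left (?D e y) o\<^sub>L blinfun_inner_left e)" for y
  have A: "blinfun_apply (A y) v = ?D v y" if "y \<in> ball p r" for y v
    using frame_linear[OF E has_derivative_linear[OF smooth_on_has_derivative[OF h that]], of v]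
    by (simp add: A_def blinfun.sum_left inner_commute)
  have cont: "continuous_on (ball p r) A"
    unfolding A_def
    by (intro continuous_intros bounded_linear.continuous_on[OF bounded_linear_blinfun_scaleR_left]
        smooth_on_imp_continuous_on smooth_on_frechet_derivative[OF h])
  note cA = continuous_on_radial[OF cont, of "Suc m"]
  have "((\<lambda>x. integral (cbox 0 1) (\<lambda>t. t ^ m *\<^sub>R h (p + t *\<^sub>R (x - p)))) has_derivative
      integral (cbox 0 1) (\<lambda>t. t ^ Suc m *\<^sub>R A (p + t *\<^sub>R (x - p)))) (at x within ball p r)"
  proof (rule leibniz_rule)
    fix y :: 'e and t :: real assume y: "y \<in> ball p r" and t: "t \<in> cbox 0 1"
    then have yt: "p + t *\<^sub>R (y - p) \<in> ball p r" using radial_in_ball by auto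
    have 1: "((\<lambda>y. p + t *\<^sub>R (y - p)) has_derivative (\<lambda>v. t *\<^sub>R v)) (at y within ball p r)"
      by (auto intro!: derivative_eq_intros)
    have 2: "(h has_derivative blinfun_apply (A (p + t *\<^sub>R (y - p)))) (at (p + t *\<^sub>R (y - p)))"
      using smooth_on_has_derivative[OF h yt] A[OF yt] by (metis ext)
    have "((\<lambda>y. t ^ m *\<^sub>R h (p + t *\<^sub>R (y - p))) has_derivative
        (\<lambda>v. t ^ m *\<^sub>R blinfun_apply (A (p + t *\<^sub>R (y - p))) (t *\<^sub>R v))) (at y within ball p r)"
      by (intro has_derivative_scaleR_right has_derivative_compose[OF 1 2])
    then show "((\<lambda>y. t ^ m *\<^sub>R h (p + t *\<^sub>R (y - p))) has_derivative
        blinfun_apply (t ^ Suc m *\<^sub>R A (p + t *\<^sub>R (y - p)))) (at y within ball p r)"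
      by (rule has_derivative_eq_rhs) (auto simp: blinfun.scaleR_left blinfun.scaleR_right mult.commute)
  qed (use x cA radial_integrable[OF smooth_on_imp_continuous_on[OF h]] in auto)
  moreover have "blinfun_apply (integral {0..1} (\<lambda>t. t ^ Suc m *\<^sub>R A (p + t *\<^sub>R (x - p)))) v =
      radial_integral p (Suc m) (\<lambda>y. frechet_derivative h (at y) v) x" for v
  proof -
    have "blinfun_apply (integral {0..1} (\<lambda>t. t ^ Suc m *\<^sub>R A (p + t *\<^sub>R (x - p)))) v =
        integral {0..1} (\<lambda>t. blinfun_apply (t ^ Suc m *\<^sub>R A (p + t *\<^sub>R (x - p))) v)"
      using integral_linear[OF radial_integrable[OF cont x, of "Suc m"]
          blinfun.bounded_linear_left, of v]
      by (simp add: o_def)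
    also have "\<dots> = radial_integral p (Suc m) (\<lambda>y. frechet_derivative h (at y) v) x"
      unfolding radial_integral_def
      by (rule integral_cong) (use A radial_in_ball[OF x] in \<open>auto simp: blinfun.scaleR_left\<close>)
    finally show ?thesis .
  qed
  ultimately have "((\<lambda>x. integral {0..1} (\<lambda>t. t ^ m *\<^sub>R h (p + t *\<^sub>R (x - p)))) has_derivative
      (\<lambda>v. radial_integral p (Suc m) (\<lambda>y. frechet_derivative h (at y) v) x)) (at x within ball p r)"
    unfolding cbox_interval by (rule has_derivative_eq_rhs[OF _ ext])
  then show ?thesis
    using at_within_open[OF x] by (simp add: radial_integral_def[abs_def])
qed

lemma smooth_on_radial_integral:
  fixes p :: "'e::{real_inner,banach}" and E :: "'e set" and h :: "'e \<Rightarrow> 'c::banach"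
  assumes E: "frame E" and h: "smooth_on (ball p r) h"
  shows "smooth_on (ball p r) (radial_integral p m h)"
proof -
  have "Ck_on k (ball p r) (radial_integral p m h)" for k
    using h
  proof (induction k arbitrary: m h)
    case 0
    have "continuous_on (ball p r) (\<lambda>x. integral (cbox 0 1) (\<lambda>t. t ^ m *\<^sub>R h (p + t *\<^sub>R (x - p))))"
      by (rule integral_continuous_on_param)
        (use continuous_on_radial[OF smooth_on_imp_continuous_on[OF 0]] in auto)
    then show ?case by (simp add: radial_integral_def[abs_def])
  next
    case (Suc k)
    show ?case
      by (rule Ck_on_SucI[OF _ radial_integral_has_derivative[OF E Suc.prems]])
        (auto intro: Suc.IH smooth_on_frechet_derivative Suc.prems)
  qed
  then show ?thesis by (simp add: smooth_on_def)
qed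

text \<open>The fundamental theorem of calculus along the segment from \<open>p\<close> to
  \<open>x\<close>, with \<open>x - p\<close> expanded in the frame. The coefficient
  \<open>g e\<close> is the average of the derivative in the direction \<open>e\<close> over this
  segment, hence smooth.\<close>

lemma Hadamard:
  fixes p :: "'e::{real_inner,banach}" and E :: "'e set" and f :: "'e \<Rightarrow> 'c::banach"
  assumes E: "frame E" and f: "smooth_on (ball p r) f"
  obtains g where "\<And>e. smooth_on (ball p r) (g e)"
    and "\<And>e. 0 < r \<Longrightarrow> g e p = frechet_derivative f (at p) e"
    and "\<And>x. x \<in> ball p r \<Longrightarrow> f x = f p + (\<Sum>e\<in>E. ((x - p) \<bullet> e) *\<^sub>R g e x)"
proof (rule that)
  define g where "g e = radial_integral p 0 (\<lambda>y. frechet_derivative f (at y) e)" for e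
  have sm: "smooth_on (ball p r) (\<lambda>y. frechet_derivative f (at y) e)" for e
    by (rule smooth_on_frechet_derivative[OF f])
  show "smooth_on (ball p r) (g e)" for e
    unfolding g_def by (rule smooth_on_radial_integral[OF E sm])
  show "g e p = frechet_derivative f (at p) e" for e
    by (simp add: g_def radial_integral_def)
  fix x assume x: "x \<in> ball p r"
  have "((\<lambda>t. frechet_derivative f (at (p + t *\<^sub>R (x - p))) (x - p)) has_integral
      f (p + 1 *\<^sub>R (x - p)) - f (p + 0 *\<^sub>R (x - p))) {0..1}"
  proof (rule fundamental_theorem_of_calculus)
    fix t :: real assume "t \<in> {0..1}"
    then have y: "p + t *\<^sub>R (x - p) \<in> ball p r" using x radial_in_ball by blast
    have 1: "((\<lambda>t. p + t *\<^sub>R (x - p)) has_derivative (\<lambda>s. s *\<^sub>R (x - p))) (at t within {0..1})"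
      by (auto intro!: derivative_eq_intros)
    have D: "(f has_derivative frechet_derivative f (at (p + t *\<^sub>R (x - p)))) (at (p + t *\<^sub>R (x - p)))"
      by (rule smooth_on_has_derivative[OF f y])
    show "((\<lambda>t. f (p + t *\<^sub>R (x - p))) has_vector_derivative
        frechet_derivative f (at (p + t *\<^sub>R (x - p))) (x - p)) (at t within {0..1})"
      using has_derivative_compose[OF 1 D] linear_scale[OF has_derivative_linear[OF D]]
      by (simp add: has_vector_derivative_def)
  qed simp
  then have "f x - f p = integral {0..1} (\<lambda>t. frechet_derivative f (at (p + t *\<^sub>R (x - p))) (x - p))"
    by (simp add: integral_unique)
  also have "\<dots> = integral {0..1} (\<lambda>t. \<Sum>e\<in>E. ((x - p) \<bullet> e) *\<^sub>R frechet_derivative f (at (p + t *\<^sub>R (x - p))) e)"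
  proof (rule integral_cong)
    fix t :: real assume "t \<in> {0..1}"
    then have y: "p + t *\<^sub>R (x - p) \<in> ball p r" using x radial_in_ball by blast
    show "frechet_derivative f (at (p + t *\<^sub>R (x - p))) (x - p) =
        (\<Sum>e\<in>E. ((x - p) \<bullet> e) *\<^sub>R frechet_derivative f (at (p + t *\<^sub>R (x - p))) e)"
      by (rule frame_linear[OF E has_derivative_linear[OF smooth_on_has_derivative[OF f y]]])
  qed
  also have "\<dots> = (\<Sum>e\<in>E. ((x - p) \<bullet> e) *\<^sub>R g e x)"
    using radial_integrable[OF smooth_on_imp_continuous_on[OF sm] x, of 0]
    by (subst integral_sum) (auto simp: g_def radial_integral_def frame_finite[OF E] intro: integrable_cmul)
  finally show "f x = f p + (\<Sum>e\<in>E. ((x - p) \<bullet> e) *\<^sub>R g e x)" by (simp add: algebra_simps)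
qed

text \<open>\<open>G\<close> is the radial homotopy operator: it integrates the form with components
  \<open>b\<close> over the segment from \<open>p\<close> to \<open>x\<close>. Closedness turns the
  derivative of \<open>G\<close> in the direction \<open>v\<close> into the integral of the
  t-derivative of \<open>t *\<^sub>R B v (p + t *\<^sub>R (x - p))\<close>, which is
  \<open>B v x\<close>.\<close>

lemma Poincare:
  fixes p :: "'e::{real_inner,banach}" and E :: "'e set" and b :: "'e \<Rightarrow> 'e \<Rightarrow> 'c::banach"
  assumes E: "frame E"
    and b: "\<And>e. e \<in> E \<Longrightarrow> smooth_on (ball p r) (b e)"
    and closed: "\<And>d e x. d \<in> E \<Longrightarrow> e \<in> E \<Longrightarrow> x \<in> ball p r \<Longrightarrow>
      frechet_derivative (b e) (at x) d = frechet_derivative (b d) (at x) e"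
  obtains G where "smooth_on (ball p r) G"
    and "\<And>x. x \<in> ball p r \<Longrightarrow> (G has_derivative (\<lambda>v. \<Sum>e\<in>E. (v \<bullet> e) *\<^sub>R b e x)) (at x)"
proof -
  define B where "B v x = (\<Sum>e\<in>E. (v \<bullet> e) *\<^sub>R b e x)" for v x
  define G where "G x = (\<Sum>e\<in>E. ((x - p) \<bullet> e) *\<^sub>R radial_integral p 0 (b e) x)" for x
  have smB: "smooth_on (ball p r) (B v)" for v
    unfolding B_def[abs_def] by (intro smooth_on_sum smooth_on_linear_comp[OF bounded_linear_scaleR_right] b) auto
  have DB: "(B v has_derivative (\<lambda>w. \<Sum>e\<in>E. (v \<bullet> e) *\<^sub>R frechet_derivative (b e) (at x) w)) (at x)"
    if "x \<in> ball p r" for v x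
    unfolding B_def[abs_def] using that
    by (intro has_derivative_sum has_derivative_scaleR_right smooth_on_has_derivative[OF b])
  \<comment> \<open>Closedness is assumed for pairs of frame vectors only; bilinearity extends it to
    all pairs of directions.\<close>
  have sym: "(\<Sum>e\<in>E. (v \<bullet> e) *\<^sub>R frechet_derivative (b e) (at x) w) =
      (\<Sum>e\<in>E. (w \<bullet> e) *\<^sub>R frechet_derivative (b e) (at x) v)" if x: "x \<in> ball p r" for x v w
  proof -
    have lin: "frechet_derivative (b e) (at x) w = (\<Sum>d\<in>E. (w \<bullet> d) *\<^sub>R frechet_derivative (b e) (at x) d)"
      if "e \<in> E" for e w
      by (rule frame_linear[OF E has_derivative_linear[OF smooth_on_has_derivative[OF b[OF that] x]]])
    have "(\<Sum>e\<in>E. (v \<bullet> e) *\<^sub>R frechet_derivative (b e) (at x) w) =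
        (\<Sum>e\<in>E. \<Sum>d\<in>E. ((v \<bullet> e) * (w \<bullet> d)) *\<^sub>R frechet_derivative (b e) (at x) d)"
      by (auto intro!: sum.cong simp: lin[of _ w] scaleR_sum_right)
    also have "\<dots> = (\<Sum>d\<in>E. \<Sum>e\<in>E. ((v \<bullet> e) * (w \<bullet> d)) *\<^sub>R frechet_derivative (b d) (at x) e)"
      by (subst sum.swap) (intro sum.cong refl arg_cong[where f = "scaleR _"] closed x)
    also have "\<dots> = (\<Sum>e\<in>E. (w \<bullet> e) *\<^sub>R frechet_derivative (b e) (at x) v)"
      by (auto intro!: sum.cong simp: lin[of _ v] scaleR_sum_right mult.commute)
    finally show ?thesis .
  qed
  have DG: "(G has_derivative (\<lambda>v. B v x)) (at x)" if x: "x \<in> ball p r" for x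
  proof -
    let ?R = "\<lambda>e v. radial_integral p 1 (\<lambda>y. frechet_derivative (b e) (at y) v) x"
    have "(G has_derivative (\<lambda>v. \<Sum>e\<in>E. ((x - p) \<bullet> e) *\<^sub>R ?R e v + (v \<bullet> e) *\<^sub>R radial_integral p 0 (b e) x)) (at x)"
      unfolding G_def[abs_def]
    proof (intro has_derivative_sum has_derivative_scaleR)
      show "((\<lambda>x. (x - p) \<bullet> e) has_derivative (\<lambda>v. v \<bullet> e)) (at x)" for e
        by (auto intro!: derivative_eq_intros)
      show "e \<in> E \<Longrightarrow> (radial_integral p 0 (b e) has_derivative ?R e) (at x)" for e
        using radial_integral_has_derivative[OF E b x, of e 0] by simp
    qed
    moreover have "(\<Sum>e\<in>E. ((x - p) \<bullet> e) *\<^sub>R ?R e v + (v \<bullet> e) *\<^sub>R radial_integral p 0 (b e) x) = B v x" for v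
    proof -
      let ?q = "\<lambda>t. p + t *\<^sub>R (x - p)"
      have i0: "((\<lambda>t. b e (?q t)) has_integral radial_integral p 0 (b e) x) {0..1}" if "e \<in> E" for e
        using integrable_integral[OF radial_integrable[OF smooth_on_imp_continuous_on[OF b[OF that]] x, of 0]]
        by (simp add: radial_integral_def)
      have i1: "((\<lambda>t. t *\<^sub>R frechet_derivative (b e) (at (?q t)) v) has_integral ?R e v) {0..1}" if "e \<in> E" for e
        using integrable_integral[OF radial_integrable[OF smooth_on_imp_continuous_on[OF
                smooth_on_frechet_derivative[OF b[OF that]]] x, of 1]]
        by (simp add: radial_integral_def)
      have "((\<lambda>t. \<Sum>e\<in>E. ((x - p) \<bullet> e) *\<^sub>R (t *\<^sub>R frechet_derivative (b e) (at (?q t)) v)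
           + (v \<bullet> e) *\<^sub>R b e (?q t)) has_integral
          (\<Sum>e\<in>E. ((x - p) \<bullet> e) *\<^sub>R ?R e v + (v \<bullet> e) *\<^sub>R radial_integral p 0 (b e) x)) {0..1}"
        by (intro has_integral_sum has_integral_add has_integral_cmul i0 i1 frame_finite[OF E])
      then have "(\<Sum>e\<in>E. ((x - p) \<bullet> e) *\<^sub>R ?R e v + (v \<bullet> e) *\<^sub>R radial_integral p 0 (b e) x) =
        integral {0..1} (\<lambda>t. \<Sum>e\<in>E. ((x - p) \<bullet> e) *\<^sub>R (t *\<^sub>R frechet_derivative (b e) (at (?q t)) v)
           + (v \<bullet> e) *\<^sub>R b e (?q t))"
        by (simp only: integral_unique)
      \<comment> \<open>By closedness the direction of differentiation is exchanged with the
        argument of the form, and the integrand becomes an exact derivative in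
        \<open>t\<close>.\<close>
      also have "\<dots> = integral {0..1} (\<lambda>t. t *\<^sub>R frechet_derivative (B v) (at (?q t)) (x - p) + B v (?q t))"
      proof (rule integral_cong)
        fix t :: real assume "t \<in> {0..1}"
        then have y: "?q t \<in> ball p r" using x radial_in_ball by blast
        have "(\<Sum>e\<in>E. ((x - p) \<bullet> e) *\<^sub>R frechet_derivative (b e) (at (?q t)) v) =
          frechet_derivative (B v) (at (?q t)) (x - p)"
          unfolding sym[OF y, of "x - p" v] by (rule fun_cong[OF frechet_derivative_at[OF DB[OF y, of v]]])
        from arg_cong[OF this, of "scaleR t"]
        show "(\<Sum>e\<in>E. ((x - p) \<bullet> e) *\<^sub>R (t *\<^sub>R frechet_derivative (b e) (at (?q t)) v)
           + (v \<bullet> e) *\<^sub>R b e (?q t)) = t *\<^sub>R frechet_derivative (B v) (at (?q t)) (x - p) + B v (?q t)"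
          by (simp add: sum.distrib B_def scaleR_sum_right mult.commute)
      qed
      also have "\<dots> = 1 *\<^sub>R B v (?q 1) - 0 *\<^sub>R B v (?q 0)"
      proof (rule integral_unique, rule fundamental_theorem_of_calculus)
        fix t :: real assume "t \<in> {0..1}"
        then have y: "?q t \<in> ball p r" using x radial_in_ball by blast
        have 1: "(?q has_derivative (\<lambda>s. s *\<^sub>R (x - p))) (at t within {0..1})"
          by (auto intro!: derivative_eq_intros)
        note D = smooth_on_has_derivative[OF smB y, of v]
        have 2: "((\<lambda>t. B v (?q t)) has_derivative (\<lambda>s. s *\<^sub>R frechet_derivative (B v) (at (?q t)) (x - p)))
            (at t within {0..1})"
          using has_derivative_compose[OF 1 D] linear_scale[OF has_derivative_linear[OF D]] by simp
        have "((\<lambda>t. t *\<^sub>R B v (?q t)) has_derivative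
            (\<lambda>s. t *\<^sub>R (s *\<^sub>R frechet_derivative (B v) (at (?q t)) (x - p)) + s *\<^sub>R B v (?q t))) (at t within {0..1})"
          by (rule has_derivative_scaleR[OF has_derivative_ident 2])
        then show "((\<lambda>t. t *\<^sub>R B v (?q t)) has_vector_derivative
            t *\<^sub>R frechet_derivative (B v) (at (?q t)) (x - p) + B v (?q t)) (at t within {0..1})"
          by (simp add: has_vector_derivative_def scaleR_add_right mult.commute)
      qed simp
      finally show ?thesis by simp
    qed
    ultimately show ?thesis by simp
  qed
  have "smooth_on (ball p r) G"
    by (rule smooth_onI_derivative[OF _ DG smB]) auto
  with DG show ?thesis using that unfolding B_def by blast
qed

text \<open>Hadamard's expansion around \<open>x\<close> is differentiated twice at \<open>x\<close>
  itself. The terms with a second derivative of \<open>g e\<close> carry the factor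
  \<open>(x - x) \<bullet> e\<close> and vanish; what is left is symmetric in \<open>v\<close> and
  \<open>w\<close>.\<close>

lemma second_derivative_symmetric:
  fixes f :: "'e::{real_inner,banach} \<Rightarrow> 'c::banach" and E :: "'e set"
  assumes E: "frame E" and f: "smooth_on S f" and x: "x \<in> S"
  shows "frechet_derivative (\<lambda>y. frechet_derivative f (at y) v) (at x) w =
    frechet_derivative (\<lambda>y. frechet_derivative f (at y) w) (at x) v"
proof -
  obtain r where r: "0 < r" "ball x r \<subseteq> S" using smooth_onD(1)[OF f] x open_contains_ball by metis
  have fb: "smooth_on (ball x r) f" by (rule smooth_on_subset[OF f _ r(2)]) simp
  obtain g where g: "\<And>e. smooth_on (ball x r) (g e)"
      "\<And>e. 0 < r \<Longrightarrow> g e x = frechet_derivative f (at x) e"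
      "\<And>y. y \<in> ball x r \<Longrightarrow> f y = f x + (\<Sum>e\<in>E. ((y - x) \<bullet> e) *\<^sub>R g e y)"
    by (rule Hadamard[OF E fb]) (rule that)
  define Dg where "Dg e y = frechet_derivative (g e) (at y)" for e y
  have Dg: "(g e has_derivative Dg e y) (at y)" if "y \<in> ball x r" for e y
    unfolding Dg_def by (rule smooth_on_has_derivative[OF g(1) that])
  have inn: "((\<lambda>y. (y - x) \<bullet> e) has_derivative (\<lambda>v. v \<bullet> e)) (at y)" for e y
    by (auto intro!: derivative_eq_intros)
  have D1: "frechet_derivative f (at y) v = (\<Sum>e\<in>E. ((y - x) \<bullet> e) *\<^sub>R Dg e y v + (v \<bullet> e) *\<^sub>R g e y)"
    if y: "y \<in> ball x r" for y v
  proof -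
    have "((\<lambda>y. f x + (\<Sum>e\<in>E. ((y - x) \<bullet> e) *\<^sub>R g e y)) has_derivative
        (\<lambda>v. 0 + (\<Sum>e\<in>E. ((y - x) \<bullet> e) *\<^sub>R Dg e y v + (v \<bullet> e) *\<^sub>R g e y))) (at y)"
      by (intro has_derivative_add has_derivative_const has_derivative_sum has_derivative_scaleR inn Dg y)
    then have "(f has_derivative (\<lambda>v. 0 + (\<Sum>e\<in>E. ((y - x) \<bullet> e) *\<^sub>R Dg e y v + (v \<bullet> e) *\<^sub>R g e y))) (at y)"
      by (rule has_derivative_transform_within_open[OF _ open_ball y]) (use g(3) in simp)
    from fun_cong[OF frechet_derivative_at[OF this], of v] show ?thesis by simp
  qed
  have "frechet_derivative (\<lambda>y. frechet_derivative f (at y) v) (at x) w =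
      (\<Sum>e\<in>E. (w \<bullet> e) *\<^sub>R Dg e x v + (v \<bullet> e) *\<^sub>R Dg e x w)" for v w
  proof -
    have x: "x \<in> ball x r" using r by simp
    have sm: "smooth_on (ball x r) (\<lambda>y. Dg e y v)" for e
      unfolding Dg_def by (rule smooth_on_frechet_derivative[OF g(1)])
    have "((\<lambda>y. \<Sum>e\<in>E. ((y - x) \<bullet> e) *\<^sub>R Dg e y v + (v \<bullet> e) *\<^sub>R g e y) has_derivative
        (\<lambda>w. \<Sum>e\<in>E. (((x - x) \<bullet> e) *\<^sub>R frechet_derivative (\<lambda>y. Dg e y v) (at x) w + (w \<bullet> e) *\<^sub>R Dg e x v)
          + (v \<bullet> e) *\<^sub>R Dg e x w)) (at x)"
      by (intro has_derivative_add has_derivative_sum has_derivative_scaleR has_derivative_scaleR_right inn Dg x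
          smooth_on_has_derivative[OF sm])
    then have "((\<lambda>y. frechet_derivative f (at y) v) has_derivative
        (\<lambda>w. \<Sum>e\<in>E. (((x - x) \<bullet> e) *\<^sub>R frechet_derivative (\<lambda>y. Dg e y v) (at x) w + (w \<bullet> e) *\<^sub>R Dg e x v)
          + (v \<bullet> e) *\<^sub>R Dg e x w)) (at x)"
      by (rule has_derivative_transform_within_open[OF _ open_ball x]) (use D1 in simp)
    from fun_cong[OF frechet_derivative_at[OF this], of w] show ?thesis by simp
  qed
  then show ?thesis by (simp add: add.commute)
qed

section \<open>Smooth functions and smooth maps on manifolds\<close>

text \<open>Open submanifolds and products are only ever used through their charts, so the Hausdorff
  property and second countability are left out.\<close>

definition smooth_atlas :: "('a, 'e::{real_inner,banach}) mfd \<Rightarrow> bool" where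
  "smooth_atlas M \<longleftrightarrow>
     (\<exists>E::'e set. frame E) \<and>
     (\<Union>(C, \<phi>)\<in>atlas M. C) = points M \<and>
     (\<forall>(C, \<phi>)\<in>atlas M. openin (mtop M) C \<and> open (\<phi> ` C) \<and>
        homeomorphic_map (subtopology (mtop M) C) (top_of_set (\<phi> ` C)) \<phi>) \<and>
     (\<forall>(C, \<phi>)\<in>atlas M. \<forall>(D, \<psi>)\<in>atlas M. smooth_on (\<phi> ` (C \<inter> D)) (\<psi> \<circ> inv_into C \<phi>))"

lemma smooth_manifold_imp_atlas: "smooth_manifold M \<Longrightarrow> smooth_atlas M"
  by (simp only: smooth_manifold_def smooth_atlas_def) (meson frame_exists)

lemma smooth_atlas_frame:
  fixes M :: "('a, 'e::{real_inner,banach}) mfd"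
  shows "smooth_atlas M \<Longrightarrow> \<exists>E::'e set. frame E"
  by (simp add: smooth_atlas_def)

lemma complex_frame: "\<exists>E::complex set. frame E"
  by (rule frame_exists[of Basis]) auto

lemma atlas_cover:
  assumes "smooth_atlas M" "x \<in> points M"
  obtains C \<phi> where "(C, \<phi>) \<in> atlas M" "x \<in> C"
proof -
  have "x \<in> (\<Union>(C, \<phi>)\<in>atlas M. C)" using assms unfolding smooth_atlas_def by blast
  then show ?thesis using that by auto
qed

lemma chart_facts:
  assumes "smooth_atlas M" "(C, \<phi>) \<in> atlas M"
  shows chart_open: "openin (mtop M) C"
    and chart_image_open: "open (\<phi> ` C)"
    and chart_homeo: "homeomorphic_map (subtopology (mtop M) C) (top_of_set (\<phi> ` C)) \<phi>"
  using assms unfolding smooth_atlas_def by blast+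

lemma chart_subset: "smooth_atlas M \<Longrightarrow> (C, \<phi>) \<in> atlas M \<Longrightarrow> C \<subseteq> points M"
  by (simp add: chart_open openin_subset)

lemma chart_topspace: "smooth_atlas M \<Longrightarrow> (C, \<phi>) \<in> atlas M \<Longrightarrow> topspace (subtopology (mtop M) C) = C"
  using chart_subset by fastforce

lemma chart_transition:
  "smooth_atlas M \<Longrightarrow> (C, \<phi>) \<in> atlas M \<Longrightarrow> (D, \<psi>) \<in> atlas M \<Longrightarrow>
    smooth_on (\<phi> ` (C \<inter> D)) (\<psi> \<circ> inv_into C \<phi>)"
  unfolding smooth_atlas_def by blast

lemma chart_inj: "smooth_atlas M \<Longrightarrow> (C, \<phi>) \<in> atlas M \<Longrightarrow> inj_on \<phi> C"
  using homeomorphic_imp_injective_map[OF chart_homeo] chart_topspace by metis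

lemma chart_inv [simp]: "smooth_atlas M \<Longrightarrow> (C, \<phi>) \<in> atlas M \<Longrightarrow> x \<in> C \<Longrightarrow> inv_into C \<phi> (\<phi> x) = x"
  by (simp add: chart_inj)

lemma chart_continuous:
  assumes "smooth_atlas M" "(C, \<phi>) \<in> atlas M"
  shows "continuous_map (subtopology (mtop M) C) euclidean \<phi>"
  using homeomorphic_imp_continuous_map[OF chart_homeo[OF assms]] by (simp add: continuous_map_in_subtopology)

lemma chart_preimage_open:
  assumes "smooth_atlas M" "(C, \<phi>) \<in> atlas M" "open S"
  shows "openin (mtop M) {x \<in> C. \<phi> x \<in> S}"
proof -
  have "openin (subtopology (mtop M) C) {x \<in> topspace (subtopology (mtop M) C). \<phi> x \<in> S}"
    by (rule openin_continuous_map_preimage[OF chart_continuous[OF assms(1,2)]]) (use assms in simp)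
  then show ?thesis
    using chart_topspace[OF assms(1,2)] openin_trans_full[OF _ chart_open[OF assms(1,2)]] by metis
qed

lemma chart_image_of_open:
  assumes "smooth_atlas M" "(C, \<phi>) \<in> atlas M" "openin (mtop M) V" "V \<subseteq> C"
  shows "open (\<phi> ` V)"
proof -
  have "openin (subtopology (mtop M) C) V" using assms chart_open[OF assms(1,2)]
    by (simp add: openin_open_subtopology)
  then have "openin (top_of_set (\<phi> ` C)) (\<phi> ` V)"
    using homeomorphic_imp_open_map[OF chart_homeo[OF assms(1,2)]] by (simp add: open_map_def)
  then show ?thesis using chart_image_open[OF assms(1,2)] openin_open_trans by blast
qed

section \<open>Smooth functions on open subsets of a manifold\<close>

lemma smooth_fun_open: "smooth_fun M U f \<Longrightarrow> openin (mtop M) U"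
  by (simp add: smooth_fun_def)

lemma smooth_fun_in_chart:
  assumes "smooth_fun M U f" "(C, \<phi>) \<in> atlas M"
  shows "smooth_on (\<phi> ` (U \<inter> C)) (\<lambda>u. f (inv_into C \<phi> u))"
  using assms unfolding smooth_fun_def o_def by blast

text \<open>On a subset of one chart domain a single chart decides, because every other chart
  differs from it by a smooth transition map.\<close>

lemma smooth_fun_chartI:
  assumes M: "smooth_atlas M" and C: "(C, \<phi>) \<in> atlas M" and V: "openin (mtop M) V" "V \<subseteq> C"
    and f: "smooth_on (\<phi> ` V) (\<lambda>u. f (inv_into C \<phi> u))"
  shows "smooth_fun M V f"
  unfolding smooth_fun_def
proof (intro conjI ballI V(1), clarify)
  fix D \<psi> assume D: "(D, \<psi>) \<in> atlas M"
  have VD: "openin (mtop M) (V \<inter> D)" using V chart_open[OF M D] by blast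
  have t: "smooth_on (\<psi> ` (V \<inter> D)) (\<phi> \<circ> inv_into D \<psi>)"
    by (rule smooth_on_subset[OF chart_transition[OF M D C] chart_image_of_open[OF M D VD]]) (use V in auto)
  have "smooth_on (\<psi> ` (V \<inter> D)) (\<lambda>u. f (inv_into C \<phi> ((\<phi> \<circ> inv_into D \<psi>) u)))"
    by (rule smooth_on_compose[OF smooth_atlas_frame[OF M] f t]) (use M D in auto)
  then show "smooth_on (\<psi> ` (V \<inter> D)) (f \<circ> inv_into D \<psi>)"
    by (rule smooth_on_cong) (use M D C V in auto)
qed

lemma smooth_fun_subset:
  assumes "smooth_atlas M" "smooth_fun M U f" "openin (mtop M) V" "V \<subseteq> U"
  shows "smooth_fun M V f"
  unfolding smooth_fun_def
proof (intro conjI ballI assms(3), clarify)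
  fix D \<psi> assume D: "(D, \<psi>) \<in> atlas M"
  show "smooth_on (\<psi> ` (V \<inter> D)) (f \<circ> inv_into D \<psi>)" unfolding o_def
    by (rule smooth_on_subset[OF smooth_fun_in_chart[OF assms(2) D] chart_image_of_open[OF assms(1) D]])
      (use assms chart_open[OF assms(1) D] in auto)
qed

lemma smooth_fun_local:
  assumes "\<And>x. x \<in> U \<Longrightarrow> \<exists>V. x \<in> V \<and> V \<subseteq> U \<and> smooth_fun M V f"
  shows "smooth_fun M U f"
  unfolding smooth_fun_def
proof (intro conjI ballI, goal_cases)
  case 1
  show ?case
  proof (subst openin_subopen, intro ballI)
    fix x assume "x \<in> U"
    then obtain V where "x \<in> V" "V \<subseteq> U" "smooth_fun M V f" using assms by blast
    then show "\<exists>T. openin (mtop M) T \<and> x \<in> T \<and> T \<subseteq> U" using smooth_fun_open by blast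
  qed
next
  case (2 x)
  obtain D \<psi> where x: "x = (D, \<psi>)" by force
  have "smooth_on (\<psi> ` (U \<inter> D)) (\<lambda>u. f (inv_into D \<psi> u))"
  proof (rule smooth_on_local)
    fix u assume "u \<in> \<psi> ` (U \<inter> D)"
    then obtain y where y: "y \<in> U" "y \<in> D" "u = \<psi> y" by auto
    then obtain V where "y \<in> V" "V \<subseteq> U" "smooth_fun M V f" using assms by blast
    then show "\<exists>T. u \<in> T \<and> T \<subseteq> \<psi> ` (U \<inter> D) \<and> smooth_on T (\<lambda>u. f (inv_into D \<psi> u))"
      using 2 x y smooth_fun_in_chart by (intro exI[of _ "\<psi> ` (V \<inter> D)"]) auto
  qed
  then show ?case by (simp add: x o_def)
qed

lemma smooth_fun_cong:
  assumes "smooth_fun M U f" "\<And>x. x \<in> U \<Longrightarrow> f x = g x" "smooth_atlas M"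
  shows "smooth_fun M U g"
  unfolding smooth_fun_def
proof (intro conjI ballI smooth_fun_open[OF assms(1)], clarify)
  fix D \<psi> assume D: "(D, \<psi>) \<in> atlas M"
  show "smooth_on (\<psi> ` (U \<inter> D)) (g \<circ> inv_into D \<psi>)" unfolding o_def
    by (rule smooth_on_cong[OF smooth_fun_in_chart[OF assms(1) D]]) (use assms(2,3) D in auto)
qed

lemma smooth_fun_const:
  assumes "smooth_atlas M" "openin (mtop M) U"
  shows "smooth_fun M U (\<lambda>x. c)"
  unfolding smooth_fun_def o_def using assms chart_open[OF assms(1)]
  by (auto intro!: smooth_on_const chart_image_of_open[OF assms(1)])

lemma smooth_fun_linear_comp: "bounded_linear h \<Longrightarrow> smooth_fun M U f \<Longrightarrow> smooth_fun M U (\<lambda>x. h (f x))"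
  unfolding smooth_fun_def o_def using smooth_on_linear_comp by fast

lemma smooth_fun_add: "smooth_fun M U f \<Longrightarrow> smooth_fun M U g \<Longrightarrow> smooth_fun M U (\<lambda>x. f x + g x)"
  unfolding smooth_fun_def o_def using smooth_on_add by fast

lemma smooth_fun_bilinear:
  "bounded_bilinear q \<Longrightarrow> smooth_fun M U f \<Longrightarrow> smooth_fun M U g \<Longrightarrow> smooth_fun M U (\<lambda>x. q (f x) (g x))"
  unfolding smooth_fun_def o_def using smooth_on_bilinear by fast

lemmas smooth_fun_mult = smooth_fun_bilinear[OF bounded_bilinear_mult]
lemmas smooth_fun_of_real = smooth_fun_linear_comp[OF bounded_linear_of_real]
lemmas smooth_fun_uminus = smooth_fun_linear_comp[OF bounded_linear_minus[OF bounded_linear_ident]]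

lemma smooth_fun_sum:
  assumes "smooth_atlas M" "openin (mtop M) U" "\<And>i. i \<in> I \<Longrightarrow> smooth_fun M U (f i)"
  shows "smooth_fun M U (\<lambda>x. \<Sum>i\<in>I. f i x)"
  using assms(3)
  by (induction I rule: infinite_finite_induct)
    (auto intro: smooth_fun_add smooth_fun_const assms(1,2))

lemma smooth_fun_Pair:
  "smooth_fun M U f \<Longrightarrow> smooth_fun M U g \<Longrightarrow> smooth_fun M U (\<lambda>x. (f x, g x))"
  unfolding smooth_fun_def o_def using smooth_on_Pair by fast

lemma smooth_fun_compose:
  fixes g :: "'m::real_inner \<Rightarrow> 'c::real_normed_vector"
  assumes "smooth_atlas M" "\<exists>E::'m set. frame E" "smooth_on T g" "smooth_fun M U f" "f ` U \<subseteq> T"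
  shows "smooth_fun M U (\<lambda>x. g (f x))"
  unfolding smooth_fun_def
proof (intro conjI ballI smooth_fun_open[OF assms(4)], clarify)
  fix D \<psi> assume D: "(D, \<psi>) \<in> atlas M"
  show "smooth_on (\<psi> ` (U \<inter> D)) ((\<lambda>x. g (f x)) \<circ> inv_into D \<psi>)" unfolding o_def
    by (rule smooth_on_compose[OF assms(2,3) smooth_fun_in_chart[OF assms(4) D]])
      (use assms(1,5) D in auto)
qed

lemma smooth_fun_inverse:
  fixes f :: "'a \<Rightarrow> complex"
  assumes "smooth_atlas M" "smooth_fun M U f" "\<And>x. x \<in> U \<Longrightarrow> f x \<noteq> 0"
  shows "smooth_fun M U (\<lambda>x. inverse (f x))"
  by (rule smooth_fun_compose[OF assms(1) complex_frame smooth_on_inverse assms(2)]) (use assms(3) in auto)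

lemma smooth_fun_chart:
  assumes "smooth_atlas M" "(C, \<phi>) \<in> atlas M" "openin (mtop M) V" "V \<subseteq> C"
  shows "smooth_fun M V \<phi>"
proof (rule smooth_fun_chartI[OF assms])
  show "smooth_on (\<phi> ` V) (\<lambda>u. \<phi> (inv_into C \<phi> u))"
    by (rule smooth_on_cong[OF smooth_on_linear[OF bounded_linear_ident chart_image_of_open[OF assms]]])
      (use assms in auto)
qed

lemma smooth_fun_continuous:
  assumes M: "smooth_atlas M" and f: "smooth_fun M U f"
  shows "continuous_map (subtopology (mtop M) U) euclidean f"
  unfolding continuous_map_def
proof (intro conjI allI impI)
  fix S :: "'c set" assume "openin euclidean S"
  then have S: "open S" by simp
  have U: "openin (mtop M) U" by (rule smooth_fun_open[OF f])
  then have tU: "topspace (subtopology (mtop M) U) = U" using openin_subset by fastforce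
  have "openin (mtop M) {x \<in> U. f x \<in> S}"
  proof (subst openin_subopen, clarify)
    fix x assume x: "x \<in> U" "f x \<in> S"
    then obtain C \<phi> where C: "(C, \<phi>) \<in> atlas M" "x \<in> C" using atlas_cover[OF M] U openin_subset by blast
    let ?g = "\<lambda>u. f (inv_into C \<phi> u)"
    have o: "open (\<phi> ` (U \<inter> C))" by (rule chart_image_of_open[OF M C(1)]) (use U chart_open[OF M C(1)] in auto)
    have "continuous_on (\<phi> ` (U \<inter> C)) ?g"
      by (rule smooth_on_imp_continuous_on[OF smooth_fun_in_chart[OF f C(1)]])
    then have "open (\<phi> ` (U \<inter> C) \<inter> ?g -` S)" 
      by (intro continuous_open_preimage o S)
    then have "openin (mtop M) {y \<in> C. \<phi> y \<in> \<phi> ` (U \<inter> C) \<inter> ?g -` S}"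
      by (rule chart_preimage_open[OF M C(1)])
    moreover have "{y \<in> C. \<phi> y \<in> \<phi> ` (U \<inter> C) \<inter> ?g -` S} = {y \<in> U \<inter> C. f y \<in> S}"
    proof (intro equalityI subsetI CollectI)
      fix y assume y: "y \<in> {y \<in> C. \<phi> y \<in> \<phi> ` (U \<inter> C) \<inter> ?g -` S}"
      then have "y \<in> U" using inj_on_image_mem_iff[OF chart_inj[OF M C(1)], of y "U \<inter> C"] by blast
      then show "y \<in> U \<inter> C \<and> f y \<in> S" using y chart_inv[OF M C(1), of y] by (simp add: vimage_def)
    qed (use chart_inv[OF M C(1)] in auto)
    ultimately show "\<exists>T. openin (mtop M) T \<and> x \<in> T \<and> T \<subseteq> {x \<in> U. f x \<in> S}"
      using x C by (intro exI[of _ "{y \<in> U \<inter> C. f y \<in> S}"]) auto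
  qed
  then show "openin (subtopology (mtop M) U) {x \<in> topspace (subtopology (mtop M) U). f x \<in> S}"
    unfolding tU using U by (auto simp: openin_open_subtopology)
qed auto

section \<open>Smooth maps between manifolds\<close>

lemma smooth_map_continuous: "smooth_map M N F \<Longrightarrow> continuous_map (mtop M) (mtop N) F"
  by (simp add: smooth_map_def)

lemma smooth_map_preimage_open:
  "smooth_map M N F \<Longrightarrow> openin (mtop N) V \<Longrightarrow> openin (mtop M) {x \<in> points M. F x \<in> V}"
  using smooth_map_continuous openin_continuous_map_preimage by blast

lemma smooth_map_in_points: "smooth_map M N F \<Longrightarrow> x \<in> points M \<Longrightarrow> F x \<in> points N"
  using smooth_map_continuous[of M N F] by (auto simp: continuous_map_def)

text \<open>Near each point \<open>f (F x)\<close> is the chart expression of \<open>f\<close>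
  applied to \<open>\<psi> (F x)\<close>, and the latter is smooth by the definition of a smooth
  map.\<close>

lemma smooth_map_pullback:
  fixes N :: "('b, 'f::{real_inner,banach}) mfd"
  assumes M: "smooth_atlas M" and N: "smooth_atlas N" and F: "smooth_map M N F"
    and f: "smooth_fun N V f"
  shows "smooth_fun M {x \<in> points M. F x \<in> V} (\<lambda>x. f (F x))"
proof (rule smooth_fun_local)
  fix x assume "x \<in> {x \<in> points M. F x \<in> V}"
  then have x: "x \<in> points M" "F x \<in> V" by auto
  have "F x \<in> points N" using smooth_map_in_points[OF F x(1)] .
  then obtain D \<psi> where D: "(D, \<psi>) \<in> atlas N" "F x \<in> D" using atlas_cover[OF N] by blast
  let ?W = "{x \<in> points M. F x \<in> V \<inter> D}"
  have V: "openin (mtop N) (V \<inter> D)" using smooth_fun_open[OF f] chart_open[OF N D(1)] by blast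
  have 1: "smooth_fun M {x \<in> points M. F x \<in> D} (\<lambda>x. \<psi> (F x))"
    using F D(1) unfolding smooth_map_def o_def by blast
  have W: "openin (mtop M) ?W" by (rule smooth_map_preimage_open[OF F V])
  have 2: "smooth_fun M ?W (\<lambda>x. \<psi> (F x))" by (rule smooth_fun_subset[OF M 1 W]) auto
  have "smooth_fun M ?W (\<lambda>x. f (inv_into D \<psi> (\<psi> (F x))))"
    by (rule smooth_fun_compose[OF M smooth_atlas_frame[OF N] smooth_fun_in_chart[OF f D(1)] 2]) auto
  then have "smooth_fun M ?W (\<lambda>x. f (F x))"
    by (rule smooth_fun_cong[OF _ _ M]) (use N D(1) in auto)
  then show "\<exists>W. x \<in> W \<and> W \<subseteq> {x \<in> points M. F x \<in> V} \<and> smooth_fun M W (\<lambda>x. f (F x))"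
    using x D by (intro exI[of _ ?W]) auto
qed

lemma smooth_map_compose:
  assumes M: "smooth_atlas M" and N: "smooth_atlas N" and F: "smooth_map M N F" and G: "smooth_map N K G"
  shows "smooth_map M K (\<lambda>x. G (F x))"
  unfolding smooth_map_def
proof (intro conjI ballI, goal_cases)
  case 1
  show ?case
    using continuous_map_compose[OF smooth_map_continuous[OF F] smooth_map_continuous[OF G]] by (simp add: o_def)
next
  case (2 z)
  obtain D \<psi> where z: "z = (D, \<psi>)" by force
  have "smooth_fun N {x \<in> points N. G x \<in> D} (\<lambda>x. \<psi> (G x))"
    using G 2 z unfolding smooth_map_def o_def by blast
  from smooth_map_pullback[OF M N F this]
  have "smooth_fun M {x \<in> points M. F x \<in> {x \<in> points N. G x \<in> D}} (\<lambda>x. \<psi> (G (F x)))" .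
  moreover have "{x \<in> points M. F x \<in> {x \<in> points N. G x \<in> D}} = {x \<in> points M. G (F x) \<in> D}"
    using smooth_map_in_points[OF F] by auto
  ultimately show ?case by (simp add: z o_def)
qed

section \<open>Open submanifolds\<close>

lemma points_submfd: "openin (mtop M) U \<Longrightarrow> points (open_submfd M U) = U"
  using openin_subset by (fastforce simp: open_submfd_def)

lemma openin_submfd: "openin (mtop M) U \<Longrightarrow> openin (mtop (open_submfd M U)) V \<longleftrightarrow> openin (mtop M) V \<and> V \<subseteq> U"
  by (simp add: open_submfd_def openin_open_subtopology)

lemma inv_into_restrict_chart:
  assumes "smooth_atlas M" "(C, \<phi>) \<in> atlas M" "S \<subseteq> C" "u \<in> \<phi> ` S"
  shows "inv_into S \<phi> u = inv_into C \<phi> u"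
  using assms chart_inj[OF assms(1,2)] inj_on_subset by (fastforce intro!: inv_into_f_eq)

text \<open>The charts of the submanifold have smaller domains, which changes the function
  \<open>inv_into\<close>, but not its values on the image of \<open>V\<close>.\<close>

lemma smooth_fun_submfd:
  assumes M: "smooth_atlas M" and U: "openin (mtop M) U"
  shows "smooth_fun (open_submfd M U) V f \<longleftrightarrow> smooth_fun M V f \<and> V \<subseteq> U"
proof -
  have "smooth_on (\<phi> ` (V \<inter> (C \<inter> U))) (f \<circ> inv_into (C \<inter> U) \<phi>) \<longleftrightarrow>
    smooth_on (\<phi> ` (V \<inter> C)) (f \<circ> inv_into C \<phi>)" if "V \<subseteq> U" and C: "(C, \<phi>) \<in> atlas M" for C \<phi>
  proof -
    have eq: "V \<inter> (C \<inter> U) = V \<inter> C" using that by auto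
    have "inv_into (C \<inter> U) \<phi> u = inv_into C \<phi> u" if "u \<in> \<phi> ` (V \<inter> C)" for u
      by (rule inv_into_restrict_chart[OF M C]) (use that \<open>V \<subseteq> U\<close> in auto)
    then show ?thesis unfolding eq by (metis (no_types, lifting) comp_apply smooth_on_cong)
  qed
  then show ?thesis
    unfolding smooth_fun_def openin_submfd[OF U] by (auto simp: open_submfd_def)
qed

lemma smooth_atlas_submfd:
  assumes M: "smooth_atlas M" and U: "openin (mtop M) U"
  shows "smooth_atlas (open_submfd M U)"
  unfolding smooth_atlas_def
proof (intro conjI ballI smooth_atlas_frame[OF M], goal_cases)
  case 1
  have "(\<Union>(C, \<phi>)\<in>atlas (open_submfd M U). C) = (\<Union>(C, \<phi>)\<in>atlas M. C) \<inter> U"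
    by (auto simp: open_submfd_def)
  also have "\<dots> = U" using M openin_subset[OF U] unfolding smooth_atlas_def by auto
  finally show ?case by (simp add: points_submfd[OF U])
next
  case (2 z)
  then obtain C \<phi> where C: "(C, \<phi>) \<in> atlas M" "z = (C \<inter> U, \<phi>)" by (auto simp: open_submfd_def)
  have CU: "openin (mtop M) (C \<inter> U)" using U chart_open[OF M C(1)] by auto
  have "homeomorphic_map (subtopology (subtopology (mtop M) C) (C \<inter> U))
      (subtopology (top_of_set (\<phi> ` C)) (\<phi> ` (C \<inter> U))) \<phi>"
    by (rule homeomorphic_map_subtopologies_alt[OF chart_homeo[OF M C(1)]])
      (use chart_topspace[OF M C(1)] chart_inj[OF M C(1)] in \<open>auto dest: inj_onD\<close>)
  moreover have "\<phi> ` C \<inter> \<phi> ` (C \<inter> U) = \<phi> ` (C \<inter> U)" by auto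
  moreover have "U \<inter> (C \<inter> U) = C \<inter> U" by auto
  ultimately show ?case
    using CU chart_image_of_open[OF M C(1) CU] openin_submfd[OF U] C(2)
    by (auto simp: open_submfd_def subtopology_subtopology)
next
  case (3 z)
  then obtain C \<phi> where C: "(C, \<phi>) \<in> atlas M" "z = (C \<inter> U, \<phi>)" by (auto simp: open_submfd_def)
  show ?case unfolding C(2) case_prod_conv
  proof
    fix w assume "w \<in> atlas (open_submfd M U)"
    then obtain D \<psi> where D: "(D, \<psi>) \<in> atlas M" "w = (D \<inter> U, \<psi>)" by (auto simp: open_submfd_def)
    have "openin (mtop M) (C \<inter> U \<inter> (D \<inter> U))" using U chart_open[OF M C(1)] chart_open[OF M D(1)] by blast
    then have "smooth_on (\<phi> ` (C \<inter> U \<inter> (D \<inter> U))) (\<psi> \<circ> inv_into C \<phi>)"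
      by (intro smooth_on_subset[OF chart_transition[OF M C(1) D(1)] chart_image_of_open[OF M C(1)]]) auto
    then have "smooth_on (\<phi> ` (C \<inter> U \<inter> (D \<inter> U))) (\<psi> \<circ> inv_into (C \<inter> U) \<phi>)"
      by (rule smooth_on_cong) (use inv_into_restrict_chart[OF M C(1), of "C \<inter> U"] in auto)
    then show "case w of (D, \<psi>) \<Rightarrow> smooth_on (\<phi> ` (C \<inter> U \<inter> D)) (\<psi> \<circ> inv_into (C \<inter> U) \<phi>)" by (simp add: C D)
  qed
qed

lemma smooth_map_restrict_domain:
  assumes M: "smooth_atlas M" and U: "openin (mtop M) U" and F: "smooth_map M N F" and "smooth_atlas N"
  shows "smooth_map (open_submfd M U) N F"
  unfolding smooth_map_def
proof (intro conjI ballI, goal_cases)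
  case 1
  then show ?case
    using smooth_map_continuous[OF F] by (simp add: open_submfd_def continuous_map_from_subtopology)
next
  case (2 z)
  obtain D \<psi> where z: "z = (D, \<psi>)" by force
  have 1: "smooth_fun M {x \<in> points M. F x \<in> D} (\<lambda>x. \<psi> (F x))"
    using F 2 z unfolding smooth_map_def o_def by blast
  have "openin (mtop M) ({x \<in> points M. F x \<in> D} \<inter> U)" using U smooth_fun_open[OF 1] by blast
  moreover have eq: "{x \<in> points (open_submfd M U). F x \<in> D} = {x \<in> points M. F x \<in> D} \<inter> U"
    using points_submfd[OF U] openin_subset[OF U] by auto
  ultimately have "smooth_fun M {x \<in> points (open_submfd M U). F x \<in> D} (\<lambda>x. \<psi> (F x))"
    using smooth_fun_subset[OF M 1] by simp
  then show ?case unfolding z case_prod_conv smooth_fun_submfd[OF M U] using eq by (simp add: o_def)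
qed

lemma smooth_map_local:
  assumes M: "smooth_atlas M"
    and loc: "\<And>x. x \<in> points M \<Longrightarrow> \<exists>U. openin (mtop M) U \<and> x \<in> U \<and> smooth_map (open_submfd M U) N F"
  shows "smooth_map M N F"
  unfolding smooth_map_def
proof (intro conjI ballI, goal_cases)
  case 1
  show ?case unfolding continuous_map_def
  proof (intro conjI allI impI)
    show "F \<in> points M \<rightarrow> points N"
    proof
      fix x assume "x \<in> points M"
      then obtain U where U: "openin (mtop M) U" "x \<in> U" "smooth_map (open_submfd M U) N F" using loc by blast
      then show "F x \<in> points N" using smooth_map_in_points[OF U(3)] points_submfd[OF U(1)] by blast
    qed
    fix V assume V: "openin (mtop N) V"
    show "openin (mtop M) {x \<in> points M. F x \<in> V}"
    proof (subst openin_subopen, clarify)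
      fix x assume x: "x \<in> points M" "F x \<in> V"
      obtain U where U: "openin (mtop M) U" "x \<in> U" "smooth_map (open_submfd M U) N F"
        using loc[OF x(1)] by blast
      have "openin (mtop (open_submfd M U)) {y \<in> points (open_submfd M U). F y \<in> V}"
        by (rule smooth_map_preimage_open[OF U(3) V])
      then show "\<exists>T. openin (mtop M) T \<and> x \<in> T \<and> T \<subseteq> {x \<in> points M. F x \<in> V}"
        using x U(2) openin_subset[OF U(1)] unfolding openin_submfd[OF U(1)] points_submfd[OF U(1)]
        by (intro exI[of _ "{y \<in> U. F y \<in> V}"]) auto
    qed
  qed
next
  case (2 z)
  obtain D \<psi> where z: "z = (D, \<psi>)" by force
  have "smooth_fun M {x \<in> points M. F x \<in> D} (\<psi> \<circ> F)"
  proof (rule smooth_fun_local)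
    fix x assume x: "x \<in> {x \<in> points M. F x \<in> D}"
    then obtain U where U: "openin (mtop M) U" "x \<in> U" "smooth_map (open_submfd M U) N F"
      using loc by blast
    have "smooth_fun (open_submfd M U) {x \<in> points (open_submfd M U). F x \<in> D} (\<psi> \<circ> F)"
      using U(3) 2 z unfolding smooth_map_def by blast
    then show "\<exists>V. x \<in> V \<and> V \<subseteq> {x \<in> points M. F x \<in> D} \<and> smooth_fun M V (\<psi> \<circ> F)"
      using x U(2) openin_subset[OF U(1)] unfolding smooth_fun_submfd[OF M U(1)] points_submfd[OF U(1)]
      by (intro exI[of _ "{y \<in> U. F y \<in> D}"]) auto
  qed
  then show ?case by (simp add: z)
qed

lemma smooth_map_cong:
  assumes "smooth_atlas M" "smooth_map M N F" "\<And>x. x \<in> points M \<Longrightarrow> F x = G x"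
  shows "smooth_map M N G"
  unfolding smooth_map_def
proof (intro conjI ballI, goal_cases)
  case 1
  show ?case using smooth_map_continuous[OF assms(2)] assms(3) continuous_map_eq by blast
next
  case (2 z)
  obtain D \<psi> where z: "z = (D, \<psi>)" by force
  have "smooth_fun M {x \<in> points M. F x \<in> D} (\<psi> \<circ> F)" using assms(2) 2 z unfolding smooth_map_def by blast
  then have "smooth_fun M {x \<in> points M. F x \<in> D} (\<psi> \<circ> G)"
    by (rule smooth_fun_cong) (use assms in auto)
  moreover have "{x \<in> points M. F x \<in> D} = {x \<in> points M. G x \<in> D}" using assms(3) by auto
  ultimately show ?case by (simp add: z)
qed

lemma smooth_map_into_submfd:
  assumes N: "smooth_atlas N" and V: "openin (mtop N) V"
  shows "smooth_map M (open_submfd N V) F \<longleftrightarrow> smooth_map M N F \<and> F ` points M \<subseteq> V"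
proof
  assume F: "smooth_map M (open_submfd N V) F"
  then have sub: "F ` points M \<subseteq> V"
    using smooth_map_in_points[OF F] unfolding points_submfd[OF V] by blast
  have "smooth_map M N F"
    unfolding smooth_map_def
  proof (intro conjI ballI, goal_cases)
    case 1
    show ?case using smooth_map_continuous[OF F] by (simp add: open_submfd_def continuous_map_in_subtopology)
  next
    case (2 z)
    obtain D \<psi> where z: "z = (D, \<psi>)" by force
    have "(D \<inter> V, \<psi>) \<in> atlas (open_submfd N V)" using 2 z by (force simp: open_submfd_def)
    then have "smooth_fun M {x \<in> points M. F x \<in> D \<inter> V} (\<psi> \<circ> F)" using F unfolding smooth_map_def by blast
    moreover have "{x \<in> points M. F x \<in> D \<inter> V} = {x \<in> points M. F x \<in> D}" using sub by auto
    ultimately show ?case by (simp add: z)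
  qed
  with sub show "smooth_map M N F \<and> F ` points M \<subseteq> V" by simp
next
  assume F: "smooth_map M N F \<and> F ` points M \<subseteq> V"
  show "smooth_map M (open_submfd N V) F"
    unfolding smooth_map_def
  proof (intro conjI ballI, goal_cases)
    case 1
    show ?case using F smooth_map_continuous[of M N F]
      by (auto simp: open_submfd_def continuous_map_in_subtopology)
  next
    case (2 z)
    then obtain D \<psi> where z: "z = (D \<inter> V, \<psi>)" "(D, \<psi>) \<in> atlas N" by (auto simp: open_submfd_def)
    then have "smooth_fun M {x \<in> points M. F x \<in> D} (\<psi> \<circ> F)" using F unfolding smooth_map_def by blast
    moreover have "{x \<in> points M. F x \<in> D \<inter> V} = {x \<in> points M. F x \<in> D}" using F by auto
    ultimately show ?case by (simp add: z)
  qed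
qed

lemma smooth_map_id:
  assumes M: "smooth_atlas M"
  shows "smooth_map M M (\<lambda>x. x)"
  unfolding smooth_map_def
proof (intro conjI ballI, goal_cases)
  case (2 z)
  obtain D \<psi> where z: "z = (D, \<psi>)" by force
  have "{x \<in> points M. x \<in> D} = D" using chart_subset[OF M] 2 z by auto
  then show ?case using smooth_fun_chart[OF M, of D \<psi> D] 2 z chart_open[OF M] by (simp add: o_def)
qed simp

section \<open>Products of manifolds, and the complex line as a manifold\<close>

lemma points_prod: "points (prod_mfd M N) = points M \<times> points N"
  by (simp add: prod_mfd_def)

lemma inv_into_map_prod:
  assumes "smooth_atlas M" "(C, \<phi>) \<in> atlas M" "smooth_atlas N" "(D, \<psi>) \<in> atlas N" "u \<in> \<phi> ` C" "v \<in> \<psi> ` D"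
  shows "inv_into (C \<times> D) (map_prod \<phi> \<psi>) (u, v) = (inv_into C \<phi> u, inv_into D \<psi> v)"
proof -
  have "inj_on (map_prod \<phi> \<psi>) (C \<times> D)"
    using chart_inj[OF assms(1,2)] chart_inj[OF assms(3,4)] by (rule map_prod_inj_on)
  then show ?thesis using assms by (intro inv_into_f_eq) (auto simp: f_inv_into_f inv_into_into)
qed

text \<open>The derivative of \<open>f (fst z)\<close> in the direction \<open>v\<close> is the
  derivative of \<open>f\<close> in the direction \<open>fst v\<close>, again composed with
  \<open>fst\<close>. Each component therefore passes through its own induction on the
  order.\<close>

lemma smooth_on_map_prod:
  assumes "smooth_on S f" "smooth_on T g"
  shows "smooth_on (S \<times> T) (\<lambda>z. (f (fst z), g (snd z)))"
proof -
  have "Ck_on k (S \<times> T) (\<lambda>z. f (fst z))" for k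
    using smooth_onD(2)[OF assms(1), of k]
  proof (induction k arbitrary: f)
    case 0
    then show ?case by (auto intro!: continuous_on_compose2[of S f] continuous_intros)
  next
    case (Suc k)
    show ?case
    proof (rule Ck_on_SucI[where f' = "\<lambda>z v. frechet_derivative f (at (fst z)) (fst v)"])
      show "open (S \<times> T)" by (rule open_Times[OF smooth_onD(1)[OF assms(1)] smooth_onD(1)[OF assms(2)]])
      fix z assume "z \<in> S \<times> T"
      then show "((\<lambda>z. f (fst z)) has_derivative (\<lambda>v. frechet_derivative f (at (fst z)) (fst v))) (at z)"
        by (auto intro!: has_derivative_compose[OF has_derivative_fst[OF has_derivative_ident]]
            Ck_on_has_derivative[OF Suc.prems])
    next
      fix v :: "'a \<times> 'c"
      show "Ck_on k (S \<times> T) (\<lambda>z. frechet_derivative f (at (fst z)) (fst v))"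
        by (rule Suc.IH[OF Ck_on_frechet_derivative[OF Suc.prems]])
    qed
  qed
  moreover have "Ck_on k (S \<times> T) (\<lambda>z. g (snd z))" for k
    using smooth_onD(2)[OF assms(2), of k]
  proof (induction k arbitrary: g)
    case 0
    then show ?case by (auto intro!: continuous_on_compose2[of T g] continuous_intros)
  next
    case (Suc k)
    show ?case
    proof (rule Ck_on_SucI[where f' = "\<lambda>z v. frechet_derivative g (at (snd z)) (snd v)"])
      show "open (S \<times> T)" by (rule open_Times[OF smooth_onD(1)[OF assms(1)] smooth_onD(1)[OF assms(2)]])
      fix z assume "z \<in> S \<times> T"
      then show "((\<lambda>z. g (snd z)) has_derivative (\<lambda>v. frechet_derivative g (at (snd z)) (snd v))) (at z)"
        by (auto intro!: has_derivative_compose[OF has_derivative_snd[OF has_derivative_ident]]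
            Ck_on_has_derivative[OF Suc.prems])
    next
      fix v :: "'a \<times> 'c"
      show "Ck_on k (S \<times> T) (\<lambda>z. frechet_derivative g (at (snd z)) (snd v))"
        by (rule Suc.IH[OF Ck_on_frechet_derivative[OF Suc.prems]])
    qed
  qed
  ultimately show ?thesis
    using assms by (intro smooth_on_Pair) (auto simp: smooth_on_def open_Times)
qed

lemma frame_prod:
  assumes "\<exists>E::'e::real_inner set. frame E" "\<exists>E::'f::real_inner set. frame E"
  shows "\<exists>E::('e \<times> 'f) set. frame E"
proof -
  obtain E :: "'e set" and F :: "'f set" where "frame E" "frame F" using assms by blast
  then have E: "finite E" "\<And>x. (\<Sum>e\<in>E. (x \<bullet> e) *\<^sub>R e) = x" and F: "finite F" "\<And>x. (\<Sum>e\<in>F. (x \<bullet> e) *\<^sub>R e) = x"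
    by (auto simp: frame_def)
  have "x \<in> span ((\<lambda>e. (e, 0)) ` E \<union> (\<lambda>e. (0, e)) ` F)" (is "x \<in> span ?B") for x :: "'e \<times> 'f"
  proof -
    have "x = (\<Sum>e\<in>E. (fst x \<bullet> e) *\<^sub>R (e, 0)) + (\<Sum>e\<in>F. (snd x \<bullet> e) *\<^sub>R (0, e))"
      by (rule prod_eqI) (simp_all add: fst_sum snd_sum E F)
    also have "\<dots> \<in> span ?B" by (intro span_add span_sum span_scale span_base) auto
    finally show ?thesis .
  qed
  then show ?thesis using E F by (intro frame_exists[of ?B]) auto
qed

lemma smooth_atlas_prod:
  assumes M: "smooth_atlas M" and N: "smooth_atlas N"
  shows "smooth_atlas (prod_mfd M N)"
  unfolding smooth_atlas_def
proof (intro conjI ballI frame_prod smooth_atlas_frame[OF M] smooth_atlas_frame[OF N], goal_cases)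
  case 1
  have "(\<Union>(C, \<phi>)\<in>atlas (prod_mfd M N). C) = (\<Union>(C, \<phi>)\<in>atlas M. C) \<times> (\<Union>(C, \<phi>)\<in>atlas N. C)"
  proof (intro equalityI subsetI)
    fix x assume "x \<in> (\<Union>(C, \<phi>)\<in>atlas M. C) \<times> (\<Union>(C, \<phi>)\<in>atlas N. C)"
    then obtain C \<phi> D \<psi> where CD: "(C, \<phi>) \<in> atlas M" "(D, \<psi>) \<in> atlas N" "fst x \<in> C" "snd x \<in> D" by auto
    then have "(C \<times> D, map_prod \<phi> \<psi>) \<in> atlas (prod_mfd M N)" by (auto simp: prod_mfd_def)
    then show "x \<in> (\<Union>(C, \<phi>)\<in>atlas (prod_mfd M N). C)" using CD by (auto simp: mem_Times_iff intro!: bexI[of _ "(C \<times> D, map_prod \<phi> \<psi>)"])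
  qed (auto simp: prod_mfd_def)
  then show ?case using M N unfolding smooth_atlas_def by (simp add: points_prod)
next
  case (2 z)
  then obtain C \<phi> D \<psi> where C: "(C, \<phi>) \<in> atlas M" and D: "(D, \<psi>) \<in> atlas N"
    and z: "z = (C \<times> D, map_prod \<phi> \<psi>)" by (auto simp: prod_mfd_def)
  have "homeomorphic_map (prod_topology (subtopology (mtop M) C) (subtopology (mtop N) D))
      (prod_topology (top_of_set (\<phi> ` C)) (top_of_set (\<psi> ` D))) (\<lambda>(x, y). (\<phi> x, \<psi> y))"
    using chart_homeo[OF M C] chart_homeo[OF N D] homeomorphic_maps_prod
    unfolding homeomorphic_map_maps by blast
  moreover have "map_prod \<phi> \<psi> = (\<lambda>(x, y). (\<phi> x, \<psi> y))" by auto
  moreover have "map_prod \<phi> \<psi> ` (C \<times> D) = \<phi> ` C \<times> \<psi> ` D" by auto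
  ultimately show ?case
    using chart_image_open[OF M C] chart_image_open[OF N D] chart_open[OF M C] chart_open[OF N D]
    by (simp add: z prod_mfd_def openin_prod_Times_iff subtopology_Times open_Times
        flip: euclidean_product_topology)
next
  case (3 z)
  then obtain C \<phi> D \<psi> where C: "(C, \<phi>) \<in> atlas M" and D: "(D, \<psi>) \<in> atlas N"
    and z: "z = (C \<times> D, map_prod \<phi> \<psi>)" by (auto simp: prod_mfd_def)
  show ?case unfolding z case_prod_conv
  proof
    fix w assume "w \<in> atlas (prod_mfd M N)"
    then obtain C' \<phi>' D' \<psi>' where C': "(C', \<phi>') \<in> atlas M" and D': "(D', \<psi>') \<in> atlas N"
      and w: "w = (C' \<times> D', map_prod \<phi>' \<psi>')" by (auto simp: prod_mfd_def)
    have eq: "map_prod \<phi> \<psi> ` (C \<times> D \<inter> C' \<times> D') = \<phi> ` (C \<inter> C') \<times> \<psi> ` (D \<inter> D')" by force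
    have "smooth_on (map_prod \<phi> \<psi> ` (C \<times> D \<inter> C' \<times> D'))
        (\<lambda>z. ((\<phi>' \<circ> inv_into C \<phi>) (fst z), (\<psi>' \<circ> inv_into D \<psi>) (snd z)))"
      unfolding eq by (rule smooth_on_map_prod[OF chart_transition[OF M C C'] chart_transition[OF N D D']])
    then have "smooth_on (map_prod \<phi> \<psi> ` (C \<times> D \<inter> C' \<times> D')) (map_prod \<phi>' \<psi>' \<circ> inv_into (C \<times> D) (map_prod \<phi> \<psi>))"
      by (rule smooth_on_cong) (auto simp: inv_into_map_prod[OF M C N D] M C N D)
    then show "case w of (D', \<psi>') \<Rightarrow> smooth_on (map_prod \<phi> \<psi> ` (C \<times> D \<inter> D'))
        (\<psi>' \<circ> inv_into (C \<times> D) (map_prod \<phi> \<psi>))" by (simp add: w)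
  qed
qed

lemma smooth_atlas_complex: "smooth_atlas complex_mfd"
  unfolding smooth_atlas_def using complex_frame
  by (auto simp: complex_mfd_def o_def homeomorphic_map_id[unfolded id_def] id_def
      intro!: smooth_on_linear bounded_linear_ident)

lemma smooth_fun_prod:
  assumes M: "smooth_atlas M" and N: "smooth_atlas N" and f: "smooth_fun M U f" and g: "smooth_fun N V g"
  shows "smooth_fun (prod_mfd M N) (U \<times> V) (\<lambda>z. (f (fst z), g (snd z)))"
  unfolding smooth_fun_def
proof (intro conjI ballI, goal_cases)
  case 1
  show ?case using smooth_fun_open[OF f] smooth_fun_open[OF g]
    by (simp add: prod_mfd_def openin_prod_Times_iff)
next
  case (2 z)
  then obtain C \<phi> D \<psi> where C: "(C, \<phi>) \<in> atlas M" and D: "(D, \<psi>) \<in> atlas N"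
    and z: "z = (C \<times> D, map_prod \<phi> \<psi>)" by (auto simp: prod_mfd_def)
  have eq: "map_prod \<phi> \<psi> ` (U \<times> V \<inter> C \<times> D) = \<phi> ` (U \<inter> C) \<times> \<psi> ` (V \<inter> D)" by force
  have "smooth_on (map_prod \<phi> \<psi> ` (U \<times> V \<inter> C \<times> D))
      (\<lambda>z. (f (inv_into C \<phi> (fst z)), g (inv_into D \<psi> (snd z))))"
    unfolding eq by (rule smooth_on_map_prod[OF smooth_fun_in_chart[OF f C] smooth_fun_in_chart[OF g D]])
  then have "smooth_on (map_prod \<phi> \<psi> ` (U \<times> V \<inter> C \<times> D))
      ((\<lambda>z. (f (fst z), g (snd z))) \<circ> inv_into (C \<times> D) (map_prod \<phi> \<psi>))"
    by (rule smooth_on_cong) (auto simp: inv_into_map_prod[OF M C N D])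
  then show ?case by (simp add: z)
qed

lemma smooth_map_fst:
  assumes M: "smooth_atlas M" and N: "smooth_atlas N"
  shows "smooth_map (prod_mfd M N) M fst"
  unfolding smooth_map_def
proof (intro conjI ballI, goal_cases)
  case 1
  show ?case by (simp add: prod_mfd_def continuous_map_fst)
next
  case (2 z)
  obtain D \<psi> where z: "z = (D, \<psi>)" by force
  have D: "(D, \<psi>) \<in> atlas M" using 2 z by simp
  \<comment> \<open>The projection is paired with a constant function on the other factor, so that
    the rule for pairs on products applies; the constant is projected away again.\<close>
  have "smooth_fun (prod_mfd M N) (D \<times> points N) (\<lambda>z. fst (\<psi> (fst z), (\<lambda>x. 0 :: complex) (snd z)))"
    by (intro smooth_fun_linear_comp[OF bounded_linear_fst] smooth_fun_prod[OF M N]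
        smooth_fun_const[OF N] smooth_fun_chart[OF M D]) (use chart_open[OF M D] in auto)
  moreover have "{x \<in> points (prod_mfd M N). fst x \<in> D} = D \<times> points N"
    using chart_subset[OF M D] by (auto simp: points_prod)
  ultimately show ?case by (simp add: z o_def)
qed

lemma smooth_map_snd:
  assumes M: "smooth_atlas M" and N: "smooth_atlas N"
  shows "smooth_map (prod_mfd M N) N snd"
  unfolding smooth_map_def
proof (intro conjI ballI, goal_cases)
  case 1
  show ?case by (simp add: prod_mfd_def continuous_map_snd)
next
  case (2 z)
  obtain D \<psi> where z: "z = (D, \<psi>)" by force
  have D: "(D, \<psi>) \<in> atlas N" using 2 z by simp
  have "smooth_fun (prod_mfd M N) (points M \<times> D) (\<lambda>z. snd ((\<lambda>x. 0 :: complex) (fst z), \<psi> (snd z)))"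
    by (intro smooth_fun_linear_comp[OF bounded_linear_snd] smooth_fun_prod[OF M N]
        smooth_fun_const[OF M] smooth_fun_chart[OF N D]) (use chart_open[OF N D] in auto)
  moreover have "{x \<in> points (prod_mfd M N). snd x \<in> D} = points M \<times> D"
    using chart_subset[OF N D] by (auto simp: points_prod)
  ultimately show ?case by (simp add: z o_def)
qed

lemma smooth_map_Pair:
  assumes M: "smooth_atlas M" and f: "smooth_map M N f" and g: "smooth_map M K g"
  shows "smooth_map M (prod_mfd N K) (\<lambda>x. (f x, g x))"
  unfolding smooth_map_def
proof (intro conjI ballI, goal_cases)
  case 1
  show ?case using smooth_map_continuous[OF f] smooth_map_continuous[OF g]
    by (simp add: prod_mfd_def continuous_map_pairedI)
next
  case (2 z)
  then obtain C \<phi> D \<psi> where C: "(C, \<phi>) \<in> atlas N" and D: "(D, \<psi>) \<in> atlas K"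
    and z: "z = (C \<times> D, map_prod \<phi> \<psi>)" by (auto simp: prod_mfd_def)
  have 1: "smooth_fun M {x \<in> points M. f x \<in> C} (\<lambda>x. \<phi> (f x))"
    using f C unfolding smooth_map_def o_def by blast
  have 2: "smooth_fun M {x \<in> points M. g x \<in> D} (\<lambda>x. \<psi> (g x))"
    using g D unfolding smooth_map_def o_def by blast
  let ?W = "{x \<in> points M. f x \<in> C} \<inter> {x \<in> points M. g x \<in> D}"
  have W: "openin (mtop M) ?W" using smooth_fun_open[OF 1] smooth_fun_open[OF 2] by blast
  have "smooth_fun M ?W (\<lambda>x. (\<phi> (f x), \<psi> (g x)))"
    by (intro smooth_fun_Pair smooth_fun_subset[OF M 1 W] smooth_fun_subset[OF M 2 W]) auto
  moreover have "{x \<in> points M. (f x, g x) \<in> C \<times> D} = ?W" by auto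
  ultimately show ?case by (simp add: z o_def)
qed

lemma smooth_map_complexI:
  assumes M: "smooth_atlas M" and f: "smooth_fun M (points M) f"
  shows "smooth_map M complex_mfd f"
  using smooth_fun_continuous[OF M f] f by (simp add: smooth_map_def complex_mfd_def o_def id_def)

lemma smooth_map_complexD:
  "smooth_map M complex_mfd f \<Longrightarrow> smooth_fun M (points M) f"
  by (simp add: smooth_map_def complex_mfd_def o_def id_def)

section \<open>Tangent vectors and vector fields in a chart\<close>

text \<open>The partial derivative in the direction \<open>e\<close> of the chart. The value 0 on
  functions that are not smooth near \<open>x\<close> is the convention of
  \<open>tangent_space\<close>, so that the result is a tangent vector.\<close>

definition coord_deriv ::
    "('a, 'e::{real_inner,banach}) mfd \<Rightarrow> 'a set \<Rightarrow> ('a \<Rightarrow> 'e) \<Rightarrow> 'e \<Rightarrow> 'a \<Rightarrow> 'a tvec" where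
  "coord_deriv M C \<phi> e x = (\<lambda>f. if smooth_near M x f
     then frechet_derivative (\<lambda>u. f (inv_into C \<phi> u)) (at (\<phi> x)) e else 0)"

lemma smooth_nearI: "smooth_fun M U f \<Longrightarrow> x \<in> U \<Longrightarrow> smooth_near M x f"
  unfolding smooth_near_def by blast

lemma tangent_space_nonsmooth: "v \<in> tangent_space M x \<Longrightarrow> \<not> smooth_near M x f \<Longrightarrow> v f = 0"
  unfolding tangent_space_def by blast

lemma tangent_space_add: "v \<in> tangent_space M x \<Longrightarrow> smooth_near M x f \<Longrightarrow> smooth_near M x g \<Longrightarrow>
    v (\<lambda>y. f y + g y) = v f + v g"
  unfolding tangent_space_def by blast

lemma tangent_space_mult: "v \<in> tangent_space M x \<Longrightarrow> smooth_near M x f \<Longrightarrow> smooth_near M x g \<Longrightarrow>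
    v (\<lambda>y. f y * g y) = v f * g x + f x * v g"
  unfolding tangent_space_def by blast

lemma tangent_space_scale: "v \<in> tangent_space M x \<Longrightarrow> smooth_near M x f \<Longrightarrow> v (\<lambda>y. c * f y) = c * v f"
  unfolding tangent_space_def by blast

context
  fixes M :: "('a, 'e::{real_inner,banach}) mfd"
  assumes M: "smooth_atlas M"
begin

lemma smooth_near_const: "x \<in> points M \<Longrightarrow> smooth_near M x (\<lambda>y. c)"
  by (rule smooth_nearI[OF smooth_fun_const[OF M openin_topspace]])

lemma smooth_near_binop:
  assumes "smooth_near M x f" "smooth_near M x g"
    and "\<And>U. smooth_fun M U f \<Longrightarrow> smooth_fun M U g \<Longrightarrow> smooth_fun M U h"
  shows "smooth_near M x h"
proof -
  obtain U V where UV: "x \<in> U" "smooth_fun M U f" "x \<in> V" "smooth_fun M V g"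
    using assms(1,2) unfolding smooth_near_def by blast
  have o: "openin (mtop M) (U \<inter> V)" using UV smooth_fun_open by blast
  have "smooth_fun M (U \<inter> V) h"
    by (intro assms(3) smooth_fun_subset[OF M UV(2) o] smooth_fun_subset[OF M UV(4) o]) auto
  then show ?thesis using UV by (blast intro: smooth_nearI)
qed

lemma smooth_near_add: "smooth_near M x f \<Longrightarrow> smooth_near M x g \<Longrightarrow> smooth_near M x (\<lambda>y. f y + g y)"
  by (rule smooth_near_binop[where f = f and g = g]) (auto intro: smooth_fun_add)

lemma smooth_near_mult: "smooth_near M x f \<Longrightarrow> smooth_near M x g \<Longrightarrow> smooth_near M x (\<lambda>y. f y * g y)"
  by (rule smooth_near_binop[where f = f and g = g]) (auto intro: smooth_fun_mult)

lemma smooth_near_cong: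
  assumes "smooth_near M x f" "openin (mtop M) U" "x \<in> U" "\<And>y. y \<in> U \<Longrightarrow> f y = g y"
  shows "smooth_near M x g"
proof -
  obtain V where V: "x \<in> V" "smooth_fun M V f" using assms(1) unfolding smooth_near_def by blast
  have "openin (mtop M) (U \<inter> V)" using V assms smooth_fun_open by blast
  then have "smooth_fun M (U \<inter> V) f" by (rule smooth_fun_subset[OF M V(2)]) auto
  then have "smooth_fun M (U \<inter> V) g" by (rule smooth_fun_cong[OF _ _ M]) (use assms in auto)
  then show ?thesis using V assms by (blast intro: smooth_nearI)
qed

text \<open>This holds for arbitrary functions: if one of them fails to be smooth near
  \<open>x\<close>, then so does the other, and both values are the default 0.\<close>

lemma tangent_space_local:
  assumes v: "v \<in> tangent_space M x" and U: "openin (mtop M) U" "x \<in> U" and eq: "\<And>y. y \<in> U \<Longrightarrow> f y = g y"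
  shows "v f = v g"
proof (cases "smooth_near M x f")
  case True
  then have "smooth_near M x g" by (rule smooth_near_cong[OF _ U eq])
  then show ?thesis using True v U eq unfolding tangent_space_def by blast
next
  case False
  then have "\<not> smooth_near M x g" using smooth_near_cong[OF _ U, of g f] eq by auto
  then show ?thesis using False v by (simp add: tangent_space_nonsmooth)
qed

text \<open>The product rule for 1 * 1 gives \<open>v 1 = 2 * v 1\<close>, and scaling does the
  rest.\<close>

lemma tangent_space_const:
  assumes "v \<in> tangent_space M x" "x \<in> points M"
  shows "v (\<lambda>y. c) = 0"
proof -
  have "v (\<lambda>y. 1 * 1) = v (\<lambda>y. 1) * 1 + 1 * v (\<lambda>y. 1)"
    by (rule tangent_space_mult[OF assms(1)]) (rule smooth_near_const[OF assms(2)])+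
  then have "v (\<lambda>y. 1) = 0" by simp
  then show ?thesis
    using tangent_space_scale[OF assms(1) smooth_near_const[OF assms(2)], of c 1] by simp
qed

lemma tangent_space_sum:
  assumes "v \<in> tangent_space M x" "x \<in> points M" "\<And>i. i \<in> I \<Longrightarrow> smooth_near M x (f i)"
  shows "v (\<lambda>y. \<Sum>i\<in>I. f i y) = (\<Sum>i\<in>I. v (f i))"
    and "smooth_near M x (\<lambda>y. \<Sum>i\<in>I. f i y)"
proof -
  have "v (\<lambda>y. \<Sum>i\<in>I. f i y) = (\<Sum>i\<in>I. v (f i)) \<and> smooth_near M x (\<lambda>y. \<Sum>i\<in>I. f i y)"
    using assms(3)
    by (induction I rule: infinite_finite_induct)
      (auto simp: tangent_space_const[OF assms(1,2)] smooth_near_const[OF assms(2)]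
        tangent_space_add[OF assms(1)] smooth_near_add)
  then show "v (\<lambda>y. \<Sum>i\<in>I. f i y) = (\<Sum>i\<in>I. v (f i))" "smooth_near M x (\<lambda>y. \<Sum>i\<in>I. f i y)" by auto
qed

lemma tangent_space_lincomb:
  assumes "v \<in> tangent_space M x" "w \<in> tangent_space M x"
  shows "(\<lambda>f. a * v f + b * w f) \<in> tangent_space M x"
  unfolding tangent_space_def
proof (intro CollectI conjI allI impI)
  fix f g assume "smooth_near M x f" "smooth_near M x g"
    and "\<exists>U. openin (mtop M) U \<and> x \<in> U \<and> (\<forall>y\<in>U. f y = g y)"
  then show "a * v f + b * w f = a * v g + b * w g"
    using tangent_space_local[OF assms(1)] tangent_space_local[OF assms(2)] by metis
qed (simp_all add: tangent_space_nonsmooth[OF assms(1)] tangent_space_nonsmooth[OF assms(2)]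
    tangent_space_add[OF assms(1)] tangent_space_add[OF assms(2)] tangent_space_mult[OF assms(1)]
    tangent_space_mult[OF assms(2)] tangent_space_scale[OF assms(1)] tangent_space_scale[OF assms(2)]
    algebra_simps)

lemma smooth_near_chart:
  assumes C: "(C, \<phi>) \<in> atlas M" and x: "x \<in> C" and f: "smooth_near M x f"
  obtains r where "0 < r" "ball (\<phi> x) r \<subseteq> \<phi> ` C" "smooth_on (ball (\<phi> x) r) (\<lambda>u. f (inv_into C \<phi> u))"
proof -
  obtain U where U: "x \<in> U" "smooth_fun M U f" using f unfolding smooth_near_def by blast
  have s: "smooth_on (\<phi> ` (U \<inter> C)) (\<lambda>u. f (inv_into C \<phi> u))" by (rule smooth_fun_in_chart[OF U(2) C])
  obtain r where r: "0 < r" "ball (\<phi> x) r \<subseteq> \<phi> ` (U \<inter> C)"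
    using smooth_onD(1)[OF s] x U(1) open_contains_ball by (metis IntI imageI)
  show ?thesis
    by (rule that[OF r(1)]) (use r smooth_on_subset[OF s] in auto)
qed

lemma coord_deriv_tangent:
  assumes C: "(C, \<phi>) \<in> atlas M" and x: "x \<in> C"
  shows "coord_deriv M C \<phi> e x \<in> tangent_space M x"
proof -
  have D: "((\<lambda>u. f (inv_into C \<phi> u)) has_derivative
      frechet_derivative (\<lambda>u. f (inv_into C \<phi> u)) (at (\<phi> x))) (at (\<phi> x))"
    if "smooth_near M x f" for f :: "'a \<Rightarrow> real"
    using smooth_near_chart[OF C x that] smooth_on_has_derivative centre_in_ball by metis
  have ix: "inv_into C \<phi> (\<phi> x) = x" using M C x by simp
  show ?thesis
    unfolding tangent_space_def
  proof (intro CollectI conjI allI impI)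
    fix f g :: "'a \<Rightarrow> real" assume f: "smooth_near M x f" and g: "smooth_near M x g"
    show "coord_deriv M C \<phi> e x (\<lambda>y. f y + g y) = coord_deriv M C \<phi> e x f + coord_deriv M C \<phi> e x g"
      using fun_cong[OF frechet_derivative_at[OF has_derivative_add[OF D[OF f] D[OF g]]], of e] f g
      by (simp add: coord_deriv_def smooth_near_add)
    show "coord_deriv M C \<phi> e x (\<lambda>y. f y * g y) = coord_deriv M C \<phi> e x f * g x + f x * coord_deriv M C \<phi> e x g"
      using fun_cong[OF frechet_derivative_at[OF has_derivative_mult[OF D[OF f] D[OF g]]], of e] f g ix
      by (simp add: coord_deriv_def smooth_near_mult)
    assume "\<exists>U. openin (mtop M) U \<and> x \<in> U \<and> (\<forall>y\<in>U. f y = g y)"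
    then obtain U where U: "openin (mtop M) U" "x \<in> U" "\<forall>y\<in>U. f y = g y" by blast
    have o: "open (\<phi> ` (U \<inter> C))"
      by (rule chart_image_of_open[OF M C]) (use U chart_open[OF M C] in auto)
    have "frechet_derivative (\<lambda>u. f (inv_into C \<phi> u)) (at (\<phi> x)) =
        frechet_derivative (\<lambda>u. g (inv_into C \<phi> u)) (at (\<phi> x))"
      by (rule frechet_derivative_cong[OF o]) (use x U M C in auto)
    then show "coord_deriv M C \<phi> e x f = coord_deriv M C \<phi> e x g"
      using f g by (simp add: coord_deriv_def)
  next
    fix f :: "'a \<Rightarrow> real" and c assume f: "smooth_near M x f"
    show "coord_deriv M C \<phi> e x (\<lambda>y. c * f y) = c * coord_deriv M C \<phi> e x f"
      using fun_cong[OF frechet_derivative_at[OF has_derivative_mult_right[OF D[OF f], of c]], of e] f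
        smooth_near_mult[OF smooth_near_const f] chart_subset[OF M C] x
      by (auto simp: coord_deriv_def)
  qed (simp add: coord_deriv_def)
qed

lemma smooth_near_coord:
  assumes "(C, \<phi>) \<in> atlas M" "x \<in> C"
  shows "smooth_near M x (\<lambda>y. \<phi> y \<bullet> e)"
  by (rule smooth_nearI[OF smooth_fun_linear_comp[OF bounded_linear_inner_left
      smooth_fun_chart[OF M assms(1) chart_open[OF M assms(1)] order_refl]] assms(2)])

text \<open>Hadamard's lemma writes a smooth \<open>f\<close> near \<open>x\<close> as
  \<open>f x\<close> plus a sum of products of a centred coordinate function and a smooth function.
  A derivation kills the constant and sees only the values of the second factors at
  \<open>x\<close>, which are the partial derivatives of \<open>f\<close>.\<close>

lemma tangent_expand:
  assumes E: "frame E" and C: "(C, \<phi>) \<in> atlas M" and x: "x \<in> C" and v: "v \<in> tangent_space M x"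
  shows "v f = (\<Sum>e\<in>E. v (\<lambda>y. \<phi> y \<bullet> e) * coord_deriv M C \<phi> e x f)"
proof (cases "smooth_near M x f")
  case False
  then show ?thesis using v by (simp add: tangent_space_nonsmooth coord_deriv_def)
next
  case True
  have xp: "x \<in> points M" using chart_subset[OF M C] x by blast
  obtain r where r: "0 < r" "ball (\<phi> x) r \<subseteq> \<phi> ` C" "smooth_on (ball (\<phi> x) r) (\<lambda>u. f (inv_into C \<phi> u))"
    using smooth_near_chart[OF C x True] .
  obtain g where g: "\<And>e. smooth_on (ball (\<phi> x) r) (g e)"
      "\<And>e. 0 < r \<Longrightarrow> g e (\<phi> x) = frechet_derivative (\<lambda>u. f (inv_into C \<phi> u)) (at (\<phi> x)) e"
      "\<And>u. u \<in> ball (\<phi> x) r \<Longrightarrow>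
        f (inv_into C \<phi> u) = f (inv_into C \<phi> (\<phi> x)) + (\<Sum>e\<in>E. ((u - \<phi> x) \<bullet> e) *\<^sub>R g e u)"
    by (rule Hadamard[OF E r(3)]) (rule that)
  \<comment> \<open>Hadamard's expansion is valid on a ball around \<phi> x only; \<open>W\<close>
    is the corresponding open set of the manifold, and locality of \<open>v\<close> makes it
    sufficient.\<close>
  define W where "W = {y \<in> C. \<phi> y \<in> ball (\<phi> x) r}"
  have W: "openin (mtop M) W" unfolding W_def by (rule chart_preimage_open[OF M C open_ball])
  have xW: "x \<in> W" using x r(1) by (simp add: W_def)
  have WC: "W \<subseteq> C" by (auto simp: W_def)
  have "\<phi> ` W = ball (\<phi> x) r" using r(2) unfolding W_def by blast
  then have "smooth_fun M W (\<lambda>y. g e (\<phi> y))" for e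
    by (intro smooth_fun_compose[OF M smooth_atlas_frame[OF M] g(1) smooth_fun_chart[OF M C W WC]]) auto
  then have gn: "smooth_near M x (\<lambda>y. g e (\<phi> y))" for e using xW by (rule smooth_nearI)
  let ?h = "\<lambda>e y. \<phi> y \<bullet> e + - (\<phi> x \<bullet> e)"
  have hn: "smooth_near M x (?h e)" for e
    by (intro smooth_near_add smooth_near_coord[OF C x] smooth_near_const[OF xp])
  have vh: "v (?h e) = v (\<lambda>y. \<phi> y \<bullet> e)" for e
    using tangent_space_add[OF v smooth_near_coord[OF C x, of e] smooth_near_const[OF xp, of "- (\<phi> x \<bullet> e)"]]
      tangent_space_const[OF v xp] by simp
  have "v f = v (\<lambda>y. f x + (\<Sum>e\<in>E. ?h e y * g e (\<phi> y)))"
  proof (rule tangent_space_local[OF v W xW])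
    fix y assume "y \<in> W"
    then have "y \<in> C" "\<phi> y \<in> ball (\<phi> x) r" by (auto simp: W_def)
    then show "f y = f x + (\<Sum>e\<in>E. ?h e y * g e (\<phi> y))"
      using g(3)[of "\<phi> y"] M C x by (simp add: inner_diff_left)
  qed
  also have "\<dots> = v (\<lambda>y. \<Sum>e\<in>E. ?h e y * g e (\<phi> y))"
    using tangent_space_add[OF v smooth_near_const[OF xp] tangent_space_sum(2)[OF v xp smooth_near_mult[OF hn gn]]]
      tangent_space_const[OF v xp] by simp
  also have "\<dots> = (\<Sum>e\<in>E. v (\<lambda>y. ?h e y * g e (\<phi> y)))"
    by (rule tangent_space_sum(1)[OF v xp smooth_near_mult[OF hn gn]])
  \<comment> \<open>In each product rule the second term carries the value of the centred coordinate
    at \<open>x\<close>, which is 0.\<close>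
  also have "\<dots> = (\<Sum>e\<in>E. v (\<lambda>y. \<phi> y \<bullet> e) * g e (\<phi> x))"
    using tangent_space_mult[OF v hn gn] by (simp add: vh[simplified])
  finally show ?thesis using True by (simp add: coord_deriv_def g(2)[OF r(1)])
qed

section \<open>Vector fields as operators on smooth functions\<close>

lemma vector_field_tangent: "X \<in> vector_fields M U \<Longrightarrow> x \<in> U \<Longrightarrow> X x \<in> tangent_space M x"
  unfolding vector_fields_def by blast

lemma vector_field_smooth:
  "X \<in> vector_fields M U \<Longrightarrow> smooth_fun M V f \<Longrightarrow> V \<subseteq> U \<Longrightarrow> smooth_fun M V (\<lambda>x. X x f)"
  unfolding vector_fields_def using smooth_fun_open by blast

lemma vector_fieldI:
  assumes "X \<in> extensional U" "\<And>x. x \<in> U \<Longrightarrow> X x \<in> tangent_space M x"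
    "\<And>V f. V \<subseteq> U \<Longrightarrow> smooth_fun M V f \<Longrightarrow> smooth_fun M V (\<lambda>x. X x f)"
  shows "X \<in> vector_fields M U"
  using assms unfolding vector_fields_def by blast

lemma vector_field_restrict:
  assumes "X \<in> vector_fields M U" "V \<subseteq> U"
  shows "restrict X V \<in> vector_fields M V"
proof (rule vector_fieldI)
  fix W and f :: "'a \<Rightarrow> real" assume W: "W \<subseteq> V" "smooth_fun M W f"
  have "smooth_fun M W (\<lambda>x. X x f)" by (rule vector_field_smooth[OF assms(1) W(2)]) (use W assms in auto)
  then show "smooth_fun M W (\<lambda>x. restrict X V x f)" by (rule smooth_fun_cong[OF _ _ M]) (use W in auto)
qed (use assms vector_field_tangent in auto)

lemma vf_add_closed:
  assumes "X \<in> vector_fields M U" "Y \<in> vector_fields M U"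
  shows "vf_add U X Y \<in> vector_fields M U"
proof (rule vector_fieldI)
  fix x assume x: "x \<in> U"
  then show "vf_add U X Y x \<in> tangent_space M x"
    using tangent_space_lincomb[OF vector_field_tangent[OF assms(1) x] vector_field_tangent[OF assms(2) x], of 1 1]
    by (simp add: vf_add_def)
next
  fix W and f :: "'a \<Rightarrow> real" assume W: "W \<subseteq> U" "smooth_fun M W f"
  have "smooth_fun M W (\<lambda>x. X x f + Y x f)"
    by (intro smooth_fun_add vector_field_smooth[OF assms(1) W(2,1)] vector_field_smooth[OF assms(2) W(2,1)])
  then show "smooth_fun M W (\<lambda>x. vf_add U X Y x f)"
    by (rule smooth_fun_cong[OF _ _ M]) (use W in \<open>auto simp: vf_add_def\<close>)
qed (simp add: vf_add_def)

lemma vf_scale_closed: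
  assumes "X \<in> vector_fields M U" "smooth_fun M U g"
  shows "vf_scale U g X \<in> vector_fields M U"
proof (rule vector_fieldI)
  fix x assume x: "x \<in> U"
  then show "vf_scale U g X x \<in> tangent_space M x"
    using tangent_space_lincomb[OF vector_field_tangent[OF assms(1) x] vector_field_tangent[OF assms(1) x], of "g x" 0]
    by (simp add: vf_scale_def)
next
  fix W and f :: "'a \<Rightarrow> real" assume W: "W \<subseteq> U" "smooth_fun M W f"
  have "smooth_fun M W (\<lambda>x. g x * X x f)"
    by (intro smooth_fun_mult vector_field_smooth[OF assms(1) W(2,1)]
        smooth_fun_subset[OF M assms(2) smooth_fun_open[OF W(2)] W(1)])
  then show "smooth_fun M W (\<lambda>x. vf_scale U g X x f)"
    by (rule smooth_fun_cong[OF _ _ M]) (use W in \<open>auto simp: vf_scale_def\<close>)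
qed (simp add: vf_scale_def)

lemma coord_field:
  assumes C: "(C, \<phi>) \<in> atlas M" and U: "U \<subseteq> C"
  shows "(\<lambda>x\<in>U. coord_deriv M C \<phi> e x) \<in> vector_fields M U"
proof (rule vector_fieldI)
  fix W :: "'a set" and f :: "'a \<Rightarrow> real" assume W: "W \<subseteq> U" "smooth_fun M W f"
  have o: "openin (mtop M) W" "W \<subseteq> C" using smooth_fun_open[OF W(2)] W(1) U by auto
  have "smooth_fun M W (\<lambda>x. frechet_derivative (\<lambda>u. f (inv_into C \<phi> u)) (at (\<phi> x)) e)"
  proof (rule smooth_fun_chartI[OF M C o])
    have "W \<inter> C = W" using o by auto
    then have s: "smooth_on (\<phi> ` W) (\<lambda>u. frechet_derivative (\<lambda>u. f (inv_into C \<phi> u)) (at u) e)"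
      using smooth_on_frechet_derivative[OF smooth_fun_in_chart[OF W(2) C]] by simp
    show "smooth_on (\<phi> ` W)
        (\<lambda>u. frechet_derivative (\<lambda>u. f (inv_into C \<phi> u)) (at (\<phi> (inv_into C \<phi> u))) e)"
      by (rule smooth_on_cong[OF s]) (use M C o in auto)
  qed
  then show "smooth_fun M W (\<lambda>x. (\<lambda>x\<in>U. coord_deriv M C \<phi> e x) x f)"
    by (rule smooth_fun_cong[OF _ _ M]) (use W in \<open>auto simp: coord_deriv_def smooth_nearI[OF W(2)]\<close>)
qed (use U coord_deriv_tangent[OF C] in auto)

subsection \<open>Complex-valued functions\<close>

lemma smooth_fun_Re_Im:
  assumes "smooth_fun M U (g :: 'a \<Rightarrow> complex)"
  shows "smooth_fun M U (\<lambda>x. Re (g x))" "smooth_fun M U (\<lambda>x. Im (g x))"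
  using assms by (auto intro: smooth_fun_linear_comp bounded_linear_Re bounded_linear_Im)

lemma cderiv_local:
  assumes "v \<in> tangent_space M x" "openin (mtop M) U" "x \<in> U" "\<And>y. y \<in> U \<Longrightarrow> f y = g y"
  shows "cderiv v f = cderiv v g"
  using tangent_space_local[OF assms(1-3), of "\<lambda>y. Re (f y)" "\<lambda>y. Re (g y)"]
    tangent_space_local[OF assms(1-3), of "\<lambda>y. Im (f y)" "\<lambda>y. Im (g y)"] assms(4)
  by (simp add: cderiv_def)

lemma cderiv_const: "v \<in> tangent_space M x \<Longrightarrow> x \<in> points M \<Longrightarrow> cderiv v (\<lambda>y. c) = 0"
  by (simp add: cderiv_def tangent_space_const complex_eq_iff)

lemma cderiv_coord:
  assumes C: "(C, \<phi>) \<in> atlas M" and x: "x \<in> C" "x \<in> U" and g: "smooth_fun M U (g :: 'a \<Rightarrow> complex)"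
  shows "cderiv (coord_deriv M C \<phi> e x) g = frechet_derivative (\<lambda>u. g (inv_into C \<phi> u)) (at (\<phi> x)) e"
proof -
  let ?g = "\<lambda>u. g (inv_into C \<phi> u)"
  have D: "(?g has_derivative frechet_derivative ?g (at (\<phi> x))) (at (\<phi> x))"
    by (rule smooth_on_has_derivative[OF smooth_fun_in_chart[OF g C]]) (use x in auto)
  note sm = smooth_fun_Re_Im[OF g]
  show ?thesis
    using fun_cong[OF frechet_derivative_at[OF bounded_linear.has_derivative[OF bounded_linear_Re D]], of e]
      fun_cong[OF frechet_derivative_at[OF bounded_linear.has_derivative[OF bounded_linear_Im D]], of e]
      smooth_nearI[OF sm(1) x(2)] smooth_nearI[OF sm(2) x(2)]
    by (simp add: coord_deriv_def cderiv_def complex_eq_iff)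
qed

lemma cderiv_expand:
  assumes E: "frame E" and C: "(C, \<phi>) \<in> atlas M" and x: "x \<in> C" "x \<in> U" and v: "v \<in> tangent_space M x"
    and g: "smooth_fun M U (g :: 'a \<Rightarrow> complex)"
  shows "cderiv v g =
    (\<Sum>e\<in>E. of_real (v (\<lambda>y. \<phi> y \<bullet> e)) * frechet_derivative (\<lambda>u. g (inv_into C \<phi> u)) (at (\<phi> x)) e)"
  using tangent_expand[OF E C x(1) v, of "\<lambda>y. Re (g y)"] tangent_expand[OF E C x(1) v, of "\<lambda>y. Im (g y)"]
  by (simp add: cderiv_coord[OF C x g, symmetric] cderiv_def complex_eq_iff)

lemma cderiv_mult:
  assumes v: "v \<in> tangent_space M x" and "smooth_fun M U f" "smooth_fun M U g" "x \<in> U"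
  shows "cderiv v (\<lambda>y. f y * g y) = cderiv v f * g x + f x * cderiv v g"
proof -
  note n = smooth_nearI[OF _ assms(4)]
  note s = n[OF smooth_fun_Re_Im(1)[OF assms(2)]] n[OF smooth_fun_Re_Im(2)[OF assms(2)]]
    n[OF smooth_fun_Re_Im(1)[OF assms(3)]] n[OF smooth_fun_Re_Im(2)[OF assms(3)]]
  have xp: "x \<in> points M" using smooth_fun_open[OF assms(2)] openin_subset assms(4) by blast
  \<comment> \<open>The real part of the product. The difference is written as a sum with a multiple
    by -1, the form in which additivity and scaling of a tangent vector are stated.\<close>
  have "v (\<lambda>y. Re (f y) * Re (g y) + -1 * (Im (f y) * Im (g y))) =
      v (\<lambda>y. Re (f y)) * Re (g x) + Re (f x) * v (\<lambda>y. Re (g y)) -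
      (v (\<lambda>y. Im (f y)) * Im (g x) + Im (f x) * v (\<lambda>y. Im (g y)))"
    using tangent_space_add[OF v smooth_near_mult[OF s(1,3)] smooth_near_mult[OF smooth_near_const[OF xp, of "-1"]
          smooth_near_mult[OF s(2,4)]]] tangent_space_scale[OF v smooth_near_mult[OF s(2,4)], of "-1"]
      tangent_space_mult[OF v s(1,3)] tangent_space_mult[OF v s(2,4)]
    by simp
  moreover have "v (\<lambda>y. Re (f y) * Im (g y) + Im (f y) * Re (g y)) =
      v (\<lambda>y. Re (f y)) * Im (g x) + Re (f x) * v (\<lambda>y. Im (g y)) +
      (v (\<lambda>y. Im (f y)) * Re (g x) + Im (f x) * v (\<lambda>y. Re (g y)))"
    using tangent_space_add[OF v smooth_near_mult[OF s(1,4)] smooth_near_mult[OF s(2,3)]]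
      tangent_space_mult[OF v s(1,4)] tangent_space_mult[OF v s(2,3)] by simp
  ultimately show ?thesis by (simp add: cderiv_def complex_eq_iff algebra_simps)
qed

lemma cderiv_exp:
  assumes x: "x \<in> U" and v: "v \<in> tangent_space M x" and g: "smooth_fun M U g"
  shows "cderiv v (\<lambda>y. exp (g y)) = exp (g x) * cderiv v g"
proof -
  obtain E :: "'e set" where E: "frame E" using smooth_atlas_frame[OF M] by blast
  have "x \<in> points M" using smooth_fun_open[OF g] openin_subset x by blast
  then obtain C \<phi> where C: "(C, \<phi>) \<in> atlas M" "x \<in> C" using atlas_cover[OF M] by blast
  let ?g = "\<lambda>u. g (inv_into C \<phi> u)"
  have D: "(?g has_derivative frechet_derivative ?g (at (\<phi> x))) (at (\<phi> x))"
    by (rule smooth_on_has_derivative[OF smooth_fun_in_chart[OF g C(1)]]) (use x C in auto)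
  have eg: "smooth_fun M U (\<lambda>y. exp (g y))"
    by (rule smooth_fun_compose[OF M complex_frame smooth_on_exp g]) auto
  have "((\<lambda>u. exp (?g u)) has_derivative (\<lambda>e. exp (g x) * frechet_derivative ?g (at (\<phi> x)) e)) (at (\<phi> x))"
    using has_derivative_compose[OF D DERIV_exp[unfolded has_field_derivative_def]] M C by simp
  from fun_cong[OF frechet_derivative_at[OF this]]
  have "frechet_derivative (\<lambda>u. exp (?g u)) (at (\<phi> x)) e = exp (g x) * frechet_derivative ?g (at (\<phi> x)) e" for e
    by simp
  then show ?thesis
    unfolding cderiv_expand[OF E C x v eg] cderiv_expand[OF E C x v g]
    by (simp add: sum_distrib_left mult_ac)
qed

text \<open>The coordinate fields of a chart test every direction at every point of the chart, so
  the chart expression has derivative zero on a ball. A ball is convex, hence the function is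
  constant there.\<close>

lemma cderiv_zero_locally_constant:
  assumes u: "smooth_fun M W u" and x: "x \<in> W"
    and z: "\<And>V X x. openin (mtop M) V \<Longrightarrow> V \<subseteq> W \<Longrightarrow> X \<in> vector_fields M V \<Longrightarrow> x \<in> V \<Longrightarrow>
      cderiv (X x) u = 0"
  shows "\<exists>V. openin (mtop M) V \<and> x \<in> V \<and> V \<subseteq> W \<and> (\<forall>y\<in>V. u y = u x)"
proof -
  have W: "openin (mtop M) W" by (rule smooth_fun_open[OF u])
  then have "x \<in> points M" using openin_subset x by blast
  then obtain C \<phi> where C: "(C, \<phi>) \<in> atlas M" "x \<in> C" using atlas_cover[OF M] by blast
  let ?u = "\<lambda>a. u (inv_into C \<phi> a)"
  have s: "smooth_on (\<phi> ` (W \<inter> C)) ?u" by (rule smooth_fun_in_chart[OF u C(1)])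
  obtain r where r: "0 < r" "ball (\<phi> x) r \<subseteq> \<phi> ` (W \<inter> C)"
    using smooth_onD(1)[OF s] x C(2) open_contains_ball by (metis IntI imageI)
  have Du: "(?u has_derivative (\<lambda>h. 0)) (at a)" if a: "a \<in> ball (\<phi> x) r" for a
  proof -
    obtain y where y: "y \<in> W" "y \<in> C" "a = \<phi> y" using a r by blast
    have D: "(?u has_derivative frechet_derivative ?u (at a)) (at a)"
      by (rule smooth_on_has_derivative[OF s]) (use a r in auto)
    have WC: "openin (mtop M) (W \<inter> C)" "W \<inter> C \<subseteq> C" using W chart_open[OF M C(1)] by auto
    have "frechet_derivative ?u (at a) e = 0" for e
      using cderiv_coord[OF C(1) y(2,1) u, of e] z[OF WC(1) _ coord_field[OF C(1) WC(2)], of y e] y by simp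
    then have "frechet_derivative ?u (at a) = (\<lambda>h. 0)" by auto
    with D show ?thesis by simp
  qed
  have c: "?u a = ?u (\<phi> x)" if "a \<in> ball (\<phi> x) r" for a
    using has_derivative_zero_unique[of "ball (\<phi> x) r" ?u a "\<phi> x"] that r(1) Du
    by (auto intro: has_derivative_at_withinI)
  let ?V = "{y \<in> C. \<phi> y \<in> ball (\<phi> x) r}"
  have "?V \<subseteq> W"
  proof
    fix y assume "y \<in> ?V"
    then have "y \<in> C" "\<phi> y \<in> \<phi> ` (W \<inter> C)" using r(2) by blast+
    then show "y \<in> W" using inj_on_image_mem_iff[OF chart_inj[OF M C(1)], of y "W \<inter> C"] by blast
  qed
  moreover have "\<forall>y\<in>?V. u y = u x"
  proof
    fix y assume "y \<in> ?V"
    then show "u y = u x" using c[of "\<phi> y"] M C by simp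
  qed
  moreover have "x \<in> ?V" using C(2) r(1) by simp
  ultimately show ?thesis using chart_preimage_open[OF M C(1) open_ball, of "\<phi> x" r] by blast
qed

end

subsection \<open>Push-forward along diffeomorphisms\<close>

lemma smooth_near_pullback:
  assumes M: "smooth_atlas M" and N: "smooth_atlas N" and F: "smooth_map M N F"
    and "x \<in> points M" "smooth_near N (F x) f"
  shows "smooth_near M x (\<lambda>y. f (F y))"
proof -
  obtain U where U: "F x \<in> U" "smooth_fun N U f" using assms(5) unfolding smooth_near_def by blast
  show ?thesis by (rule smooth_nearI[OF smooth_map_pullback[OF M N F U(2)]]) (use U assms(4) in auto)
qed

lemma tangent_map_closed:
  assumes M: "smooth_atlas M" and N: "smooth_atlas N" and F: "smooth_map M N F"
    and x: "x \<in> points M" and v: "v \<in> tangent_space M x"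
  shows "tangent_map M N F x v \<in> tangent_space N (F x)"
  unfolding tangent_space_def
proof (intro CollectI conjI allI impI)
  note pb = smooth_near_pullback[OF M N F x]
  have Fx: "F x \<in> points N" by (rule smooth_map_in_points[OF F x])
  fix f g :: "'c \<Rightarrow> real" assume f: "smooth_near N (F x) f" and g: "smooth_near N (F x) g"
  show "tangent_map M N F x v (\<lambda>y. f y + g y) = tangent_map M N F x v f + tangent_map M N F x v g"
    using f g by (simp add: tangent_map_def smooth_near_add[OF N] o_def tangent_space_add[OF v pb pb])
  show "tangent_map M N F x v (\<lambda>y. f y * g y) = tangent_map M N F x v f * g (F x) + f (F x) * tangent_map M N F x v g"
    using f g by (simp add: tangent_map_def smooth_near_mult[OF N] o_def tangent_space_mult[OF v pb pb])
  assume "\<exists>U. openin (mtop N) U \<and> F x \<in> U \<and> (\<forall>y\<in>U. f y = g y)"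
  then obtain U where U: "openin (mtop N) U" "F x \<in> U" "\<forall>y\<in>U. f y = g y" by blast
  have "v (f \<circ> F) = v (g \<circ> F)"
    by (rule tangent_space_local[OF M v smooth_map_preimage_open[OF F U(1)]]) (use x U in auto)
  then show "tangent_map M N F x v f = tangent_map M N F x v g" using f g by (simp add: tangent_map_def)
next
  note pb = smooth_near_pullback[OF M N F x]
  have Fx: "F x \<in> points N" by (rule smooth_map_in_points[OF F x])
  fix f :: "'c \<Rightarrow> real" and c assume f: "smooth_near N (F x) f"
  show "tangent_map M N F x v (\<lambda>y. c * f y) = c * tangent_map M N F x v f"
    using f smooth_near_mult[OF N smooth_near_const[OF N Fx] f]
    by (simp add: tangent_map_def o_def tangent_space_scale[OF v pb])
qed (simp add: tangent_map_def)

text \<open>On functions smooth near \<open>x\<close> this is the chain rule and locality of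
  \<open>v\<close>; on all others both sides take the default value 0. So the two functionals
  coincide, which is what equality of tangent vectors means here.\<close>

lemma tangent_map_inverse:
  assumes M: "smooth_atlas M" and N: "smooth_atlas N" and F: "smooth_map M N F" and G: "smooth_map N M G"
    and GF: "\<And>y. y \<in> points M \<Longrightarrow> G (F y) = y" and x: "x \<in> points M" and v: "v \<in> tangent_space M x"
  shows "tangent_map N M G (F x) (tangent_map M N F x v) = v"
proof
  fix f
  show "tangent_map N M G (F x) (tangent_map M N F x v) f = v f"
  proof (cases "smooth_near M x f")
    case True
    have "smooth_near N (F x) (\<lambda>y. f (G y))"
      by (rule smooth_near_pullback[OF N M G smooth_map_in_points[OF F x]]) (simp add: GF x True)
    moreover have "v (\<lambda>y. f (G (F y))) = v f"
      by (rule tangent_space_local[OF M v openin_topspace x]) (simp add: GF)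
    ultimately show ?thesis using True by (simp add: tangent_map_def GF x o_def)
  next
    case False
    then show ?thesis using v by (simp add: tangent_map_def GF x tangent_space_nonsmooth)
  qed
qed

lemma cderiv_tangent_map:
  assumes "smooth_fun N V g" "F x \<in> V"
  shows "cderiv (tangent_map M N F x v) g = cderiv v (\<lambda>y. g (F y))"
  using smooth_nearI[OF smooth_fun_linear_comp[OF bounded_linear_Re assms(1)] assms(2)]
    smooth_nearI[OF smooth_fun_linear_comp[OF bounded_linear_Im assms(1)] assms(2)]
  by (simp add: cderiv_def tangent_map_def o_def)

context
  fixes M :: "('a, 'e::{real_inner,banach}) mfd" and \<Phi> :: "'a \<Rightarrow> 'a"
  assumes M: "smooth_atlas M" and \<Phi>: "diffeo M M \<Phi>"
begin

lemma diffeo_smooth: "smooth_map M M \<Phi>" "smooth_map M M (inv_into (points M) \<Phi>)"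
  using \<Phi> by (auto simp: diffeo_def)

lemma diffeo_in_points: "x \<in> points M \<Longrightarrow> \<Phi> x \<in> points M"
  using \<Phi> by (auto simp: diffeo_def bij_betw_def)

lemma diffeo_inv_left: "x \<in> points M \<Longrightarrow> inv_into (points M) \<Phi> (\<Phi> x) = x"
  using \<Phi> by (auto simp: diffeo_def bij_betw_def)

lemma diffeo_inv_right: "x \<in> points M \<Longrightarrow> \<Phi> (inv_into (points M) \<Phi> x) = x"
  using \<Phi> by (simp add: diffeo_def bij_betw_def f_inv_into_f)

lemma diffeo_inv_in_points: "x \<in> points M \<Longrightarrow> inv_into (points M) \<Phi> x \<in> points M"
  using smooth_map_in_points[OF diffeo_smooth(2)] .

lemma diffeo_inverse: "diffeo M M (inv_into (points M) \<Phi>)"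
proof -
  have b: "bij_betw (inv_into (points M) \<Phi>) (points M) (points M)"
    using \<Phi> by (simp add: diffeo_def bij_betw_inv_into)
  have "inv_into (points M) (inv_into (points M) \<Phi>) x = \<Phi> x" if "x \<in> points M" for x
    using \<Phi> that by (simp add: diffeo_def inv_into_inv_into_eq)
  then have "smooth_map M M (inv_into (points M) (inv_into (points M) \<Phi>))"
    using smooth_map_cong[OF M diffeo_smooth(1)] by simp
  with b show ?thesis by (simp add: diffeo_def diffeo_smooth(2))
qed

lemma image_eq_preim: "U \<subseteq> points M \<Longrightarrow> \<Phi> ` U = {y \<in> points M. inv_into (points M) \<Phi> y \<in> U}"
proof (intro equalityI subsetI)
  fix y assume "y \<in> {y \<in> points M. inv_into (points M) \<Phi> y \<in> U}"
  then have "y = \<Phi> (inv_into (points M) \<Phi> y)" "inv_into (points M) \<Phi> y \<in> U"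
    using diffeo_inv_right by auto
  then show "y \<in> \<Phi> ` U" by (rule image_eqI)
qed (auto simp: diffeo_inv_left diffeo_in_points subset_iff)

lemma preim_image: "U \<subseteq> points M \<Longrightarrow> preim M \<Phi> (\<Phi> ` U) = U"
proof (intro equalityI subsetI)
  fix x assume U: "U \<subseteq> points M" and "x \<in> preim M \<Phi> (\<Phi> ` U)"
  then obtain y where "y \<in> U" "\<Phi> x = \<Phi> y" "x \<in> points M" by (auto simp: preim_def)
  then show "x \<in> U" using U diffeo_inv_left by (metis subsetD)
qed (auto simp: preim_def)

lemma image_preim: "U \<subseteq> points M \<Longrightarrow> \<Phi> ` preim M \<Phi> U = U"
proof (intro equalityI subsetI)
  fix y assume "U \<subseteq> points M" "y \<in> U"
  then have "y = \<Phi> (inv_into (points M) \<Phi> y)" "inv_into (points M) \<Phi> y \<in> preim M \<Phi> U"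
    using diffeo_inv_right diffeo_inv_in_points by (auto simp: preim_def subset_iff)
  then show "y \<in> \<Phi> ` preim M \<Phi> U" by (rule image_eqI)
qed (auto simp: preim_def)

lemma openin_image: "openin (mtop M) U \<Longrightarrow> openin (mtop M) (\<Phi> ` U)"
  using smooth_map_preimage_open[OF diffeo_smooth(2)] image_eq_preim openin_subset by metis

lemma openin_preim: "openin (mtop M) U \<Longrightarrow> openin (mtop M) (preim M \<Phi> U)"
  unfolding preim_def by (rule smooth_map_preimage_open[OF diffeo_smooth(1)])

lemma smooth_fun_pull:
  assumes "smooth_fun M V f" "V \<subseteq> \<Phi> ` U" "U \<subseteq> points M"
  shows "smooth_fun M {x \<in> U. \<Phi> x \<in> V} (\<lambda>x. f (\<Phi> x))"
proof -
  have "{x \<in> points M. \<Phi> x \<in> V} = {x \<in> U. \<Phi> x \<in> V}"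
    using assms(2,3) preim_image[OF assms(3)] by (auto simp: preim_def)
  then show ?thesis using smooth_map_pullback[OF M M diffeo_smooth(1) assms(1)] by simp
qed

lemma smooth_fun_push:
  assumes "smooth_fun M U f"
  shows "smooth_fun M (\<Phi> ` U) (\<lambda>y. f (inv_into (points M) \<Phi> y))"
  using smooth_map_pullback[OF M M diffeo_smooth(2) assms] image_eq_preim smooth_fun_open[OF assms] openin_subset
  by metis

lemma vf_push_apply: "x \<in> U \<Longrightarrow> U \<subseteq> points M \<Longrightarrow> vf_push M \<Phi> U X (\<Phi> x) = tangent_map M M \<Phi> x (X x)"
  using diffeo_inv_left by (auto simp: vf_push_def Let_def)

text \<open>Applied to \<open>f\<close>, the push-forward is the function obtained by letting
  \<open>X\<close> act on the pull-back of \<open>f\<close> and transporting the result to the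
  target by the inverse of \<Phi>. Both operations preserve smoothness.\<close>

lemma vf_push_closed:
  assumes X: "X \<in> vector_fields M U" and U: "openin (mtop M) U"
  shows "vf_push M \<Phi> U X \<in> vector_fields M (\<Phi> ` U)"
proof (rule vector_fieldI[OF M])
  have Up: "U \<subseteq> points M" using U openin_subset by blast
  show "vf_push M \<Phi> U X \<in> extensional (\<Phi> ` U)" by (simp add: vf_push_def)
  fix y assume "y \<in> \<Phi> ` U"
  then obtain x where x: "x \<in> U" "y = \<Phi> x" by blast
  show "vf_push M \<Phi> U X y \<in> tangent_space M y"
    unfolding x(2) vf_push_apply[OF x(1) Up]
    by (rule tangent_map_closed[OF M M diffeo_smooth(1) _ vector_field_tangent[OF M X x(1)]]) (use x Up in auto)
next
  have Up: "U \<subseteq> points M" using U openin_subset by blast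
  fix V and f :: "'a \<Rightarrow> real" assume V: "V \<subseteq> \<Phi> ` U" and f: "smooth_fun M V f"
  let ?W = "{x \<in> U. \<Phi> x \<in> V}"
  have VW: "\<Phi> ` ?W = V" using V by auto
  have "smooth_fun M (\<Phi> ` ?W) (\<lambda>y. X (inv_into (points M) \<Phi> y) (\<lambda>x. f (\<Phi> x)))"
    by (rule smooth_fun_push[OF vector_field_smooth[OF M X smooth_fun_pull[OF f V Up]]]) auto
  then have 1: "smooth_fun M V (\<lambda>y. X (inv_into (points M) \<Phi> y) (\<lambda>x. f (\<Phi> x)))"
    unfolding VW .
  show "smooth_fun M V (\<lambda>y. vf_push M \<Phi> U X y f)"
  proof (rule smooth_fun_cong[OF 1 _ M])
    fix y assume y: "y \<in> V"
    then obtain x where x: "x \<in> U" "y = \<Phi> x" using V by blast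
    show "X (inv_into (points M) \<Phi> y) (\<lambda>x. f (\<Phi> x)) = vf_push M \<Phi> U X y f"
      using smooth_nearI[OF f y] x Up diffeo_inv_left vf_push_apply[OF x(1) Up]
      by (auto simp: tangent_map_def o_def)
  qed
qed

lemma vf_push_restrict:
  assumes "V \<subseteq> U" "U \<subseteq> points M"
  shows "vf_push M \<Phi> V (restrict X V) = restrict (vf_push M \<Phi> U X) (\<Phi> ` V)"
proof
  fix y
  show "vf_push M \<Phi> V (restrict X V) y = restrict (vf_push M \<Phi> U X) (\<Phi> ` V) y"
  proof (cases "y \<in> \<Phi> ` V")
    case True
    then obtain x where x: "x \<in> V" "y = \<Phi> x" by blast
    then have "x \<in> U" "V \<subseteq> points M" using assms by auto
    then show ?thesis using x vf_push_apply[of x U X] vf_push_apply[of x V "restrict X V"] assms True by simp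
  qed (simp add: vf_push_def)
qed

end

section \<open>Line bundles\<close>

text \<open>Smoothness is required of the map \<open>(y, z) \<mapsto> z \<odot> s y\<close> into the total space, not only of
  the section \<open>s\<close>, so that maps between total spaces can be treated in frames.\<close>

definition local_frame ::
    "('a, 'e::{real_inner,banach}) mfd \<Rightarrow> ('l, 'f::{real_inner,banach}, 'a) lbundle \<Rightarrow> 'a set
      \<Rightarrow> ('a, 'l) sect \<Rightarrow> ('l \<Rightarrow> complex) \<Rightarrow> bool" where
  "local_frame M L U s \<kappa> \<longleftrightarrow> openin (mtop M) U \<and> s \<in> extensional U \<and>
     (\<forall>y\<in>U. s y \<in> carrier (fibre L y) \<and> (\<forall>z. \<kappa> (z \<odot>\<^bsub>fibre L y\<^esub> s y) = z) \<and>
        (\<forall>l\<in>carrier (fibre L y). \<kappa> l \<odot>\<^bsub>fibre L y\<^esub> s y = l)) \<and>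
     smooth_fun (total L) {l \<in> points (total L). proj L l \<in> U} \<kappa> \<and>
     smooth_map (prod_mfd (open_submfd M U) complex_mfd) (total L) (\<lambda>p. snd p \<odot>\<^bsub>fibre L (fst p)\<^esub> s (fst p))"

lemma open_submfd_submfd: "V \<subseteq> U \<Longrightarrow> open_submfd (open_submfd M U) V = open_submfd M V"
  by (auto simp: open_submfd_def subtopology_subtopology Int_absorb1 image_image split_beta Int_assoc)

context
  fixes M :: "('a, 'e::{real_inner,banach}) mfd" and L :: "('l, 'f::{real_inner,banach}, 'a) lbundle"
  assumes M: "smooth_atlas M" and L: "complex_line_bundle M L"
begin

lemma total_atlas: "smooth_atlas (total L)"
  using L smooth_manifold_imp_atlas by (auto simp: complex_line_bundle_def)

lemma proj_smooth: "smooth_map (total L) M (proj L)"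
  using L by (simp add: complex_line_bundle_def)

lemma fibre_module: "x \<in> points M \<Longrightarrow> module complex_ring (fibre L x)"
  using L by (simp add: complex_line_bundle_def)

lemma fibre_carrier: "x \<in> points M \<Longrightarrow> l \<in> carrier (fibre L x) \<longleftrightarrow> l \<in> points (total L) \<and> proj L l = x"
  using L by (simp add: complex_line_bundle_def)

lemma fibre_of_point: "l \<in> points (total L) \<Longrightarrow> l \<in> carrier (fibre L (proj L l)) \<and> proj L l \<in> points M"
  using fibre_carrier smooth_map_in_points[OF proj_smooth] by blast

lemma fibre_abelian_group: "x \<in> points M \<Longrightarrow> abelian_group (fibre L x)"
  using fibre_module module.axioms(2) by blast

lemma fibre_smult_closed:
  "x \<in> points M \<Longrightarrow> l \<in> carrier (fibre L x) \<Longrightarrow> z \<odot>\<^bsub>fibre L x\<^esub> l \<in> carrier (fibre L x)"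
  using module.smult_closed[OF fibre_module, of x z l] by (simp add: complex_ring_def)

lemma fibre_smult_add:
  "x \<in> points M \<Longrightarrow> l \<in> carrier (fibre L x) \<Longrightarrow>
    (a + b) \<odot>\<^bsub>fibre L x\<^esub> l = a \<odot>\<^bsub>fibre L x\<^esub> l \<oplus>\<^bsub>fibre L x\<^esub> b \<odot>\<^bsub>fibre L x\<^esub> l"
  using module.smult_l_distr[OF fibre_module, of x a b l] by (simp add: complex_ring_def)

lemma fibre_smult_mult:
  "x \<in> points M \<Longrightarrow> l \<in> carrier (fibre L x) \<Longrightarrow>
    (a * b) \<odot>\<^bsub>fibre L x\<^esub> l = a \<odot>\<^bsub>fibre L x\<^esub> (b \<odot>\<^bsub>fibre L x\<^esub> l)"
  using module.smult_assoc1[OF fibre_module, of x a b l] by (simp add: complex_ring_def)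

lemma fibre_smult_one: "x \<in> points M \<Longrightarrow> l \<in> carrier (fibre L x) \<Longrightarrow> 1 \<odot>\<^bsub>fibre L x\<^esub> l = l"
  using module.smult_one[OF fibre_module, of x l] by (simp add: complex_ring_def)

lemma fibre_smult_zero: "x \<in> points M \<Longrightarrow> l \<in> carrier (fibre L x) \<Longrightarrow> 0 \<odot>\<^bsub>fibre L x\<^esub> l = \<zero>\<^bsub>fibre L x\<^esub>"
  using module.smult_l_null[OF fibre_module, of x l] by (simp add: complex_ring_def)

lemma fibre_zero_closed: "x \<in> points M \<Longrightarrow> \<zero>\<^bsub>fibre L x\<^esub> \<in> carrier (fibre L x)"
  by (simp add: abelian_group.axioms(1) abelian_monoid.zero_closed fibre_abelian_group)

lemma fibre_add_closed: "x \<in> points M \<Longrightarrow> l \<in> carrier (fibre L x) \<Longrightarrow> m \<in> carrier (fibre L x) \<Longrightarrow>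
    l \<oplus>\<^bsub>fibre L x\<^esub> m \<in> carrier (fibre L x)"
  by (simp add: abelian_group.axioms(1) abelian_monoid.a_closed fibre_abelian_group)

subsection \<open>Sections\<close>

lemma section_carrier:
  "s \<in> carrier (sections M L U) \<longleftrightarrow>
    s \<in> extensional U \<and> (\<forall>x\<in>U. s x \<in> carrier (fibre L x)) \<and> smooth_map (open_submfd M U) (total L) s"
  by (simp add: sections_def)

lemma section_fibre: "s \<in> carrier (sections M L U) \<Longrightarrow> x \<in> U \<Longrightarrow> s x \<in> carrier (fibre L x)"
  by (simp add: section_carrier)

lemma section_extensional: "s \<in> carrier (sections M L U) \<Longrightarrow> s \<in> extensional U"
  by (simp add: section_carrier)

lemma section_restrict:
  assumes s: "s \<in> carrier (sections M L U)" and U: "openin (mtop M) U" and V: "openin (mtop M) V" "V \<subseteq> U"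
  shows "restrict s V \<in> carrier (sections M L V)"
proof -
  have "openin (mtop (open_submfd M U)) V" using U V openin_submfd by blast
  moreover have "smooth_map (open_submfd M U) (total L) s" using s by (simp add: section_carrier)
  ultimately have "smooth_map (open_submfd (open_submfd M U) V) (total L) s"
    by (rule smooth_map_restrict_domain[OF smooth_atlas_submfd[OF M U] _ _ total_atlas])
  then have "smooth_map (open_submfd M V) (total L) s" by (simp add: open_submfd_submfd[OF V(2)])
  then have "smooth_map (open_submfd M V) (total L) (restrict s V)"
    by (rule smooth_map_cong[OF smooth_atlas_submfd[OF M V(1)]]) (simp add: points_submfd[OF V(1)])
  then show ?thesis using s V by (auto simp: section_carrier)
qed

lemma section_local:
  assumes U: "openin (mtop M) U" and s: "s \<in> extensional U"
    and loc: "\<And>x. x \<in> U \<Longrightarrow> \<exists>V. openin (mtop M) V \<and> x \<in> V \<and> V \<subseteq> U \<and> restrict s V \<in> carrier (sections M L V)"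
  shows "s \<in> carrier (sections M L U)"
  unfolding section_carrier
proof (intro conjI s ballI)
  fix x assume "x \<in> U"
  then obtain V where "openin (mtop M) V" "x \<in> V" "V \<subseteq> U" "restrict s V \<in> carrier (sections M L V)" using loc by blast
  then show "s x \<in> carrier (fibre L x)" using section_fibre[of "restrict s V" V x] by simp
next
  show "smooth_map (open_submfd M U) (total L) s"
  proof (rule smooth_map_local[OF smooth_atlas_submfd[OF M U]])
    fix x assume "x \<in> points (open_submfd M U)"
    then have "x \<in> U" by (simp add: points_submfd[OF U])
    then obtain V where V: "openin (mtop M) V" "x \<in> V" "V \<subseteq> U" "restrict s V \<in> carrier (sections M L V)"
      using loc by blast
    have "smooth_map (open_submfd M V) (total L) (restrict s V)" using V(4) by (simp add: section_carrier)
    then have "smooth_map (open_submfd M V) (total L) s"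
      by (rule smooth_map_cong[OF smooth_atlas_submfd[OF M V(1)]]) (simp add: points_submfd[OF V(1)])
    then show "\<exists>V. openin (mtop (open_submfd M U)) V \<and> x \<in> V \<and> smooth_map (open_submfd (open_submfd M U) V) (total L) s"
      using V by (intro exI[of _ V]) (simp add: openin_submfd[OF U] open_submfd_submfd)
  qed
qed

text \<open>The frame is the constant 1 seen through a local trivialisation, and the coefficient
  \<kappa> is the second component of the trivialisation. The map of \<open>local_frame\<close> into
  the total space is then the inverse trivialisation.\<close>

lemma local_frame_exists:
  assumes "x \<in> points M"
  obtains U s \<kappa> where "x \<in> U" "local_frame M L U s \<kappa>"
proof -
  obtain U \<psi> where U: "openin (mtop M) U" "x \<in> U" and
    d: "diffeo (open_submfd (total L) {l \<in> points (total L). proj L l \<in> U})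
          (prod_mfd (open_submfd M U) complex_mfd) \<psi>" and
    lin: "\<And>y l z. y \<in> U \<Longrightarrow> l \<in> carrier (fibre L y) \<Longrightarrow> fst (\<psi> l) = y \<and> snd (\<psi> (z \<odot>\<^bsub>fibre L y\<^esub> l)) = z * snd (\<psi> l)"
  proof -
    have "\<exists>U \<psi>. openin (mtop M) U \<and> x \<in> U \<and>
        diffeo (open_submfd (total L) {l \<in> points (total L). proj L l \<in> U})
          (prod_mfd (open_submfd M U) complex_mfd) \<psi> \<and>
        (\<forall>y\<in>U. \<forall>l\<in>carrier (fibre L y). fst (\<psi> l) = y \<and>
           (\<forall>m\<in>carrier (fibre L y). snd (\<psi> (l \<oplus>\<^bsub>fibre L y\<^esub> m)) = snd (\<psi> l) + snd (\<psi> m)) \<and>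
           (\<forall>z. snd (\<psi> (z \<odot>\<^bsub>fibre L y\<^esub> l)) = z * snd (\<psi> l)))"
      using L assms unfolding complex_line_bundle_def by (elim conjE) (erule bspec)
    then show ?thesis using that by auto
  qed
  let ?N = "total L" and ?W = "{l \<in> points (total L). proj L l \<in> U}"
  let ?P = "prod_mfd (open_submfd M U) complex_mfd"
  have W: "openin (mtop ?N) ?W" by (rule smooth_map_preimage_open[OF proj_smooth U(1)])
  note aN = smooth_atlas_submfd[OF total_atlas W] and aU = smooth_atlas_submfd[OF M U(1)]
  have aP: "smooth_atlas ?P" by (rule smooth_atlas_prod[OF aU smooth_atlas_complex])
  have pP: "points ?P = U \<times> UNIV" by (simp add: points_prod points_submfd[OF U(1)] complex_mfd_def)
  have pU: "y \<in> points M" if "y \<in> U" for y using that U(1) openin_subset by blast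
  define g where "g = inv_into ?W \<psi>"
  have bij: "bij_betw \<psi> ?W (U \<times> UNIV)" using d by (simp add: diffeo_def points_submfd[OF W] pP)
  have smooth: "smooth_map (open_submfd ?N ?W) ?P \<psi>" "smooth_map ?P (open_submfd ?N ?W) g"
    using d by (auto simp: diffeo_def points_submfd[OF W] g_def)
  define s where "s = (\<lambda>y\<in>U. g (y, 1))"
  define \<kappa> where "\<kappa> l = snd (\<psi> l)" for l
  have gW: "g (y, z) \<in> ?W" and \<psi>g: "\<psi> (g (y, z)) = (y, z)" if "y \<in> U" for y z
  proof -
    have m: "(y, z) \<in> \<psi> ` ?W" using bij that by (simp add: bij_betw_def)
    show "g (y, z) \<in> ?W" "\<psi> (g (y, z)) = (y, z)"
      unfolding g_def using inv_into_into[OF m] f_inv_into_f[OF m] by auto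
  qed
  have g\<psi>: "g (\<psi> l) = l" if "l \<in> ?W" for l unfolding g_def using bij that by (simp add: bij_betw_def)
  \<comment> \<open>The trivialisation is known to respect base points for elements of fibres. So
    \<open>g (y, z)\<close> is first placed in the fibre over its own projection, which is then
    recognised as the fibre over \<open>y\<close>.\<close>
  have gf: "g (y, z) \<in> carrier (fibre L y)" if y: "y \<in> U" for y z
  proof -
    let ?l = "g (y, z)"
    have "?l \<in> carrier (fibre L (proj L ?l))" "proj L ?l \<in> U" using gW[OF y] fibre_of_point by auto
    then have "fst (\<psi> ?l) = proj L ?l" using lin by blast
    then show ?thesis using \<psi>g[OF y] \<open>?l \<in> carrier (fibre L (proj L ?l))\<close> by simp
  qed
  have sm: "\<tau> \<odot>\<^bsub>fibre L y\<^esub> s y = g (y, \<tau>)" if y: "y \<in> U" for y \<tau>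
  proof -
    have sy: "s y \<in> carrier (fibre L y)" using gf y by (simp add: s_def)
    let ?l = "\<tau> \<odot>\<^bsub>fibre L y\<^esub> s y"
    have l: "?l \<in> carrier (fibre L y)" by (rule fibre_smult_closed[OF pU[OF y] sy])
    have "\<psi> ?l = (y, \<tau>)"
      using lin[OF y sy, of \<tau>] lin[OF y l] \<psi>g[OF y] y by (simp add: s_def prod_eq_iff)
    moreover have "?l \<in> ?W" using l fibre_carrier[OF pU[OF y]] y by simp
    ultimately show ?thesis using g\<psi> by metis
  qed
  have "local_frame M L U s \<kappa>"
    unfolding local_frame_def
  proof (intro conjI ballI allI impI U(1))
    show "s \<in> extensional U" by (simp add: s_def)
    fix y assume y: "y \<in> U"
    show "s y \<in> carrier (fibre L y)" using gf y by (simp add: s_def)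
    show "\<kappa> (z \<odot>\<^bsub>fibre L y\<^esub> s y) = z" for z using sm[OF y] \<psi>g[OF y] by (simp add: \<kappa>_def)
    fix l assume l: "l \<in> carrier (fibre L y)"
    then have "l \<in> ?W" "fst (\<psi> l) = y" using fibre_carrier[OF pU[OF y]] y lin by auto
    then show "\<kappa> l \<odot>\<^bsub>fibre L y\<^esub> s y = l" using sm[OF y] g\<psi> by (simp add: \<kappa>_def) (metis prod.collapse)
  next
    have "smooth_map (open_submfd ?N ?W) complex_mfd (\<lambda>l. snd (\<psi> l))"
      by (rule smooth_map_compose[OF aN aP smooth(1) smooth_map_snd[OF aU smooth_atlas_complex]])
    from smooth_map_complexD[OF this]
    show "smooth_fun ?N ?W \<kappa>"
      by (simp add: \<kappa>_def[abs_def] points_submfd[OF W] smooth_fun_submfd[OF total_atlas W])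
  next
    have "smooth_map ?P ?N g" using smooth(2) smooth_map_into_submfd[OF total_atlas W] by blast
    then show "smooth_map ?P ?N (\<lambda>p. snd p \<odot>\<^bsub>fibre L (fst p)\<^esub> s (fst p))"
      by (rule smooth_map_cong[OF aP]) (auto simp: pP sm)
  qed
  then show ?thesis using that U(2) by blast
qed

section \<open>Coefficients with respect to a local frame\<close>

context
  fixes U s \<kappa>
  assumes fr: "local_frame M L U s \<kappa>"
begin

lemma frame_open: "openin (mtop M) U" and frame_smooth_coeff:
    "smooth_fun (total L) {l \<in> points (total L). proj L l \<in> U} \<kappa>"
  using fr by (auto simp: local_frame_def)

lemma frame_points: "y \<in> U \<Longrightarrow> y \<in> points M"
  using frame_open openin_subset by blast

lemma frame_fibre: "y \<in> U \<Longrightarrow> s y \<in> carrier (fibre L y)"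
  using fr by (auto simp: local_frame_def)

lemma frame_coeff_smult_frame: "y \<in> U \<Longrightarrow> \<kappa> (z \<odot>\<^bsub>fibre L y\<^esub> s y) = z"
  using fr by (auto simp: local_frame_def)

lemma frame_coeff_frame: "y \<in> U \<Longrightarrow> \<kappa> (s y) = 1"
  using frame_coeff_smult_frame[of y 1] fibre_smult_one[OF frame_points frame_fibre] by simp

lemma frame_expand_point: "y \<in> U \<Longrightarrow> l \<in> carrier (fibre L y) \<Longrightarrow> \<kappa> l \<odot>\<^bsub>fibre L y\<^esub> s y = l"
  using fr by (auto simp: local_frame_def)

lemma frame_smooth_map:
  "smooth_map (prod_mfd (open_submfd M U) complex_mfd) (total L) (\<lambda>p. snd p \<odot>\<^bsub>fibre L (fst p)\<^esub> s (fst p))"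
  using fr by (simp add: local_frame_def)

lemma frame_prod_atlas: "smooth_atlas (prod_mfd (open_submfd M U) complex_mfd)"
  by (rule smooth_atlas_prod[OF smooth_atlas_submfd[OF M frame_open] smooth_atlas_complex])

lemma frame_smooth_mapI:
  assumes K: "smooth_atlas K" and f: "smooth_map K M f" "f ` points K \<subseteq> U" and \<tau>: "smooth_fun K (points K) \<tau>"
  shows "smooth_map K (total L) (\<lambda>y. \<tau> y \<odot>\<^bsub>fibre L (f y)\<^esub> s (f y))"
proof -
  have "smooth_map K (open_submfd M U) f" using f smooth_map_into_submfd[OF M frame_open] by blast
  then have "smooth_map K (prod_mfd (open_submfd M U) complex_mfd) (\<lambda>y. (f y, \<tau> y))"
    by (rule smooth_map_Pair[OF K _ smooth_map_complexI[OF K \<tau>]])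
  from smooth_map_compose[OF K frame_prod_atlas this frame_smooth_map] show ?thesis by simp
qed

lemma frame_sectionI:
  assumes VU: "V \<subseteq> U" and \<tau>: "smooth_fun M V \<tau>"
  shows "(\<lambda>y\<in>V. \<tau> y \<odot>\<^bsub>fibre L y\<^esub> s y) \<in> carrier (sections M L V)"
proof -
  have V: "openin (mtop M) V" by (rule smooth_fun_open[OF \<tau>])
  note aV = smooth_atlas_submfd[OF M V]
  have "smooth_map (open_submfd M V) (total L) (\<lambda>y. \<tau> y \<odot>\<^bsub>fibre L y\<^esub> s y)"
    by (rule frame_smooth_mapI[OF aV smooth_map_restrict_domain[OF M V smooth_map_id[OF M] M]])
      (use VU \<tau> in \<open>auto simp: points_submfd[OF V] smooth_fun_submfd[OF M V]\<close>)
  then have "smooth_map (open_submfd M V) (total L) (\<lambda>y\<in>V. \<tau> y \<odot>\<^bsub>fibre L y\<^esub> s y)"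
    by (rule smooth_map_cong[OF aV]) (simp add: points_submfd[OF V])
  then show ?thesis
    unfolding section_carrier using VU frame_fibre fibre_smult_closed[OF frame_points] by auto
qed

lemma frame_coeff_inj:
  assumes "y \<in> U" "l \<in> carrier (fibre L y)" "m \<in> carrier (fibre L y)" "\<kappa> l = \<kappa> m"
  shows "l = m"
  using frame_expand_point[OF assms(1,2)] unfolding assms(4) frame_expand_point[OF assms(1,3)] by (rule sym)

lemma frame_coeff_smult:
  assumes "y \<in> U" "l \<in> carrier (fibre L y)"
  shows "\<kappa> (z \<odot>\<^bsub>fibre L y\<^esub> l) = z * \<kappa> l"
proof -
  have "(z * \<kappa> l) \<odot>\<^bsub>fibre L y\<^esub> s y = z \<odot>\<^bsub>fibre L y\<^esub> l"
    unfolding fibre_smult_mult[OF frame_points[OF assms(1)] frame_fibre[OF assms(1)]]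
      frame_expand_point[OF assms] ..
  from arg_cong[OF this, of \<kappa>] show ?thesis using frame_coeff_smult_frame[OF assms(1)] by simp
qed

lemma frame_coeff_add:
  assumes "y \<in> U" "l \<in> carrier (fibre L y)" "m \<in> carrier (fibre L y)"
  shows "\<kappa> (l \<oplus>\<^bsub>fibre L y\<^esub> m) = \<kappa> l + \<kappa> m"
proof -
  have "(\<kappa> l + \<kappa> m) \<odot>\<^bsub>fibre L y\<^esub> s y = l \<oplus>\<^bsub>fibre L y\<^esub> m"
    unfolding fibre_smult_add[OF frame_points[OF assms(1)] frame_fibre[OF assms(1)]]
      frame_expand_point[OF assms(1,2)] frame_expand_point[OF assms(1,3)] ..
  from arg_cong[OF this, of \<kappa>] show ?thesis using frame_coeff_smult_frame[OF assms(1)] by simp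
qed

lemma frame_coeff_zero: "y \<in> U \<Longrightarrow> \<kappa> \<zero>\<^bsub>fibre L y\<^esub> = 0"
  using frame_coeff_smult_frame[of y 0] fibre_smult_zero[OF frame_points frame_fibre] by metis

lemma frame_coeff_eq_0: "y \<in> U \<Longrightarrow> l \<in> carrier (fibre L y) \<Longrightarrow> \<kappa> l = 0 \<longleftrightarrow> l = \<zero>\<^bsub>fibre L y\<^esub>"
  using frame_coeff_zero frame_coeff_inj[of y l "\<zero>\<^bsub>fibre L y\<^esub>"] fibre_zero_closed[OF frame_points] by metis

lemma frame_coeff_section:
  assumes t: "t \<in> carrier (sections M L V)" and V: "openin (mtop M) V" "V \<subseteq> U"
  shows "smooth_fun M V (\<lambda>y. \<kappa> (t y))"
proof -
  have "smooth_map (open_submfd M V) (total L) t" using t by (simp add: section_carrier)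
  from smooth_map_pullback[OF smooth_atlas_submfd[OF M V(1)] total_atlas this frame_smooth_coeff]
  have "smooth_fun M {x \<in> V. t x \<in> {l \<in> points (total L). proj L l \<in> U}} (\<lambda>y. \<kappa> (t y))"
    by (simp add: points_submfd[OF V(1)] smooth_fun_submfd[OF M V(1)])
  moreover have "{x \<in> V. t x \<in> {l \<in> points (total L). proj L l \<in> U}} = V"
  proof (intro equalityI subsetI)
    fix x assume x: "x \<in> V"
    then have "t x \<in> points (total L) \<and> proj L (t x) = x"
      using fibre_carrier[OF frame_points, of x "t x"] section_fibre[OF t x] V(2) by blast
    then show "x \<in> {x \<in> V. t x \<in> {l \<in> points (total L). proj L l \<in> U}}" using x V(2) by auto
  qed auto
  ultimately show ?thesis by simp
qed

lemma frame_section_expand: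
  assumes "t \<in> extensional V" "\<And>y. y \<in> V \<Longrightarrow> t y \<in> carrier (fibre L y)" "V \<subseteq> U"
  shows "t = (\<lambda>y\<in>V. \<kappa> (t y) \<odot>\<^bsub>fibre L y\<^esub> s y)"
  using assms frame_expand_point by (auto simp: fun_eq_iff extensional_def)

lemma section_from_coeff:
  assumes "t \<in> extensional V" "\<And>y. y \<in> V \<Longrightarrow> t y \<in> carrier (fibre L y)" "V \<subseteq> U"
    and "smooth_fun M V (\<lambda>y. \<kappa> (t y))"
  shows "t \<in> carrier (sections M L V)"
  using frame_section_expand[OF assms(1-3)] frame_sectionI[OF assms(3,4)] by simp

lemma frame_section: "V \<subseteq> U \<Longrightarrow> openin (mtop M) V \<Longrightarrow> restrict s V \<in> carrier (sections M L V)"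
proof -
  assume V: "V \<subseteq> U" "openin (mtop M) V"
  have "smooth_fun M V (\<lambda>y. \<kappa> (restrict s V y))"
    by (rule smooth_fun_cong[OF smooth_fun_const[OF M V(2), of 1] _ M]) (use V frame_coeff_frame in auto)
  then show ?thesis
    by (intro section_from_coeff V(1)) (use V frame_fibre in auto)
qed

lemma frame_restrict:
  assumes V: "openin (mtop M) V" "V \<subseteq> U"
  shows "local_frame M L V (restrict s V) \<kappa>"
  unfolding local_frame_def
proof (intro conjI ballI allI impI V(1))
  show "smooth_fun (total L) {l \<in> points (total L). proj L l \<in> V} \<kappa>"
    by (rule smooth_fun_subset[OF total_atlas frame_smooth_coeff smooth_map_preimage_open[OF proj_smooth V(1)]])
      (use V in auto)
  let ?P = "prod_mfd (open_submfd M V) complex_mfd"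
  note aV = smooth_atlas_submfd[OF M V(1)]
  have aP: "smooth_atlas ?P" by (rule smooth_atlas_prod[OF aV smooth_atlas_complex])
  have pP: "points ?P = V \<times> UNIV" by (simp add: points_prod points_submfd[OF V(1)] complex_mfd_def)
  have f: "smooth_map ?P M fst"
    using smooth_map_fst[OF aV smooth_atlas_complex] smooth_map_into_submfd[OF M V(1)] by blast
  have "smooth_map ?P (total L) (\<lambda>p. snd p \<odot>\<^bsub>fibre L (fst p)\<^esub> s (fst p))"
    by (rule frame_smooth_mapI[OF aP f _ smooth_map_complexD[OF smooth_map_snd[OF aV smooth_atlas_complex]]])
      (use V(2) pP in auto)
  then show "smooth_map ?P (total L) (\<lambda>p. snd p \<odot>\<^bsub>fibre L (fst p)\<^esub> restrict s V (fst p))"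
    by (rule smooth_map_cong[OF aP]) (auto simp: pP)
qed (use V frame_fibre frame_coeff_smult_frame frame_expand_point in auto)

end

text \<open>Smoothness of a section, a statement about a map into the total space, is reduced to
  smoothness of complex functions. The closure of sections under sums and multiples rests on
  this.\<close>

lemma section_by_frames:
  assumes U: "openin (mtop M) U" and t: "t \<in> extensional U" "\<And>y. y \<in> U \<Longrightarrow> t y \<in> carrier (fibre L y)"
    and sm: "\<And>V s \<kappa>. local_frame M L V s \<kappa> \<Longrightarrow> V \<subseteq> U \<Longrightarrow> smooth_fun M V (\<lambda>y. \<kappa> (t y))"
  shows "t \<in> carrier (sections M L U)"
proof (rule section_local[OF U t(1)])
  fix x assume x: "x \<in> U"
  then have "x \<in> points M" using U openin_subset by blast
  then obtain W s \<kappa> where W: "x \<in> W" "local_frame M L W s \<kappa>" using local_frame_exists by blast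
  let ?V = "W \<inter> U"
  have V: "openin (mtop M) ?V" "?V \<subseteq> U" using U frame_open[OF W(2)] by auto
  have fr: "local_frame M L ?V (restrict s ?V) \<kappa>" by (rule frame_restrict[OF W(2) V(1)]) auto
  have sf: "smooth_fun M ?V (\<lambda>y. \<kappa> (restrict t ?V y))"
    by (rule smooth_fun_cong[OF sm[OF fr V(2)] _ M]) auto
  have "restrict t ?V \<in> carrier (sections M L ?V)"
    by (rule section_from_coeff[OF fr restrict_extensional _ order_refl sf]) (use t(2) in auto)
  then show "\<exists>V. openin (mtop M) V \<and> x \<in> V \<and> V \<subseteq> U \<and> restrict t V \<in> carrier (sections M L V)"
    using V x W(1) by blast
qed

lemma section_coeff_smooth:
  assumes t: "t \<in> carrier (sections M L U)" and U: "openin (mtop M) U"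
    and fr: "local_frame M L V s \<kappa>" and V: "V \<subseteq> U"
  shows "smooth_fun M V (\<lambda>y. \<kappa> (t y))"
proof -
  have "smooth_fun M V (\<lambda>y. \<kappa> (restrict t V y))"
    by (rule frame_coeff_section[OF fr section_restrict[OF t U frame_open[OF fr] V] frame_open[OF fr] order_refl])
  then show ?thesis by (rule smooth_fun_cong[OF _ _ M]) auto
qed

lemma sections_add_closed:
  assumes U: "openin (mtop M) U" and s: "s \<in> carrier (sections M L U)" and t: "t \<in> carrier (sections M L U)"
  shows "s \<oplus>\<^bsub>sections M L U\<^esub> t \<in> carrier (sections M L U)"
proof (rule section_by_frames[OF U])
  have p: "y \<in> points M" if "y \<in> U" for y using U openin_subset that by blast
  fix V f \<kappa> assume fr: "local_frame M L V f \<kappa>" and V: "V \<subseteq> U"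
  have "smooth_fun M V (\<lambda>y. \<kappa> (s y) + \<kappa> (t y))"
    by (intro smooth_fun_add section_coeff_smooth[OF s U fr V] section_coeff_smooth[OF t U fr V])
  then show "smooth_fun M V (\<lambda>y. \<kappa> ((s \<oplus>\<^bsub>sections M L U\<^esub> t) y))"
    by (rule smooth_fun_cong[OF _ _ M]) (use V frame_coeff_add[OF fr] section_fibre[OF s] section_fibre[OF t] in
        \<open>auto simp: sections_def subset_iff\<close>)
qed (use U openin_subset section_fibre[OF s] section_fibre[OF t] in
    \<open>auto simp: sections_def intro!: fibre_add_closed\<close>)

lemma sections_smult_closed:
  assumes U: "openin (mtop M) U" and t: "t \<in> carrier (sections M L U)" and g: "smooth_fun M U g"
  shows "fun_smult L U g t \<in> carrier (sections M L U)"
proof (rule section_by_frames[OF U])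
  fix V f \<kappa> assume fr: "local_frame M L V f \<kappa>" and V: "V \<subseteq> U"
  have "smooth_fun M V (\<lambda>y. g y * \<kappa> (t y))"
    by (intro smooth_fun_mult section_coeff_smooth[OF t U fr V] smooth_fun_subset[OF M g frame_open[OF fr] V])
  then show "smooth_fun M V (\<lambda>y. \<kappa> (fun_smult L U g t y))"
    by (rule smooth_fun_cong[OF _ _ M]) (use V frame_coeff_smult[OF fr] section_fibre[OF t] in
        \<open>auto simp: fun_smult_def subset_iff\<close>)
qed (use U openin_subset section_fibre[OF t] in \<open>auto simp: fun_smult_def intro!: fibre_smult_closed\<close>)

lemma sections_smult_const:
  "z \<odot>\<^bsub>sections M L U\<^esub> t = fun_smult L U (\<lambda>x. z) t"
  by (simp add: sections_def fun_smult_def)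

lemma sections_zero_closed:
  assumes U: "openin (mtop M) U"
  shows "\<zero>\<^bsub>sections M L U\<^esub> \<in> carrier (sections M L U)"
proof (rule section_by_frames[OF U])
  fix V f \<kappa> assume fr: "local_frame M L V f \<kappa>" and V: "V \<subseteq> U"
  have "smooth_fun M V (\<lambda>y. 0 :: complex)" by (rule smooth_fun_const[OF M frame_open[OF fr]])
  then show "smooth_fun M V (\<lambda>y. \<kappa> (\<zero>\<^bsub>sections M L U\<^esub> y))"
    by (rule smooth_fun_cong[OF _ _ M]) (use V frame_coeff_zero[OF fr] in \<open>auto simp: sections_def subset_iff\<close>)
qed (use U openin_subset in \<open>auto simp: sections_def intro!: fibre_zero_closed\<close>)

lemma sections_abelian_group:
  assumes U: "openin (mtop M) U"
  shows "abelian_group (sections M L U)"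
proof (rule abelian_groupI)
  have p: "abelian_group (fibre L y)" if "y \<in> U" for y using U openin_subset that fibre_abelian_group by blast
  show "\<zero>\<^bsub>sections M L U\<^esub> \<in> carrier (sections M L U)" by (rule sections_zero_closed[OF U])
  fix r s t assume r: "r \<in> carrier (sections M L U)" and s: "s \<in> carrier (sections M L U)"
    and t: "t \<in> carrier (sections M L U)"
  note f = section_fibre[OF r] section_fibre[OF s] section_fibre[OF t]
  show "r \<oplus>\<^bsub>sections M L U\<^esub> s \<in> carrier (sections M L U)" by (rule sections_add_closed[OF U r s])
  show "r \<oplus>\<^bsub>sections M L U\<^esub> s \<oplus>\<^bsub>sections M L U\<^esub> t = r \<oplus>\<^bsub>sections M L U\<^esub> (s \<oplus>\<^bsub>sections M L U\<^esub> t)"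
    using f abelian_monoid.a_assoc[OF abelian_group.axioms(1)[OF p]] by (auto simp: sections_def fun_eq_iff)
  show "r \<oplus>\<^bsub>sections M L U\<^esub> s = s \<oplus>\<^bsub>sections M L U\<^esub> r"
    using f abelian_monoid.a_comm[OF abelian_group.axioms(1)[OF p]] by (auto simp: sections_def fun_eq_iff)
  show "\<zero>\<^bsub>sections M L U\<^esub> \<oplus>\<^bsub>sections M L U\<^esub> r = r"
    using f abelian_monoid.l_zero[OF abelian_group.axioms(1)[OF p]] section_extensional[OF r]
    by (auto simp: sections_def fun_eq_iff extensional_def)
  \<comment> \<open>The additive inverse is the multiple by -1, whose smoothness is already
    known.\<close>
  have "fun_smult L U (\<lambda>x. -1) r \<in> carrier (sections M L U)"
    by (rule sections_smult_closed[OF U r smooth_fun_const[OF M U]])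
  moreover have "fun_smult L U (\<lambda>x. -1) r \<oplus>\<^bsub>sections M L U\<^esub> r = \<zero>\<^bsub>sections M L U\<^esub>"
  proof
    fix y
    have "(-1) \<odot>\<^bsub>fibre L y\<^esub> r y \<oplus>\<^bsub>fibre L y\<^esub> r y = \<zero>\<^bsub>fibre L y\<^esub>" if y: "y \<in> U"
    proof -
      have yp: "y \<in> points M" using U openin_subset y by blast
      show ?thesis using fibre_smult_add[OF yp f(1)[OF y], of "-1" 1] fibre_smult_one[OF yp f(1)[OF y]]
          fibre_smult_zero[OF yp f(1)[OF y]] by simp
    qed
    then show "(fun_smult L U (\<lambda>x. -1) r \<oplus>\<^bsub>sections M L U\<^esub> r) y = \<zero>\<^bsub>sections M L U\<^esub> y"
      by (simp add: sections_def fun_smult_def)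
  qed
  ultimately show "\<exists>s\<in>carrier (sections M L U). s \<oplus>\<^bsub>sections M L U\<^esub> r = \<zero>\<^bsub>sections M L U\<^esub>" by blast
qed

end

section \<open>One-forms\<close>

lemma complex_one_form_linear:
  "complex_one_form M U \<alpha> \<Longrightarrow> x \<in> U \<Longrightarrow> v \<in> tangent_space M x \<Longrightarrow> w \<in> tangent_space M x \<Longrightarrow>
    \<alpha> x (\<lambda>f. a * v f + b * w f) = of_real a * \<alpha> x v + of_real b * \<alpha> x w"
  unfolding complex_one_form_def by blast

lemma complex_one_form_smooth:
  "complex_one_form M U \<alpha> \<Longrightarrow> openin (mtop M) V \<Longrightarrow> V \<subseteq> U \<Longrightarrow> X \<in> vector_fields M V \<Longrightarrow>
    smooth_fun M V (\<lambda>x. \<alpha> x (X x))"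
  unfolding complex_one_form_def by blast

lemma tangent_space_zero: "(\<lambda>f. 0) \<in> tangent_space M x"
  by (simp add: tangent_space_def)

lemma complex_one_form_zero:
  assumes "complex_one_form M U \<alpha>" "x \<in> U"
  shows "\<alpha> x (\<lambda>f. 0) = 0"
  using complex_one_form_linear[OF assms tangent_space_zero tangent_space_zero, of 0 0] by simp

text \<open>Linearity is given for combinations of two vectors, so the induction has to carry along
  that the partial sums are tangent vectors.\<close>

lemma complex_one_form_sum:
  assumes M: "smooth_atlas M" and \<alpha>: "complex_one_form M U \<alpha>" and x: "x \<in> U" and I: "finite I"
    and v: "\<And>i. i \<in> I \<Longrightarrow> v i \<in> tangent_space M x"
  shows "\<alpha> x (\<lambda>f. \<Sum>i\<in>I. a i * v i f) = (\<Sum>i\<in>I. of_real (a i) * \<alpha> x (v i))"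
proof -
  have "(\<lambda>f. \<Sum>i\<in>I. a i * v i f) \<in> tangent_space M x \<and>
      \<alpha> x (\<lambda>f. \<Sum>i\<in>I. a i * v i f) = (\<Sum>i\<in>I. of_real (a i) * \<alpha> x (v i))"
    using I v
  proof (induction I)
    case empty
    then show ?case by (simp add: tangent_space_zero complex_one_form_zero[OF \<alpha> x])
  next
    case (insert i I)
    then have S: "(\<lambda>f. \<Sum>i\<in>I. a i * v i f) \<in> tangent_space M x" and vi: "v i \<in> tangent_space M x" by auto
    show ?case
      using tangent_space_lincomb[OF M vi S, of "a i" 1] complex_one_form_linear[OF \<alpha> x vi S, of "a i" 1] insert
      by simp
  qed
  then show ?thesis by blast
qed

text \<open>With \<open>c = \<i>\<close> this is applied to a connection form and a pulled-back
  connection form; the result is the closed form whose potential is exponentiated.\<close>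

lemma complex_one_form_scaled_diff:
  assumes "complex_one_form M U \<alpha>" "complex_one_form M U \<beta>"
  shows "complex_one_form M U (\<lambda>x v. c * (\<alpha> x v - \<beta> x v))"
  unfolding complex_one_form_def
proof (intro conjI ballI allI impI)
  fix x v w and a b :: real assume "x \<in> U" "v \<in> tangent_space M x" "w \<in> tangent_space M x"
  then show "c * (\<alpha> x (\<lambda>f. a * v f + b * w f) - \<beta> x (\<lambda>f. a * v f + b * w f)) =
      of_real a * (c * (\<alpha> x v - \<beta> x v)) + of_real b * (c * (\<alpha> x w - \<beta> x w))"
    by (simp add: complex_one_form_linear[OF assms(1)] complex_one_form_linear[OF assms(2)] algebra_simps)
next
  fix V X assume V: "openin (mtop M) V" "V \<subseteq> U" "X \<in> vector_fields M V"
  have "smooth_fun M V (\<lambda>x. c * (\<alpha> x (X x) + - \<beta> x (X x)))"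
    by (intro smooth_fun_linear_comp[OF bounded_linear_mult_right] smooth_fun_add smooth_fun_uminus
        complex_one_form_smooth[OF assms(1) V] complex_one_form_smooth[OF assms(2) V])
  then show "smooth_fun M V (\<lambda>x. c * (\<alpha> x (X x) - \<beta> x (X x)))" by simp
qed

lemma cderiv_scaled_diff:
  assumes M: "smooth_atlas M" and v: "v \<in> tangent_space M x" and f: "smooth_fun M U f" and g: "smooth_fun M U g"
    and x: "x \<in> U"
  shows "cderiv v (\<lambda>y. c * (f y - g y)) = c * (cderiv v f - cderiv v g)"
proof -
  have xp: "x \<in> points M" using smooth_fun_open[OF f] openin_subset x by blast
  have U: "openin (mtop M) U" by (rule smooth_fun_open[OF f])
  have mg: "smooth_fun M U (\<lambda>y. -1 * g y)" by (rule smooth_fun_mult[OF smooth_fun_const[OF M U] g])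
  note n = smooth_nearI[OF _ x]
  have "cderiv v (\<lambda>y. c * (f y + -1 * g y)) = c * cderiv v (\<lambda>y. f y + -1 * g y)"
    using cderiv_mult[OF M v smooth_fun_const[OF M U, of c] smooth_fun_add[OF f mg] x]
    by (simp add: cderiv_const[OF M v xp])
  also have "cderiv v (\<lambda>y. f y + -1 * g y) = cderiv v f + cderiv v (\<lambda>y. -1 * g y)"
    using tangent_space_add[OF v n[OF smooth_fun_Re_Im(1)[OF M f]] n[OF smooth_fun_Re_Im(1)[OF M mg]]]
      tangent_space_add[OF v n[OF smooth_fun_Re_Im(2)[OF M f]] n[OF smooth_fun_Re_Im(2)[OF M mg]]]
    by (simp add: cderiv_def complex_eq_iff)
  also have "cderiv v (\<lambda>y. -1 * g y) = -1 * cderiv v g"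
    using cderiv_mult[OF M v smooth_fun_const[OF M U, of "-1"] g x] by (simp add: cderiv_const[OF M v xp])
  finally show ?thesis by simp
qed

lemma ext_deriv1_scaled_diff:
  assumes M: "smooth_atlas M" and U: "openin (mtop M) U"
    and \<alpha>: "complex_one_form M U \<alpha>" and \<beta>: "complex_one_form M U \<beta>"
    and X: "X \<in> vector_fields M U" and Y: "Y \<in> vector_fields M U" and x: "x \<in> U"
  shows "ext_deriv1 M U (\<lambda>x v. c * (\<alpha> x v - \<beta> x v)) X Y x = c * (ext_deriv1 M U \<alpha> X Y x - ext_deriv1 M U \<beta> X Y x)"
  unfolding ext_deriv1_def
    cderiv_scaled_diff[OF M vector_field_tangent[OF M X x] complex_one_form_smooth[OF \<alpha> U order_refl Y]
      complex_one_form_smooth[OF \<beta> U order_refl Y] x]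
    cderiv_scaled_diff[OF M vector_field_tangent[OF M Y x] complex_one_form_smooth[OF \<alpha> U order_refl X]
      complex_one_form_smooth[OF \<beta> U order_refl X] x]
  by (simp add: algebra_simps)

text \<open>Symmetry of second derivatives in the chart, for functions smooth near \<open>x\<close>;
  for the others the bracket is 0 by its default value.\<close>

lemma coord_bracket_zero:
  assumes M: "smooth_atlas M" and C: "(C, \<phi>) \<in> atlas M" and U: "openin (mtop M) U" "U \<subseteq> C" and x: "x \<in> U"
  shows "lie_bracket M U (\<lambda>x\<in>U. coord_deriv M C \<phi> d x) (\<lambda>x\<in>U. coord_deriv M C \<phi> e x) x = (\<lambda>f. 0)"
proof
  fix f
  show "lie_bracket M U (\<lambda>x\<in>U. coord_deriv M C \<phi> d x) (\<lambda>x\<in>U. coord_deriv M C \<phi> e x) x f = 0"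
  proof (cases "smooth_near M x f")
    case True
    obtain E :: "'b set" where E: "frame E" using smooth_atlas_frame[OF M] by blast
    have xC: "x \<in> C" using x U by blast
    obtain W where W: "x \<in> W" "smooth_fun M W f" using True unfolding smooth_near_def by blast
    let ?V = "W \<inter> U" and ?f = "\<lambda>u. f (inv_into C \<phi> u)"
    have V: "openin (mtop M) ?V" using U smooth_fun_open[OF W(2)] by blast
    have sV: "smooth_fun M ?V f" by (rule smooth_fun_subset[OF M W(2) V]) auto
    have s: "smooth_on (\<phi> ` ?V) ?f"
      using smooth_fun_in_chart[OF sV C] U(2) by (simp add: Int_absorb2 le_infI2)
    have *: "(\<lambda>x\<in>U. coord_deriv M C \<phi> d x) x (\<lambda>y. (\<lambda>x\<in>U. coord_deriv M C \<phi> e x) y f) =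
        frechet_derivative (\<lambda>u. frechet_derivative ?f (at u) e) (at (\<phi> x)) d" for d e
    proof -
      have sm: "smooth_fun M ?V (\<lambda>y. (\<lambda>x\<in>U. coord_deriv M C \<phi> e x) y f)"
        by (rule vector_field_smooth[OF M coord_field[OF M C U(2)] sV]) auto
      have "frechet_derivative (\<lambda>u. (\<lambda>x\<in>U. coord_deriv M C \<phi> e x) (inv_into C \<phi> u) f) (at (\<phi> x)) =
          frechet_derivative (\<lambda>u. frechet_derivative ?f (at u) e) (at (\<phi> x))"
      proof (rule frechet_derivative_cong[OF smooth_onD(1)[OF s]])
        fix u assume "u \<in> \<phi> ` ?V"
        then obtain y where y: "y \<in> W" "y \<in> U" "y \<in> C" "u = \<phi> y" using U(2) by blast
        then show "(\<lambda>x\<in>U. coord_deriv M C \<phi> e x) (inv_into C \<phi> u) f = frechet_derivative ?f (at u) e"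
          using M C smooth_nearI[OF W(2)] by (simp add: coord_deriv_def)
      qed (use x W in auto)
      then show ?thesis
        using smooth_nearI[OF sm, of x] x W(1) by (simp add: coord_deriv_def[of M C \<phi> d])
    qed
    have "lie_bracket M U X Y x f = X x (\<lambda>y. Y y f) - Y x (\<lambda>y. X y f)" for X Y
      using x True by (simp add: lie_bracket_def)
    then show ?thesis
      using second_derivative_symmetric[OF E s, of "\<phi> x" d e] x W(1) by (simp only: *) auto
  qed (simp add: lie_bracket_def x)
qed

text \<open>Coordinate fields commute, so for them the exterior derivative has no bracket term, and
  its vanishing is the symmetry of derivatives that the Poincare lemma asks of the components of
  \<beta>. The domain is the preimage of a ball, where radial integration is possible.\<close>

lemma closed_form_potential:
  fixes M :: "('a, 'e::{real_inner,banach}) mfd"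
  assumes M: "smooth_atlas M" and C: "(C, \<phi>) \<in> atlas M" and r: "ball p r \<subseteq> \<phi> ` C"
    and U: "U = {y \<in> C. \<phi> y \<in> ball p r}" and \<beta>: "complex_one_form M U \<beta>"
    and closed: "\<And>X Y x. X \<in> vector_fields M U \<Longrightarrow> Y \<in> vector_fields M U \<Longrightarrow> x \<in> U \<Longrightarrow> ext_deriv1 M U \<beta> X Y x = 0"
  obtains g where "smooth_fun M U g" "\<And>x v. x \<in> U \<Longrightarrow> v \<in> tangent_space M x \<Longrightarrow> cderiv v g = \<beta> x v"
proof -
  obtain E :: "'e set" where E: "frame E" using smooth_atlas_frame[OF M] by blast
  have Uo: "openin (mtop M) U" unfolding U by (rule chart_preimage_open[OF M C open_ball])
  have UC: "U \<subseteq> C" by (auto simp: U)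
  have im: "\<phi> ` U = ball p r" using r unfolding U by blast
  define cf where "cf e = (\<lambda>x\<in>U. coord_deriv M C \<phi> e x)" for e
  have cf: "cf e \<in> vector_fields M U" for e unfolding cf_def by (rule coord_field[OF M C UC])
  define b where "b e u = \<beta> (inv_into C \<phi> u) (cf e (inv_into C \<phi> u))" for e u
  have smf: "smooth_fun M U (\<lambda>x. \<beta> x (cf e x))" for e by (rule complex_one_form_smooth[OF \<beta> Uo order_refl cf])
  have smb: "smooth_on (ball p r) (b e)" for e
    using smooth_fun_in_chart[OF smf C, of e] UC im by (simp add: b_def[abs_def] Int_absorb2)
  have cd: "cderiv (cf d x) (\<lambda>y. \<beta> y (cf e y)) = frechet_derivative (b e) (at (\<phi> x)) d" if x: "x \<in> U" for x d e
    using cderiv_coord[OF M C _ x smf[of e], of d] x UC by (auto simp: cf_def b_def[abs_def])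
  have closed': "frechet_derivative (b e) (at u) d = frechet_derivative (b d) (at u) e" if u: "u \<in> ball p r" for u d e
  proof -
    obtain x where x: "x \<in> U" "u = \<phi> x" using u im by blast
    have "lie_bracket M U (cf d) (cf e) x = (\<lambda>f. 0)"
      unfolding cf_def by (rule coord_bracket_zero[OF M C Uo UC x(1)])
    then show ?thesis
      using closed[OF cf[of d] cf[of e] x(1)] complex_one_form_zero[OF \<beta> x(1)] x
      by (simp add: ext_deriv1_def cd)
  qed
  obtain G where G: "smooth_on (ball p r) G"
      "\<And>u. u \<in> ball p r \<Longrightarrow> (G has_derivative (\<lambda>v. \<Sum>e\<in>E. (v \<bullet> e) *\<^sub>R b e u)) (at u)"
    by (rule Poincare[OF E smb closed']) (assumption, rule that)
  have g: "smooth_fun M U (\<lambda>y. G (\<phi> y))"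
    by (rule smooth_fun_compose[OF M smooth_atlas_frame[OF M] G(1) smooth_fun_chart[OF M C Uo UC]]) (use im in auto)
  show ?thesis
  proof (rule that[OF g])
    fix x v assume x: "x \<in> U" and v: "v \<in> tangent_space M x"
    have xC: "x \<in> C" and xp: "x \<in> points M" using x UC chart_subset[OF M C] by auto
    have xb: "\<phi> x \<in> ball p r" using x by (simp add: U)
    have DG: "frechet_derivative (\<lambda>u. G (\<phi> (inv_into C \<phi> u))) (at (\<phi> x)) e = (\<Sum>d\<in>E. of_real (e \<bullet> d) * b d (\<phi> x))" for e
    proof -
      have "frechet_derivative (\<lambda>u. G (\<phi> (inv_into C \<phi> u))) (at (\<phi> x)) = frechet_derivative G (at (\<phi> x))"
        by (rule frechet_derivative_cong[OF open_ball xb]) (use im[symmetric] M C UC in \<open>auto simp: subset_iff\<close>)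
      then show ?thesis
        using fun_cong[OF frechet_derivative_at[OF G(2)[OF xb]], of e] by (simp add: scaleR_conv_of_real)
    qed
    note n = smooth_near_coord[OF M C xC]
    \<comment> \<open>Members of a frame are not assumed to be orthogonal, so
      \<open>e \<bullet> d\<close> does not reduce to 0 or 1; this identity resums the double sum
      produced by the two expansions.\<close>
    have vd: "v (\<lambda>y. \<phi> y \<bullet> d) = (\<Sum>e\<in>E. v (\<lambda>y. \<phi> y \<bullet> e) * (e \<bullet> d))" for d
    proof -
      have "\<phi> y \<bullet> d = (\<Sum>e\<in>E. (e \<bullet> d) * (\<phi> y \<bullet> e))" for y
        using frame_linear[OF E bounded_linear.linear[OF bounded_linear_inner_left[of d]], of "\<phi> y"]
        by (simp add: mult.commute)
      then have "v (\<lambda>y. \<phi> y \<bullet> d) = v (\<lambda>y. \<Sum>e\<in>E. (e \<bullet> d) * (\<phi> y \<bullet> e))" by metis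
      also have "\<dots> = (\<Sum>e\<in>E. v (\<lambda>y. (e \<bullet> d) * (\<phi> y \<bullet> e)))"
        by (rule tangent_space_sum(1)[OF M v xp smooth_near_mult[OF M smooth_near_const[OF M xp] n]])
      also have "\<dots> = (\<Sum>e\<in>E. v (\<lambda>y. \<phi> y \<bullet> e) * (e \<bullet> d))"
        by (simp add: tangent_space_scale[OF v n] mult.commute)
      finally show ?thesis .
    qed
    have "cderiv v (\<lambda>y. G (\<phi> y)) = (\<Sum>e\<in>E. \<Sum>d\<in>E. of_real (v (\<lambda>y. \<phi> y \<bullet> e)) * (of_real (e \<bullet> d) * b d (\<phi> x)))"
      unfolding cderiv_expand[OF M E C xC x v g] DG by (simp add: sum_distrib_left)
    also have "\<dots> = (\<Sum>d\<in>E. of_real (\<Sum>e\<in>E. v (\<lambda>y. \<phi> y \<bullet> e) * (e \<bullet> d)) * b d (\<phi> x))"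
      by (subst sum.swap) (simp add: sum_distrib_left sum_distrib_right mult_ac)
    also have "\<dots> = (\<Sum>d\<in>E. of_real (v (\<lambda>y. \<phi> y \<bullet> d)) * b d (\<phi> x))"
      by (intro sum.cong refl arg_cong2[where f = "(*)"] arg_cong[where f = of_real] vd[symmetric])
    also have "\<dots> = (\<Sum>d\<in>E. of_real (v (\<lambda>y. \<phi> y \<bullet> d)) * \<beta> x (coord_deriv M C \<phi> d x))"
      using M C xC x by (simp add: b_def cf_def)
    also have "\<dots> = \<beta> x (\<lambda>f. \<Sum>d\<in>E. v (\<lambda>y. \<phi> y \<bullet> d) * coord_deriv M C \<phi> d x f)"
      by (rule complex_one_form_sum[OF M \<beta> x frame_finite[OF E] coord_deriv_tangent[OF M C xC], symmetric])
    also have "\<dots> = \<beta> x v" using tangent_expand[OF M E C xC v] by metis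
    finally show "cderiv v (\<lambda>y. G (\<phi> y)) = \<beta> x v" .
  qed
qed

subsection \<open>Pull-back\<close>

context
  fixes M :: "('a, 'e::{real_inner,banach}) mfd" and \<Phi> :: "'a \<Rightarrow> 'a"
  assumes M: "smooth_atlas M" and \<Phi>: "diffeo M M \<Phi>"
begin

lemma complex_one_form_pullback:
  assumes U: "openin (mtop M) U" and \<alpha>: "complex_one_form M (\<Phi> ` U) \<alpha>"
  shows "complex_one_form M U (\<lambda>x v. \<alpha> (\<Phi> x) (tangent_map M M \<Phi> x v))"
  unfolding complex_one_form_def
proof (intro conjI ballI allI impI)
  have Up: "U \<subseteq> points M" using U openin_subset by blast
  fix x v w and a b :: real assume x: "x \<in> U" and v: "v \<in> tangent_space M x" and w: "w \<in> tangent_space M x"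
  note c = tangent_map_closed[OF M M diffeo_smooth(1)[OF M \<Phi>]]
  have xp: "x \<in> points M" using x Up by blast
  have "tangent_map M M \<Phi> x (\<lambda>f. a * v f + b * w f) =
      (\<lambda>f. a * tangent_map M M \<Phi> x v f + b * tangent_map M M \<Phi> x w f)"
    by (auto simp: tangent_map_def fun_eq_iff)
  then show "\<alpha> (\<Phi> x) (tangent_map M M \<Phi> x (\<lambda>f. a * v f + b * w f)) =
      of_real a * \<alpha> (\<Phi> x) (tangent_map M M \<Phi> x v) + of_real b * \<alpha> (\<Phi> x) (tangent_map M M \<Phi> x w)"
    using complex_one_form_linear[OF \<alpha> _ c[OF xp v] c[OF xp w], of a b] x by simp
next
  have Up: "U \<subseteq> points M" using U openin_subset by blast
  fix V X assume V: "openin (mtop M) V" "V \<subseteq> U" and X: "X \<in> vector_fields M V"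
  have Vp: "V \<subseteq> points M" using V Up by blast
  have "smooth_fun M (\<Phi> ` V) (\<lambda>y. \<alpha> y (vf_push M \<Phi> V X y))"
    by (rule complex_one_form_smooth[OF \<alpha> openin_image[OF M \<Phi> V(1)] _ vf_push_closed[OF M \<Phi> X V(1)]])
      (use V in auto)
  from smooth_fun_pull[OF M \<Phi> this order_refl Vp]
  have "smooth_fun M V (\<lambda>x. \<alpha> (\<Phi> x) (vf_push M \<Phi> V X (\<Phi> x)))"
    by (simp add: Collect_conj_eq Int_absorb2 subset_iff)
  then show "smooth_fun M V (\<lambda>x. \<alpha> (\<Phi> x) (tangent_map M M \<Phi> x (X x)))"
    by (rule smooth_fun_cong[OF _ _ M]) (use vf_push_apply[OF M \<Phi> _ Vp] in auto)
qed

text \<open>At the point \<Phi> x, applying the two pushed fields in succession to \<open>f\<close>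
  is the same as applying \<open>Y\<close> and then \<open>X\<close> at \<open>x\<close> to the
  pull-back of \<open>f\<close>. Both terms of the commutator transform in this way.\<close>

lemma lie_bracket_push:
  assumes U: "openin (mtop M) U" and X: "X \<in> vector_fields M U" and Y: "Y \<in> vector_fields M U" and x: "x \<in> U"
  shows "lie_bracket M (\<Phi> ` U) (vf_push M \<Phi> U X) (vf_push M \<Phi> U Y) (\<Phi> x) =
    tangent_map M M \<Phi> x (lie_bracket M U X Y x)"
proof
  fix f
  have Up: "U \<subseteq> points M" using U openin_subset by blast
  have xp: "x \<in> points M" using x Up by blast
  show "lie_bracket M (\<Phi> ` U) (vf_push M \<Phi> U X) (vf_push M \<Phi> U Y) (\<Phi> x) f =
    tangent_map M M \<Phi> x (lie_bracket M U X Y x) f"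
  proof (cases "smooth_near M (\<Phi> x) f")
    case True
    then obtain W where W: "\<Phi> x \<in> W" "smooth_fun M W f" unfolding smooth_near_def by blast
    let ?V = "W \<inter> \<Phi> ` U"
    have V: "openin (mtop M) ?V" using smooth_fun_open[OF W(2)] openin_image[OF M \<Phi> U] by blast
    have sV: "smooth_fun M ?V f" by (rule smooth_fun_subset[OF M W(2) V]) auto
    let ?O = "{y \<in> U. \<Phi> y \<in> ?V}"
    have O: "openin (mtop M) ?O" by (rule smooth_fun_open[OF smooth_fun_pull[OF M \<Phi> sV _ Up]]) auto
    have *: "vf_push M \<Phi> U X (\<Phi> x) (\<lambda>y. vf_push M \<Phi> U Y y f) = X x (\<lambda>y. Y y (\<lambda>z. f (\<Phi> z)))"
      if X: "X \<in> vector_fields M U" and Y: "Y \<in> vector_fields M U" for X Y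
    proof -
      have "smooth_fun M ?V (\<lambda>y. vf_push M \<Phi> U Y y f)"
        by (rule vector_field_smooth[OF M vf_push_closed[OF M \<Phi> Y U] sV]) auto
      then have "smooth_near M (\<Phi> x) (\<lambda>y. vf_push M \<Phi> U Y y f)"
        by (rule smooth_nearI) (use W x in auto)
      then have "vf_push M \<Phi> U X (\<Phi> x) (\<lambda>y. vf_push M \<Phi> U Y y f) = X x (\<lambda>y. vf_push M \<Phi> U Y (\<Phi> y) f)"
        by (simp add: vf_push_apply[OF M \<Phi> x Up] tangent_map_def o_def)
      also have "\<dots> = X x (\<lambda>y. Y y (\<lambda>z. f (\<Phi> z)))"
      proof (rule tangent_space_local[OF M vector_field_tangent[OF M X x] O])
        fix y assume y: "y \<in> ?O"
        then show "vf_push M \<Phi> U Y (\<Phi> y) f = Y y (\<lambda>z. f (\<Phi> z))"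
          using vf_push_apply[OF M \<Phi> _ Up, of y Y] smooth_nearI[OF W(2), of "\<Phi> y"]
          by (simp add: tangent_map_def o_def)
      qed (use x W in auto)
      finally show ?thesis .
    qed
    show ?thesis
      using True smooth_near_pullback[OF M M diffeo_smooth(1)[OF M \<Phi>] xp True] x
      by (simp add: lie_bracket_def tangent_map_def o_def * X Y)
  qed (use x in \<open>simp add: lie_bracket_def tangent_map_def\<close>)
qed

text \<open>The exterior derivative commutes with pull-back, since both derivatives along vector
  fields and brackets are compatible with push-forward.\<close>

lemma ext_deriv1_pullback:
  assumes U: "openin (mtop M) U" and \<alpha>: "complex_one_form M (\<Phi> ` U) \<alpha>"
    and X: "X \<in> vector_fields M U" and Y: "Y \<in> vector_fields M U" and x: "x \<in> U"
  shows "ext_deriv1 M U (\<lambda>x v. \<alpha> (\<Phi> x) (tangent_map M M \<Phi> x v)) X Y x =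
    ext_deriv1 M (\<Phi> ` U) \<alpha> (vf_push M \<Phi> U X) (vf_push M \<Phi> U Y) (\<Phi> x)"
proof -
  have Up: "U \<subseteq> points M" using U openin_subset by blast
  have *: "cderiv (vf_push M \<Phi> U X (\<Phi> x)) (\<lambda>y. \<alpha> y (vf_push M \<Phi> U Y y)) =
      cderiv (X x) (\<lambda>y. \<alpha> (\<Phi> y) (tangent_map M M \<Phi> y (Y y)))"
    if X: "X \<in> vector_fields M U" and Y: "Y \<in> vector_fields M U" for X Y
  proof -
    have "smooth_fun M (\<Phi> ` U) (\<lambda>y. \<alpha> y (vf_push M \<Phi> U Y y))"
      by (rule complex_one_form_smooth[OF \<alpha> openin_image[OF M \<Phi> U] order_refl vf_push_closed[OF M \<Phi> Y U]])
    then have "cderiv (vf_push M \<Phi> U X (\<Phi> x)) (\<lambda>y. \<alpha> y (vf_push M \<Phi> U Y y)) =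
        cderiv (X x) (\<lambda>y. \<alpha> (\<Phi> y) (vf_push M \<Phi> U Y (\<Phi> y)))"
      unfolding vf_push_apply[OF M \<Phi> x Up] by (rule cderiv_tangent_map) (use x in auto)
    also have "\<dots> = cderiv (X x) (\<lambda>y. \<alpha> (\<Phi> y) (tangent_map M M \<Phi> y (Y y)))"
      by (rule cderiv_local[OF M vector_field_tangent[OF M X x] U x]) (simp add: vf_push_apply[OF M \<Phi> _ Up])
    finally show ?thesis .
  qed
  show ?thesis
    by (simp add: ext_deriv1_def *[OF X Y] *[OF Y X] lie_bracket_push[OF U X Y x])
qed

end

section \<open>Connections\<close>

text \<open>The local expression d + i\<alpha> of the connection, in terms of the coefficient
  \<kappa> of a frame. It is stated for every section over every smaller open set, the form in which
  the comparison of connections uses it.\<close>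

definition connection_form ::
    "('a, 'e::{real_inner,banach}) mfd \<Rightarrow> ('l, 'f::{real_inner,banach}, 'a) lbundle \<Rightarrow> ('a, 'l) conn
      \<Rightarrow> 'a set \<Rightarrow> ('l \<Rightarrow> complex) \<Rightarrow> ('a \<Rightarrow> 'a tvec \<Rightarrow> complex) \<Rightarrow> bool" where
  "connection_form M L D U \<kappa> \<alpha> \<longleftrightarrow> complex_one_form M U \<alpha> \<and>
     (\<forall>V X t x. openin (mtop M) V \<longrightarrow> V \<subseteq> U \<longrightarrow> X \<in> vector_fields M V \<longrightarrow> t \<in> carrier (sections M L V) \<longrightarrow>
        x \<in> V \<longrightarrow> \<kappa> (D V X t x) = cderiv (X x) (\<lambda>y. \<kappa> (t y)) + \<i> * \<alpha> x (X x) * \<kappa> (t x))"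

context
  fixes M :: "('a, 'e::{real_inner,banach}) mfd" and L :: "('l, 'f::{real_inner,banach}, 'a) lbundle"
    and D :: "('a, 'l) conn"
  assumes M: "smooth_atlas M" and L: "complex_line_bundle M L" and D: "connection M L D"
begin

context
  fixes U X s
  assumes U: "openin (mtop M) U" and X: "X \<in> vector_fields M U" and s: "s \<in> carrier (sections M L U)"
begin

lemmas conn_axioms = D[unfolded connection_def, THEN spec, THEN mp, OF U, THEN bspec, OF X, THEN bspec, OF s]

lemma conn_closed: "D U X s \<in> carrier (sections M L U)"
  by (rule conn_axioms[THEN conjunct1])

lemma conn_restrict:
  "openin (mtop M) V \<Longrightarrow> V \<subseteq> U \<Longrightarrow> restrict (D U X s) V = D V (restrict X V) (restrict s V)"
  by (rule conn_axioms[THEN conjunct2, THEN conjunct1, rule_format])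

lemma conn_vf_add:
  "Y \<in> vector_fields M U \<Longrightarrow> D U (vf_add U X Y) s = D U X s \<oplus>\<^bsub>sections M L U\<^esub> D U Y s"
  by (rule conn_axioms[THEN conjunct2, THEN conjunct2, THEN conjunct1, rule_format])

lemma conn_vf_scale:
  "smooth_fun M U g \<Longrightarrow> D U (vf_scale U g X) s = fun_smult L U (\<lambda>x. of_real (g x)) (D U X s)"
  by (rule conn_axioms[THEN conjunct2, THEN conjunct2, THEN conjunct2, THEN conjunct1, rule_format])

lemma conn_add:
  "t \<in> carrier (sections M L U) \<Longrightarrow> D U X (s \<oplus>\<^bsub>sections M L U\<^esub> t) = D U X s \<oplus>\<^bsub>sections M L U\<^esub> D U X t"
  by (rule conn_axioms[THEN conjunct2, THEN conjunct2, THEN conjunct2, THEN conjunct2, THEN conjunct1, rule_format])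

lemma conn_Leibniz:
  "smooth_fun M U g \<Longrightarrow> D U X (fun_smult L U g s) =
     fun_smult L U (\<lambda>x. cderiv (X x) g) s \<oplus>\<^bsub>sections M L U\<^esub> fun_smult L U g (D U X s)"
  by (rule conn_axioms[THEN conjunct2, THEN conjunct2, THEN conjunct2, THEN conjunct2, THEN conjunct2, rule_format])

lemma conn_fibre: "x \<in> U \<Longrightarrow> D U X s x \<in> carrier (fibre L x)"
  by (rule section_fibre[OF M L conn_closed])

end

lemma frame_coeff_conn_smult:
  assumes fr: "local_frame M L U s \<kappa>" and V: "openin (mtop M) V" "V \<subseteq> U" and X: "X \<in> vector_fields M V"
    and t: "t \<in> carrier (sections M L V)" and g: "smooth_fun M V g" and x: "x \<in> V"
  shows "\<kappa> (D V X (fun_smult L V g t) x) = cderiv (X x) g * \<kappa> (t x) + g x * \<kappa> (D V X t x)"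
proof -
  have xU: "x \<in> U" using x V by blast
  have tx: "t x \<in> carrier (fibre L x)" and Dx: "D V X t x \<in> carrier (fibre L x)"
    using section_fibre[OF M L t x] conn_fibre[OF V(1) X t x] .
  note p = frame_points[OF M L fr xU]
  show ?thesis
    unfolding conn_Leibniz[OF V(1) X t g] using x
    by (simp add: sections_def fun_smult_def frame_coeff_add[OF M L fr xU] frame_coeff_smult[OF M L fr xU]
        fibre_smult_closed[OF M L p] tx Dx)
qed

text \<open>The coefficient of the derivative of the frame along \<open>X\<close> has to be shown to
  depend on \<open>X\<close> pointwise, although the connection only accepts whole vector fields.
  Inside a chart \<open>X\<close> is a combination of coordinate fields with smooth coefficients, so
  function-linearity determines everything from the coordinate fields.\<close>

lemma connection_form_exists:
  assumes fr: "local_frame M L U s \<kappa>" and C: "(C, \<phi>) \<in> atlas M" and UC: "U \<subseteq> C"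
  obtains \<alpha> where "connection_form M L D U \<kappa> \<alpha>"
proof -
  obtain E :: "'e set" where E: "frame E" using smooth_atlas_frame[OF M] by blast
  have Uo: "openin (mtop M) U" by (rule frame_open[OF M L fr])
  define cf where "cf V e = (\<lambda>x\<in>V. coord_deriv M C \<phi> e x)" for V e
  have cf: "cf V e \<in> vector_fields M V" if "V \<subseteq> U" for V e
    unfolding cf_def by (rule coord_field[OF M C]) (use that UC in auto)
  have sU: "s \<in> carrier (sections M L U)"
    using frame_section[OF M L fr order_refl Uo] fr by (simp add: local_frame_def extensional_restrict)
  define A where "A e x = \<kappa> (D U (cf U e) s x)" for e x
  have A: "smooth_fun M U (A e)" for e
    unfolding A_def[abs_def]
    by (rule frame_coeff_section[OF M L fr conn_closed[OF Uo cf[OF order_refl] sU] Uo order_refl])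
  \<comment> \<open>The factor \<open>- \<i>\<close> cancels the \<open>\<i>\<close> of the
    curvature convention: \<open>\<i> * \<alpha>\<close> gives the coefficient of the covariant
    derivative of the frame.\<close>
  define \<alpha> where "\<alpha> x v = - \<i> * (\<Sum>e\<in>E. of_real (v (\<lambda>y. \<phi> y \<bullet> e)) * A e x)" for x v
  have X\<phi>: "smooth_fun M V (\<lambda>x. X x (\<lambda>y. \<phi> y \<bullet> e))"
    if V: "openin (mtop M) V" "V \<subseteq> U" and X: "X \<in> vector_fields M V" for V X e
    by (rule vector_field_smooth[OF M X smooth_fun_linear_comp[OF bounded_linear_inner_left smooth_fun_chart[OF M C V(1)]]])
      (use V UC in auto)
  have \<alpha>_form: "complex_one_form M U \<alpha>"
    unfolding complex_one_form_def
  proof (intro conjI ballI allI impI)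
    fix V X assume V: "openin (mtop M) V" "V \<subseteq> U" and X: "X \<in> vector_fields M V"
    show "smooth_fun M V (\<lambda>x. \<alpha> x (X x))"
      unfolding \<alpha>_def
      by (intro smooth_fun_linear_comp[OF bounded_linear_mult_right] smooth_fun_sum[OF M V(1)] smooth_fun_mult
          smooth_fun_of_real X\<phi>[OF V X] smooth_fun_subset[OF M A V])
  qed (simp add: \<alpha>_def sum_distrib_left sum.distrib algebra_simps)
  have frame_case: "\<kappa> (D V X (restrict s V) x) = \<i> * \<alpha> x (X x)"
    if V: "openin (mtop M) V" "V \<subseteq> U" and X: "X \<in> vector_fields M V" and x: "x \<in> V" for V X x
  proof -
    have sV: "restrict s V \<in> carrier (sections M L V)" by (rule frame_section[OF M L fr V(2,1)])
    have Dcf: "\<kappa> (D V (cf V e) (restrict s V) y) = A e y" if y: "y \<in> V" for e y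
    proof -
      have "restrict (cf U e) V = cf V e" using V(2) by (auto simp: cf_def fun_eq_iff)
      then show ?thesis
        using fun_cong[OF conn_restrict[OF Uo cf[OF order_refl] sU V], of e y] y by (simp add: A_def)
    qed
    \<comment> \<open>The connection axioms handle one sum and one multiple at a time, so the
      combination is built up by induction on the set of directions, together with the fact that
      each partial sum is a smooth vector field.\<close>
    have part: "(\<lambda>y\<in>V. \<lambda>f. \<Sum>e\<in>F. X y (\<lambda>z. \<phi> z \<bullet> e) * coord_deriv M C \<phi> e y f) \<in> vector_fields M V \<and>
        (\<forall>y\<in>V. \<kappa> (D V (\<lambda>y\<in>V. \<lambda>f. \<Sum>e\<in>F. X y (\<lambda>z. \<phi> z \<bullet> e) * coord_deriv M C \<phi> e y f) (restrict s V) y) =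
          (\<Sum>e\<in>F. of_real (X y (\<lambda>z. \<phi> z \<bullet> e)) * A e y))" if "finite F" for F
      using that
    proof (induction F)
      case empty
      have z: "smooth_fun M V (\<lambda>y. 0 :: real)" by (rule smooth_fun_const[OF M V(1)])
      \<comment> \<open>The zero field is presented as 0 times \<open>X\<close>, so that linearity
        over functions applies to it.\<close>
      have eq: "(\<lambda>y\<in>V. \<lambda>f. 0) = vf_scale V (\<lambda>y. 0) X" by (simp add: vf_scale_def)
      have "\<kappa> (D V (vf_scale V (\<lambda>y. 0) X) (restrict s V) y) = 0" if y: "y \<in> V" for y
      proof -
        have yU: "y \<in> U" using y V by blast
        show ?thesis unfolding conn_vf_scale[OF V(1) X sV z]
          using y frame_coeff_smult[OF M L fr yU conn_fibre[OF V(1) X sV y], of 0] by (simp add: fun_smult_def)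
      qed
      then show ?case using vf_scale_closed[OF M X z] unfolding sum.empty eq by blast
    next
      case (insert e F)
      let ?X = "\<lambda>y\<in>V. \<lambda>f. \<Sum>e\<in>F. X y (\<lambda>z. \<phi> z \<bullet> e) * coord_deriv M C \<phi> e y f"
      let ?a = "\<lambda>y. X y (\<lambda>z. \<phi> z \<bullet> e)"
      have IH: "?X \<in> vector_fields M V"
        "\<And>y. y \<in> V \<Longrightarrow> \<kappa> (D V ?X (restrict s V) y) = (\<Sum>e\<in>F. of_real (X y (\<lambda>z. \<phi> z \<bullet> e)) * A e y)"
        using insert.IH by blast+
      have eq: "(\<lambda>y\<in>V. \<lambda>f. \<Sum>e\<in>insert e F. X y (\<lambda>z. \<phi> z \<bullet> e) * coord_deriv M C \<phi> e y f) =
          vf_add V (vf_scale V ?a (cf V e)) ?X"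
        using insert.hyps by (auto simp: vf_add_def vf_scale_def cf_def fun_eq_iff)
      have sc: "vf_scale V ?a (cf V e) \<in> vector_fields M V"
        by (rule vf_scale_closed[OF M cf[OF V(2)] X\<phi>[OF V X]])
      have "\<kappa> (D V (vf_add V (vf_scale V ?a (cf V e)) ?X) (restrict s V) y) =
          (\<Sum>e\<in>insert e F. of_real (X y (\<lambda>z. \<phi> z \<bullet> e)) * A e y)" if y: "y \<in> V" for y
      proof -
        have yU: "y \<in> U" using y V by blast
        note fc = conn_fibre[OF V(1) cf[OF V(2)] sV y] conn_fibre[OF V(1) IH(1) sV y]
        have "D V (vf_add V (vf_scale V ?a (cf V e)) ?X) (restrict s V) y =
            of_real (?a y) \<odot>\<^bsub>fibre L y\<^esub> D V (cf V e) (restrict s V) y \<oplus>\<^bsub>fibre L y\<^esub> D V ?X (restrict s V) y"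
          unfolding conn_vf_add[OF V(1) sc sV IH(1)] conn_vf_scale[OF V(1) cf[OF V(2)] sV X\<phi>[OF V X]]
          using y by (simp add: sections_def fun_smult_def)
        then show ?thesis
          using insert.hyps fc IH(2)[OF y] Dcf[OF y]
          by (simp add: frame_coeff_add[OF M L fr yU] frame_coeff_smult[OF M L fr yU]
              fibre_smult_closed[OF M L frame_points[OF M L fr yU]])
      qed
      then show ?case unfolding eq using vf_add_closed[OF M sc IH(1)] by blast
    qed
    have "X = (\<lambda>y\<in>V. \<lambda>f. \<Sum>e\<in>E. X y (\<lambda>z. \<phi> z \<bullet> e) * coord_deriv M C \<phi> e y f)"
    proof
      fix y
      show "X y = (\<lambda>y\<in>V. \<lambda>f. \<Sum>e\<in>E. X y (\<lambda>z. \<phi> z \<bullet> e) * coord_deriv M C \<phi> e y f) y"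
      proof (cases "y \<in> V")
        case True
        then have "y \<in> C" using V UC by blast
        from ext[OF tangent_expand[OF M E C this vector_field_tangent[OF M X True]]]
        show ?thesis unfolding restrict_apply'[OF True] .
      next
        case False
        then show ?thesis using X by (simp add: vector_fields_def extensional_def)
      qed
    qed
    then show ?thesis using part[OF frame_finite[OF E]] x by (simp add: \<alpha>_def)
  qed
  have "connection_form M L D U \<kappa> \<alpha>"
    unfolding connection_form_def
  proof (intro conjI allI impI \<alpha>_form)
    fix V X t x
    assume V: "openin (mtop M) V" "V \<subseteq> U" and X: "X \<in> vector_fields M V" and t: "t \<in> carrier (sections M L V)"
      and x: "x \<in> V"
    have xU: "x \<in> U" using x V by blast
    have sV: "restrict s V \<in> carrier (sections M L V)" by (rule frame_section[OF M L fr V(2,1)])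
    have eq: "fun_smult L V (\<lambda>y. \<kappa> (t y)) (restrict s V) = (\<lambda>y\<in>V. \<kappa> (t y) \<odot>\<^bsub>fibre L y\<^esub> s y)"
      by (auto simp: fun_smult_def fun_eq_iff)
    \<comment> \<open>A general section is a function times the frame; the Leibniz rule splits its
      derivative into that of the coefficient and that of the frame.\<close>
    have "t = fun_smult L V (\<lambda>y. \<kappa> (t y)) (restrict s V)"
      unfolding eq
      by (rule frame_section_expand[OF M L fr section_extensional[OF M L t] section_fibre[OF M L t] V(2)])
    then have "\<kappa> (D V X t x) = \<kappa> (D V X (fun_smult L V (\<lambda>y. \<kappa> (t y)) (restrict s V)) x)" by metis
    also have "\<dots> = cderiv (X x) (\<lambda>y. \<kappa> (t y)) + \<i> * \<alpha> x (X x) * \<kappa> (t x)"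
      using frame_coeff_conn_smult[OF fr V X sV frame_coeff_section[OF M L fr t V] x]
        frame_case[OF V X x] x frame_coeff_frame[OF M L fr xU] by simp
    finally show "\<kappa> (D V X t x) = cderiv (X x) (\<lambda>y. \<kappa> (t y)) + \<i> * \<alpha> x (X x) * \<kappa> (t x)" .
  qed
  then show ?thesis by (rule that)
qed

text \<open>\<open>has_curvature\<close> speaks of a non-vanishing section whose derivative is
  \<open>\<i> * \<alpha>\<close> times itself. The frame is such a section: its own coefficient is
  the constant 1, so the derivative term in the connection form drops out.\<close>

lemma connection_form_curvature:
  assumes \<omega>: "has_curvature M L D \<omega>" and fr: "local_frame M L U s \<kappa>" and \<alpha>: "connection_form M L D U \<kappa> \<alpha>"
    and X: "X \<in> vector_fields M U" and Y: "Y \<in> vector_fields M U" and x: "x \<in> U"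
  shows "ext_deriv1 M U \<alpha> X Y x = of_real (\<omega> x (X x) (Y x))"
proof -
  have Uo: "openin (mtop M) U" by (rule frame_open[OF M L fr])
  have sU: "s \<in> carrier (sections M L U)"
    using frame_section[OF M L fr order_refl Uo] fr by (simp add: local_frame_def extensional_restrict)
  have nz: "\<forall>y\<in>U. s y \<noteq> \<zero>\<^bsub>fibre L y\<^esub>"
    using frame_coeff_frame[OF M L fr] frame_coeff_zero[OF M L fr] by fastforce
  have form: "complex_one_form M U \<alpha>" using \<alpha> by (simp add: connection_form_def)
  have "D V X (restrict s V) = fun_smult L V (\<lambda>x. \<i> * \<alpha> x (X x)) s"
    if V: "openin (mtop M) V" "V \<subseteq> U" and X: "X \<in> vector_fields M V" for V X
  proof
    fix y
    have sV: "restrict s V \<in> carrier (sections M L V)" by (rule frame_section[OF M L fr V(2,1)])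
    show "D V X (restrict s V) y = fun_smult L V (\<lambda>x. \<i> * \<alpha> x (X x)) s y"
    proof (cases "y \<in> V")
      case True
      then have yU: "y \<in> U" using V by blast
      have c: "cderiv (X y) (\<lambda>z. \<kappa> (restrict s V z)) = cderiv (X y) (\<lambda>z. 1)"
        by (rule cderiv_local[OF M vector_field_tangent[OF M X True] V(1) True])
          (use V frame_coeff_frame[OF M L fr] in auto)
      have "\<kappa> (D V X (restrict s V) y) = \<i> * \<alpha> y (X y)"
        using \<alpha> V X sV True c cderiv_const[OF M vector_field_tangent[OF M X True] frame_points[OF M L fr yU]]
          frame_coeff_frame[OF M L fr yU] by (simp add: connection_form_def)
      then show ?thesis
        using frame_expand_point[OF M L fr yU conn_fibre[OF V(1) X sV True]] True by (simp add: fun_smult_def)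
    next
      case False
      then show ?thesis
        using section_extensional[OF M L conn_closed[OF V(1) X sV]] by (simp add: fun_smult_def extensional_def)
    qed
  qed
  then show ?thesis
    by (intro \<omega>[unfolded has_curvature_def, rule_format, OF Uo sU _ form _ Uo order_refl X Y x]) (use nz in auto)
qed

end

section \<open>Flat lifts\<close>

text \<open>Fibres are one-dimensional, so homogeneity makes \<open>F\<close> linear on them.\<close>

definition flat_lift ::
    "('a, 'e::{real_inner,banach}) mfd \<Rightarrow> ('l, 'f::{real_inner,banach}, 'a) lbundle \<Rightarrow> ('a, 'l) conn
      \<Rightarrow> ('a \<Rightarrow> 'a) \<Rightarrow> 'a set \<Rightarrow> ('l \<Rightarrow> 'l) \<Rightarrow> bool" where
  "flat_lift M L D \<Phi> U F \<longleftrightarrow>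
     (\<forall>y\<in>U. \<forall>l\<in>carrier (fibre L y). F l \<in> carrier (fibre L (\<Phi> y)) \<and>
        (\<forall>z. F (z \<odot>\<^bsub>fibre L y\<^esub> l) = z \<odot>\<^bsub>fibre L (\<Phi> y)\<^esub> F l) \<and>
        (F l = \<zero>\<^bsub>fibre L (\<Phi> y)\<^esub> \<longrightarrow> l = \<zero>\<^bsub>fibre L y\<^esub>)) \<and>
     (\<forall>V t. openin (mtop M) V \<longrightarrow> V \<subseteq> U \<longrightarrow> t \<in> carrier (sections M L V) \<longrightarrow>
        sect_push M \<Phi> F (\<Phi> ` V) t \<in> carrier (sections M L (\<Phi> ` V)) \<and>
        (\<forall>X\<in>vector_fields M V. D (\<Phi> ` V) (vf_push M \<Phi> V X) (sect_push M \<Phi> F (\<Phi> ` V) t) =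
           sect_push M \<Phi> F (\<Phi> ` V) (D V X t)))"

context
  fixes M :: "('a, 'e::{real_inner,banach}) mfd" and L :: "('l, 'f::{real_inner,banach}, 'a) lbundle"
    and D :: "('a, 'l) conn" and \<Phi> :: "'a \<Rightarrow> 'a"
  assumes M: "smooth_atlas M" and L: "complex_line_bundle M L" and D: "connection M L D"
    and \<Phi>: "diffeo M M \<Phi>"
begin

section \<open>Elementary properties of flat lifts\<close>

lemma openin_points: "openin (mtop M) U \<Longrightarrow> x \<in> U \<Longrightarrow> x \<in> points M"
  using openin_subset by blast

lemma sect_push_apply: "x \<in> V \<Longrightarrow> V \<subseteq> points M \<Longrightarrow> sect_push M \<Phi> F (\<Phi> ` V) t (\<Phi> x) = (F (t x) :: 'l)"
  using diffeo_inv_left[OF M \<Phi>] by (auto simp: sect_push_def)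

lemma sect_push_ext: "sect_push M \<Phi> F V t \<in> extensional V"
  by (simp add: sect_push_def)

lemma sect_push_restrict:
  fixes F :: "'l \<Rightarrow> 'l"
  assumes "W \<subseteq> V" "V \<subseteq> points M"
  shows "restrict (sect_push M \<Phi> F (\<Phi> ` V) t) (\<Phi> ` W) = sect_push M \<Phi> F (\<Phi> ` W) (restrict t W)"
proof
  fix y
  show "restrict (sect_push M \<Phi> F (\<Phi> ` V) t) (\<Phi> ` W) y = sect_push M \<Phi> F (\<Phi> ` W) (restrict t W) y"
  proof (cases "y \<in> \<Phi> ` W")
    case True
    then obtain x where x: "x \<in> W" "y = \<Phi> x" by blast
    then show ?thesis using sect_push_apply[of x V F t] sect_push_apply[of x W F "restrict t W"] assms True by auto
  qed (simp add: sect_push_def)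
qed

lemma flat_lift_fibre:
  assumes "flat_lift M L D \<Phi> U F" "y \<in> U" "l \<in> carrier (fibre L y)"
  shows "F l \<in> carrier (fibre L (\<Phi> y))" "F (z \<odot>\<^bsub>fibre L y\<^esub> l) = z \<odot>\<^bsub>fibre L (\<Phi> y)\<^esub> F l"
    "F l = \<zero>\<^bsub>fibre L (\<Phi> y)\<^esub> \<Longrightarrow> l = \<zero>\<^bsub>fibre L y\<^esub>"
  using assms unfolding flat_lift_def by blast+

lemma flat_lift_section:
  assumes "flat_lift M L D \<Phi> U F" "openin (mtop M) V" "V \<subseteq> U" "t \<in> carrier (sections M L V)"
  shows "sect_push M \<Phi> F (\<Phi> ` V) t \<in> carrier (sections M L (\<Phi> ` V))"
    "X \<in> vector_fields M V \<Longrightarrow> D (\<Phi> ` V) (vf_push M \<Phi> V X) (sect_push M \<Phi> F (\<Phi> ` V) t) =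
      sect_push M \<Phi> F (\<Phi> ` V) (D V X t)"
  using assms unfolding flat_lift_def by blast+

lemma flat_lift_subset: "flat_lift M L D \<Phi> U F \<Longrightarrow> W \<subseteq> U \<Longrightarrow> flat_lift M L D \<Phi> W F"
  unfolding flat_lift_def by (simp add: subset_iff)

lemma sect_push_cong:
  assumes "openin (mtop M) V" "\<And>y l. y \<in> V \<Longrightarrow> l \<in> carrier (fibre L y) \<Longrightarrow> F l = G l"
    "t \<in> carrier (sections M L V)"
  shows "sect_push M \<Phi> F (\<Phi> ` V) t = sect_push M \<Phi> G (\<Phi> ` V) t"
  using assms(2) section_fibre[OF M L assms(3)] diffeo_inv_left[OF M \<Phi>] openin_points[OF assms(1)]
  by (auto simp: sect_push_def fun_eq_iff)

lemma flat_lift_cong: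
  assumes F: "flat_lift M L D \<Phi> U F" and eq: "\<And>y l. y \<in> U \<Longrightarrow> l \<in> carrier (fibre L y) \<Longrightarrow> F l = G l"
    and U: "openin (mtop M) U"
  shows "flat_lift M L D \<Phi> U G"
  unfolding flat_lift_def
proof (intro conjI ballI allI impI)
  fix y l z assume yl: "y \<in> U" "l \<in> carrier (fibre L y)"
  note p = openin_points[OF U yl(1)]
  show "G l \<in> carrier (fibre L (\<Phi> y))" "G (z \<odot>\<^bsub>fibre L y\<^esub> l) = z \<odot>\<^bsub>fibre L (\<Phi> y)\<^esub> G l"
    using flat_lift_fibre[OF F yl] eq[OF yl] eq[OF yl(1) fibre_smult_closed[OF M L p yl(2)]] by simp_all
  show "l = \<zero>\<^bsub>fibre L y\<^esub>" if "G l = \<zero>\<^bsub>fibre L (\<Phi> y)\<^esub>" using flat_lift_fibre(3)[OF F yl] eq[OF yl] that by simp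
next
  fix V t assume V: "openin (mtop M) V" "V \<subseteq> U" and t: "t \<in> carrier (sections M L V)"
  have eq': "sect_push M \<Phi> F (\<Phi> ` V) t = sect_push M \<Phi> G (\<Phi> ` V) t" if "t \<in> carrier (sections M L V)" for t
    by (rule sect_push_cong[OF V(1) eq that]) (use V in auto)
  show "sect_push M \<Phi> G (\<Phi> ` V) t \<in> carrier (sections M L (\<Phi> ` V))"
    using flat_lift_section(1)[OF F V t] eq'[OF t] by simp
  fix X assume X: "X \<in> vector_fields M V"
  show "D (\<Phi> ` V) (vf_push M \<Phi> V X) (sect_push M \<Phi> G (\<Phi> ` V) t) = sect_push M \<Phi> G (\<Phi> ` V) (D V X t)"
    using flat_lift_section(2)[OF F V t X] eq'[OF t] eq'[OF conn_closed[OF M L D V(1) X t]] by simp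
qed

text \<open>Needed for gluing, where the lift is compared with a different local formula around each
  point. The identity of covariant derivatives is checked pointwise, after both sides have been
  restricted to a neighbourhood on which the lift is known to be flat.\<close>

lemma flat_lift_local:
  assumes loc: "\<And>x. x \<in> U \<Longrightarrow> \<exists>W. openin (mtop M) W \<and> x \<in> W \<and> flat_lift M L D \<Phi> W F"
  shows "flat_lift M L D \<Phi> U F"
  unfolding flat_lift_def
proof (intro conjI ballI allI impI)
  fix y l z assume yl: "y \<in> U" "l \<in> carrier (fibre L y)"
  then obtain W where W: "y \<in> W" "flat_lift M L D \<Phi> W F" using loc by blast
  show "F l \<in> carrier (fibre L (\<Phi> y))" "F (z \<odot>\<^bsub>fibre L y\<^esub> l) = z \<odot>\<^bsub>fibre L (\<Phi> y)\<^esub> F l"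
    "F l = \<zero>\<^bsub>fibre L (\<Phi> y)\<^esub> \<Longrightarrow> l = \<zero>\<^bsub>fibre L y\<^esub>"
    using flat_lift_fibre[OF W(2,1) yl(2)] by auto
next
  fix V t assume V: "openin (mtop M) V" "V \<subseteq> U" and t: "t \<in> carrier (sections M L V)"
  have Vp: "V \<subseteq> points M" using V(1) openin_subset by blast
  note \<Phi>V = openin_image[OF M \<Phi> V(1)]
  have nbhd: "\<exists>W. openin (mtop M) W \<and> x \<in> W \<and> W \<subseteq> V \<and> flat_lift M L D \<Phi> W F" if x: "x \<in> V" for x
  proof -
    obtain W where "openin (mtop M) W" "x \<in> W" "flat_lift M L D \<Phi> W F" using loc x V(2) by blast
    then show ?thesis using x V(1) by (intro exI[of _ "W \<inter> V"]) (auto intro: flat_lift_subset)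
  qed
  show sec: "sect_push M \<Phi> F (\<Phi> ` V) t \<in> carrier (sections M L (\<Phi> ` V))"
  proof (rule section_local[OF M L \<Phi>V sect_push_ext])
    fix y assume "y \<in> \<Phi> ` V"
    then obtain x where x: "x \<in> V" "y = \<Phi> x" by blast
    then obtain W where W: "openin (mtop M) W" "x \<in> W" "W \<subseteq> V" "flat_lift M L D \<Phi> W F" using nbhd by blast
    have "restrict (sect_push M \<Phi> F (\<Phi> ` V) t) (\<Phi> ` W) \<in> carrier (sections M L (\<Phi> ` W))"
      unfolding sect_push_restrict[OF W(3) Vp]
      by (rule flat_lift_section(1)[OF W(4,1) order_refl section_restrict[OF M L t V(1) W(1,3)]])
    then show "\<exists>W. openin (mtop M) W \<and> y \<in> W \<and> W \<subseteq> \<Phi> ` V \<and>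
        restrict (sect_push M \<Phi> F (\<Phi> ` V) t) W \<in> carrier (sections M L W)"
      using openin_image[OF M \<Phi> W(1)] x W by blast
  qed
  fix X assume X: "X \<in> vector_fields M V"
  note \<Phi>X = vf_push_closed[OF M \<Phi> X V(1)]
  show "D (\<Phi> ` V) (vf_push M \<Phi> V X) (sect_push M \<Phi> F (\<Phi> ` V) t) = sect_push M \<Phi> F (\<Phi> ` V) (D V X t)"
  proof
    fix y
    show "D (\<Phi> ` V) (vf_push M \<Phi> V X) (sect_push M \<Phi> F (\<Phi> ` V) t) y = sect_push M \<Phi> F (\<Phi> ` V) (D V X t) y"
    proof (cases "y \<in> \<Phi> ` V")
      case True
      then obtain x where x: "x \<in> V" "y = \<Phi> x" by blast
      then obtain W where W: "openin (mtop M) W" "x \<in> W" "W \<subseteq> V" "flat_lift M L D \<Phi> W F" using nbhd by blast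
      have y: "y \<in> \<Phi> ` W" using x W by blast
      have \<Phi>W: "openin (mtop M) (\<Phi> ` W)" "\<Phi> ` W \<subseteq> \<Phi> ` V" using openin_image[OF M \<Phi> W(1)] W(3) by auto
      have "restrict (D (\<Phi> ` V) (vf_push M \<Phi> V X) (sect_push M \<Phi> F (\<Phi> ` V) t)) (\<Phi> ` W) =
          D (\<Phi> ` W) (vf_push M \<Phi> W (restrict X W)) (sect_push M \<Phi> F (\<Phi> ` W) (restrict t W))"
        unfolding conn_restrict[OF M L D \<Phi>V \<Phi>X sec \<Phi>W] sect_push_restrict[OF W(3) Vp]
          vf_push_restrict[OF M \<Phi> W(3) Vp] ..
      also have "\<dots> = sect_push M \<Phi> F (\<Phi> ` W) (D W (restrict X W) (restrict t W))"
        by (rule flat_lift_section(2)[OF W(4,1) order_refl section_restrict[OF M L t V(1) W(1,3)]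
            vector_field_restrict[OF M X W(3)]])
      also have "\<dots> = restrict (sect_push M \<Phi> F (\<Phi> ` V) (D V X t)) (\<Phi> ` W)"
        unfolding sect_push_restrict[OF W(3) Vp] conn_restrict[OF M L D V(1) X t W(1,3)] ..
      finally show ?thesis using y by (metis restrict_apply')
    next
      case False
      then show ?thesis
        using section_extensional[OF M L conn_closed[OF M L D \<Phi>V \<Phi>X sec]]
        by (simp add: sect_push_def extensional_def)
    qed
  qed
qed

section \<open>Existence of flat lifts near each point\<close>

lemma flat_lift_exists:
  assumes \<omega>: "has_curvature M L D \<omega>"
    and symp: "\<And>x v w. x \<in> points M \<Longrightarrow> v \<in> tangent_space M x \<Longrightarrow> w \<in> tangent_space M x \<Longrightarrow>
      \<omega> (\<Phi> x) (tangent_map M M \<Phi> x v) (tangent_map M M \<Phi> x w) = \<omega> x v w"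
    and x: "x \<in> points M"
  obtains U F where "openin (mtop M) U" "x \<in> U" "flat_lift M L D \<Phi> U F"
proof -
  have \<Phi>x: "\<Phi> x \<in> points M" by (rule diffeo_in_points[OF M \<Phi> x])
  obtain C \<phi> where C: "(C, \<phi>) \<in> atlas M" "x \<in> C" using atlas_cover[OF M x] .
  obtain C' \<phi>' where C': "(C', \<phi>') \<in> atlas M" "\<Phi> x \<in> C'" using atlas_cover[OF M \<Phi>x] .
  obtain U0 s0 \<kappa> where U0: "x \<in> U0" "local_frame M L U0 s0 \<kappa>" using local_frame_exists[OF M L x] .
  obtain U0' s0' \<kappa>' where U0': "\<Phi> x \<in> U0'" "local_frame M L U0' s0' \<kappa>'" using local_frame_exists[OF M L \<Phi>x] .
  \<comment> \<open>Small enough for a frame and a chart at \<open>x\<close> and, on the image side,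
    for a frame and a chart at \<Phi> x.\<close>
  define O1 where "O1 = U0 \<inter> C \<inter> preim M \<Phi> (U0' \<inter> C')"
  have O1: "openin (mtop M) O1" "O1 \<subseteq> C"
    using frame_open[OF M L U0(2)] chart_open[OF M C(1)] openin_preim[OF M \<Phi>, of "U0' \<inter> C'"]
      frame_open[OF M L U0'(2)] chart_open[OF M C'(1)] by (auto simp: O1_def)
  have xO: "x \<in> O1" using x U0 C U0' C' by (simp add: O1_def preim_def)
  obtain r where r: "0 < r" "ball (\<phi> x) r \<subseteq> \<phi> ` O1"
    using chart_image_of_open[OF M C(1) O1] xO open_contains_ball by (metis imageI)
  \<comment> \<open>The preimage of a ball in the chart, since a potential of a closed form is
    available on such sets.\<close>
  define U where "U = {y \<in> C. \<phi> y \<in> ball (\<phi> x) r}"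
  have rC: "ball (\<phi> x) r \<subseteq> \<phi> ` C" using r(2) O1(2) by blast
  have U: "openin (mtop M) U" unfolding U_def by (rule chart_preimage_open[OF M C(1) open_ball])
  have xU: "x \<in> U" using C r by (simp add: U_def)
  have UC: "U \<subseteq> C" by (auto simp: U_def)
  have UO: "U \<subseteq> O1"
  proof
    fix y assume "y \<in> U"
    then have "y \<in> C" "\<phi> y \<in> \<phi> ` O1" using r(2) unfolding U_def by blast+
    then show "y \<in> O1" using inj_on_image_mem_iff[OF chart_inj[OF M C(1)], of y O1] O1(2) by blast
  qed
  have Up: "U \<subseteq> points M" using U openin_subset by blast
  have sub: "U \<subseteq> U0" "\<Phi> ` U \<subseteq> U0'" "\<Phi> ` U \<subseteq> C'" using UO by (auto simp: O1_def preim_def)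
  note \<Phi>U = openin_image[OF M \<Phi> U]
  define s where "s = restrict s0 U"
  define s' where "s' = restrict s0' (\<Phi> ` U)"
  have fr: "local_frame M L U s \<kappa>" unfolding s_def by (rule frame_restrict[OF M L U0(2) U sub(1)])
  have fr': "local_frame M L (\<Phi> ` U) s' \<kappa>'" unfolding s'_def by (rule frame_restrict[OF M L U0'(2) \<Phi>U sub(2)])
  obtain \<alpha> where \<alpha>: "connection_form M L D U \<kappa> \<alpha>" using connection_form_exists[OF M L D fr C(1) UC] .
  obtain \<alpha>' where \<alpha>': "connection_form M L D (\<Phi> ` U) \<kappa>' \<alpha>'"
    using connection_form_exists[OF M L D fr' C'(1) sub(3)] .
  have f1: "complex_one_form M U \<alpha>" and f2: "complex_one_form M (\<Phi> ` U) \<alpha>'"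
    using \<alpha> \<alpha>' by (auto simp: connection_form_def)
  let ?p = "\<lambda>y v. \<alpha>' (\<Phi> y) (tangent_map M M \<Phi> y v)"
  let ?\<beta> = "\<lambda>y v. \<i> * (\<alpha> y v - ?p y v)"
  have f3: "complex_one_form M U ?p" by (rule complex_one_form_pullback[OF M \<Phi> U f2])
  have "ext_deriv1 M U ?\<beta> X Y y = 0"
    if X: "X \<in> vector_fields M U" and Y: "Y \<in> vector_fields M U" and y: "y \<in> U" for X Y y
  proof -
    have yp: "y \<in> points M" using y Up by blast
    have "ext_deriv1 M U ?p X Y y =
        of_real (\<omega> (\<Phi> y) (vf_push M \<Phi> U X (\<Phi> y)) (vf_push M \<Phi> U Y (\<Phi> y)))"
      unfolding ext_deriv1_pullback[OF M \<Phi> U f2 X Y y]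
      by (rule connection_form_curvature[OF M L D \<omega> fr' \<alpha>' vf_push_closed[OF M \<Phi> X U] vf_push_closed[OF M \<Phi> Y U]])
        (use y in auto)
    also have "\<dots> = of_real (\<omega> y (X y) (Y y))"
      unfolding vf_push_apply[OF M \<Phi> y Up]
      by (simp add: symp[OF yp vector_field_tangent[OF M X y] vector_field_tangent[OF M Y y]])
    finally show ?thesis
      using connection_form_curvature[OF M L D \<omega> fr \<alpha> X Y y]
      by (simp add: ext_deriv1_scaled_diff[OF M U f1 f3 X Y y])
  qed
  then obtain g where g: "smooth_fun M U g"
      "\<And>y v. y \<in> U \<Longrightarrow> v \<in> tangent_space M y \<Longrightarrow> cderiv v g = ?\<beta> y v"
    using closed_form_potential[OF M C(1) rC U_def complex_one_form_scaled_diff[OF f1 f3]] by blast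
  define c where "c y = exp (g y)" for y
  have c: "smooth_fun M U c" unfolding c_def
    by (rule smooth_fun_compose[OF M complex_frame smooth_on_exp g(1)]) auto
  \<comment> \<open>In coefficients this is multiplication by \<open>c\<close>, that is
    \<open>\<kappa>' (F l) = c y * \<kappa> l\<close>. The base point is read off by
    \<open>proj L\<close>, which makes \<open>F\<close> a function on the total space.\<close>
  define F where "F l = (c (proj L l) * \<kappa> l) \<odot>\<^bsub>fibre L (\<Phi> (proj L l))\<^esub> s' (\<Phi> (proj L l))" for l
  have F: "F l = (c y * \<kappa> l) \<odot>\<^bsub>fibre L (\<Phi> y)\<^esub> s' (\<Phi> y)" if "y \<in> U" "l \<in> carrier (fibre L y)" for y l
    using that fibre_carrier[OF M L, of y l] Up by (auto simp: F_def)
  have Fc: "F l \<in> carrier (fibre L (\<Phi> y))" and \<kappa>F: "\<kappa>' (F l) = c y * \<kappa> l"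
    if y: "y \<in> U" and l: "l \<in> carrier (fibre L y)" for y l
  proof -
    have y': "\<Phi> y \<in> \<Phi> ` U" using y by blast
    show "F l \<in> carrier (fibre L (\<Phi> y))" "\<kappa>' (F l) = c y * \<kappa> l"
      unfolding F[OF y l]
      using fibre_smult_closed[OF M L frame_points[OF M L fr' y'] frame_fibre[OF M L fr' y']]
        frame_coeff_smult_frame[OF M L fr' y'] by auto
  qed
  have "flat_lift M L D \<Phi> U F"
    unfolding flat_lift_def
  proof (intro conjI ballI allI impI)
    fix y l z assume y: "y \<in> U" and l: "l \<in> carrier (fibre L y)"
    have y': "\<Phi> y \<in> \<Phi> ` U" using y by blast
    have zl: "z \<odot>\<^bsub>fibre L y\<^esub> l \<in> carrier (fibre L y)"
      by (rule fibre_smult_closed[OF M L frame_points[OF M L fr y] l])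
    have zF: "z \<odot>\<^bsub>fibre L (\<Phi> y)\<^esub> F l \<in> carrier (fibre L (\<Phi> y))"
      by (rule fibre_smult_closed[OF M L frame_points[OF M L fr' y'] Fc[OF y l]])
    show "F l \<in> carrier (fibre L (\<Phi> y))" by (rule Fc[OF y l])
    show "F (z \<odot>\<^bsub>fibre L y\<^esub> l) = z \<odot>\<^bsub>fibre L (\<Phi> y)\<^esub> F l"
      by (rule frame_coeff_inj[OF M L fr' y' Fc[OF y zl] zF])
        (simp add: \<kappa>F[OF y zl] frame_coeff_smult[OF M L fr' y' Fc[OF y l]] \<kappa>F[OF y l]
          frame_coeff_smult[OF M L fr y l])
    assume "F l = \<zero>\<^bsub>fibre L (\<Phi> y)\<^esub>"
    then have "c y * \<kappa> l = 0" using \<kappa>F[OF y l] frame_coeff_zero[OF M L fr' y'] by simp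
    then show "l = \<zero>\<^bsub>fibre L y\<^esub>" using frame_coeff_eq_0[OF M L fr y l] by (simp add: c_def)
  next
    fix V t assume V: "openin (mtop M) V" "V \<subseteq> U" and t: "t \<in> carrier (sections M L V)"
    have Vp: "V \<subseteq> points M" using V Up by blast
    note \<Phi>V = openin_image[OF M \<Phi> V(1)]
    have \<Phi>VU: "\<Phi> ` V \<subseteq> \<Phi> ` U" using V by blast
    have tf: "t y \<in> carrier (fibre L y)" if "y \<in> V" for y using section_fibre[OF M L t that] .
    have cV: "smooth_fun M V c" by (rule smooth_fun_subset[OF M c V])
    have \<kappa>t: "smooth_fun M V (\<lambda>y. \<kappa> (t y))" by (rule frame_coeff_section[OF M L fr t V])
    have sm: "smooth_fun M (\<Phi> ` V) (\<lambda>y. \<kappa>' (sect_push M \<Phi> F (\<Phi> ` V) t y))"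
    proof (rule smooth_fun_cong[OF smooth_fun_push[OF M \<Phi> smooth_fun_mult[OF cV \<kappa>t]] _ M])
      fix y' assume "y' \<in> \<Phi> ` V"
      then obtain y where y: "y \<in> V" "y' = \<Phi> y" by blast
      have yU: "y \<in> U" and yp: "y \<in> points M" using y V Vp by auto
      show "c (inv_into (points M) \<Phi> y') * \<kappa> (t (inv_into (points M) \<Phi> y')) =
          \<kappa>' (sect_push M \<Phi> F (\<Phi> ` V) t y')"
        unfolding y(2) sect_push_apply[OF y(1) Vp] \<kappa>F[OF yU tf[OF y(1)]] diffeo_inv_left[OF M \<Phi> yp] ..
    qed
    show sec: "sect_push M \<Phi> F (\<Phi> ` V) t \<in> carrier (sections M L (\<Phi> ` V))"
    proof (rule section_from_coeff[OF M L fr' sect_push_ext _ \<Phi>VU sm])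
      fix y' assume "y' \<in> \<Phi> ` V"
      then obtain y where y: "y \<in> V" "y' = \<Phi> y" by blast
      then show "sect_push M \<Phi> F (\<Phi> ` V) t y' \<in> carrier (fibre L y')"
        using sect_push_apply[OF y(1) Vp] Fc[OF _ tf[OF y(1)]] V by auto
    qed
    fix X assume X: "X \<in> vector_fields M V"
    note \<Phi>X = vf_push_closed[OF M \<Phi> X V(1)]
    show "D (\<Phi> ` V) (vf_push M \<Phi> V X) (sect_push M \<Phi> F (\<Phi> ` V) t) = sect_push M \<Phi> F (\<Phi> ` V) (D V X t)"
    proof
      fix y'
      show "D (\<Phi> ` V) (vf_push M \<Phi> V X) (sect_push M \<Phi> F (\<Phi> ` V) t) y' = sect_push M \<Phi> F (\<Phi> ` V) (D V X t) y'"
      proof (cases "y' \<in> \<Phi> ` V")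
        case False
        then show ?thesis
          using section_extensional[OF M L conn_closed[OF M L D \<Phi>V \<Phi>X sec]]
          by (simp add: sect_push_def extensional_def)
      next
        case True
        then obtain y where y: "y \<in> V" "y' = \<Phi> y" by blast
        have yU: "y \<in> U" and y'U: "y' \<in> \<Phi> ` U" using y V by auto
        have Xy: "X y \<in> tangent_space M y" by (rule vector_field_tangent[OF M X y(1)])
        have DXt: "D V X t y \<in> carrier (fibre L y)" by (rule conn_fibre[OF M L D V(1) X t y(1)])
        have "\<kappa>' (D (\<Phi> ` V) (vf_push M \<Phi> V X) (sect_push M \<Phi> F (\<Phi> ` V) t) y') =
            cderiv (vf_push M \<Phi> V X y') (\<lambda>z. \<kappa>' (sect_push M \<Phi> F (\<Phi> ` V) t z)) +
            \<i> * \<alpha>' y' (vf_push M \<Phi> V X y') * \<kappa>' (sect_push M \<Phi> F (\<Phi> ` V) t y')"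
          using \<alpha>' \<Phi>V \<Phi>VU \<Phi>X sec True unfolding connection_form_def by blast
        also have "cderiv (vf_push M \<Phi> V X y') (\<lambda>z. \<kappa>' (sect_push M \<Phi> F (\<Phi> ` V) t z)) =
            cderiv (X y) (\<lambda>z. \<kappa>' (sect_push M \<Phi> F (\<Phi> ` V) t (\<Phi> z)))"
          unfolding y(2) vf_push_apply[OF M \<Phi> y(1) Vp] by (rule cderiv_tangent_map[OF sm]) (use y in auto)
        also have "\<dots> = cderiv (X y) (\<lambda>z. c z * \<kappa> (t z))"
          by (rule cderiv_local[OF M Xy V(1) y(1)]) (use V \<kappa>F tf in \<open>auto simp: sect_push_apply[OF _ Vp]\<close>)
        also have "\<dots> = cderiv (X y) c * \<kappa> (t y) + c y * cderiv (X y) (\<lambda>z. \<kappa> (t z))"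
          by (rule cderiv_mult[OF M Xy cV \<kappa>t y(1)])
        \<comment> \<open>Here the choice of the potential enters: the derivative of exp(g)
          contributes the difference of the two connection forms and so exchanges the form of the
          target frame for that of the source frame.\<close>
        also have "cderiv (X y) c = c y * (\<i> * (\<alpha> y (X y) - \<alpha>' y' (vf_push M \<Phi> V X y')))"
          using cderiv_exp[OF M yU Xy g(1)] g(2)[OF yU Xy] vf_push_apply[OF M \<Phi> y(1) Vp, of X] y(2)
          by (simp add: c_def[abs_def])
        also have "\<kappa>' (sect_push M \<Phi> F (\<Phi> ` V) t y') = c y * \<kappa> (t y)"
          using sect_push_apply[OF y(1) Vp] \<kappa>F[OF yU tf[OF y(1)]] y(2) by simp
        finally have "\<kappa>' (D (\<Phi> ` V) (vf_push M \<Phi> V X) (sect_push M \<Phi> F (\<Phi> ` V) t) y') =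
            c y * (cderiv (X y) (\<lambda>z. \<kappa> (t z)) + \<i> * \<alpha> y (X y) * \<kappa> (t y))"
          by (simp add: algebra_simps)
        also have "\<dots> = c y * \<kappa> (D V X t y)"
          by (simp only: \<alpha>[unfolded connection_form_def, THEN conjunct2, rule_format, OF V X t y(1)])
        also have "\<dots> = \<kappa>' (F (D V X t y))" by (rule \<kappa>F[OF yU DXt, symmetric])
        finally have "D (\<Phi> ` V) (vf_push M \<Phi> V X) (sect_push M \<Phi> F (\<Phi> ` V) t) y' = F (D V X t y)"
          by (intro frame_coeff_inj[OF M L fr' y'U conn_fibre[OF M L D \<Phi>V \<Phi>X sec True]])
            (use Fc[OF yU DXt] y(2) in auto)
        then show ?thesis using sect_push_apply[OF y(1) Vp] y(2) by simp
      qed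
    qed
  qed
  then show ?thesis using that U xU by blast
qed

section \<open>Uniqueness of flat lifts up to locally constant factors\<close>

lemma locally_constant_smooth:
  assumes U: "openin (mtop M) U" and u: "u \<in> carrier (locally_constant_units (mtop M) U)"
  shows "smooth_fun M U u"
    and "x \<in> U \<Longrightarrow> v \<in> tangent_space M x \<Longrightarrow> cderiv v u = 0"
proof -
  have loc: "\<exists>V. openin (mtop M) V \<and> x \<in> V \<and> V \<subseteq> U \<and> (\<forall>y\<in>V. u y = u x)" if "x \<in> U" for x
    using u that by (auto simp: locally_constant_units_def)
  show "smooth_fun M U u"
  proof (rule smooth_fun_local)
    fix x assume "x \<in> U"
    then obtain V where V: "openin (mtop M) V" "x \<in> V" "V \<subseteq> U" "\<forall>y\<in>V. u y = u x" using loc by blast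
    have "smooth_fun M V u" by (rule smooth_fun_cong[OF smooth_fun_const[OF M V(1), of "u x"] _ M])
      (rule V(4)[rule_format, symmetric])
    then show "\<exists>V. x \<in> V \<and> V \<subseteq> U \<and> smooth_fun M V u" using V by blast
  qed
  assume x: "x \<in> U" and v: "v \<in> tangent_space M x"
  then obtain V where V: "openin (mtop M) V" "x \<in> V" "V \<subseteq> U" "\<forall>y\<in>V. u y = u x" using loc by blast
  have "cderiv v u = cderiv v (\<lambda>y. u x)" by (rule cderiv_local[OF M v V(1,2)]) (rule V(4)[rule_format])
  then show "cderiv v u = 0" using cderiv_const[OF M v openin_points[OF U x]] by simp
qed

text \<open>The only new term in the covariant derivative of a pushed section comes from the Leibniz
  rule and carries the derivative of \<open>b\<close>, which is zero. Since \<open>b\<close> has no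
  zeros, the scaled lift still kills no non-zero vector.\<close>

lemma flat_lift_scale:
  assumes U: "openin (mtop M) U" and F: "flat_lift M L D \<Phi> U F"
    and b: "b \<in> carrier (locally_constant_units (mtop M) U)"
  shows "flat_lift M L D \<Phi> U (\<lambda>l. b (proj L l) \<odot>\<^bsub>fibre L (\<Phi> (proj L l))\<^esub> F l)"
proof -
  let ?G = "\<lambda>l. b (proj L l) \<odot>\<^bsub>fibre L (\<Phi> (proj L l))\<^esub> F l"
  let ?b = "\<lambda>y. b (inv_into (points M) \<Phi> y)"
  have Up: "U \<subseteq> points M" using U openin_subset by blast
  have nz: "b y \<noteq> 0" if "y \<in> U" for y using b that by (simp add: locally_constant_units_def)
  have G: "?G l = b y \<odot>\<^bsub>fibre L (\<Phi> y)\<^esub> F l" if "y \<in> U" "l \<in> carrier (fibre L y)" for y l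
    using that fibre_carrier[OF M L, of y l] Up by auto
  show ?thesis
    unfolding flat_lift_def
  proof (intro conjI ballI allI impI)
    fix y l z assume y: "y \<in> U" and l: "l \<in> carrier (fibre L y)"
    have yp: "y \<in> points M" using y Up by blast
    note p = diffeo_in_points[OF M \<Phi> yp] and f = flat_lift_fibre[OF F y l]
    show "?G l \<in> carrier (fibre L (\<Phi> y))" unfolding G[OF y l] by (rule fibre_smult_closed[OF M L p f(1)])
    show "?G (z \<odot>\<^bsub>fibre L y\<^esub> l) = z \<odot>\<^bsub>fibre L (\<Phi> y)\<^esub> ?G l"
      unfolding G[OF y l] G[OF y fibre_smult_closed[OF M L yp l]]
      unfolding f(2) fibre_smult_mult[OF M L p f(1), symmetric]
      by (simp add: mult.commute)
    assume "?G l = \<zero>\<^bsub>fibre L (\<Phi> y)\<^esub>"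
    then have z: "b y \<odot>\<^bsub>fibre L (\<Phi> y)\<^esub> F l = \<zero>\<^bsub>fibre L (\<Phi> y)\<^esub>" using G[OF y l] by simp
    have "F l = (inverse (b y) * b y) \<odot>\<^bsub>fibre L (\<Phi> y)\<^esub> F l"
      using nz[OF y] by (simp add: fibre_smult_one[OF M L p f(1)])
    also have "\<dots> = (inverse (b y) * 0) \<odot>\<^bsub>fibre L (\<Phi> y)\<^esub> F l"
      unfolding fibre_smult_mult[OF M L p f(1)] z fibre_smult_zero[OF M L p f(1)] ..
    also have "\<dots> = \<zero>\<^bsub>fibre L (\<Phi> y)\<^esub>" using fibre_smult_zero[OF M L p f(1)] by simp
    finally show "l = \<zero>\<^bsub>fibre L y\<^esub>" by (rule f(3))
  next
    fix V t assume V: "openin (mtop M) V" "V \<subseteq> U" and t: "t \<in> carrier (sections M L V)"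
    have Vp: "V \<subseteq> points M" using V Up by blast
    note \<Phi>V = openin_image[OF M \<Phi> V(1)]
    have bV: "smooth_fun M (\<Phi> ` V) ?b"
      by (rule smooth_fun_push[OF M \<Phi> smooth_fun_subset[OF M locally_constant_smooth(1)[OF U b] V]])
    have eq: "sect_push M \<Phi> ?G (\<Phi> ` V) t = fun_smult L (\<Phi> ` V) ?b (sect_push M \<Phi> F (\<Phi> ` V) t)"
      if t: "t \<in> carrier (sections M L V)" for t
    proof
      fix y'
      show "sect_push M \<Phi> ?G (\<Phi> ` V) t y' = fun_smult L (\<Phi> ` V) ?b (sect_push M \<Phi> F (\<Phi> ` V) t) y'"
      proof (cases "y' \<in> \<Phi> ` V")
        case True
        then obtain y where y: "y \<in> V" "y' = \<Phi> y" by blast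
        then have yU: "y \<in> U" and yp: "y \<in> points M" using V Vp by auto
        show ?thesis
          unfolding y(2) fun_smult_def sect_push_apply[OF y(1) Vp] G[OF yU section_fibre[OF M L t y(1)]]
          using True y diffeo_inv_left[OF M \<Phi> yp] sect_push_apply[OF y(1) Vp] by simp
      qed (simp add: sect_push_def fun_smult_def)
    qed
    note sec = flat_lift_section(1)[OF F V t]
    show "sect_push M \<Phi> ?G (\<Phi> ` V) t \<in> carrier (sections M L (\<Phi> ` V))"
      unfolding eq[OF t] by (rule sections_smult_closed[OF M L \<Phi>V sec bV])
    fix X assume X: "X \<in> vector_fields M V"
    note \<Phi>X = vf_push_closed[OF M \<Phi> X V(1)]
    note DF = flat_lift_section(2)[OF F V t X]
    show "D (\<Phi> ` V) (vf_push M \<Phi> V X) (sect_push M \<Phi> ?G (\<Phi> ` V) t) = sect_push M \<Phi> ?G (\<Phi> ` V) (D V X t)"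
      unfolding eq[OF t] eq[OF conn_closed[OF M L D V(1) X t]] conn_Leibniz[OF M L D \<Phi>V \<Phi>X sec bV] DF
    proof
      fix y'
      let ?s = "sect_push M \<Phi> F (\<Phi> ` V) t" and ?Ds = "sect_push M \<Phi> F (\<Phi> ` V) (D V X t)"
      show "(fun_smult L (\<Phi> ` V) (\<lambda>x. cderiv (vf_push M \<Phi> V X x) ?b) ?s \<oplus>\<^bsub>sections M L (\<Phi> ` V)\<^esub>
          fun_smult L (\<Phi> ` V) ?b ?Ds) y' = fun_smult L (\<Phi> ` V) ?b ?Ds y'"
      proof (cases "y' \<in> \<Phi> ` V")
        case True
        then obtain y where y: "y \<in> V" "y' = \<Phi> y" by blast
        then have yU: "y \<in> U" and yp: "y \<in> points M" using V Vp by auto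
        note p = diffeo_in_points[OF M \<Phi> yp]
        have Xy: "X y \<in> tangent_space M y" by (rule vector_field_tangent[OF M X y(1)])
        have "cderiv (vf_push M \<Phi> V X y') ?b = cderiv (X y) (\<lambda>z. ?b (\<Phi> z))"
          unfolding y(2) vf_push_apply[OF M \<Phi> y(1) Vp] by (rule cderiv_tangent_map[OF bV]) (use y in auto)
        also have "\<dots> = cderiv (X y) b"
          by (rule cderiv_local[OF M Xy V(1) y(1)]) (use diffeo_inv_left[OF M \<Phi>] Vp in auto)
        also have "\<dots> = 0" by (rule locally_constant_smooth(2)[OF U b yU Xy])
        finally have 0: "cderiv (vf_push M \<Phi> V X y') ?b = 0" .
        have s: "?s y' \<in> carrier (fibre L y')" by (rule section_fibre[OF M L sec True])
        have "?Ds y' \<in> carrier (fibre L y')"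
          by (rule section_fibre[OF M L flat_lift_section(1)[OF F V conn_closed[OF M L D V(1) X t]] True])
        then have "?b y' \<odot>\<^bsub>fibre L y'\<^esub> ?Ds y' \<in> carrier (fibre L y')"
          using fibre_smult_closed[OF M L] p y(2) by blast
        then have "\<zero>\<^bsub>fibre L y'\<^esub> \<oplus>\<^bsub>fibre L y'\<^esub> ?b y' \<odot>\<^bsub>fibre L y'\<^esub> ?Ds y' = ?b y' \<odot>\<^bsub>fibre L y'\<^esub> ?Ds y'"
          using abelian_monoid.l_zero[OF abelian_group.axioms(1)[OF fibre_abelian_group[OF M L p]]] y(2) by blast
        then show ?thesis
          using True 0 fibre_smult_zero[OF M L p, of "?s y'"] s y(2) by (simp add: sections_def fun_smult_def)
      qed (simp add: sections_def fun_smult_def)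
    qed
  qed
qed

text \<open>Fibres are one-dimensional, so \<open>G\<close> is a function \<open>u\<close> times
  \<open>F\<close>. Differentiating this relation along the push of a frame, flatness of both lifts
  cancels everything but the derivative of \<open>u\<close> times a non-vanishing section.\<close>

lemma flat_lift_ratio:
  assumes U: "openin (mtop M) U" and F: "flat_lift M L D \<Phi> U F" and G: "flat_lift M L D \<Phi> U G"
  obtains u where "u \<in> carrier (locally_constant_units (mtop M) U)"
    "\<And>y l. y \<in> U \<Longrightarrow> l \<in> carrier (fibre L y) \<Longrightarrow> G l = u y \<odot>\<^bsub>fibre L (\<Phi> y)\<^esub> F l"
proof -
  \<comment> \<open>The ratio at \<open>y\<close> is singled out by a condition that mentions no
    frame, so that ratios computed near different points with different frames are values of one
    function.\<close>
  define P where "P y c \<longleftrightarrow> (\<forall>l\<in>carrier (fibre L y). G l = c \<odot>\<^bsub>fibre L (\<Phi> y)\<^esub> F l)" for y c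
  have loc: "\<exists>W u. openin (mtop M) W \<and> x \<in> W \<and> W \<subseteq> U \<and> (\<forall>y\<in>W. \<forall>c. P y c \<longleftrightarrow> c = u y) \<and>
      (\<forall>y\<in>W. u y \<noteq> 0 \<and> u y = u x)" if x: "x \<in> U" for x
  proof -
    have xp: "x \<in> points M" by (rule openin_points[OF U x])
    have \<Phi>x: "\<Phi> x \<in> points M" by (rule diffeo_in_points[OF M \<Phi> xp])
    obtain U0 s0 \<kappa> where U0: "x \<in> U0" "local_frame M L U0 s0 \<kappa>" using local_frame_exists[OF M L xp] .
    obtain U0' s0' \<kappa>' where U0': "\<Phi> x \<in> U0'" "local_frame M L U0' s0' \<kappa>'" using local_frame_exists[OF M L \<Phi>x] .
    define W where "W = U \<inter> U0 \<inter> preim M \<Phi> U0'"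
    have W: "openin (mtop M) W" using U frame_open[OF M L U0(2)] openin_preim[OF M \<Phi> frame_open[OF M L U0'(2)]]
      by (auto simp: W_def)
    have xW: "x \<in> W" using x xp U0 U0' by (simp add: W_def preim_def)
    have sub: "W \<subseteq> U" "W \<subseteq> U0" "\<Phi> ` W \<subseteq> U0'" by (auto simp: W_def preim_def)
    have Wp: "W \<subseteq> points M" using W openin_subset by blast
    note \<Phi>W = openin_image[OF M \<Phi> W]
    define s where "s = restrict s0 W"
    have fr: "local_frame M L W s \<kappa>" unfolding s_def by (rule frame_restrict[OF M L U0(2) W sub(2)])
    have fr': "local_frame M L (\<Phi> ` W) (restrict s0' (\<Phi> ` W)) \<kappa>'" by (rule frame_restrict[OF M L U0'(2) \<Phi>W sub(3)])
    have s: "s \<in> carrier (sections M L W)" unfolding s_def by (rule frame_section[OF M L U0(2) sub(2) W])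
    have sf: "s y \<in> carrier (fibre L y)" if "y \<in> W" for y by (rule frame_fibre[OF M L fr that])
    define f where "f y = \<kappa>' (F (s y))" for y
    define g where "g y = \<kappa>' (G (s y))" for y
    have H: "smooth_fun M W (\<lambda>y. \<kappa>' (H (s y)))" "\<And>y. y \<in> W \<Longrightarrow> \<kappa>' (H (s y)) \<noteq> 0" if H: "flat_lift M L D \<Phi> U H" for H
    proof -
      have "smooth_fun M (\<Phi> ` W) (\<lambda>y. \<kappa>' (sect_push M \<Phi> H (\<Phi> ` W) s y))"
        by (rule frame_coeff_section[OF M L fr' flat_lift_section(1)[OF H W sub(1) s] \<Phi>W order_refl])
      from smooth_fun_pull[OF M \<Phi> this order_refl Wp]
      have "smooth_fun M W (\<lambda>y. \<kappa>' (sect_push M \<Phi> H (\<Phi> ` W) s (\<Phi> y)))"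
        by (simp add: Collect_conj_eq Int_absorb2 subset_iff)
      then show "smooth_fun M W (\<lambda>y. \<kappa>' (H (s y)))"
        by (rule smooth_fun_cong[OF _ _ M]) (simp add: sect_push_apply[OF _ Wp])
      fix y assume y: "y \<in> W"
      then have y': "\<Phi> y \<in> \<Phi> ` W" and yU: "y \<in> U" using sub by auto
      have "s y \<noteq> \<zero>\<^bsub>fibre L y\<^esub>" using frame_coeff_frame[OF M L fr y] frame_coeff_zero[OF M L fr y] by auto
      then show "\<kappa>' (H (s y)) \<noteq> 0"
        using frame_coeff_eq_0[OF M L fr' y' flat_lift_fibre(1)[OF H yU sf[OF y]]]
          flat_lift_fibre(3)[OF H yU sf[OF y]] by blast
    qed
    define u where "u y = g y * inverse (f y)" for y
    have u: "smooth_fun M W u" unfolding u_def f_def g_def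
      by (intro smooth_fun_mult H(1)[OF G] smooth_fun_inverse[OF M H(1)[OF F] H(2)[OF F]])
    have nz: "u y \<noteq> 0" if "y \<in> W" for y using H(2)[OF F that] H(2)[OF G that] by (simp add: u_def f_def g_def)
    have P: "P y c \<longleftrightarrow> c = u y" if y: "y \<in> W" for y c
    proof -
      have y': "\<Phi> y \<in> \<Phi> ` W" and yU: "y \<in> U" and yp: "y \<in> points M" using y sub Wp by auto
      note p' = diffeo_in_points[OF M \<Phi> yp]
      have \<kappa>H: "\<kappa>' (H l) = \<kappa> l * \<kappa>' (H (s y))" if H: "flat_lift M L D \<Phi> U H" and l: "l \<in> carrier (fibre L y)" for H l
        using flat_lift_fibre(2)[OF H yU sf[OF y], of "\<kappa> l"] frame_expand_point[OF M L fr y l]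
          frame_coeff_smult[OF M L fr' y' flat_lift_fibre(1)[OF H yU sf[OF y]], of "\<kappa> l"] by simp
      have iff: "G l = c \<odot>\<^bsub>fibre L (\<Phi> y)\<^esub> F l \<longleftrightarrow> \<kappa> l * g y = c * (\<kappa> l * f y)" if l: "l \<in> carrier (fibre L y)" for l
      proof -
        have Fl: "F l \<in> carrier (fibre L (\<Phi> y))" and Gl: "G l \<in> carrier (fibre L (\<Phi> y))"
          using flat_lift_fibre(1)[OF F yU l] flat_lift_fibre(1)[OF G yU l] .
        have "G l = c \<odot>\<^bsub>fibre L (\<Phi> y)\<^esub> F l \<longleftrightarrow> \<kappa>' (G l) = \<kappa>' (c \<odot>\<^bsub>fibre L (\<Phi> y)\<^esub> F l)"
          using frame_coeff_inj[OF M L fr' y' Gl fibre_smult_closed[OF M L p' Fl]] by metis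
        then show ?thesis
          unfolding frame_coeff_smult[OF M L fr' y' Fl] \<kappa>H[OF F l] \<kappa>H[OF G l] f_def g_def .
      qed
      have fy: "f y \<noteq> 0" using H(2)[OF F y] by (simp add: f_def)
      show ?thesis
      proof
        assume "P y c"
        then have "\<kappa> (s y) * g y = c * (\<kappa> (s y) * f y)" using iff[OF sf[OF y]] sf[OF y] unfolding P_def by blast
        then show "c = u y" using fy frame_coeff_frame[OF M L fr y] by (simp add: u_def)
      qed (use iff fy in \<open>auto simp: P_def u_def\<close>)
    qed
    have Gu: "G l = u y \<odot>\<^bsub>fibre L (\<Phi> y)\<^esub> F l" if "y \<in> W" "l \<in> carrier (fibre L y)" for y l
      using P[OF that(1), of "u y"] that(2) unfolding P_def by blast
    \<comment> \<open>The covariant derivative of \<open>G t = u F t\<close> is computed twice: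
      directly, by flatness of \<open>G\<close>, and by the Leibniz rule with flatness of
      \<open>F\<close>. Here \<open>t\<close> is the frame, so the coefficient of \<open>F t\<close>
      has no zeros and can be divided out.\<close>
    have zero: "cderiv (X y) u = 0"
      if V: "openin (mtop M) V" "V \<subseteq> W" and X: "X \<in> vector_fields M V" and y: "y \<in> V" for V X y
    proof -
      have Vp: "V \<subseteq> points M" and VU: "V \<subseteq> U" and yW: "y \<in> W" using V Wp sub y by auto
      have yp: "y \<in> points M" and yU: "y \<in> U" using y Vp VU by auto
      note \<Phi>V = openin_image[OF M \<Phi> V(1)]
      have \<Phi>VW: "\<Phi> ` V \<subseteq> \<Phi> ` W" using V by blast
      have y': "\<Phi> y \<in> \<Phi> ` V" and y'W: "\<Phi> y \<in> \<Phi> ` W" using y yW by auto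
      define t where "t = restrict s V"
      have t: "t \<in> carrier (sections M L V)" unfolding t_def by (rule section_restrict[OF M L s W V])
      have ty: "t z = s z" if "z \<in> V" for z using that by (simp add: t_def)
      let ?u = "\<lambda>y. u (inv_into (points M) \<Phi> y)"
      have uV: "smooth_fun M (\<Phi> ` V) ?u" by (rule smooth_fun_push[OF M \<Phi> smooth_fun_subset[OF M u V]])
      let ?Ft = "sect_push M \<Phi> F (\<Phi> ` V) t"
      note secF = flat_lift_section(1)[OF F V(1) VU t]
      note \<Phi>X = vf_push_closed[OF M \<Phi> X V(1)]
      have "sect_push M \<Phi> G (\<Phi> ` V) t = fun_smult L (\<Phi> ` V) ?u ?Ft"
      proof
        fix z'
        show "sect_push M \<Phi> G (\<Phi> ` V) t z' = fun_smult L (\<Phi> ` V) ?u ?Ft z'"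
        proof (cases "z' \<in> \<Phi> ` V")
          case True
          then obtain z where z: "z \<in> V" "z' = \<Phi> z" by blast
          then have zW: "z \<in> W" and zp: "z \<in> points M" using V Vp by auto
          have tz: "t z \<in> carrier (fibre L z)" by (rule section_fibre[OF M L t z(1)])
          show ?thesis
            using True Gu[OF zW tz] diffeo_inv_left[OF M \<Phi> zp] by (simp add: z(2) fun_smult_def sect_push_apply[OF z(1) Vp])
        qed (simp add: sect_push_def fun_smult_def)
      qed
      then have "D (\<Phi> ` V) (vf_push M \<Phi> V X) (fun_smult L (\<Phi> ` V) ?u ?Ft) (\<Phi> y) = G (D V X t y)"
        using flat_lift_section(2)[OF G V(1) VU t X] sect_push_apply[OF y Vp, of G "D V X t"] by simp
      moreover have "\<kappa>' (D (\<Phi> ` V) (vf_push M \<Phi> V X) (fun_smult L (\<Phi> ` V) ?u ?Ft) (\<Phi> y)) =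
          cderiv (vf_push M \<Phi> V X (\<Phi> y)) ?u * \<kappa>' (?Ft (\<Phi> y)) +
          u y * \<kappa>' (D (\<Phi> ` V) (vf_push M \<Phi> V X) ?Ft (\<Phi> y))"
        using frame_coeff_conn_smult[OF M L D fr' \<Phi>V \<Phi>VW \<Phi>X secF uV y'] diffeo_inv_left[OF M \<Phi> yp] by simp
      moreover have "D (\<Phi> ` V) (vf_push M \<Phi> V X) ?Ft (\<Phi> y) = F (D V X t y)"
        using flat_lift_section(2)[OF F V(1) VU t X] sect_push_apply[OF y Vp, of F "D V X t"] by simp
      moreover have "\<kappa>' (G (D V X t y)) = u y * \<kappa>' (F (D V X t y))"
      proof -
        have d: "D V X t y \<in> carrier (fibre L y)" by (rule conn_fibre[OF M L D V(1) X t y])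
        show ?thesis unfolding Gu[OF yW d]
          by (rule frame_coeff_smult[OF M L fr' y'W flat_lift_fibre(1)[OF F yU d]])
      qed
      moreover have "\<kappa>' (?Ft (\<Phi> y)) \<noteq> 0" using H(2)[OF F yW] by (simp add: sect_push_apply[OF y Vp] ty[OF y])
      ultimately have "cderiv (vf_push M \<Phi> V X (\<Phi> y)) ?u = 0" by simp
      moreover have "cderiv (vf_push M \<Phi> V X (\<Phi> y)) ?u = cderiv (X y) (\<lambda>z. ?u (\<Phi> z))"
        unfolding vf_push_apply[OF M \<Phi> y Vp] by (rule cderiv_tangent_map[OF uV]) (rule y')
      moreover have "cderiv (X y) (\<lambda>z. ?u (\<Phi> z)) = cderiv (X y) u"
        by (rule cderiv_local[OF M vector_field_tangent[OF M X y] V(1) y])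
          (use diffeo_inv_left[OF M \<Phi>] Vp in auto)
      ultimately show ?thesis by simp
    qed
    have "\<exists>V. openin (mtop M) V \<and> x \<in> V \<and> V \<subseteq> W \<and> (\<forall>y\<in>V. u y = u x)"
      by (rule cderiv_zero_locally_constant[OF M u xW]) (rule zero)
    then obtain V where V: "openin (mtop M) V" "x \<in> V" "V \<subseteq> W" "\<forall>y\<in>V. u y = u x" by blast
    moreover have "\<forall>y\<in>V. \<forall>c. P y c \<longleftrightarrow> c = u y" using P V(3) by blast
    moreover have "\<forall>y\<in>V. u y \<noteq> 0 \<and> u y = u x" using nz V(3,4) by blast
    moreover have "V \<subseteq> U" using V(3) sub(1) by blast
    ultimately show ?thesis by (intro exI[of _ V] exI[of _ u] conjI)
  qed
  \<comment> \<open>The local analysis shows that exactly one number satisfies \<open>P y\<close> at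
    each point of \<open>U\<close>, so the description is meaningful.\<close>
  define u where "u = (\<lambda>y\<in>U. THE c. P y c)"
  have u: "u y = c" if "y \<in> U" "\<forall>c'. P y c' \<longleftrightarrow> c' = c" for y c
    unfolding u_def restrict_apply'[OF that(1)] by (rule the_equality) (use that(2) in auto)
  show ?thesis
  proof (rule that)
    show "u \<in> carrier (locally_constant_units (mtop M) U)"
      unfolding locally_constant_units_def
    proof (simp, intro conjI ballI)
      show "u \<in> extensional U" by (simp add: u_def)
      fix x assume x: "x \<in> U"
      obtain W v where W: "openin (mtop M) W" "x \<in> W" "W \<subseteq> U" "\<forall>y\<in>W. \<forall>c. P y c \<longleftrightarrow> c = v y"
          "\<forall>y\<in>W. v y \<noteq> 0 \<and> v y = v x" using loc[OF x] by blast
      have uv: "u y = v y" if "y \<in> W" for y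
        using u[OF subsetD[OF W(3) that] bspec[OF W(4) that]] .
      show "u x \<noteq> 0" using uv[OF W(2)] bspec[OF W(5,2)] by simp
      have "\<forall>y\<in>W. u y = u x"
      proof
        fix y assume y: "y \<in> W"
        show "u y = u x" unfolding uv[OF y] uv[OF W(2)] using bspec[OF W(5) y] by (rule conjunct2)
      qed
      then show "\<exists>V. openin (mtop M) V \<and> x \<in> V \<and> V \<subseteq> U \<and> (\<forall>y\<in>V. u y = u x)"
        by (intro exI[of _ W] conjI W(1-3))
    qed
    fix y l assume y: "y \<in> U" and l: "l \<in> carrier (fibre L y)"
    obtain W v where W: "y \<in> W" "\<forall>y\<in>W. \<forall>c. P y c \<longleftrightarrow> c = v y" using loc[OF y] by blast
    have "u y = v y" by (rule u[OF y bspec[OF W(2,1)]])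
    then have "P y (u y)" using bspec[OF W(2,1)] by simp
    then show "G l = u y \<odot>\<^bsub>fibre L (\<Phi> y)\<^esub> F l" using l unfolding P_def by blast
  qed
qed

text \<open>In coefficients \<open>F\<close> is multiplication by a number \<open>c\<close>,
  non-zero because \<open>F\<close> kills no non-zero vector. Bijectivity and additivity are then
  properties of multiplication.\<close>

lemma flat_lift_fibre_linear:
  assumes F: "flat_lift M L D \<Phi> (points M) F" and x: "x \<in> points M"
  shows "bij_betw F (carrier (fibre L x)) (carrier (fibre L (\<Phi> x)))"
    and "l \<in> carrier (fibre L x) \<Longrightarrow> m \<in> carrier (fibre L x) \<Longrightarrow>
      F (l \<oplus>\<^bsub>fibre L x\<^esub> m) = F l \<oplus>\<^bsub>fibre L (\<Phi> x)\<^esub> F m"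
proof -
  note p = diffeo_in_points[OF M \<Phi> x]
  obtain U s \<kappa> where U: "x \<in> U" "local_frame M L U s \<kappa>" using local_frame_exists[OF M L x] .
  obtain U' s' \<kappa>' where U': "\<Phi> x \<in> U'" "local_frame M L U' s' \<kappa>'" using local_frame_exists[OF M L p] .
  have sx: "s x \<in> carrier (fibre L x)" by (rule frame_fibre[OF M L U(2,1)])
  define c where "c = \<kappa>' (F (s x))"
  note f = flat_lift_fibre[OF F x]
  have \<kappa>F: "\<kappa>' (F l) = \<kappa> l * c" if l: "l \<in> carrier (fibre L x)" for l
    using f(2)[OF sx, of "\<kappa> l"] frame_expand_point[OF M L U(2,1) l]
      frame_coeff_smult[OF M L U'(2,1) f(1)[OF sx], of "\<kappa> l"] by (simp add: c_def)
  have c0: "c \<noteq> 0"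
  proof
    assume "c = 0"
    then have "s x = \<zero>\<^bsub>fibre L x\<^esub>"
      using frame_coeff_eq_0[OF M L U'(2,1) f(1)[OF sx]] f(3)[OF sx] by (simp add: c_def)
    then show False using frame_coeff_frame[OF M L U(2,1)] frame_coeff_zero[OF M L U(2,1)] by simp
  qed
  show "bij_betw F (carrier (fibre L x)) (carrier (fibre L (\<Phi> x)))"
    unfolding bij_betw_def
  proof (intro conjI equalityI subsetI inj_onI)
    fix l m assume l: "l \<in> carrier (fibre L x)" and m: "m \<in> carrier (fibre L x)" and "F l = F m"
    then have "\<kappa> l = \<kappa> m" using \<kappa>F[OF l] \<kappa>F[OF m] c0 by simp
    then show "l = m" by (rule frame_coeff_inj[OF M L U(2,1) l m])
  next
    fix m assume m: "m \<in> carrier (fibre L (\<Phi> x))"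
    let ?l = "(\<kappa>' m / c) \<odot>\<^bsub>fibre L x\<^esub> s x"
    have l: "?l \<in> carrier (fibre L x)" by (rule fibre_smult_closed[OF M L x sx])
    have "F ?l = m"
      by (rule frame_coeff_inj[OF M L U'(2,1) f(1)[OF l] m])
        (simp add: \<kappa>F[OF l] frame_coeff_smult_frame[OF M L U(2,1)] c0)
    then show "m \<in> F ` carrier (fibre L x)" using imageI[OF l, of F] by simp
  qed (use f(1) in auto)
  assume l: "l \<in> carrier (fibre L x)" and m: "m \<in> carrier (fibre L x)"
  note lm = fibre_add_closed[OF M L x l m]
  show "F (l \<oplus>\<^bsub>fibre L x\<^esub> m) = F l \<oplus>\<^bsub>fibre L (\<Phi> x)\<^esub> F m"
    by (rule frame_coeff_inj[OF M L U'(2,1) f(1)[OF lm] fibre_add_closed[OF M L p f(1)[OF l] f(1)[OF m]]])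
      (simp add: \<kappa>F[OF lm] frame_coeff_add[OF M L U'(2,1) f(1)[OF l] f(1)[OF m]] \<kappa>F[OF l] \<kappa>F[OF m]
        frame_coeff_add[OF M L U(2,1) l m] algebra_simps)
qed

text \<open>A fibrewise linear map covering \<theta> is determined in frames by one complex function
  on the base, and smoothness of that function is smoothness of the map. It serves for a lift with
  \<theta> equal to \<Phi> and for its inverse with \<theta> equal to the inverse of \<Phi>.\<close>

lemma smooth_map_frames:
  assumes fr: "local_frame M L W s \<kappa>" and fr': "local_frame M L W' s' \<kappa>'"
    and \<theta>: "smooth_map M M \<theta>" "\<theta> ` W \<subseteq> W'" and \<tau>: "smooth_fun M W \<tau>"
    and F: "\<And>y l. y \<in> W \<Longrightarrow> l \<in> carrier (fibre L y) \<Longrightarrow> F l = (\<kappa> l * \<tau> y) \<odot>\<^bsub>fibre L (\<theta> y)\<^esub> s' (\<theta> y)"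
  shows "smooth_map (open_submfd (total L) {l \<in> points (total L). proj L l \<in> W}) (total L) F"
proof -
  let ?O = "{l \<in> points (total L). proj L l \<in> W}"
  note N = total_atlas[OF M L] and pr = proj_smooth[OF M L]
  have O: "openin (mtop (total L)) ?O" by (rule smooth_map_preimage_open[OF pr frame_open[OF M L fr]])
  note K = smooth_atlas_submfd[OF N O]
  have 1: "smooth_map (open_submfd (total L) ?O) M (\<lambda>l. \<theta> (proj L l))"
    by (rule smooth_map_compose[OF K M smooth_map_restrict_domain[OF N O pr M] \<theta>(1)])
  have "smooth_fun (total L) ?O (\<lambda>l. \<kappa> l * \<tau> (proj L l))"
    by (intro smooth_fun_mult frame_smooth_coeff[OF M L fr] smooth_map_pullback[OF N M pr \<tau>])
  then have 2: "smooth_fun (open_submfd (total L) ?O) (points (open_submfd (total L) ?O)) (\<lambda>l. \<kappa> l * \<tau> (proj L l))"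
    by (simp add: points_submfd[OF O] smooth_fun_submfd[OF N O])
  have "smooth_map (open_submfd (total L) ?O) (total L)
      (\<lambda>l. (\<kappa> l * \<tau> (proj L l)) \<odot>\<^bsub>fibre L (\<theta> (proj L l))\<^esub> s' (\<theta> (proj L l)))"
    by (rule frame_smooth_mapI[OF M L fr' K 1 _ 2]) (use \<theta>(2) in \<open>auto simp: points_submfd[OF O]\<close>)
  then show ?thesis
    by (rule smooth_map_cong[OF K]) (use F fibre_of_point[OF M L] in \<open>auto simp: points_submfd[OF O]\<close>)
qed

text \<open>A flat lift is only known to carry smooth sections to smooth sections. Pushing a frame
  recovers the function \<tau> that describes the lift in frames, and with it smoothness on the
  total space.\<close>

lemma flat_lift_bundle_lift:
  assumes F: "flat_lift M L D \<Phi> (points M) F"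
  shows "bundle_lift M L \<Phi> F"
proof -
  let ?N = "points (total L)" and ?\<Psi> = "inv_into (points M) \<Phi>"
  note fp = fibre_of_point[OF M L] and fc = fibre_carrier[OF M L] and f = flat_lift_fibre[OF F]
  have pF: "F l \<in> ?N \<and> proj L (F l) = \<Phi> (proj L l)" if "l \<in> ?N" for l
    using f(1)[of "proj L l" l] fp[OF that] fc[OF diffeo_in_points[OF M \<Phi>], of "proj L l" "F l"] by blast
  have inj: "inj_on F ?N"
  proof (rule inj_onI)
    fix l m assume l: "l \<in> ?N" and m: "m \<in> ?N" and eq: "F l = F m"
    then have "\<Phi> (proj L l) = \<Phi> (proj L m)" using pF by metis
    then have pm: "proj L l = proj L m" using diffeo_inv_left[OF M \<Phi>] fp[OF l] fp[OF m] by metis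
    then show "l = m"
      using flat_lift_fibre_linear(1)[OF F, of "proj L l"] fp[OF l] fp[OF m] eq
      by (auto simp: bij_betw_def dest: inj_onD)
  qed
  have surj: "\<exists>l\<in>?N. F l = m \<and> proj L l = ?\<Psi> (proj L m)" if m: "m \<in> ?N" for m
  proof -
    let ?y = "?\<Psi> (proj L m)"
    have y: "?y \<in> points M" "\<Phi> ?y = proj L m"
      using diffeo_inv_in_points[OF M \<Phi>] diffeo_inv_right[OF M \<Phi>] fp[OF m] by auto
    then have "m \<in> F ` carrier (fibre L ?y)"
      using flat_lift_fibre_linear(1)[OF F y(1)] fp[OF m] by (simp add: bij_betw_def)
    then show ?thesis using fc[OF y(1)] by blast
  qed
  have bij: "bij_betw F ?N ?N" unfolding bij_betw_def using inj pF surj by blast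
  let ?G = "inv_into ?N F"
  have G: "?G m \<in> ?N" "F (?G m) = m" "proj L (?G m) = ?\<Psi> (proj L m)" if m: "m \<in> ?N" for m
  proof -
    obtain l where "l \<in> ?N" "F l = m" "proj L l = ?\<Psi> (proj L m)" using surj[OF m] by blast
    then show "?G m \<in> ?N" "F (?G m) = m" "proj L (?G m) = ?\<Psi> (proj L m)" using inj by auto
  qed
  \<comment> \<open>Local description of the lift by one smooth, non-vanishing function \<tau>; both
    directions of the diffeomorphism are read off from it.\<close>
  have frames: "\<exists>W W' s s' \<kappa> \<kappa>' \<tau>. x \<in> W \<and> W' = \<Phi> ` W \<and> local_frame M L W s \<kappa> \<and> local_frame M L W' s' \<kappa>' \<and>
      smooth_fun M W \<tau> \<and> (\<forall>y\<in>W. \<tau> y \<noteq> 0 \<and>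
        (\<forall>l\<in>carrier (fibre L y). F l = (\<kappa> l * \<tau> y) \<odot>\<^bsub>fibre L (\<Phi> y)\<^esub> s' (\<Phi> y)))" if x: "x \<in> points M" for x
  proof -
    have \<Phi>x: "\<Phi> x \<in> points M" by (rule diffeo_in_points[OF M \<Phi> x])
    obtain U0 s0 \<kappa> where U0: "x \<in> U0" "local_frame M L U0 s0 \<kappa>" using local_frame_exists[OF M L x] .
    obtain U0' s0' \<kappa>' where U0': "\<Phi> x \<in> U0'" "local_frame M L U0' s0' \<kappa>'" using local_frame_exists[OF M L \<Phi>x] .
    define W where "W = U0 \<inter> preim M \<Phi> U0'"
    have W: "openin (mtop M) W" using frame_open[OF M L U0(2)] openin_preim[OF M \<Phi> frame_open[OF M L U0'(2)]]
      by (auto simp: W_def)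
    have xW: "x \<in> W" using x U0 U0' by (simp add: W_def preim_def)
    have sub: "W \<subseteq> U0" "\<Phi> ` W \<subseteq> U0'" by (auto simp: W_def preim_def)
    have Wp: "W \<subseteq> points M" using W openin_subset by blast
    note \<Phi>W = openin_image[OF M \<Phi> W]
    define s where "s = restrict s0 W"
    define s' where "s' = restrict s0' (\<Phi> ` W)"
    have fr: "local_frame M L W s \<kappa>" unfolding s_def by (rule frame_restrict[OF M L U0(2) W sub(1)])
    have fr': "local_frame M L (\<Phi> ` W) s' \<kappa>'" unfolding s'_def by (rule frame_restrict[OF M L U0'(2) \<Phi>W sub(2)])
    have s: "s \<in> carrier (sections M L W)" unfolding s_def by (rule frame_section[OF M L U0(2) sub(1) W])
    define \<tau> where "\<tau> y = \<kappa>' (F (s y))" for y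
    have "smooth_fun M (\<Phi> ` W) (\<lambda>y. \<kappa>' (sect_push M \<Phi> F (\<Phi> ` W) s y))"
      by (rule frame_coeff_section[OF M L fr' flat_lift_section(1)[OF F W Wp s] \<Phi>W order_refl])
    from smooth_fun_pull[OF M \<Phi> this order_refl Wp]
    have "smooth_fun M W (\<lambda>y. \<kappa>' (sect_push M \<Phi> F (\<Phi> ` W) s (\<Phi> y)))"
      by (simp add: Collect_conj_eq Int_absorb2 subset_iff)
    then have "smooth_fun M W \<tau>"
      by (rule smooth_fun_cong[OF _ _ M]) (simp add: sect_push_apply[OF _ Wp] \<tau>_def)
    moreover have "\<tau> y \<noteq> 0 \<and> (\<forall>l\<in>carrier (fibre L y). F l = (\<kappa> l * \<tau> y) \<odot>\<^bsub>fibre L (\<Phi> y)\<^esub> s' (\<Phi> y))"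
      if y: "y \<in> W" for y
    proof -
      have y': "\<Phi> y \<in> \<Phi> ` W" and yp: "y \<in> points M" using y Wp by auto
      note sf = frame_fibre[OF M L fr y] and p' = diffeo_in_points[OF M \<Phi> yp]
      note Fs = f(1)[OF yp sf]
      have "s y \<noteq> \<zero>\<^bsub>fibre L y\<^esub>" using frame_coeff_frame[OF M L fr y] frame_coeff_zero[OF M L fr y] by auto
      then have "\<tau> y \<noteq> 0" using frame_coeff_eq_0[OF M L fr' y' Fs] f(3)[OF yp sf] by (auto simp: \<tau>_def)
      moreover have "F l = (\<kappa> l * \<tau> y) \<odot>\<^bsub>fibre L (\<Phi> y)\<^esub> s' (\<Phi> y)" if l: "l \<in> carrier (fibre L y)" for l
        unfolding \<tau>_def fibre_smult_mult[OF M L p' frame_fibre[OF M L fr' y']] frame_expand_point[OF M L fr' y' Fs]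
        using f(2)[OF yp sf, of "\<kappa> l"] frame_expand_point[OF M L fr y l] by simp
      ultimately show ?thesis by blast
    qed
    ultimately show ?thesis using xW fr fr' by blast
  qed
  note N = total_atlas[OF M L] and pr = proj_smooth[OF M L]
  have "smooth_map (total L) (total L) F"
  proof (rule smooth_map_local[OF N])
    fix l assume l: "l \<in> ?N"
    obtain W W' s s' \<kappa> \<kappa>' \<tau> where W: "proj L l \<in> W" "W' = \<Phi> ` W" "local_frame M L W s \<kappa>" "local_frame M L W' s' \<kappa>'"
      "smooth_fun M W \<tau>" "\<And>y l. y \<in> W \<Longrightarrow> l \<in> carrier (fibre L y) \<Longrightarrow> F l = (\<kappa> l * \<tau> y) \<odot>\<^bsub>fibre L (\<Phi> y)\<^esub> s' (\<Phi> y)"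
      using frames[of "proj L l"] fp[OF l] by blast
    have "smooth_map (open_submfd (total L) {l \<in> ?N. proj L l \<in> W}) (total L) F"
      by (rule smooth_map_frames[OF W(3,4) diffeo_smooth(1)[OF M \<Phi>] _ W(5,6)]) (use W in auto)
    then show "\<exists>U. openin (mtop (total L)) U \<and> l \<in> U \<and> smooth_map (open_submfd (total L) U) (total L) F"
      using l W(1) smooth_map_preimage_open[OF pr frame_open[OF M L W(3)]] by blast
  qed
  moreover have "smooth_map (total L) (total L) ?G"
  proof (rule smooth_map_local[OF N])
    fix m assume m: "m \<in> ?N"
    have "?\<Psi> (proj L m) \<in> points M" using diffeo_inv_in_points[OF M \<Phi>] fp[OF m] by blast
    from frames[OF this] obtain W W' s s' \<kappa> \<kappa>' \<tau> where W: "?\<Psi> (proj L m) \<in> W" "W' = \<Phi> ` W"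
      "local_frame M L W s \<kappa>" "local_frame M L W' s' \<kappa>'" "smooth_fun M W \<tau>" "\<And>y. y \<in> W \<Longrightarrow> \<tau> y \<noteq> 0"
      "\<And>y l. y \<in> W \<Longrightarrow> l \<in> carrier (fibre L y) \<Longrightarrow> F l = (\<kappa> l * \<tau> y) \<odot>\<^bsub>fibre L (\<Phi> y)\<^esub> s' (\<Phi> y)"
      by blast
    have Wp: "W \<subseteq> points M" using frame_points[OF M L W(3)] by blast
    \<comment> \<open>The inverse map multiplies by the reciprocal of \<tau>, transported to the
      image side.\<close>
    have \<tau>': "smooth_fun M W' (\<lambda>y. inverse (\<tau> (?\<Psi> y)))"
      unfolding W(2) by (rule smooth_fun_push[OF M \<Phi> smooth_fun_inverse[OF M W(5,6)]])
    have "smooth_map (open_submfd (total L) {l \<in> ?N. proj L l \<in> W'}) (total L) ?G"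
    proof (rule smooth_map_frames[OF W(4,3) diffeo_smooth(2)[OF M \<Phi>] _ \<tau>'])
      show "?\<Psi> ` W' \<subseteq> W" using W(2) Wp diffeo_inv_left[OF M \<Phi>] by auto
      fix y' k assume "y' \<in> W'" and k: "k \<in> carrier (fibre L y')"
      then obtain y where y: "y \<in> W" "y' = \<Phi> y" using W(2) by blast
      have yp: "y \<in> points M" using y Wp by blast
      have y'p: "y' \<in> points M" using diffeo_in_points[OF M \<Phi> yp] y by simp
      have \<Psi>y: "?\<Psi> y' = y" using diffeo_inv_left[OF M \<Phi> yp] y by simp
      have kN: "k \<in> ?N" "proj L k = y'" using fc[OF y'p] k by auto
      have Gk: "?G k \<in> carrier (fibre L y)" using G(1,3)[OF kN(1)] kN \<Psi>y fc[OF yp] by simp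
      have y'W: "\<Phi> y \<in> W'" using y W(2) by blast
      have "k = (\<kappa> (?G k) * \<tau> y) \<odot>\<^bsub>fibre L (\<Phi> y)\<^esub> s' (\<Phi> y)" using W(7)[OF y(1) Gk] G(2)[OF kN(1)] by simp
      then have "\<kappa>' k = \<kappa> (?G k) * \<tau> y" using frame_coeff_smult_frame[OF M L W(4) y'W] by metis
      then have "\<kappa> (?G k) = \<kappa>' k * inverse (\<tau> y)" using W(6)[OF y(1)] by simp
      then show "?G k = (\<kappa>' k * inverse (\<tau> (?\<Psi> y'))) \<odot>\<^bsub>fibre L (?\<Psi> y')\<^esub> s (?\<Psi> y')"
        using frame_expand_point[OF M L W(3) y(1) Gk] \<Psi>y by simp
    qed
    moreover have "proj L m \<in> W'"
    proof -
      have "proj L m = \<Phi> (?\<Psi> (proj L m))" using diffeo_inv_right[OF M \<Phi>] fp[OF m] by simp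
      then show ?thesis using W(1,2) by blast
    qed
    ultimately show "\<exists>U. openin (mtop (total L)) U \<and> m \<in> U \<and> smooth_map (open_submfd (total L) U) (total L) ?G"
      using m smooth_map_preimage_open[OF pr frame_open[OF M L W(4)]] by blast
  qed
  ultimately have "diffeo (total L) (total L) F" using bij by (simp add: diffeo_def)
  then show ?thesis
    unfolding bundle_lift_def using pF flat_lift_fibre_linear[OF F] f(2) by simp
qed

text \<open>The pulled-back connection pushes field and section, differentiates and pulls back.
  Flatness turns the middle step into the push of the original derivative, and injectivity of
  \<open>F\<close> cancels this push against the pull.\<close>

lemma flat_lift_same_connection:
  assumes F: "flat_lift M L D \<Phi> (points M) F"
  shows "same_connection M L (pullback_connection M L \<Phi> F D) D"
  unfolding same_connection_def pullback_connection_def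
proof (intro allI impI)
  fix U X s assume U: "openin (mtop M) U" and X: "X \<in> vector_fields M U" and s: "s \<in> carrier (sections M L U)"
  have Up: "U \<subseteq> points M" using U openin_subset by blast
  have inj: "inj_on F (points (total L))"
    using flat_lift_bundle_lift[OF F] by (simp add: bundle_lift_def diffeo_def bij_betw_def)
  note Ds = conn_closed[OF M L D U X s]
  have "sect_pull M L \<Phi> F (\<Phi> ` U) (sect_push M \<Phi> F (\<Phi> ` U) (D U X s)) = D U X s"
  proof
    fix x
    show "sect_pull M L \<Phi> F (\<Phi> ` U) (sect_push M \<Phi> F (\<Phi> ` U) (D U X s)) x = D U X s x"
    proof (cases "x \<in> U")
      case True
      have "D U X s x \<in> points (total L)"
        using section_fibre[OF M L Ds True] fibre_carrier[OF M L, of x] Up True by blast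
      then show ?thesis
        using True inj by (simp add: sect_pull_def preim_image[OF M \<Phi> Up] sect_push_apply[OF True Up])
    next
      case False
      then show ?thesis using section_extensional[OF M L Ds]
        by (simp add: sect_pull_def preim_image[OF M \<Phi> Up] extensional_def)
    qed
  qed
  then show "sect_pull M L \<Phi> F (\<Phi> ` U) (D (\<Phi> ` U) (vf_push M \<Phi> U X) (sect_push M \<Phi> F (\<Phi> ` U) s)) = D U X s"
    using flat_lift_section(2)[OF F U Up s X] by simp
qed

end

section \<open>Gluing flat lifts\<close>

lemma locally_constant_units_iff:
  "f \<in> carrier (locally_constant_units T U) \<longleftrightarrow> f \<in> extensional U \<and> (\<forall>x\<in>U. f x \<noteq> 0) \<and>
    (\<forall>x\<in>U. \<exists>V. openin T V \<and> x \<in> V \<and> V \<subseteq> U \<and> (\<forall>y\<in>V. f y = f x))"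
  by (simp add: locally_constant_units_def)

lemma locally_constant_units_nonzero: "f \<in> carrier (locally_constant_units T U) \<Longrightarrow> x \<in> U \<Longrightarrow> f x \<noteq> 0"
  unfolding locally_constant_units_iff by blast

text \<open>The premise says that \<open>q\<close> has no zeros on non-zero arguments. It covers
  products, and also inverses when \<open>q\<close> ignores its second argument.\<close>

lemma locally_constant_units_pointwise:
  assumes "f \<in> carrier (locally_constant_units T U)" "g \<in> carrier (locally_constant_units T U)"
    and "\<And>x y. q x y \<noteq> 0 \<or> x = 0 \<or> y = 0"
  shows "(\<lambda>x\<in>U. q (f x) (g x)) \<in> carrier (locally_constant_units T U)"
  unfolding locally_constant_units_iff
proof (intro conjI ballI)
  fix x assume x: "x \<in> U"
  show "(\<lambda>x\<in>U. q (f x) (g x)) x \<noteq> 0"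
    using assms(3)[of "f x" "g x"] locally_constant_units_nonzero[OF assms(1) x]
      locally_constant_units_nonzero[OF assms(2) x] x by simp
  obtain V W where V: "openin T V" "x \<in> V" "V \<subseteq> U" "\<forall>y\<in>V. f y = f x" and
    W: "openin T W" "x \<in> W" "W \<subseteq> U" "\<forall>y\<in>W. g y = g x"
    using assms(1,2) x unfolding locally_constant_units_iff by blast
  have "(\<lambda>x\<in>U. q (f x) (g x)) y = (\<lambda>x\<in>U. q (f x) (g x)) x" if y: "y \<in> V \<inter> W" for y
  proof -
    have "f y = f x" "g y = g x" "y \<in> U" using y V(3,4) W(4) by blast+
    then show ?thesis using x by simp
  qed
  then show "\<exists>V. openin T V \<and> x \<in> V \<and> V \<subseteq> U \<and>
      (\<forall>y\<in>V. (\<lambda>x\<in>U. q (f x) (g x)) y = (\<lambda>x\<in>U. q (f x) (g x)) x)"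
    by (intro exI[of _ "V \<inter> W"] conjI ballI openin_Int V(1) W(1) IntI V(2) W(2) le_infI1 V(3))
qed simp

lemma locally_constant_units_one: "openin T U \<Longrightarrow> (\<lambda>x\<in>U. 1) \<in> carrier (locally_constant_units T U)"
  unfolding locally_constant_units_iff by auto

lemma locally_constant_units_mult:
  "x \<in> U \<Longrightarrow> (f \<otimes>\<^bsub>locally_constant_units T U\<^esub> g) x = f x * g x"
  by (simp add: locally_constant_units_def)

lemma locally_constant_units_group:
  assumes U: "openin T U"
  shows "comm_group (locally_constant_units T U)"
proof (rule comm_groupI)
  let ?G = "locally_constant_units T U"
  show "\<one>\<^bsub>?G\<^esub> \<in> carrier ?G" using locally_constant_units_one[OF U] by (simp add: locally_constant_units_def)
  fix f g k assume f: "f \<in> carrier ?G" and g: "g \<in> carrier ?G"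
  have "(\<lambda>x\<in>U. f x * g x) \<in> carrier ?G"
    by (rule locally_constant_units_pointwise[OF f g, where q = "(*)"]) auto
  then show "f \<otimes>\<^bsub>?G\<^esub> g \<in> carrier ?G" by (simp add: locally_constant_units_def)
  show "\<one>\<^bsub>?G\<^esub> \<otimes>\<^bsub>?G\<^esub> f = f"
    by (rule extensionalityI[of _ U]) (use f in \<open>simp_all add: locally_constant_units_def\<close>)
  have "(\<lambda>x\<in>U. inverse (f x)) \<in> carrier ?G"
    by (rule locally_constant_units_pointwise[OF f f, where q = "\<lambda>x y. inverse x"]) simp
  moreover have "(\<lambda>x\<in>U. inverse (f x)) \<otimes>\<^bsub>?G\<^esub> f = \<one>\<^bsub>?G\<^esub>"
    using locally_constant_units_nonzero[OF f] by (auto simp: locally_constant_units_def fun_eq_iff)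
  ultimately show "\<exists>g\<in>carrier ?G. g \<otimes>\<^bsub>?G\<^esub> f = \<one>\<^bsub>?G\<^esub>" by blast
qed (auto simp: locally_constant_units_def fun_eq_iff mult_ac)

lemma locally_constant_units_inv:
  assumes U: "openin T U" and f: "f \<in> carrier (locally_constant_units T U)" and x: "x \<in> U"
  shows "(inv\<^bsub>locally_constant_units T U\<^esub> f) x = inverse (f x)"
proof -
  let ?G = "locally_constant_units T U"
  interpret comm_group ?G by (rule locally_constant_units_group[OF U])
  have "(f \<otimes>\<^bsub>?G\<^esub> inv\<^bsub>?G\<^esub> f) x = \<one>\<^bsub>?G\<^esub> x" using f by simp
  then have "f x * (inv\<^bsub>?G\<^esub> f) x = 1" using x by (simp add: locally_constant_units_def)
  then show ?thesis using inverse_unique by metis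
qed

lemma locally_constant_units_restrict:
  assumes f: "f \<in> carrier (locally_constant_units T U)" and V: "openin T V" "V \<subseteq> U"
  shows "restrict f V \<in> carrier (locally_constant_units T V)"
  unfolding locally_constant_units_iff
proof (intro conjI ballI)
  fix x assume x: "x \<in> V"
  then show "restrict f V x \<noteq> 0" using locally_constant_units_nonzero[OF f, of x] V by auto
  have "x \<in> U" using x V by blast
  then obtain W where W: "openin T W" "x \<in> W" "W \<subseteq> U" "\<forall>y\<in>W. f y = f x"
    using f unfolding locally_constant_units_iff by blast
  have "\<forall>y\<in>W \<inter> V. restrict f V y = restrict f V x"
  proof
    fix y assume "y \<in> W \<inter> V"
    then have "f y = f x" "y \<in> V" using W(4) by blast+
    then show "restrict f V y = restrict f V x" using x by simp
  qed
  then show "\<exists>W. openin T W \<and> x \<in> W \<and> W \<subseteq> V \<and> (\<forall>y\<in>W. restrict f V y = restrict f V x)"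
    by (intro exI[of _ "W \<inter> V"] conjI openin_Int V(1) W(1) IntI W(2) x le_infI2 order_refl)
qed simp

section \<open>Coboundaries of locally constant units in degrees zero and one\<close>

lemma cech_cochains_mem:
  "c \<in> cech_cochains G n \<U> \<Longrightarrow> Us \<in> cech_index n \<U> \<Longrightarrow> c Us \<in> carrier (G (\<Inter>(set Us)))"
  by (auto simp: cech_cochains_def)

context
  fixes T :: "'a topology" and \<U> :: "'a set set"
  assumes cover: "open_cover T \<U>"
begin

lemma cover_open: "U \<in> \<U> \<Longrightarrow> openin T U"
  using cover by (simp add: open_cover_def)

text \<open>The term for \<open>k = 0\<close> drops \<open>U\<close> and leaves \<open>c [V]\<close>
  with exponent 1; the term for \<open>k = 1\<close> drops \<open>V\<close> and leaves
  \<open>c [U]\<close> with exponent -1.\<close>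

lemma units_coboundary_0:
  assumes c: "c \<in> cech_cochains (locally_constant_units T) 0 \<U>" and UV: "U \<in> \<U>" "V \<in> \<U>" and x: "x \<in> U \<inter> V"
  shows "cech_coboundary (locally_constant_units T) 0 \<U> c [U, V] x = c [V] x * inverse (c [U] x)"
proof -
  let ?G = "locally_constant_units T (U \<inter> V)"
  have o: "openin T (U \<inter> V)" using cover_open UV by blast
  interpret comm_group ?G by (rule locally_constant_units_group[OF o])
  have m: "restrict (c [W]) (U \<inter> V) \<in> carrier ?G" if "W \<in> \<U>" "U \<inter> V \<subseteq> W" for W
    by (rule locally_constant_units_restrict[OF _ o that(2)])
      (use cech_cochains_mem[OF c, of "[W]"] that in \<open>auto simp: cech_index_def\<close>)
  note mU = m[OF UV(1) Int_lower1] and mV = m[OF UV(2) Int_lower2]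
  have "cech_coboundary (locally_constant_units T) 0 \<U> c [U, V] =
      finprod ?G (\<lambda>k. restrict (c (remove_nth k [U, V])) (U \<inter> V) [^]\<^bsub>?G\<^esub> ((-1) ^ k :: int)) {..Suc 0}"
    using UV by (simp add: cech_coboundary_def cech_index_def Let_def)
  also have "\<dots> = inv\<^bsub>?G\<^esub> (restrict (c [U]) (U \<inter> V)) \<otimes>\<^bsub>?G\<^esub> restrict (c [V]) (U \<inter> V)"
    using mU mV by (subst finprod_Suc) (auto simp: remove_nth_def le_Suc_eq int_pow_neg)
  finally show ?thesis
    using x locally_constant_units_inv[OF o mU x] by (simp add: locally_constant_units_mult mult.commute)
qed

text \<open>The exponents are 1, -1, 1, so that triviality of the coboundary is the relation between
  the three ratios of a triple of lifts.\<close>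

lemma units_coboundary_1:
  assumes c: "c \<in> cech_cochains (locally_constant_units T) 1 \<U>"
    and UV: "U \<in> \<U>" "V \<in> \<U>" "W \<in> \<U>" and x: "x \<in> U \<inter> (V \<inter> W)"
  shows "cech_coboundary (locally_constant_units T) 1 \<U> c [U, V, W] x =
    c [V, W] x * inverse (c [U, W] x) * c [U, V] x"
proof -
  let ?I = "U \<inter> (V \<inter> W)"
  let ?G = "locally_constant_units T ?I"
  have o: "openin T ?I" using cover_open UV by blast
  interpret comm_group ?G by (rule locally_constant_units_group[OF o])
  have m: "restrict (c [A, B]) ?I \<in> carrier ?G" if "A \<in> \<U>" "B \<in> \<U>" "?I \<subseteq> A \<inter> B" for A B
    by (rule locally_constant_units_restrict[OF _ o that(3)])
      (use cech_cochains_mem[OF c, of "[A, B]"] that in \<open>auto simp: cech_index_def\<close>)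
  have m1: "restrict (c [V, W]) ?I \<in> carrier ?G" and m2: "restrict (c [U, W]) ?I \<in> carrier ?G"
    and m3: "restrict (c [U, V]) ?I \<in> carrier ?G" by (rule m; use UV in blast)+
  have "cech_coboundary (locally_constant_units T) 1 \<U> c [U, V, W] =
      finprod ?G (\<lambda>k. restrict (c (remove_nth k [U, V, W])) ?I [^]\<^bsub>?G\<^esub> ((-1) ^ k :: int)) {..Suc (Suc 0)}"
    using UV by (simp add: cech_coboundary_def cech_index_def Let_def)
  also have "\<dots> = restrict (c [U, V]) ?I \<otimes>\<^bsub>?G\<^esub>
      (inv\<^bsub>?G\<^esub> (restrict (c [U, W]) ?I) \<otimes>\<^bsub>?G\<^esub> restrict (c [V, W]) ?I)"
    using m1 m2 m3
    by (subst finprod_Suc, force simp: remove_nth_def le_Suc_eq int_pow_neg,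
        subst finprod_Suc) (auto simp: remove_nth_def le_Suc_eq int_pow_neg)
  finally show ?thesis
    using x locally_constant_units_inv[OF o m2 x] by (simp add: locally_constant_units_mult mult_ac)
qed

end

text \<open>The ratios of the chosen lifts form a cocycle because passing from \<open>U\<close> to
  \<open>W\<close> directly or through \<open>V\<close> gives the same lift. Equality with the
  trivial class provides a refinement on which the cocycle is a coboundary; the values of the
  bounding cochain there are the factors by which the lifts are rescaled.\<close>

lemma flat_lift_glue:
  fixes M :: "('a, 'e::{real_inner,banach}) mfd" and L :: "('l, 'f::{real_inner,banach}, 'a) lbundle"
    and D :: "('a, 'l) conn" and \<Phi> :: "'a \<Rightarrow> 'a"
  assumes M: "smooth_atlas M" and L: "complex_line_bundle M L" and D: "connection M L D"
    and \<Phi>: "diffeo M M \<Phi>"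
    and H1: "carrier (cech_group (mtop M) (locally_constant_units (mtop M)) 1) =
      {\<one>\<^bsub>cech_group (mtop M) (locally_constant_units (mtop M)) 1\<^esub>}"
    and ex: "\<And>x. x \<in> points M \<Longrightarrow> \<exists>U F. openin (mtop M) U \<and> x \<in> U \<and> flat_lift M L D \<Phi> U F"
  obtains F where "flat_lift M L D \<Phi> (points M) F"
proof -
  let ?T = "mtop M" and ?G = "locally_constant_units (mtop M)"
  \<comment> \<open>The cover by all open sets that carry a flat lift, so that no selection of
    neighbourhoods is needed before a lift is chosen on each member.\<close>
  define \<U> where "\<U> = {U. openin ?T U \<and> (\<exists>F. flat_lift M L D \<Phi> U F)}"
  have cover: "open_cover ?T \<U>"
  proof -
    have "points M \<subseteq> \<Union>\<U>"
    proof
      fix x assume "x \<in> points M"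
      from ex[OF this] show "x \<in> \<Union>\<U>" unfolding \<U>_def by blast
    qed
    then show ?thesis unfolding open_cover_def \<U>_def using openin_subset by fast
  qed
  define Fl where "Fl U = (SOME F. flat_lift M L D \<Phi> U F)" for U
  have Fl: "flat_lift M L D \<Phi> U (Fl U)" if "U \<in> \<U>" for U
  proof -
    have "\<exists>F. flat_lift M L D \<Phi> U F" using that unfolding \<U>_def by blast
    from someI_ex[OF this] show ?thesis by (simp add: Fl_def)
  qed
  have oU: "openin ?T U" if "U \<in> \<U>" for U using cover_open[OF cover that] .
  \<comment> \<open>A vector with non-zero image under the lift, on which two scalar factors can be
    compared.\<close>
  have nz: "\<exists>l\<in>carrier (fibre L y). Fl U l \<in> carrier (fibre L (\<Phi> y)) \<and> Fl U l \<noteq> \<zero>\<^bsub>fibre L (\<Phi> y)\<^esub>"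
    if U: "U \<in> \<U>" "y \<in> U" for U y
  proof -
    have "y \<in> points M" using oU[OF U(1)] U(2) openin_subset by blast
    then obtain W s \<kappa> where W: "y \<in> W" "local_frame M L W s \<kappa>" using local_frame_exists[OF M L] by blast
    have "s y \<noteq> \<zero>\<^bsub>fibre L y\<^esub>" using frame_coeff_frame[OF M L W(2,1)] frame_coeff_zero[OF M L W(2,1)] by auto
    then show ?thesis
      using flat_lift_fibre(1,3)[OF M L D \<Phi> Fl[OF U(1)] U(2) frame_fibre[OF M L W(2,1)]] frame_fibre[OF M L W(2,1)]
      by blast
  qed
  have cancel: "a = b"
    if y: "y \<in> points M" and m: "m \<in> carrier (fibre L y)" "m \<noteq> \<zero>\<^bsub>fibre L y\<^esub>"
      and eq: "a \<odot>\<^bsub>fibre L y\<^esub> m = b \<odot>\<^bsub>fibre L y\<^esub> m" for a b y m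
  proof -
    obtain W s \<kappa> where W: "y \<in> W" "local_frame M L W s \<kappa>" using local_frame_exists[OF M L y] by blast
    have "a * \<kappa> m = b * \<kappa> m"
      using arg_cong[OF eq, of \<kappa>] by (simp add: frame_coeff_smult[OF M L W(2,1) m(1)])
    then show ?thesis using frame_coeff_eq_0[OF M L W(2,1) m(1)] m(2) by simp
  qed
  have "\<forall>U\<in>\<U>. \<forall>V\<in>\<U>. \<exists>u. u \<in> carrier (?G (U \<inter> V)) \<and>
      (\<forall>y\<in>U \<inter> V. \<forall>l\<in>carrier (fibre L y). Fl V l = u y \<odot>\<^bsub>fibre L (\<Phi> y)\<^esub> Fl U l)"
  proof (intro ballI)
    fix U V assume UV: "U \<in> \<U>" "V \<in> \<U>"
    have "openin ?T (U \<inter> V)" using UV oU by blast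
    from flat_lift_ratio[OF M L D \<Phi> this flat_lift_subset[OF M L D \<Phi> Fl[OF UV(1)] Int_lower1]
        flat_lift_subset[OF M L D \<Phi> Fl[OF UV(2)] Int_lower2]]
    show "\<exists>u. u \<in> carrier (?G (U \<inter> V)) \<and>
      (\<forall>y\<in>U \<inter> V. \<forall>l\<in>carrier (fibre L y). Fl V l = u y \<odot>\<^bsub>fibre L (\<Phi> y)\<^esub> Fl U l)" by metis
  qed
  then obtain u where u: "\<And>U V. U \<in> \<U> \<Longrightarrow> V \<in> \<U> \<Longrightarrow> u U V \<in> carrier (?G (U \<inter> V))"
    "\<And>U V y l. U \<in> \<U> \<Longrightarrow> V \<in> \<U> \<Longrightarrow> y \<in> U \<inter> V \<Longrightarrow> l \<in> carrier (fibre L y) \<Longrightarrow>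
      Fl V l = u U V y \<odot>\<^bsub>fibre L (\<Phi> y)\<^esub> Fl U l"
    by metis
  define c where "c = (\<lambda>Us\<in>cech_index 1 \<U>. u (Us ! 0) (Us ! 1))"
  have pairs: "Us \<in> cech_index 1 \<W> \<longleftrightarrow> (\<exists>U\<in>\<W>. \<exists>V\<in>\<W>. Us = [U, V])" for \<W> :: "'a set set" and Us
    by (auto simp: cech_index_def length_Suc_conv numeral_eq_Suc)
  have cUV: "c [U, V] = u U V" if "U \<in> \<U>" "V \<in> \<U>" for U V
    using that by (simp add: c_def cech_index_def)
  have cc: "c \<in> cech_cochains ?G 1 \<U>"
    unfolding cech_cochains_def
  proof (rule PiE_I)
    fix Us assume "Us \<in> cech_index 1 \<U>"
    then obtain U V where "U \<in> \<U>" "V \<in> \<U>" "Us = [U, V]" using pairs by blast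
    then show "c Us \<in> carrier (?G (\<Inter>(set Us)))" using u(1) cUV by simp
  qed (simp add: c_def)
  have cocycle: "(\<U>, c) \<in> cech_cocycles ?T ?G 1"
  proof -
    have "cech_coboundary ?G 1 \<U> c = cech_one ?G (Suc 1) \<U>"
    proof
      fix Us
      show "cech_coboundary ?G 1 \<U> c Us = cech_one ?G (Suc 1) \<U> Us"
      proof (cases "Us \<in> cech_index (Suc 1) \<U>")
        case True
        then obtain U V W where Us: "Us = [U, V, W]" "U \<in> \<U>" "V \<in> \<U>" "W \<in> \<U>"
          by (auto simp: cech_index_def length_Suc_conv)
        let ?I = "U \<inter> (V \<inter> W)"
        have o: "openin ?T ?I" using oU Us by blast
        interpret comm_group "?G ?I" by (rule locally_constant_units_group[OF o])
        \<comment> \<open>Membership in the group makes the coboundary extensional on the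
          intersection, so that it remains to compare values at points of the intersection.\<close>
        have "cech_coboundary ?G 1 \<U> c Us \<in> carrier (?G ?I)"
        proof -
          have "restrict (c (remove_nth k Us)) ?I \<in> carrier (?G ?I)" if "k \<le> Suc (Suc 0)" for k
          proof -
            have "remove_nth k Us \<in> cech_index 1 \<U> \<and> ?I \<subseteq> \<Inter>(set (remove_nth k Us))"
              using that Us by (auto simp: remove_nth_def le_Suc_eq cech_index_def)
            then show ?thesis
              using locally_constant_units_restrict[OF cech_cochains_mem[OF cc] o] by blast
          qed
          then have "finprod (?G ?I) (\<lambda>k. restrict (c (remove_nth k Us)) ?I [^]\<^bsub>?G ?I\<^esub> ((-1) ^ k :: int)) {..Suc 1}
              \<in> carrier (?G ?I)" by (intro finprod_closed) auto
          then show ?thesis using True Us(1) by (simp add: cech_coboundary_def Let_def)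
        qed
        then have ext: "cech_coboundary ?G 1 \<U> c Us \<in> extensional ?I" by (simp add: locally_constant_units_iff)
        have "cech_coboundary ?G 1 \<U> c Us x = (\<lambda>x\<in>?I. 1) x" for x
        proof (cases "x \<in> ?I")
          case x: True
          obtain l where l: "l \<in> carrier (fibre L x)" "Fl U l \<in> carrier (fibre L (\<Phi> x))"
            "Fl U l \<noteq> \<zero>\<^bsub>fibre L (\<Phi> x)\<^esub>" using nz[OF Us(2), of x] x by blast
          have "x \<in> points M" using x o openin_subset by blast
          then have p: "\<Phi> x \<in> points M" by (rule diffeo_in_points[OF M \<Phi>])
          have xUW: "x \<in> U \<inter> W" and xUV: "x \<in> U \<inter> V" and xVW: "x \<in> V \<inter> W" using x by auto
          \<comment> \<open>Both sides are the lift over \<open>W\<close>, obtained from the lift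
            over \<open>U\<close> once through \<open>V\<close> and once directly.\<close>
          have "(u V W x * u U V x) \<odot>\<^bsub>fibre L (\<Phi> x)\<^esub> Fl U l = u U W x \<odot>\<^bsub>fibre L (\<Phi> x)\<^esub> Fl U l"
            unfolding fibre_smult_mult[OF M L p l(2)]
            by (simp only: u(2)[OF Us(2,4) xUW l(1), symmetric] u(2)[OF Us(2,3) xUV l(1), symmetric]
                u(2)[OF Us(3,4) xVW l(1), symmetric])
          then have "u V W x * u U V x = u U W x" by (rule cancel[OF p l(2,3)])
          moreover have "u U W x \<noteq> 0" by (rule locally_constant_units_nonzero[OF u(1)[OF Us(2,4)] xUW])
          ultimately show ?thesis
            unfolding Us(1) units_coboundary_1[OF cover cc Us(2-4) x] cUV[OF Us(3,4)] cUV[OF Us(2,4)] cUV[OF Us(2,3)]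
            using x by (simp add: field_simps)
        next
          case False
          then show ?thesis unfolding extensional_arb[OF ext False] restrict_def by (simp only: if_False)
        qed
        then have "cech_coboundary ?G 1 \<U> c Us = (\<lambda>x\<in>?I. 1)" by blast
        then show ?thesis using True Us(1) by (simp add: cech_one_def locally_constant_units_def)
      qed (simp add: cech_coboundary_def cech_one_def)
    qed
    then show ?thesis using cover cc by (simp add: cech_cocycles_def)
  qed
  \<comment> \<open>Classes are images under \<open>cech_rel\<close>. From equality of two classes
    the relation itself is recovered only once the cocycle is known to lie in its own class; the
    coboundary of the trivial cochain witnesses this.\<close>
  have refl: "((\<U>, c), (\<U>, c)) \<in> cech_rel ?T ?G 1"
  proof -
    have one: "cech_one ?G 0 \<U> \<in> cech_cochains ?G 0 \<U>"
      unfolding cech_cochains_def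
    proof (rule PiE_I)
      fix Us assume "Us \<in> cech_index 0 \<U>"
      then obtain U where "Us = [U]" "U \<in> \<U>" by (auto simp: cech_index_def length_Suc_conv)
      then show "cech_one ?G 0 \<U> Us \<in> carrier (?G (\<Inter>(set Us)))"
        using locally_constant_units_one[OF oU] by (simp add: cech_one_def cech_index_def locally_constant_units_def)
    qed (simp add: cech_one_def)
    let ?b = "cech_coboundary ?G 0 \<U> (cech_one ?G 0 \<U>)"
    have "cech_refine 1 \<U> id c = cech_mult ?G 1 \<U> (cech_refine 1 \<U> id c) ?b"
    proof
      fix Us
      show "cech_refine 1 \<U> id c Us = cech_mult ?G 1 \<U> (cech_refine 1 \<U> id c) ?b Us"
      proof (cases "Us \<in> cech_index 1 \<U>")
        case True
        then obtain U V where Us: "Us = [U, V]" "U \<in> \<U>" "V \<in> \<U>" using pairs by blast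
        have "?b [U, V] x = 1" if "x \<in> U \<inter> V" for x
          unfolding units_coboundary_0[OF cover one Us(2,3) that]
          using Us that by (simp add: cech_one_def cech_index_def locally_constant_units_def)
        then show ?thesis
          using True Us(1) by (auto simp: cech_refine_def cech_mult_def locally_constant_units_def fun_eq_iff)
      qed (simp add: cech_refine_def cech_mult_def)
    qed
    moreover have "refinement_map \<U> \<U> id" by (simp add: refinement_map_def)
    moreover have "?b \<in> cech_coboundaries ?G 1 \<U>" using one by (simp add: cech_coboundaries_def)
    ultimately show ?thesis unfolding cech_rel_def using cocycle cover by blast
  qed
  let ?one = "({points M}, cech_one ?G 1 {points M})"
  have "cech_class ?T ?G 1 (\<U>, c) \<in> carrier (cech_group ?T ?G 1)"
    unfolding cech_group_def cech_class_def using cocycle by (simp add: quotientI)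
  then have "cech_class ?T ?G 1 (\<U>, c) = cech_class ?T ?G 1 ?one"
    unfolding H1 by (simp add: cech_group_def)
  then have "(?one, (\<U>, c)) \<in> cech_rel ?T ?G 1" using refl by (auto simp: cech_class_def)
  then obtain \<W> \<rho> \<sigma> b where W: "open_cover ?T \<W>" "refinement_map \<W> {points M} \<rho>" "refinement_map \<W> \<U> \<sigma>"
    "b \<in> cech_coboundaries ?G 1 \<W>"
    "cech_refine 1 \<W> \<rho> (cech_one ?G 1 {points M}) = cech_mult ?G 1 \<W> (cech_refine 1 \<W> \<sigma> c) b"
    unfolding cech_rel_def by blast
  obtain b' where b': "b' \<in> cech_cochains ?G 0 \<W>" "b = cech_coboundary ?G 0 \<W> b'"
    using W(4) by (auto simp: cech_coboundaries_def)
  have bW: "b' [W] \<in> carrier (?G W)" if "W \<in> \<W>" for W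
    using cech_cochains_mem[OF b'(1), of "[W]"] that by (simp add: cech_index_def)
  have sU: "\<sigma> W \<in> \<U>" "W \<subseteq> \<sigma> W" if "W \<in> \<W>" for W using W(3) that by (auto simp: refinement_map_def)
  \<comment> \<open>The relation to the trivial cocycle, evaluated at a pair of members of the
    refinement, says that the ratio times the coboundary of \<open>b'\<close> is 1. The factors
    \<open>b'\<close> thus compensate the ratios.\<close>
  have key: "u (\<sigma> V) (\<sigma> W) x * b' [W] x = b' [V] x" if VW: "V \<in> \<W>" "W \<in> \<W>" and x: "x \<in> V \<inter> W" for V W x
  proof -
    have i: "[V, W] \<in> cech_index 1 \<W>" "map \<sigma> [V, W] \<in> cech_index 1 \<U>"
      using VW sU by (auto simp: cech_index_def)
    have r: "\<rho> V = points M" "\<rho> W = points M" using W(2) VW by (auto simp: refinement_map_def)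
    have "x \<in> points M" using x cover_open[OF W(1) VW(1)] openin_subset by blast
    then have "cech_refine 1 \<W> \<rho> (cech_one ?G 1 {points M}) [V, W] x = 1"
      using i(1) x r by (simp add: cech_refine_def cech_one_def cech_index_def locally_constant_units_def)
    moreover have "cech_mult ?G 1 \<W> (cech_refine 1 \<W> \<sigma> c) b [V, W] x =
        u (\<sigma> V) (\<sigma> W) x * (b' [W] x * inverse (b' [V] x))"
      using i(1) x cUV[OF sU(1) sU(1), OF VW] units_coboundary_0[OF W(1) b'(1) VW x]
      by (simp add: cech_mult_def cech_refine_def locally_constant_units_mult b'(2))
    ultimately have "u (\<sigma> V) (\<sigma> W) x * (b' [W] x * inverse (b' [V] x)) = 1" using W(5) by simp
    moreover have "b' [V] x \<noteq> 0" using locally_constant_units_nonzero[OF bW[OF VW(1)]] x by blast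
    ultimately show ?thesis by (simp add: field_simps)
  qed
  \<comment> \<open>One member of the refinement is picked at each point; \<open>key\<close> makes
    the rescaled lifts agree on overlaps, so this choice does not affect smoothness or
    flatness.\<close>
  define w where "w y = (SOME W. W \<in> \<W> \<and> y \<in> W)" for y
  have w: "w y \<in> \<W>" "y \<in> w y" if "y \<in> points M" for y
  proof -
    have "\<exists>W. W \<in> \<W> \<and> y \<in> W" using W(1) that by (auto simp: open_cover_def)
    from someI_ex[OF this] show "w y \<in> \<W>" "y \<in> w y" by (auto simp: w_def)
  qed
  define F where "F l = b' [w (proj L l)] (proj L l) \<odot>\<^bsub>fibre L (\<Phi> (proj L l))\<^esub> Fl (\<sigma> (w (proj L l))) l" for l
  have "flat_lift M L D \<Phi> (points M) F"
  proof (rule flat_lift_local[OF M L D \<Phi>])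
    fix x assume x: "x \<in> points M"
    let ?W = "w x"
    have o: "openin ?T ?W" by (rule cover_open[OF W(1) w(1)[OF x]])
    note s = sU[OF w(1)[OF x]]
    have "flat_lift M L D \<Phi> ?W (\<lambda>l. b' [?W] (proj L l) \<odot>\<^bsub>fibre L (\<Phi> (proj L l))\<^esub> Fl (\<sigma> ?W) l)"
      by (rule flat_lift_scale[OF M L D \<Phi> o flat_lift_subset[OF M L D \<Phi> Fl[OF s(1)] s(2)] bW[OF w(1)[OF x]]])
    \<comment> \<open>On \<open>w x\<close> the map \<open>F\<close> uses the member
      \<open>w y\<close>, which may differ from \<open>w x\<close> at other points \<open>y\<close>;
      the two formulas agree by \<open>key\<close>.\<close>
    then have "flat_lift M L D \<Phi> ?W F"
    proof (rule flat_lift_cong[OF M L D \<Phi> _ _ o])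
      fix y l assume y: "y \<in> ?W" and l: "l \<in> carrier (fibre L y)"
      have yp: "y \<in> points M" using y o openin_subset by blast
      have pl: "proj L l = y" using fibre_carrier[OF M L yp] l by blast
      note V = w[OF yp] and p = diffeo_in_points[OF M \<Phi> yp]
      have yi: "y \<in> w y \<inter> ?W" using V(2) y by blast
      have yi': "y \<in> \<sigma> (w y) \<inter> \<sigma> ?W" using yi s(2) sU(2)[OF V(1)] by blast
      have Fc: "Fl (\<sigma> (w y)) l \<in> carrier (fibre L (\<Phi> y))"
        using flat_lift_fibre(1)[OF M L D \<Phi> Fl[OF sU(1)[OF V(1)]] _ l] yi' by blast
      have "b' [?W] y \<odot>\<^bsub>fibre L (\<Phi> y)\<^esub> Fl (\<sigma> ?W) l =
          (b' [?W] y * u (\<sigma> (w y)) (\<sigma> ?W) y) \<odot>\<^bsub>fibre L (\<Phi> y)\<^esub> Fl (\<sigma> (w y)) l"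
        unfolding fibre_smult_mult[OF M L p Fc] u(2)[OF sU(1)[OF V(1)] s(1) yi' l, symmetric] ..
      also have "\<dots> = b' [w y] y \<odot>\<^bsub>fibre L (\<Phi> y)\<^esub> Fl (\<sigma> (w y)) l"
        using key[OF V(1) w(1)[OF x] yi] by (simp add: mult.commute)
      finally show "b' [?W] (proj L l) \<odot>\<^bsub>fibre L (\<Phi> (proj L l))\<^esub> Fl (\<sigma> ?W) l = F l"
        by (simp add: F_def pl)
    qed
    then show "\<exists>W. openin ?T W \<and> x \<in> W \<and> flat_lift M L D \<Phi> W F" using o w(2)[OF x] by blast
  qed
  then show ?thesis by (rule that)
qed

section \<open>Bump functions\<close>

text \<open>The bump functions only use \<open>m = 0\<close>; the whole family is needed because the derivative of
  one member is a combination of two others.\<close>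

definition flat_exp :: "nat \<Rightarrow> real \<Rightarrow> real" where
  "flat_exp m t = (if 0 < t then inverse t ^ m * exp (- inverse t) else 0)"

lemma flat_exp_tendsto_0: "(flat_exp m \<longlongrightarrow> 0) (at 0)"
proof -
  have "((\<lambda>t. inverse t ^ m / exp (inverse t)) \<longlongrightarrow> 0) (at_right (0 :: real))"
    by (rule filterlim_compose[OF tendsto_power_div_exp_0 filterlim_inverse_at_top_right])
  then have "(flat_exp m \<longlongrightarrow> 0) (at_right 0)"
    by (rule Lim_transform_eventually)
      (auto simp: flat_exp_def exp_minus divide_inverse eventually_at_right_field intro!: exI[of _ 1])
  moreover have "(flat_exp m \<longlongrightarrow> 0) (at_left 0)"
    by (rule Lim_transform_eventually[OF tendsto_const])
      (auto simp: flat_exp_def eventually_at_left_field intro!: exI[of _ "-1"])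
  ultimately show ?thesis by (simp add: filterlim_split_at)
qed

text \<open>One formula serves all three cases: for positive \<open>t\<close> it is the product
  rule, while at and to the left of 0 every member of the family vanishes.\<close>

lemma flat_exp_has_derivative:
  "(flat_exp m has_real_derivative flat_exp (m + 2) t - real m * flat_exp (m + 1) t) (at t)"
proof -
  consider "t < 0" | "t = 0" | "t > 0" by linarith
  then show ?thesis
  proof cases
    case 1
    have "((\<lambda>t. 0) has_real_derivative 0) (at t)" by simp
    then have "(flat_exp m has_real_derivative 0) (at t)"
      by (rule has_field_derivative_transform_within_open[of _ _ _ "{..<0}"]) (use 1 in \<open>auto simp: flat_exp_def\<close>)
    then show ?thesis using 1 by (simp add: flat_exp_def)
  next
    case 2
    \<comment> \<open>The difference quotient at 0 is the next member of the family, so the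
      derivative there is a limit already known to be 0.\<close>
    have "flat_exp m h / h = flat_exp (m + 1) h" for h by (simp add: flat_exp_def divide_inverse)
    then have "((\<lambda>h. (flat_exp m (0 + h) - flat_exp m 0) / h) \<longlongrightarrow> 0) (at 0)"
      using flat_exp_tendsto_0[of "m + 1"] by (simp add: flat_exp_def[of m 0])
    then show ?thesis using 2 by (simp add: DERIV_def flat_exp_def)
  next
    case 3
    have "((\<lambda>t. inverse t ^ m * exp (- inverse t)) has_real_derivative
        inverse t ^ (m + 2) * exp (- inverse t) - real m * (inverse t ^ (m + 1) * exp (- inverse t))) (at t)"
    proof -
      have i: "(inverse has_real_derivative - (inverse t ^ 2)) (at t)"
        using DERIV_inverse[of t] 3 by (simp add: numeral_2_eq_2)
      have "((\<lambda>t. inverse t ^ m * exp (- inverse t)) has_real_derivative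
          (real m * (- (inverse t ^ 2) * inverse t ^ (m - Suc 0))) * exp (- inverse t) +
          (exp (- inverse t) * - (- (inverse t ^ 2))) * inverse t ^ m) (at t)"
        by (intro DERIV_mult DERIV_power[OF i] DERIV_chain2[OF DERIV_exp] DERIV_minus i)
      \<comment> \<open>The exponent \<open>m - Suc 0\<close> is a truncated difference; for
        \<open>m = 0\<close> the factor \<open>real m\<close> removes the term.\<close>
      then show ?thesis by (rule DERIV_cong) (cases m; simp add: power2_eq_square algebra_simps)
    qed
    then have "(flat_exp m has_real_derivative
        inverse t ^ (m + 2) * exp (- inverse t) - real m * (inverse t ^ (m + 1) * exp (- inverse t))) (at t)"
      by (rule has_field_derivative_transform_within_open[of _ _ _ "{0<..}"]) (use 3 in \<open>auto simp: flat_exp_def\<close>)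
    then show ?thesis using 3 by (simp add: flat_exp_def)
  qed
qed

lemma smooth_flat_exp: "smooth_on UNIV (flat_exp m)"
proof -
  have "Ck_on k UNIV (flat_exp m)" for k
  proof (induction k arbitrary: m)
    case 0
    show ?case
      by (auto intro!: continuous_at_imp_continuous_on DERIV_isCont[OF flat_exp_has_derivative])
  next
    case (Suc k)
    show ?case
    proof (rule Ck_on_SucI[OF open_UNIV])
      show "(flat_exp m has_derivative (\<lambda>v. (flat_exp (m + 2) t + (- real m) * flat_exp (m + 1) t) * v)) (at t)" for t
        using flat_exp_has_derivative[of m t] by (simp add: has_field_derivative_def)
      show "Ck_on k UNIV (\<lambda>t. (flat_exp (m + 2) t + (- real m) * flat_exp (m + 1) t) * v)" for v
        by (intro Ck_on_linear_comp[OF bounded_linear_mult_left] Ck_on_add Suc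
            Ck_on_linear_comp[OF bounded_linear_mult_right]) auto
    qed
  qed
  then show ?thesis by (simp add: smooth_on_def)
qed

text \<open>Combinations of the frame vectors with bounded coefficients form a finite sum of compact
  segments, hence a compact set. The ball is a closed subset of a translate of it.\<close>

lemma compact_cball_frame:
  fixes p :: "'e::real_inner"
  assumes E: "\<exists>E::'e set. frame E"
  shows "compact (cball p r)"
proof -
  obtain E :: "'e set" where E: "frame E" using assms by blast
  have "compact {(\<Sum>e\<in>F. c e *\<^sub>R e) | c. \<forall>e\<in>F. \<bar>c e\<bar> \<le> r * norm e}" if "finite F" for F :: "'e set"
    using that
  proof (induction F)
    case (insert e F)
    let ?I = "(\<lambda>t. t *\<^sub>R e) ` {- (r * norm e)..r * norm e}"
    let ?S = "{(\<Sum>e\<in>F. c e *\<^sub>R e) | c. \<forall>e\<in>F. \<bar>c e\<bar> \<le> r * norm e}"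
    have "compact ?I" by (intro compact_continuous_image continuous_intros) auto
    from compact_sums[OF this insert.IH] have "compact {x + y | x y. x \<in> ?I \<and> y \<in> ?S}" .
    moreover have "{(\<Sum>e\<in>insert e F. c e *\<^sub>R e) | c. \<forall>e\<in>insert e F. \<bar>c e\<bar> \<le> r * norm e} =
        {x + y | x y. x \<in> ?I \<and> y \<in> ?S}"
    proof (intro equalityI subsetI)
      fix z assume "z \<in> {(\<Sum>e\<in>insert e F. c e *\<^sub>R e) | c. \<forall>e\<in>insert e F. \<bar>c e\<bar> \<le> r * norm e}"
      then obtain c where c: "z = c e *\<^sub>R e + (\<Sum>e\<in>F. c e *\<^sub>R e)" "\<bar>c e\<bar> \<le> r * norm e" "\<forall>e\<in>F. \<bar>c e\<bar> \<le> r * norm e"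
        using insert.hyps by auto
      then have "c e \<in> {- (r * norm e)..r * norm e}" "(\<Sum>e\<in>F. c e *\<^sub>R e) \<in> ?S" by auto
      then have "c e *\<^sub>R e \<in> ?I" "(\<Sum>e\<in>F. c e *\<^sub>R e) \<in> ?S" by (auto intro: imageI)
      then show "z \<in> {x + y | x y. x \<in> ?I \<and> y \<in> ?S}" using c(1) by blast
    next
      fix z assume "z \<in> {x + y | x y. x \<in> ?I \<and> y \<in> ?S}"
      then obtain x y where xy: "z = x + y" "x \<in> ?I" "y \<in> ?S" by blast
      obtain t where t1: "x = t *\<^sub>R e" "t \<in> {- (r * norm e)..r * norm e}" using xy(2) by blast
      obtain c where c: "y = (\<Sum>e\<in>F. c e *\<^sub>R e)" "\<forall>e\<in>F. \<bar>c e\<bar> \<le> r * norm e" using xy(3) by blast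
      have t: "\<bar>t\<bar> \<le> r * norm e" "z = t *\<^sub>R e + (\<Sum>e\<in>F. c e *\<^sub>R e)"
          "\<forall>e\<in>F. \<bar>c e\<bar> \<le> r * norm e" using xy(1) t1 c by auto
      have "(\<Sum>d\<in>F. (c(e := t)) d *\<^sub>R d) = (\<Sum>e\<in>F. c e *\<^sub>R e)"
        using insert.hyps by (intro sum.cong) auto
      then have "z = (\<Sum>d\<in>insert e F. (c(e := t)) d *\<^sub>R d)" using insert.hyps t(2) by simp
      then show "z \<in> {(\<Sum>e\<in>insert e F. c e *\<^sub>R e) | c. \<forall>e\<in>insert e F. \<bar>c e\<bar> \<le> r * norm e}"
        using t by (intro CollectI exI[of _ "c(e := t)"]) auto
    qed
    ultimately show ?case by simp
  qed simp
  then have "compact {(\<Sum>e\<in>E. c e *\<^sub>R e) | c. \<forall>e\<in>E. \<bar>c e\<bar> \<le> r * norm e}" (is "compact ?K")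
    using frame_finite[OF E] by blast
  then have "compact ((+) p ` ?K)" by (rule compact_translation)
  moreover have "cball p r \<subseteq> (+) p ` ?K"
  proof
    fix x assume "x \<in> cball p r"
    then have x: "norm (x - p) \<le> r" by (simp add: dist_norm norm_minus_commute)
    \<comment> \<open>The Cauchy-Schwarz inequality is the origin of the bound
      \<open>r * norm e\<close> on the coefficients.\<close>
    have "\<bar>(x - p) \<bullet> e\<bar> \<le> r * norm e" for e
      using Cauchy_Schwarz_ineq2[of "x - p" e] mult_right_mono[OF x norm_ge_zero[of e]] by linarith
    then have "x - p \<in> ?K" using frame_expand[OF E, of "x - p", symmetric] by blast
    then show "x \<in> (+) p ` ?K" by (intro image_eqI[of _ _ "x - p"]) auto
  qed
  ultimately show ?thesis using compact_Int_closed[of "(+) p ` ?K" "cball p r"] by (simp add: Int_absorb1)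
qed

text \<open>The function is built in a chart and extended by zero. Its support lies in the image
  \<open>K\<close> of a closed ball, which is compact and, by the Hausdorff property, closed in the
  whole manifold; this makes the extension smooth.\<close>

lemma bump_function:
  fixes M :: "('a, 'e::{real_inner,banach}) mfd"
  assumes SM: "smooth_manifold M" and V: "openin (mtop M) V" and x: "x \<in> V"
  obtains \<eta> :: "'a \<Rightarrow> real" and K where "smooth_fun M (points M) \<eta>" "\<eta> x = 1" "closedin (mtop M) K" "K \<subseteq> V"
    "\<And>y. y \<notin> K \<Longrightarrow> \<eta> y = 0"
proof -
  have M: "smooth_atlas M" by (rule smooth_manifold_imp_atlas[OF SM])
  have "x \<in> points M" using V x openin_subset by blast
  then obtain C \<phi> where C: "(C, \<phi>) \<in> atlas M" "x \<in> C" using atlas_cover[OF M] by blast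
  have VC: "openin (mtop M) (V \<inter> C)" using V chart_open[OF M C(1)] by blast
  have o: "open (\<phi> ` (V \<inter> C))" by (rule chart_image_of_open[OF M C(1) VC]) auto
  obtain r where r: "0 < r" "cball (\<phi> x) r \<subseteq> \<phi> ` (V \<inter> C)"
    using o x C(2) open_contains_cball by (metis IntI imageI)
  \<comment> \<open>The argument is positive inside the ball of radius \<open>r\<close> and at most
    0 outside it; dividing by the value at the centre normalises \<open>b\<close> to 1
    there.\<close>
  define b where "b u = flat_exp 0 (r\<^sup>2 + - ((u - \<phi> x) \<bullet> (u - \<phi> x))) * inverse (flat_exp 0 (r\<^sup>2))" for u
  have fr: "\<exists>E::real set. frame E" by (rule exI[of _ "{1}"]) (simp add: frame_def)
  have sub: "smooth_on UNIV (\<lambda>u. u + - \<phi> x)"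
    by (intro smooth_on_add smooth_on_const smooth_on_linear bounded_linear_ident) auto
  have "smooth_on UNIV (\<lambda>u. r\<^sup>2 + - ((u + - \<phi> x) \<bullet> (u + - \<phi> x)))"
    by (intro smooth_on_add smooth_on_const smooth_on_linear_comp[OF bounded_linear_minus[OF bounded_linear_ident]]
        smooth_on_bilinear[OF bounded_bilinear_inner] sub) auto
  then have sb: "smooth_on UNIV b"
    unfolding b_def[abs_def]
    by (intro smooth_on_linear_comp[OF bounded_linear_mult_left] smooth_on_compose[OF fr smooth_flat_exp]) auto
  have b0: "b u = 0" if "u \<notin> cball (\<phi> x) r" for u
  proof -
    have "r < norm (u - \<phi> x)" using that by (simp add: dist_norm norm_minus_commute)
    then have "r\<^sup>2 \<le> (norm (u - \<phi> x))\<^sup>2" using r(1) by (intro power_mono) auto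
    then show ?thesis by (simp add: b_def flat_exp_def power2_norm_eq_inner)
  qed
  have b1: "b (\<phi> x) = 1" using r(1) by (simp add: b_def flat_exp_def)
  define K where "K = inv_into C \<phi> ` cball (\<phi> x) r"
  have iv: "inv_into C \<phi> (\<phi> y) = y" if "y \<in> C" for y using M C that by simp
  have KV: "K \<subseteq> V \<inter> C" unfolding K_def using r(2) iv by force
  have K: "closedin (mtop M) K"
  proof -
    have "compactin (top_of_set (\<phi> ` C)) (cball (\<phi> x) r)"
      using r(2) compact_cball_frame[OF smooth_atlas_frame[OF M]] by (auto simp: compactin_subtopology)
    moreover have "continuous_map (top_of_set (\<phi> ` C)) (subtopology (mtop M) C) (inv_into C \<phi>)"
    proof -
      obtain g where "homeomorphic_maps (subtopology (mtop M) C) (top_of_set (\<phi> ` C)) \<phi> g"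
        using chart_homeo[OF M C(1)] homeomorphic_map_maps by blast
      then have g: "continuous_map (top_of_set (\<phi> ` C)) (subtopology (mtop M) C) g" "\<forall>y\<in>C. g (\<phi> y) = y"
        using chart_topspace[OF M C(1)] by (auto simp: homeomorphic_maps_def)
      show ?thesis by (rule continuous_map_eq[OF g(1)]) (use g(2) iv in auto)
    qed
    ultimately have "compactin (subtopology (mtop M) C) K" unfolding K_def using image_compactin by blast
    then have "compactin (mtop M) K" by (simp add: compactin_subtopology)
    moreover have "Hausdorff_space (mtop M)" using SM unfolding smooth_manifold_def by (elim conjE)
    ultimately show ?thesis by (intro compactin_imp_closedin)
  qed
  define \<eta> where "\<eta> y = (if y \<in> C then b (\<phi> y) else 0)" for y
  have \<eta>0: "\<eta> y = 0" if "y \<notin> K" for y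
  proof (cases "y \<in> C")
    case yC: True
    have "\<phi> y \<notin> cball (\<phi> x) r"
      using that imageI[of "\<phi> y" "cball (\<phi> x) r" "inv_into C \<phi>"] iv[OF yC] by (auto simp: K_def)
    then show ?thesis using b0 by (simp add: \<eta>_def)
  qed (simp add: \<eta>_def)
  have "smooth_fun M (points M) \<eta>"
  proof (rule smooth_fun_local)
    fix y assume y: "y \<in> points M"
    show "\<exists>W. y \<in> W \<and> W \<subseteq> points M \<and> smooth_fun M W \<eta>"
    proof (cases "y \<in> C")
      case True
      have "smooth_fun M C (\<lambda>y. b (\<phi> y))"
        by (rule smooth_fun_compose[OF M smooth_atlas_frame[OF M] sb
              smooth_fun_chart[OF M C(1) chart_open[OF M C(1)] order_refl]]) auto
      then have "smooth_fun M C \<eta>" by (rule smooth_fun_cong[OF _ _ M]) (simp add: \<eta>_def)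
      then show ?thesis using True chart_subset[OF M C(1)] by blast
    next
      case False
      \<comment> \<open>A point outside the chart domain has the complement of \<open>K\<close> as a
        neighbourhood on which \<eta> is zero.\<close>
      let ?W = "points M - K"
      have W: "openin (mtop M) ?W" using K by blast
      have "smooth_fun M ?W \<eta>"
        by (rule smooth_fun_cong[OF smooth_fun_const[OF M W, of 0] _ M]) (use \<eta>0 in auto)
      then show ?thesis using False y KV by blast
    qed
  qed
  then show ?thesis
    by (rule that[OF _ _ K _ \<eta>0]) (use KV b1 C in \<open>auto simp: \<eta>_def\<close>)
qed

section \<open>Covariantly constant sections\<close>

lemma cov_const_sections_iff:
  "s \<in> carrier (cov_const_sections M L P D U) \<longleftrightarrow> s \<in> carrier (sections M L U) \<and>
    (\<forall>X\<in>subbundle_sections M P U. D U X s = \<zero>\<^bsub>sections M L U\<^esub>)"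
  by (simp add: cov_const_sections_def)

lemma cov_const_sections_ops [simp]:
  "zero (cov_const_sections M L P D U) = \<zero>\<^bsub>sections M L U\<^esub>"
  "add (cov_const_sections M L P D U) = add (sections M L U)"
  "smult (cov_const_sections M L P D U) = smult (sections M L U)"
  by (simp_all add: cov_const_sections_def)

lemma subbundle_vector_field: "X \<in> subbundle_sections M P U \<Longrightarrow> X \<in> vector_fields M U"
  by (simp add: subbundle_sections_def)

context
  fixes M :: "('a, 'e::{real_inner,banach}) mfd" and L :: "('l, 'f::{real_inner,banach}, 'a) lbundle"
    and D :: "('a, 'l) conn"
  assumes M: "smooth_atlas M" and L: "complex_line_bundle M L" and D: "connection M L D"
begin

lemma cov_const_add_closed:
  assumes U: "openin (mtop M) U" and s: "s \<in> carrier (cov_const_sections M L P D U)"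
    and t: "t \<in> carrier (cov_const_sections M L P D U)"
  shows "s \<oplus>\<^bsub>sections M L U\<^esub> t \<in> carrier (cov_const_sections M L P D U)"
proof -
  note st = s[unfolded cov_const_sections_iff, THEN conjunct1] t[unfolded cov_const_sections_iff, THEN conjunct1]
  interpret A: abelian_group "sections M L U" by (rule sections_abelian_group[OF M L U])
  have "D U X (s \<oplus>\<^bsub>sections M L U\<^esub> t) = \<zero>\<^bsub>sections M L U\<^esub>" if X: "X \<in> subbundle_sections M P U" for X
    using conn_add[OF M L D U subbundle_vector_field[OF X] st] s t X by (simp add: cov_const_sections_iff)
  then show ?thesis using st by (simp add: cov_const_sections_iff)
qed

text \<open>The premise on \<open>s\<close> is conditional on \<open>z\<close> being non-zero: for
  \<open>z = 0\<close> the lemma says that the zero section is covariantly constant, and this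
  instance starts the group structure.\<close>

lemma cov_const_smult_closed:
  assumes U: "openin (mtop M) U" and s: "s \<in> carrier (sections M L U)"
    and D0: "\<And>X. X \<in> subbundle_sections M P U \<Longrightarrow> z \<noteq> 0 \<Longrightarrow> D U X s = \<zero>\<^bsub>sections M L U\<^esub>"
  shows "z \<odot>\<^bsub>sections M L U\<^esub> s \<in> carrier (cov_const_sections M L P D U)"
  unfolding cov_const_sections_iff sections_smult_const[OF M L]
proof (intro conjI ballI)
  have c: "smooth_fun M U (\<lambda>x. z)" by (rule smooth_fun_const[OF M U])
  show "fun_smult L U (\<lambda>x. z) s \<in> carrier (sections M L U)" by (rule sections_smult_closed[OF M L U s c])
  fix X assume X: "X \<in> subbundle_sections M P U"
  note Xv = subbundle_vector_field[OF X]
  show "D U X (fun_smult L U (\<lambda>x. z) s) = \<zero>\<^bsub>sections M L U\<^esub>"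
    unfolding conn_Leibniz[OF M L D U Xv s c]
  proof
    fix x
    show "(fun_smult L U (\<lambda>x. cderiv (X x) (\<lambda>x. z)) s \<oplus>\<^bsub>sections M L U\<^esub> fun_smult L U (\<lambda>x. z) (D U X s)) x =
        \<zero>\<^bsub>sections M L U\<^esub> x"
    proof (cases "x \<in> U")
      case True
      then have xp: "x \<in> points M" using U openin_subset by blast
      have "cderiv (X x) (\<lambda>x. z) = 0" by (rule cderiv_const[OF M vector_field_tangent[OF M Xv True] xp])
      moreover have "z \<odot>\<^bsub>fibre L x\<^esub> D U X s x = \<zero>\<^bsub>fibre L x\<^esub>"
      proof (cases "z = 0")
        case True
        then show ?thesis using fibre_smult_zero[OF M L xp conn_fibre[OF M L D U Xv s \<open>x \<in> U\<close>]] by simp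
      next
        case False
        have "0 \<odot>\<^bsub>fibre L x\<^esub> s x = \<zero>\<^bsub>fibre L x\<^esub>" by (rule fibre_smult_zero[OF M L xp section_fibre[OF M L s True]])
        then have "z \<odot>\<^bsub>fibre L x\<^esub> \<zero>\<^bsub>fibre L x\<^esub> = \<zero>\<^bsub>fibre L x\<^esub>"
          using fibre_smult_mult[OF M L xp section_fibre[OF M L s True], of z 0] by simp
        then show ?thesis using D0[OF X False] True by (simp add: sections_def)
      qed
      moreover have "\<zero>\<^bsub>fibre L x\<^esub> \<oplus>\<^bsub>fibre L x\<^esub> \<zero>\<^bsub>fibre L x\<^esub> = \<zero>\<^bsub>fibre L x\<^esub>"
        using abelian_monoid.l_zero[OF abelian_group.axioms(1)[OF fibre_abelian_group[OF M L xp]]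
            fibre_zero_closed[OF M L xp]] .
      ultimately show ?thesis
        using True fibre_smult_zero[OF M L xp section_fibre[OF M L s True]] by (simp add: sections_def fun_smult_def)
    qed (simp add: sections_def)
  qed
qed

lemma cov_const_abelian_group:
  assumes U: "openin (mtop M) U"
  shows "abelian_group (cov_const_sections M L P D U)"
proof -
  interpret A: abelian_group "sections M L U" by (rule sections_abelian_group[OF M L U])
  have zero_smult: "0 \<odot>\<^bsub>sections M L U\<^esub> s = \<zero>\<^bsub>sections M L U\<^esub>" if s: "s \<in> carrier (sections M L U)" for s
    unfolding sections_def
    by (simp, rule restrict_ext) (use fibre_smult_zero[OF M L _ section_fibre[OF M L s]] openin_subset[OF U] in blast)
  show ?thesis
  proof (rule abelian_groupI, unfold cov_const_sections_ops)
    show "\<zero>\<^bsub>sections M L U\<^esub> \<in> carrier (cov_const_sections M L P D U)"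
      using cov_const_smult_closed[OF U A.zero_closed, of P 0] zero_smult[OF A.zero_closed] by simp
    fix s assume s: "s \<in> carrier (cov_const_sections M L P D U)"
    have ss: "s \<in> carrier (sections M L U)" using s by (simp add: cov_const_sections_iff)
    let ?n = "(-1) \<odot>\<^bsub>sections M L U\<^esub> s"
    have n: "?n \<in> carrier (cov_const_sections M L P D U)"
      by (rule cov_const_smult_closed[OF U ss]) (use s in \<open>simp add: cov_const_sections_iff\<close>)
    have "?n \<oplus>\<^bsub>sections M L U\<^esub> s = \<zero>\<^bsub>sections M L U\<^esub>"
    proof
      fix x
      show "(?n \<oplus>\<^bsub>sections M L U\<^esub> s) x = \<zero>\<^bsub>sections M L U\<^esub> x"
      proof (cases "x \<in> U")
        case True
        then have xp: "x \<in> points M" using U openin_subset by blast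
        note sx = section_fibre[OF M L ss True]
        show ?thesis
          using True fibre_smult_add[OF M L xp sx, of "-1" 1] fibre_smult_one[OF M L xp sx] fibre_smult_zero[OF M L xp sx]
          by (simp add: sections_def)
      qed (simp add: sections_def)
    qed
    then show "\<exists>t\<in>carrier (cov_const_sections M L P D U). t \<oplus>\<^bsub>sections M L U\<^esub> s = \<zero>\<^bsub>sections M L U\<^esub>"
      using n by blast
  qed (auto simp: cov_const_sections_iff cov_const_add_closed[OF U, unfolded cov_const_sections_iff]
      A.a_ac)
qed

text \<open>A section of \<open>P\<close> over \<open>V\<close> need not extend to \<open>U\<close>, but its product with a bump function does.\<close>

lemma cov_const_restrict:
  assumes SM: "smooth_manifold M"
    and P: "\<And>x v a. x \<in> points M \<Longrightarrow> v \<in> P x \<Longrightarrow> (\<lambda>f. a * v f) \<in> P x" "\<And>x. x \<in> points M \<Longrightarrow> (\<lambda>f. 0) \<in> P x"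
    and U: "openin (mtop M) U" and V: "openin (mtop M) V" "V \<subseteq> U"
    and s: "s \<in> carrier (cov_const_sections M L P D U)"
  shows "restrict s V \<in> carrier (cov_const_sections M L P D V)"
  unfolding cov_const_sections_iff
proof (intro conjI ballI)
  have ss: "s \<in> carrier (sections M L U)" using s by (simp add: cov_const_sections_iff)
  show sV: "restrict s V \<in> carrier (sections M L V)" by (rule section_restrict[OF M L ss U V])
  fix X assume X: "X \<in> subbundle_sections M P V"
  note Xv = subbundle_vector_field[OF X]
  have pU: "y \<in> points M" if "y \<in> U" for y using that U openin_subset by blast
  show "D V X (restrict s V) = \<zero>\<^bsub>sections M L V\<^esub>"
  proof
    fix x
    show "D V X (restrict s V) x = \<zero>\<^bsub>sections M L V\<^esub> x"
    proof (cases "x \<in> V")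
      case True
      obtain \<eta> :: "'a \<Rightarrow> real" and K where \<eta>: "smooth_fun M (points M) \<eta>" "\<eta> x = 1" "closedin (mtop M) K" "K \<subseteq> V"
        "\<And>y. y \<notin> K \<Longrightarrow> \<eta> y = 0" by (rule bump_function[OF SM V(1) True]) (rule that)
      have \<eta>V: "smooth_fun M V \<eta>" by (rule smooth_fun_subset[OF M \<eta>(1) V(1)]) (use V openin_subset in blast)
      \<comment> \<open>The product \<eta> X on \<open>V\<close>, extended by zero to
        \<open>U\<close>. It is smooth because \<eta> vanishes off the closed set \<open>K\<close>,
        and it stays in \<open>P\<close> because each \<open>P y\<close> contains 0 and is closed
        under scaling.\<close>
      define Z where "Z = (\<lambda>y\<in>U. if y \<in> V then (\<lambda>f. \<eta> y * X y f) else (\<lambda>f. 0))"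
      have ZX: "restrict Z V = vf_scale V \<eta> X" using V(2) by (auto simp: Z_def vf_scale_def fun_eq_iff)
      have "Z \<in> vector_fields M U"
      proof (rule vector_fieldI[OF M])
        show "Z \<in> extensional U" by (simp add: Z_def)
        fix y assume y: "y \<in> U"
        show "Z y \<in> tangent_space M y"
        proof (cases "y \<in> V")
          case True
          then show ?thesis
            using vector_field_tangent[OF M vf_scale_closed[OF M Xv \<eta>V] True] y by (simp add: Z_def vf_scale_def)
        qed (use y tangent_space_zero in \<open>simp add: Z_def\<close>)
      next
        fix W and f :: "'a \<Rightarrow> real" assume W: "W \<subseteq> U" and f: "smooth_fun M W f"
        note Wo = smooth_fun_open[OF f]
        show "smooth_fun M W (\<lambda>y. Z y f)"
        proof (rule smooth_fun_local)
          fix y assume y: "y \<in> W"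
          show "\<exists>N. y \<in> N \<and> N \<subseteq> W \<and> smooth_fun M N (\<lambda>y. Z y f)"
          proof (cases "y \<in> V")
            case yV: True
            have WV: "openin (mtop M) (W \<inter> V)" using Wo V(1) by blast
            have fWV: "smooth_fun M (W \<inter> V) f" by (rule smooth_fun_subset[OF M f WV]) auto
            have "smooth_fun M (W \<inter> V) (\<lambda>y. vf_scale V \<eta> X y f)"
              by (rule vector_field_smooth[OF M vf_scale_closed[OF M Xv \<eta>V] fWV]) auto
            then have "smooth_fun M (W \<inter> V) (\<lambda>y. Z y f)"
              by (rule smooth_fun_cong[OF _ _ M]) (use W in \<open>auto simp: Z_def vf_scale_def\<close>)
            then show ?thesis using y yV by blast
          next
            case False
            have WK: "openin (mtop M) (W - K)" using Wo \<eta>(3) openin_diff by blast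
            have "smooth_fun M (W - K) (\<lambda>y. Z y f)"
              by (rule smooth_fun_cong[OF smooth_fun_const[OF M WK, of 0] _ M])
                (use W \<eta>(5) in \<open>auto simp: Z_def\<close>)
            then show ?thesis using y False \<eta>(4) by blast
          qed
        qed
      qed
      moreover have "Z y \<in> P y" if y: "y \<in> U" for y
        using P(1)[OF pU[OF y], of "X y" "\<eta> y"] P(2)[OF pU[OF y]] X y by (simp add: Z_def subbundle_sections_def)
      ultimately have Z: "Z \<in> subbundle_sections M P U" by (simp add: subbundle_sections_def)
      then have "D U Z s = \<zero>\<^bsub>sections M L U\<^esub>" using s by (simp add: cov_const_sections_iff)
      then have "D V (vf_scale V \<eta> X) (restrict s V) x = \<zero>\<^bsub>fibre L x\<^esub>"
        using fun_cong[OF conn_restrict[OF M L D U subbundle_vector_field[OF Z] ss V], of x] True V(2)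
        by (auto simp: ZX sections_def)
      \<comment> \<open>Since \<eta> equals 1 at \<open>x\<close>, the derivative along \<eta> X and
        the derivative along \<open>X\<close> coincide there.\<close>
      then show ?thesis
        using conn_vf_scale[OF M L D V(1) Xv sV \<eta>V] True \<eta>(2) V(2)
          fibre_smult_one[OF M L pU conn_fibre[OF M L D V(1) Xv sV True]]
        by (auto simp: fun_smult_def sections_def)
    next
      case False
      then show ?thesis
        using section_extensional[OF M L conn_closed[OF M L D V(1) Xv sV]] by (simp add: sections_def extensional_def)
    qed
  qed
qed

end

section \<open>Transport of sections along a global flat lift\<close>

context
  fixes M :: "('a, 'e::{real_inner,banach}) mfd" and L :: "('l, 'f::{real_inner,banach}, 'a) lbundle"
    and D :: "('a, 'l) conn" and \<Phi> :: "'a \<Rightarrow> 'a" and F :: "'l \<Rightarrow> 'l" and P :: "'a \<Rightarrow> 'a tvec set"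
  assumes M: "smooth_atlas M" and L: "complex_line_bundle M L" and D: "connection M L D"
    and \<Phi>: "diffeo M M \<Phi>" and F: "flat_lift M L D \<Phi> (points M) F"
    and P: "\<And>x. x \<in> points M \<Longrightarrow> P x \<subseteq> tangent_space M x"
begin

lemma lift_inverse:
  assumes x: "x \<in> points M"
  shows "l \<in> carrier (fibre L x) \<Longrightarrow> inv_into (points (total L)) F (F l) = l"
    and "m \<in> carrier (fibre L (\<Phi> x)) \<Longrightarrow> inv_into (points (total L)) F m \<in> carrier (fibre L x)"
    and "m \<in> carrier (fibre L (\<Phi> x)) \<Longrightarrow> F (inv_into (points (total L)) F m) = m"
proof -
  have inj: "inj_on F (points (total L))"
    using flat_lift_bundle_lift[OF M L D \<Phi> F] by (simp add: bundle_lift_def diffeo_def bij_betw_def)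
  show 1: "inv_into (points (total L)) F (F l) = l" if "l \<in> carrier (fibre L x)" for l
    using that fibre_carrier[OF M L x] inj by simp
  have "\<exists>l\<in>carrier (fibre L x). F l = m" if "m \<in> carrier (fibre L (\<Phi> x))" for m
  proof -
    have "m \<in> F ` carrier (fibre L x)"
      using flat_lift_fibre_linear(1)[OF M L D \<Phi> F x] that by (simp add: bij_betw_def)
    then show ?thesis by blast
  qed
  then show "m \<in> carrier (fibre L (\<Phi> x)) \<Longrightarrow> inv_into (points (total L)) F m \<in> carrier (fibre L x)"
    "m \<in> carrier (fibre L (\<Phi> x)) \<Longrightarrow> F (inv_into (points (total L)) F m) = m"
    using 1 by metis+
qed

lemma pull_push:
  assumes V: "openin (mtop M) V" and t: "t \<in> carrier (sections M L V)"
  shows "sect_pull M L \<Phi> F (\<Phi> ` V) (sect_push M \<Phi> F (\<Phi> ` V) t) = t"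
proof
  fix x
  have Vp: "V \<subseteq> points M" using V openin_subset by blast
  show "sect_pull M L \<Phi> F (\<Phi> ` V) (sect_push M \<Phi> F (\<Phi> ` V) t) x = t x"
    using lift_inverse(1)[of x, OF _ section_fibre[OF M L t]] Vp section_extensional[OF M L t]
    by (cases "x \<in> V") (auto simp: sect_pull_def preim_image[OF M \<Phi> Vp] sect_push_apply[OF M L D \<Phi> _ Vp] extensional_def)
qed

lemma push_pull:
  assumes U: "openin (mtop M) U" and s: "s \<in> carrier (sections M L U)"
  shows "sect_push M \<Phi> F U (sect_pull M L \<Phi> F U s) = s"
proof
  fix y
  show "sect_push M \<Phi> F U (sect_pull M L \<Phi> F U s) y = s y"
  proof (cases "y \<in> U")
    case True
    let ?x = "inv_into (points M) \<Phi> y"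
    have yp: "y \<in> points M" using True U openin_subset by blast
    have x: "?x \<in> points M" "\<Phi> ?x = y" using diffeo_inv_in_points[OF M \<Phi> yp] diffeo_inv_right[OF M \<Phi> yp] .
    show ?thesis
      using True x lift_inverse(3)[OF x(1), of "s y"] section_fibre[OF M L s True]
      by (simp add: sect_push_def sect_pull_def preim_def)
  next
    case False
    then show ?thesis using section_extensional[OF M L s] by (simp add: sect_push_def extensional_def)
  qed
qed

lemma sect_pull_section:
  assumes U: "openin (mtop M) U" and s: "s \<in> carrier (sections M L U)"
  shows "sect_pull M L \<Phi> F U s \<in> carrier (sections M L (preim M \<Phi> U))"
  unfolding section_carrier[OF M L]
proof (intro conjI ballI)
  let ?V = "preim M \<Phi> U"
  have V: "openin (mtop M) ?V" by (rule openin_preim[OF M \<Phi> U])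
  note aV = smooth_atlas_submfd[OF M V] and aU = smooth_atlas_submfd[OF M U] and N = total_atlas[OF M L]
  show "sect_pull M L \<Phi> F U s \<in> extensional ?V" by (simp add: sect_pull_def)
  show "sect_pull M L \<Phi> F U s x \<in> carrier (fibre L x)" if "x \<in> ?V" for x
    using that lift_inverse(2)[of x "s (\<Phi> x)"] section_fibre[OF M L s, of "\<Phi> x"] by (simp add: sect_pull_def preim_def)
  have "smooth_map (open_submfd M ?V) (open_submfd M U) \<Phi>"
    unfolding smooth_map_into_submfd[OF M U] points_submfd[OF V]
    using smooth_map_restrict_domain[OF M V diffeo_smooth(1)[OF M \<Phi>] M] by (simp add: image_subset_iff) (simp add: preim_def)
  moreover have "smooth_map (open_submfd M U) (total L) s" using s by (simp add: section_carrier[OF M L])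
  ultimately have "smooth_map (open_submfd M ?V) (total L) (\<lambda>x. s (\<Phi> x))"
    by (rule smooth_map_compose[OF aV aU])
  then have "smooth_map (open_submfd M ?V) (total L) (\<lambda>x. inv_into (points (total L)) F (s (\<Phi> x)))"
    by (rule smooth_map_compose[OF aV N])
      (use flat_lift_bundle_lift[OF M L D \<Phi> F] in \<open>simp add: bundle_lift_def diffeo_def\<close>)
  then show "smooth_map (open_submfd M ?V) (total L) (sect_pull M L \<Phi> F U s)"
    by (rule smooth_map_cong[OF aV]) (simp add: points_submfd[OF V] sect_pull_def)
qed

text \<open>Push-forward by \<Phi> carries sections of the pulled-back polarization to sections of
  \<open>P\<close>. So the push of the derivative of the pulled-back section is a derivative of
  \<open>s\<close> along \<open>P\<close>, hence zero, and \<open>F\<close> kills no non-zero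
  vector.\<close>

lemma sect_pull_cov_const:
  assumes U: "openin (mtop M) U" and s: "s \<in> carrier (cov_const_sections M L P D U)"
  shows "sect_pull M L \<Phi> F U s \<in> carrier (cov_const_sections M L (pullback_polarization M \<Phi> P) D (preim M \<Phi> U))"
  unfolding cov_const_sections_iff
proof (intro conjI ballI)
  let ?V = "preim M \<Phi> U" and ?t = "sect_pull M L \<Phi> F U s"
  have ss: "s \<in> carrier (sections M L U)" using s by (simp add: cov_const_sections_iff)
  have Up: "U \<subseteq> points M" using U openin_subset by blast
  have V: "openin (mtop M) ?V" by (rule openin_preim[OF M \<Phi> U])
  have Vp: "?V \<subseteq> points M" by (auto simp: preim_def)
  have \<Phi>V: "\<Phi> ` ?V = U" by (rule image_preim[OF M \<Phi> Up])
  show t: "?t \<in> carrier (sections M L ?V)" by (rule sect_pull_section[OF U ss])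
  fix X assume X: "X \<in> subbundle_sections M (pullback_polarization M \<Phi> P) ?V"
  note Xv = subbundle_vector_field[OF X]
  have "vf_push M \<Phi> ?V X y \<in> P y" if "y \<in> U" for y
  proof -
    obtain x where x: "x \<in> ?V" "y = \<Phi> x" using \<open>y \<in> U\<close> \<Phi>V by blast
    have xp: "x \<in> points M" using x Vp by blast
    obtain w where w: "w \<in> P (\<Phi> x)" "X x = tangent_map M M (inv_into (points M) \<Phi>) (\<Phi> x) w"
      using X x(1) by (auto simp: subbundle_sections_def pullback_polarization_def)
    have wt: "w \<in> tangent_space M (\<Phi> x)" using P[OF diffeo_in_points[OF M \<Phi> xp]] w(1) by blast
    have "tangent_map M M \<Phi> (inv_into (points M) \<Phi> (\<Phi> x)) (tangent_map M M (inv_into (points M) \<Phi>) (\<Phi> x) w) = w"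
      by (rule tangent_map_inverse[OF M M diffeo_smooth(2,1)[OF M \<Phi>] diffeo_inv_right[OF M \<Phi>]
            diffeo_in_points[OF M \<Phi> xp] wt])
    then have "vf_push M \<Phi> ?V X y = w"
      using vf_push_apply[OF M \<Phi> x(1) Vp] w(2) x(2) diffeo_inv_left[OF M \<Phi> xp] by simp
    then show ?thesis using w(1) x(2) by simp
  qed
  then have "vf_push M \<Phi> ?V X \<in> subbundle_sections M P U"
    using vf_push_closed[OF M \<Phi> Xv V] by (simp add: subbundle_sections_def \<Phi>V)
  then have "sect_push M \<Phi> F U (D ?V X ?t) = \<zero>\<^bsub>sections M L U\<^esub>"
    using flat_lift_section(2)[OF M L D \<Phi> F V Vp t Xv] push_pull[OF U ss] s \<Phi>V
    by (simp add: cov_const_sections_iff)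
  then have push0: "F (D ?V X ?t x) = \<zero>\<^bsub>fibre L (\<Phi> x)\<^esub>" if "x \<in> ?V" for x
    using sect_push_apply[OF M L D \<Phi> that Vp, of F "D ?V X ?t"] that \<Phi>V by (auto simp: sections_def preim_def)
  show "D ?V X ?t = \<zero>\<^bsub>sections M L ?V\<^esub>"
  proof
    fix x
    show "D ?V X ?t x = \<zero>\<^bsub>sections M L ?V\<^esub> x"
      using flat_lift_fibre(3)[OF M L D \<Phi> F _ conn_fibre[OF M L D V Xv t, of x] push0] Vp
        section_extensional[OF M L conn_closed[OF M L D V Xv t]]
      by (cases "x \<in> ?V") (auto simp: sections_def extensional_def)
  qed
qed

text \<open>Every section of \<open>P\<close> over the image is the push-forward of a section of the
  pulled-back polarization, namely of its own push-forward by the inverse of \<Phi>. The derivative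
  along it is the push of a zero section.\<close>

lemma sect_push_cov_const:
  assumes V: "openin (mtop M) V" and t: "t \<in> carrier (cov_const_sections M L (pullback_polarization M \<Phi> P) D V)"
  shows "sect_push M \<Phi> F (\<Phi> ` V) t \<in> carrier (cov_const_sections M L P D (\<Phi> ` V))"
  unfolding cov_const_sections_iff
proof (intro conjI ballI)
  have ts: "t \<in> carrier (sections M L V)" using t by (simp add: cov_const_sections_iff)
  have Vp: "V \<subseteq> points M" using V openin_subset by blast
  show "sect_push M \<Phi> F (\<Phi> ` V) t \<in> carrier (sections M L (\<Phi> ` V))"
    by (rule flat_lift_section(1)[OF M L D \<Phi> F V Vp ts])
  fix Y assume Y: "Y \<in> subbundle_sections M P (\<Phi> ` V)"
  note Yv = subbundle_vector_field[OF Y]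
  let ?\<Psi> = "inv_into (points M) \<Phi>"
  note \<Psi> = diffeo_inverse[OF M \<Phi>]
  have \<Phi>V: "openin (mtop M) (\<Phi> ` V)" "\<Phi> ` V \<subseteq> points M"
    using openin_image[OF M \<Phi> V] openin_subset by blast+
  define X where "X = vf_push M ?\<Psi> (\<Phi> ` V) Y"
  have \<Psi>V: "?\<Psi> ` \<Phi> ` V = V"
    using diffeo_inv_left[OF M \<Phi>] Vp by (force simp: image_image subset_iff)
  have Xx: "X x = tangent_map M M ?\<Psi> (\<Phi> x) (Y (\<Phi> x))" if "x \<in> V" for x
    using vf_push_apply[OF M \<Psi> _ \<Phi>V(2), of "\<Phi> x" Y] that diffeo_inv_left[OF M \<Phi>, of x] Vp by (auto simp: X_def)
  have Xv: "X \<in> vector_fields M V" using vf_push_closed[OF M \<Psi> Yv \<Phi>V(1)] by (simp add: X_def \<Psi>V)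
  have "X x \<in> pullback_polarization M \<Phi> P x" if "x \<in> V" for x
    using Y that unfolding Xx[OF that] by (simp add: pullback_polarization_def subbundle_sections_def)
  then have "X \<in> subbundle_sections M (pullback_polarization M \<Phi> P) V" using Xv by (simp add: subbundle_sections_def)
  then have D0: "D V X t = \<zero>\<^bsub>sections M L V\<^esub>" using t by (simp add: cov_const_sections_iff)
  have "vf_push M \<Phi> V X = Y"
  proof
    fix y
    show "vf_push M \<Phi> V X y = Y y"
    proof (cases "y \<in> \<Phi> ` V")
      case True
      then obtain x where x: "x \<in> V" "y = \<Phi> x" by blast
      have xp: "x \<in> points M" using x Vp by blast
      have "tangent_map M M \<Phi> (?\<Psi> (\<Phi> x)) (tangent_map M M ?\<Psi> (\<Phi> x) (Y (\<Phi> x))) = Y (\<Phi> x)"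
        by (rule tangent_map_inverse[OF M M diffeo_smooth(2,1)[OF M \<Phi>] diffeo_inv_right[OF M \<Phi>]
              diffeo_in_points[OF M \<Phi> xp] vector_field_tangent[OF M Yv]]) (use x in auto)
      then show ?thesis
        using vf_push_apply[OF M \<Phi> x(1) Vp] Xx[OF x(1)] x(2) diffeo_inv_left[OF M \<Phi> xp] by simp
    next
      case False
      then show ?thesis using Yv by (simp add: vf_push_def vector_fields_def extensional_def)
    qed
  qed
  then have "D (\<Phi> ` V) Y (sect_push M \<Phi> F (\<Phi> ` V) t) = sect_push M \<Phi> F (\<Phi> ` V) (D V X t)"
    using flat_lift_section(2)[OF M L D \<Phi> F V Vp ts Xv] by simp
  also have "\<dots> = \<zero>\<^bsub>sections M L (\<Phi> ` V)\<^esub>"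
    unfolding D0
  proof
    fix y
    show "sect_push M \<Phi> F (\<Phi> ` V) \<zero>\<^bsub>sections M L V\<^esub> y = \<zero>\<^bsub>sections M L (\<Phi> ` V)\<^esub> y"
    proof (cases "y \<in> \<Phi> ` V")
      case True
      then obtain x where x: "x \<in> V" "y = \<Phi> x" by blast
      have xp: "x \<in> points M" using x Vp by blast
      note z = fibre_zero_closed[OF M L xp]
      have "F \<zero>\<^bsub>fibre L x\<^esub> = \<zero>\<^bsub>fibre L (\<Phi> x)\<^esub>"
        using flat_lift_fibre(2)[OF M L D \<Phi> F xp z, of 0] fibre_smult_zero[OF M L xp z]
          fibre_smult_zero[OF M L diffeo_in_points[OF M \<Phi> xp] flat_lift_fibre(1)[OF M L D \<Phi> F xp z]] by simp
      then show ?thesis using True x by (simp add: sect_push_apply[OF M L D \<Phi> x(1) Vp] sections_def)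
    qed (simp add: sect_push_def sections_def)
  qed
  finally show "D (\<Phi> ` V) Y (sect_push M \<Phi> F (\<Phi> ` V) t) = \<zero>\<^bsub>sections M L (\<Phi> ` V)\<^esub>" .
qed

lemma sect_push_linear:
  assumes V: "openin (mtop M) V" and s: "s \<in> carrier (sections M L V)" and t: "t \<in> carrier (sections M L V)"
  shows "sect_push M \<Phi> F (\<Phi> ` V) (s \<oplus>\<^bsub>sections M L V\<^esub> t) =
      sect_push M \<Phi> F (\<Phi> ` V) s \<oplus>\<^bsub>sections M L (\<Phi> ` V)\<^esub> sect_push M \<Phi> F (\<Phi> ` V) t"
    and "sect_push M \<Phi> F (\<Phi> ` V) (z \<odot>\<^bsub>sections M L V\<^esub> s) =
      z \<odot>\<^bsub>sections M L (\<Phi> ` V)\<^esub> sect_push M \<Phi> F (\<Phi> ` V) s"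
proof -
  have Vp: "V \<subseteq> points M" using V openin_subset by blast
  have "sect_push M \<Phi> F (\<Phi> ` V) (s \<oplus>\<^bsub>sections M L V\<^esub> t) y =
      (sect_push M \<Phi> F (\<Phi> ` V) s \<oplus>\<^bsub>sections M L (\<Phi> ` V)\<^esub> sect_push M \<Phi> F (\<Phi> ` V) t) y \<and>
      sect_push M \<Phi> F (\<Phi> ` V) (z \<odot>\<^bsub>sections M L V\<^esub> s) y =
      (z \<odot>\<^bsub>sections M L (\<Phi> ` V)\<^esub> sect_push M \<Phi> F (\<Phi> ` V) s) y" for y
  proof (cases "y \<in> \<Phi> ` V")
    case True
    then obtain x where x: "x \<in> V" "y = \<Phi> x" by blast
    have xp: "x \<in> points M" using x Vp by blast
    note st = section_fibre[OF M L s x(1)] section_fibre[OF M L t x(1)]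
    show ?thesis
      using True x flat_lift_fibre_linear(2)[OF M L D \<Phi> F xp st] flat_lift_fibre(2)[OF M L D \<Phi> F xp st(1), of z]
      by (simp add: sections_def sect_push_apply[OF M L D \<Phi> x(1) Vp])
  qed (simp add: sect_push_def sections_def)
  then show "sect_push M \<Phi> F (\<Phi> ` V) (s \<oplus>\<^bsub>sections M L V\<^esub> t) =
      sect_push M \<Phi> F (\<Phi> ` V) s \<oplus>\<^bsub>sections M L (\<Phi> ` V)\<^esub> sect_push M \<Phi> F (\<Phi> ` V) t"
    "sect_push M \<Phi> F (\<Phi> ` V) (z \<odot>\<^bsub>sections M L V\<^esub> s) =
      z \<odot>\<^bsub>sections M L (\<Phi> ` V)\<^esub> sect_push M \<Phi> F (\<Phi> ` V) s" by auto
qed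

text \<open>Pulling is the inverse of pushing, so its linearity is inherited from the push, where it
  is the linearity of \<open>F\<close> on fibres.\<close>

lemma sect_pull_linear:
  assumes U: "openin (mtop M) U" and s: "s \<in> carrier (sections M L U)" and t: "t \<in> carrier (sections M L U)"
  shows "sect_pull M L \<Phi> F U (s \<oplus>\<^bsub>sections M L U\<^esub> t) =
      sect_pull M L \<Phi> F U s \<oplus>\<^bsub>sections M L (preim M \<Phi> U)\<^esub> sect_pull M L \<Phi> F U t"
    and "sect_pull M L \<Phi> F U (z \<odot>\<^bsub>sections M L U\<^esub> s) =
      z \<odot>\<^bsub>sections M L (preim M \<Phi> U)\<^esub> sect_pull M L \<Phi> F U s"
proof -
  let ?V = "preim M \<Phi> U"
  have V: "openin (mtop M) ?V" by (rule openin_preim[OF M \<Phi> U])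
  have \<Phi>V: "\<Phi> ` ?V = U" by (rule image_preim[OF M \<Phi>]) (use U openin_subset in blast)
  note sp = sect_pull_section[OF U s] and tp = sect_pull_section[OF U t]
  note pp = pull_push[OF V, unfolded \<Phi>V]
  have "sect_push M \<Phi> F U (sect_pull M L \<Phi> F U s \<oplus>\<^bsub>sections M L ?V\<^esub> sect_pull M L \<Phi> F U t) = s \<oplus>\<^bsub>sections M L U\<^esub> t"
    using sect_push_linear(1)[OF V sp tp] by (simp add: \<Phi>V push_pull[OF U s] push_pull[OF U t])
  from arg_cong[OF this, of "sect_pull M L \<Phi> F U"]
  show "sect_pull M L \<Phi> F U (s \<oplus>\<^bsub>sections M L U\<^esub> t) =
      sect_pull M L \<Phi> F U s \<oplus>\<^bsub>sections M L ?V\<^esub> sect_pull M L \<Phi> F U t"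
    unfolding pp[OF sections_add_closed[OF M L V sp tp]] by (rule sym)
  have "sect_push M \<Phi> F U (z \<odot>\<^bsub>sections M L ?V\<^esub> sect_pull M L \<Phi> F U s) = z \<odot>\<^bsub>sections M L U\<^esub> s"
    using sect_push_linear(2)[OF V sp sp] by (simp add: \<Phi>V push_pull[OF U s])
  from arg_cong[OF this, of "sect_pull M L \<Phi> F U"]
  show "sect_pull M L \<Phi> F U (z \<odot>\<^bsub>sections M L U\<^esub> s) = z \<odot>\<^bsub>sections M L ?V\<^esub> sect_pull M L \<Phi> F U s"
    unfolding sections_smult_const[OF M L, where U = "preim M \<Phi> U" and z = z]
      pp[OF sections_smult_closed[OF M L V sp smooth_fun_const[OF M V]]] by (rule sym)
qed

lemma sect_pull_restrict:
  "V \<subseteq> U \<Longrightarrow> sect_pull M L \<Phi> F V (restrict s V) = restrict (sect_pull M L \<Phi> F U s) (preim M \<Phi> V)"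
  by (auto simp: sect_pull_def preim_def fun_eq_iff)

end

section \<open>Transport of Cech cohomology\<close>

text \<open>The map on cochains induced by maps \<theta> of sections over a correspondence
  \<open>p\<close> of open sets. Cochains are indexed by lists of sets, so the original list has to
  be recovered from the transported one; this is the purpose of \<open>q\<close>.\<close>

definition cochain_transport ::
    "('a set \<Rightarrow> 'b set) \<Rightarrow> ('b set \<Rightarrow> 'a set) \<Rightarrow> ('a set \<Rightarrow> ('a \<Rightarrow> 'c) \<Rightarrow> ('b \<Rightarrow> 'd)) \<Rightarrow> nat
      \<Rightarrow> 'a set set \<Rightarrow> ('a, 'c) cochain \<Rightarrow> ('b, 'd) cochain" where
  "cochain_transport p q \<theta> n \<U> c = (\<lambda>Vs\<in>cech_index n (p ` \<U>). \<theta> (\<Inter>(set (map q Vs))) (c (map q Vs)))"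

definition cech_pull ::
    "('a set \<Rightarrow> 'b set) \<Rightarrow> ('b set \<Rightarrow> 'a set) \<Rightarrow> ('a set \<Rightarrow> ('a \<Rightarrow> 'c) \<Rightarrow> ('b \<Rightarrow> 'd)) \<Rightarrow> nat
      \<Rightarrow> 'a set set \<times> ('a, 'c) cochain \<Rightarrow> 'b set set \<times> ('b, 'd) cochain" where
  "cech_pull p q \<theta> n = (\<lambda>(\<U>, c). (p ` \<U>, cochain_transport p q \<theta> n \<U> c))"

lemma cech_pull_pair: "cech_pull p q \<theta> n (\<U>, c) = (p ` \<U>, cochain_transport p q \<theta> n \<U> c)"
  by (simp add: cech_pull_def)

lemma cochain_pull_eq: "cochain_pull M L \<Phi> F n = cech_pull (preim M \<Phi>) ((`) \<Phi>) (sect_pull M L \<Phi> F) n"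
  by (simp add: cochain_pull_def cech_pull_def cochain_transport_def Let_def)

section \<open>Indices of covers and groups of cochains\<close>

lemma cech_index_not_Nil: "Us \<in> cech_index n \<U> \<Longrightarrow> Us \<noteq> []"
  by (auto simp: cech_index_def)

lemma cech_index_remove_nth:
  assumes "Us \<in> cech_index (Suc n) \<U>" "k \<le> Suc n"
  shows "remove_nth k Us \<in> cech_index n \<U>" "\<Inter>(set Us) \<subseteq> \<Inter>(set (remove_nth k Us))"
proof -
  have "set (remove_nth k Us) \<subseteq> set Us" by (auto simp: remove_nth_def dest: in_set_takeD in_set_dropD)
  then show "remove_nth k Us \<in> cech_index n \<U>" "\<Inter>(set Us) \<subseteq> \<Inter>(set (remove_nth k Us))"
    using assms by (auto simp: cech_index_def remove_nth_def)
qed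

lemma remove_nth_map: "remove_nth k (map f xs) = map f (remove_nth k xs)"
  by (simp add: remove_nth_def take_map drop_map)

lemma open_cech_index:
  assumes "open_cover T \<U>" "Us \<in> cech_index n \<U>"
  shows "openin T (\<Inter>(set Us))"
  by (rule openin_Inter) (use assms in \<open>auto simp: cech_index_def open_cover_def\<close>)

lemma cech_rel_cocycles: "(z, w) \<in> cech_rel T G n \<Longrightarrow> z \<in> cech_cocycles T G n \<and> w \<in> cech_cocycles T G n"
  by (auto simp: cech_rel_def)

lemma cech_cochains_eqI:
  assumes "c \<in> cech_cochains G n \<U>" "d \<in> cech_cochains G n \<U>" "\<And>Us. Us \<in> cech_index n \<U> \<Longrightarrow> c Us = d Us"
  shows "c = d"
  by (rule PiE_ext[OF assms(1,2)[unfolded cech_cochains_def] assms(3)])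

text \<open>Sections are functions and restriction maps are restrictions of functions, so a presheaf
  is described by its groups and by their closure under restriction.\<close>

locale cech_presheaf =
  fixes T :: "'a topology" and G :: "'a set \<Rightarrow> ('a \<Rightarrow> 'c, 'm) monoid_scheme"
  assumes grp: "\<And>U. openin T U \<Longrightarrow> comm_group (G U)"
    and restr: "\<And>U V s. openin T U \<Longrightarrow> openin T V \<Longrightarrow> V \<subseteq> U \<Longrightarrow> s \<in> carrier (G U) \<Longrightarrow> restrict s V \<in> carrier (G V)"
begin

lemma coboundary_term_closed:
  assumes "open_cover T \<U>" "c \<in> cech_cochains G n \<U>" "Us \<in> cech_index (Suc n) \<U>" "k \<le> Suc n"
  shows "restrict (c (remove_nth k Us)) (\<Inter>(set Us)) \<in> carrier (G (\<Inter>(set Us)))"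
  by (rule restr[OF open_cech_index[OF assms(1) cech_index_remove_nth(1)[OF assms(3,4)]]
        open_cech_index[OF assms(1,3)] cech_index_remove_nth(2)[OF assms(3,4)]
        cech_cochains_mem[OF assms(2) cech_index_remove_nth(1)[OF assms(3,4)]]])

lemma coboundary_closed:
  assumes U: "open_cover T \<U>" and c: "c \<in> cech_cochains G n \<U>"
  shows "cech_coboundary G n \<U> c \<in> cech_cochains G (Suc n) \<U>"
  unfolding cech_cochains_def
proof (rule PiE_I)
  fix Us assume Us: "Us \<in> cech_index (Suc n) \<U>"
  interpret comm_group "G (\<Inter>(set Us))" by (rule grp[OF open_cech_index[OF U Us]])
  show "cech_coboundary G n \<U> c Us \<in> carrier (G (\<Inter>(set Us)))"
    unfolding cech_coboundary_def Let_def restrict_apply'[OF Us]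
    by (rule finprod_closed) (use coboundary_term_closed[OF U c Us] in auto)
qed (simp add: cech_coboundary_def)

lemma one_closed: "open_cover T \<U> \<Longrightarrow> cech_one G n \<U> \<in> cech_cochains G n \<U>"
  unfolding cech_cochains_def
  by (rule PiE_I) (auto simp: cech_one_def intro!: group.is_monoid[THEN monoid.one_closed] comm_group.axioms(2)
      grp open_cech_index)

lemma coboundaries_closed:
  "open_cover T \<U> \<Longrightarrow> b \<in> cech_coboundaries G n \<U> \<Longrightarrow> b \<in> cech_cochains G n \<U>"
  by (cases n) (auto simp: cech_coboundaries_def one_closed coboundary_closed)

lemma mult_closed:
  assumes U: "open_cover T \<U>" and c: "c \<in> cech_cochains G n \<U>" and d: "d \<in> cech_cochains G n \<U>"
  shows "cech_mult G n \<U> c d \<in> cech_cochains G n \<U>"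
  unfolding cech_cochains_def
proof (rule PiE_I)
  fix Us assume Us: "Us \<in> cech_index n \<U>"
  interpret comm_group "G (\<Inter>(set Us))" by (rule grp[OF open_cech_index[OF U Us]])
  show "cech_mult G n \<U> c d Us \<in> carrier (G (\<Inter>(set Us)))"
    using Us cech_cochains_mem[OF c Us] cech_cochains_mem[OF d Us] by (simp add: cech_mult_def)
qed (simp add: cech_mult_def)

lemma refine_index:
  assumes "refinement_map \<W> \<U> \<rho>" "Ws \<in> cech_index n \<W>"
  shows "map \<rho> Ws \<in> cech_index n \<U>" "\<Inter>(set Ws) \<subseteq> \<Inter>(set (map \<rho> Ws))"
  using assms by (fastforce simp: cech_index_def refinement_map_def)+

lemma refine_closed:
  assumes U: "open_cover T \<U>" and W: "open_cover T \<W>" and \<rho>: "refinement_map \<W> \<U> \<rho>" and c: "c \<in> cech_cochains G n \<U>"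
  shows "cech_refine n \<W> \<rho> c \<in> cech_cochains G n \<W>"
  unfolding cech_cochains_def
proof (rule PiE_I)
  fix Ws assume Ws: "Ws \<in> cech_index n \<W>"
  note r = refine_index[OF \<rho> Ws]
  show "cech_refine n \<W> \<rho> c Ws \<in> carrier (G (\<Inter>(set Ws)))"
    unfolding cech_refine_def restrict_apply'[OF Ws]
    by (rule restr[OF open_cech_index[OF U r(1)] open_cech_index[OF W Ws] r(2) cech_cochains_mem[OF c r(1)]])
qed (simp add: cech_refine_def)

lemma cocycle_cochain: "(\<U>, c) \<in> cech_cocycles T G n \<Longrightarrow> open_cover T \<U> \<and> c \<in> cech_cochains G n \<U>"
  by (simp add: cech_cocycles_def)

end

lemma finprod_atMost_hom:
  assumes "comm_group G" "comm_group H" "h \<in> hom G H" "\<And>k. k \<le> (n :: nat) \<Longrightarrow> f k \<in> carrier G"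
  shows "h (finprod G f {..n}) = finprod H (\<lambda>k. h (f k)) {..n}"
  using assms(4)
proof (induction n)
  case 0
  interpret G: comm_group G by fact
  interpret H: comm_group H by fact
  have "f 0 \<in> carrier G" "h (f 0) \<in> carrier H" using 0 assms(3) by (auto simp: hom_def)
  then show ?case by simp
next
  case (Suc n)
  interpret G: comm_group G by fact
  interpret H: comm_group H by fact
  have f: "f \<in> {..Suc n} \<rightarrow> carrier G" using Suc.prems by simp
  then have hf: "(\<lambda>k. h (f k)) \<in> {..Suc n} \<rightarrow> carrier H" using assms(3) by (auto simp: hom_def Pi_iff)
  have "h (finprod G f {..Suc n}) = h (f (Suc n)) \<otimes>\<^bsub>H\<^esub> h (finprod G f {..n})"
    unfolding G.finprod_Suc[OF f] using f by (intro hom_mult[OF assms(3)] G.finprod_closed) auto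
  then show ?case unfolding H.finprod_Suc[OF hf] using Suc by simp
qed

text \<open>The assumptions on \<open>p\<close> and \<open>q\<close> are what a homeomorphism does
  to open sets, and \<theta> is a morphism of presheaves over it. Only one direction is described,
  so that an isomorphism can be obtained from two copies with \<open>p\<close> and \<open>q\<close>
  exchanged.\<close>

locale cech_transport =
  G: cech_presheaf T G + H: cech_presheaf T' H
  for T :: "'a topology" and G :: "'a set \<Rightarrow> ('a \<Rightarrow> 'c, 'm) monoid_scheme"
    and T' :: "'b topology" and H :: "'b set \<Rightarrow> ('b \<Rightarrow> 'd, 'n) monoid_scheme" +
  fixes p :: "'a set \<Rightarrow> 'b set" and q :: "'b set \<Rightarrow> 'a set" and \<theta> :: "'a set \<Rightarrow> ('a \<Rightarrow> 'c) \<Rightarrow> ('b \<Rightarrow> 'd)"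
  assumes p_open: "\<And>U. openin T U \<Longrightarrow> openin T' (p U)"
    and q_p: "\<And>U. openin T U \<Longrightarrow> q (p U) = U"
    and p_mono: "\<And>U V. V \<subseteq> U \<Longrightarrow> p V \<subseteq> p U"
    and p_Inter: "\<And>\<U>. \<U> \<noteq> {} \<Longrightarrow> (\<And>U. U \<in> \<U> \<Longrightarrow> openin T U) \<Longrightarrow> p (\<Inter>\<U>) = \<Inter>(p ` \<U>)"
    and p_Union: "\<And>\<U>. (\<And>U. U \<in> \<U> \<Longrightarrow> openin T U) \<Longrightarrow> \<Union>(p ` \<U>) = p (\<Union>\<U>)"
    and p_top: "p (topspace T) = topspace T'"
    and \<theta>_hom: "\<And>U. openin T U \<Longrightarrow> \<theta> U \<in> hom (G U) (H (p U))"
    and \<theta>_restrict: "\<And>U V s. openin T U \<Longrightarrow> openin T V \<Longrightarrow> V \<subseteq> U \<Longrightarrow> s \<in> carrier (G U) \<Longrightarrow>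
      \<theta> V (restrict s V) = restrict (\<theta> U s) (p V)"
begin

abbreviation pull :: "nat \<Rightarrow> 'a set set \<Rightarrow> ('a, 'c) cochain \<Rightarrow> ('b, 'd) cochain" where
  "pull \<equiv> cochain_transport p q \<theta>"

lemma cover_p: "open_cover T \<U> \<Longrightarrow> open_cover T' (p ` \<U>)"
  unfolding open_cover_def using p_open p_Union[of \<U>] p_top by auto

context
  fixes \<U>
  assumes U: "open_cover T \<U>"
begin

lemma index_q_p: "Us \<in> cech_index n \<U> \<Longrightarrow> map q (map p Us) = Us"
  using U q_p by (auto simp: cech_index_def open_cover_def intro!: map_idI)

lemma index_p: "Us \<in> cech_index n \<U> \<Longrightarrow> map p Us \<in> cech_index n (p ` \<U>)"
  by (auto simp: cech_index_def)

lemma index_p_obtain: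
  assumes "Vs \<in> cech_index n (p ` \<U>)"
  obtains Us where "Us \<in> cech_index n \<U>" "Vs = map p Us"
proof
  have *: "q V \<in> \<U> \<and> p (q V) = V" if V: "V \<in> set Vs" for V
  proof -
    obtain W where "W \<in> \<U>" "V = p W" using assms V by (auto simp: cech_index_def)
    then show ?thesis using q_p U by (simp add: open_cover_def)
  qed
  then show "map q Vs \<in> cech_index n \<U>" using assms by (auto simp: cech_index_def)
  show "Vs = map p (map q Vs)" using * by (simp add: map_idI)
qed

lemma index_Inter:
  assumes "Us \<in> cech_index n \<U>"
  shows "\<Inter>(set (map p Us)) = p (\<Inter>(set Us))"
proof -
  have "p (\<Inter>(set Us)) = \<Inter>(p ` set Us)"
    by (rule p_Inter) (use assms U cech_index_not_Nil[OF assms] in \<open>auto simp: cech_index_def open_cover_def\<close>)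
  then show ?thesis by simp
qed

lemma pull_apply:
  assumes Us: "Us \<in> cech_index n \<U>"
  shows "pull n \<U> c (map p Us) = \<theta> (\<Inter>(set Us)) (c Us)"
  unfolding cochain_transport_def restrict_apply'[OF index_p[OF Us]] index_q_p[OF Us] ..

lemma pull_eqI:
  assumes "\<And>Us. Us \<in> cech_index n \<U> \<Longrightarrow> \<theta> (\<Inter>(set Us)) (c Us) = d (map p Us)" "d \<in> extensional (cech_index n (p ` \<U>))"
  shows "pull n \<U> c = d"
proof (rule extensionalityI[OF _ assms(2)])
  show "pull n \<U> c \<in> extensional (cech_index n (p ` \<U>))" by (simp add: cochain_transport_def)
  fix Vs assume "Vs \<in> cech_index n (p ` \<U>)"
  then obtain Us where "Us \<in> cech_index n \<U>" "Vs = map p Us" by (rule index_p_obtain)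
  then show "pull n \<U> c Vs = d Vs" using pull_apply assms(1) by simp
qed

lemma \<theta>_closed:
  assumes "c \<in> cech_cochains G n \<U>" "Us \<in> cech_index n \<U>"
  shows "\<theta> (\<Inter>(set Us)) (c Us) \<in> carrier (H (p (\<Inter>(set Us))))"
  using \<theta>_hom[OF open_cech_index[OF U assms(2)]] cech_cochains_mem[OF assms] by (auto simp: hom_def)

lemma pull_closed:
  assumes c: "c \<in> cech_cochains G n \<U>"
  shows "pull n \<U> c \<in> cech_cochains H n (p ` \<U>)"
  unfolding cech_cochains_def
proof (rule PiE_I)
  fix Vs assume "Vs \<in> cech_index n (p ` \<U>)"
  then obtain Us where Us: "Us \<in> cech_index n \<U>" "Vs = map p Us" by (rule index_p_obtain)
  show "pull n \<U> c Vs \<in> carrier (H (\<Inter>(set Vs)))"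
    unfolding Us(2) pull_apply[OF Us(1)] index_Inter[OF Us(1)] by (rule \<theta>_closed[OF c Us(1)])
qed (simp add: cochain_transport_def)

lemma pull_one: "pull n \<U> (cech_one G n \<U>) = cech_one H n (p ` \<U>)"
proof (rule pull_eqI)
  fix Us assume Us: "Us \<in> cech_index n \<U>"
  note o = open_cech_index[OF U Us]
  interpret A: comm_group "G (\<Inter>(set Us))" by (rule G.grp[OF o])
  interpret B: comm_group "H (p (\<Inter>(set Us)))" by (rule H.grp[OF p_open[OF o]])
  show "\<theta> (\<Inter>(set Us)) (cech_one G n \<U> Us) = cech_one H n (p ` \<U>) (map p Us)"
    using Us index_p[OF Us] index_Inter[OF Us] hom_one[OF \<theta>_hom[OF o] A.is_group B.is_group]
    by (simp add: cech_one_def)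
qed (simp add: cech_one_def)

lemma pull_mult:
  assumes c: "c \<in> cech_cochains G n \<U>" and d: "d \<in> cech_cochains G n \<U>"
  shows "pull n \<U> (cech_mult G n \<U> c d) = cech_mult H n (p ` \<U>) (pull n \<U> c) (pull n \<U> d)"
proof (rule pull_eqI)
  fix Us assume Us: "Us \<in> cech_index n \<U>"
  show "\<theta> (\<Inter>(set Us)) (cech_mult G n \<U> c d Us) =
      cech_mult H n (p ` \<U>) (pull n \<U> c) (pull n \<U> d) (map p Us)"
    unfolding cech_mult_def restrict_apply'[OF Us] restrict_apply'[OF index_p[OF Us]] index_Inter[OF Us] pull_apply[OF Us]
    by (rule hom_mult[OF \<theta>_hom[OF open_cech_index[OF U Us]] cech_cochains_mem[OF c Us] cech_cochains_mem[OF d Us]])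
qed (simp add: cech_mult_def)

text \<open>A homomorphism passes through the alternating product, and each of its factors is a
  restriction, with which \<theta> commutes.\<close>

lemma pull_coboundary:
  assumes c: "c \<in> cech_cochains G n \<U>"
  shows "pull (Suc n) \<U> (cech_coboundary G n \<U> c) = cech_coboundary H n (p ` \<U>) (pull n \<U> c)"
proof (rule pull_eqI)
  fix Us assume Us: "Us \<in> cech_index (Suc n) \<U>"
  let ?W = "\<Inter>(set Us)"
  note o = open_cech_index[OF U Us]
  note hom = \<theta>_hom[OF o]
  interpret A: comm_group "G ?W" by (rule G.grp[OF o])
  interpret B: comm_group "H (p ?W)" by (rule H.grp[OF p_open[OF o]])
  note t = G.coboundary_term_closed[OF U c Us]
  have "\<theta> ?W (cech_coboundary G n \<U> c Us) =
      finprod (H (p ?W)) (\<lambda>k. \<theta> ?W (restrict (c (remove_nth k Us)) ?W [^]\<^bsub>G ?W\<^esub> ((-1) ^ k :: int))) {..Suc n}"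
    unfolding cech_coboundary_def Let_def restrict_apply'[OF Us]
    by (rule finprod_atMost_hom[OF A.comm_group_axioms B.comm_group_axioms hom]) (use t in simp)
  also have "\<dots> = finprod (H (p ?W)) (\<lambda>k. restrict (pull n \<U> c (remove_nth k (map p Us))) (p ?W)
      [^]\<^bsub>H (p ?W)\<^esub> ((-1) ^ k :: int)) {..Suc n}"
  proof (rule B.finprod_cong')
    fix k assume k: "k \<in> {..Suc n}"
    then have k': "k \<le> Suc n" by simp
    note r = cech_index_remove_nth[OF Us k']
    have "\<theta> ?W (restrict (c (remove_nth k Us)) ?W) = restrict (pull n \<U> c (map p (remove_nth k Us))) (p ?W)"
      unfolding pull_apply[OF r(1)]
      by (rule \<theta>_restrict[OF open_cech_index[OF U r(1)] o r(2) cech_cochains_mem[OF c r(1)]])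
    then show "\<theta> ?W (restrict (c (remove_nth k Us)) ?W [^]\<^bsub>G ?W\<^esub> ((-1) ^ k :: int)) =
        restrict (pull n \<U> c (remove_nth k (map p Us))) (p ?W) [^]\<^bsub>H (p ?W)\<^esub> ((-1) ^ k :: int)"
      using hom_int_pow[OF hom t[OF k'] A.is_group B.is_group] by (simp add: remove_nth_map)
  next
    show "(\<lambda>k. restrict (pull n \<U> c (remove_nth k (map p Us))) (p ?W) [^]\<^bsub>H (p ?W)\<^esub> ((-1) ^ k :: int))
        \<in> {..Suc n} \<rightarrow> carrier (H (p ?W))"
      using H.coboundary_term_closed[OF cover_p[OF U] pull_closed[OF c] index_p[OF Us]]
      unfolding index_Inter[OF Us] by auto
  qed simp
  also have "\<dots> = cech_coboundary H n (p ` \<U>) (pull n \<U> c) (map p Us)"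
    unfolding cech_coboundary_def Let_def restrict_apply'[OF index_p[OF Us]] index_Inter[OF Us] ..
  finally show "\<theta> ?W (cech_coboundary G n \<U> c Us) = cech_coboundary H n (p ` \<U>) (pull n \<U> c) (map p Us)" .
qed (simp add: cech_coboundary_def)

lemma pull_coboundaries:
  "b \<in> cech_coboundaries G n \<U> \<Longrightarrow> pull n \<U> b \<in> cech_coboundaries H n (p ` \<U>)"
  using pull_one[of 0] pull_coboundary pull_closed by (cases n) (auto simp: cech_coboundaries_def)

lemma pull_cocycle:
  "(\<U>, c) \<in> cech_cocycles T G n \<Longrightarrow> (p ` \<U>, pull n \<U> c) \<in> cech_cocycles T' H n"
  using pull_coboundary[of c n] pull_one[of "Suc n"] pull_closed[of c n] cover_p[OF U]
  by (simp add: cech_cocycles_def)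

text \<open>Refinement maps act on sets, so between transported covers a refinement is conjugated by
  \<open>p\<close> and \<open>q\<close>. Compatibility of \<theta> with restriction identifies the
  refined cochains.\<close>

lemma pull_refine:
  assumes W: "open_cover T \<W>" and \<rho>: "refinement_map \<W> \<U> \<rho>" and c: "c \<in> cech_cochains G n \<U>"
  shows "refinement_map (p ` \<W>) (p ` \<U>) (\<lambda>V. p (\<rho> (q V)))"
    and "cech_refine n (p ` \<W>) (\<lambda>V. p (\<rho> (q V))) (pull n \<U> c) \<in> extensional (cech_index n (p ` \<W>))"
    and "Ws \<in> cech_index n \<W> \<Longrightarrow> cech_refine n (p ` \<W>) (\<lambda>V. p (\<rho> (q V))) (pull n \<U> c) (map p Ws) =
      \<theta> (\<Inter>(set Ws)) (cech_refine n \<W> \<rho> c Ws)"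
proof -
  have qp: "q (p W) = W" if "W \<in> \<W>" for W using q_p W that by (simp add: open_cover_def)
  show "refinement_map (p ` \<W>) (p ` \<U>) (\<lambda>V. p (\<rho> (q V)))"
    using \<rho> p_mono by (auto simp: refinement_map_def qp)
  show "cech_refine n (p ` \<W>) (\<lambda>V. p (\<rho> (q V))) (pull n \<U> c) \<in> extensional (cech_index n (p ` \<W>))"
    by (simp add: cech_refine_def)
  assume Ws: "Ws \<in> cech_index n \<W>"
  note r = G.refine_index[OF \<rho> Ws]
  have m: "map (\<lambda>V. p (\<rho> (q V))) (map p Ws) = map p (map \<rho> Ws)"
    using Ws qp by (auto simp: cech_index_def)
  have i: "map p Ws \<in> cech_index n (p ` \<W>)" using Ws by (auto simp: cech_index_def)
  have I: "\<Inter>(set (map p Ws)) = p (\<Inter>(set Ws))"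
  proof -
    have "p (\<Inter>(set Ws)) = \<Inter>(p ` set Ws)"
      by (rule p_Inter) (use Ws W cech_index_not_Nil[OF Ws] in \<open>auto simp: cech_index_def open_cover_def\<close>)
    then show ?thesis by simp
  qed
  show "cech_refine n (p ` \<W>) (\<lambda>V. p (\<rho> (q V))) (pull n \<U> c) (map p Ws) =
      \<theta> (\<Inter>(set Ws)) (cech_refine n \<W> \<rho> c Ws)"
    unfolding cech_refine_def restrict_apply'[OF Ws] restrict_apply'[OF i] m I pull_apply[OF r(1)]
    by (rule \<theta>_restrict[OF open_cech_index[OF U r(1)] open_cech_index[OF W Ws] r(2)
          cech_cochains_mem[OF c r(1)], symmetric])
qed

end

lemma pull_refine_eq:
  assumes "open_cover T \<U>" "open_cover T \<W>" "refinement_map \<W> \<U> \<rho>" "c \<in> cech_cochains G n \<U>"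
  shows "pull n \<W> (cech_refine n \<W> \<rho> c) = cech_refine n (p ` \<W>) (\<lambda>V. p (\<rho> (q V))) (pull n \<U> c)"
  by (rule pull_eqI[OF assms(2) _ pull_refine(2)[OF assms]]) (rule pull_refine(3)[OF assms, symmetric])

text \<open>Transport is well defined on the direct limit: the common refinement, both refinement
  maps and the coboundary are transported together.\<close>

lemma pull_rel:
  assumes "(z, w) \<in> cech_rel T G n"
  shows "(cech_pull p q \<theta> n z, cech_pull p q \<theta> n w) \<in> cech_rel T' H n"
proof -
  obtain \<U> c \<V> d where zw: "z = (\<U>, c)" "w = (\<V>, d)" by (cases z, cases w)
  obtain \<W> \<rho> \<sigma> b where z: "(\<U>, c) \<in> cech_cocycles T G n" "(\<V>, d) \<in> cech_cocycles T G n"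
    and W: "open_cover T \<W>" "refinement_map \<W> \<U> \<rho>" "refinement_map \<W> \<V> \<sigma>" "b \<in> cech_coboundaries G n \<W>"
    and eq: "cech_refine n \<W> \<rho> c = cech_mult G n \<W> (cech_refine n \<W> \<sigma> d) b"
    using assms unfolding cech_rel_def zw by blast
  note U = G.cocycle_cochain[OF z(1), THEN conjunct1] and c = G.cocycle_cochain[OF z(1), THEN conjunct2]
  note V = G.cocycle_cochain[OF z(2), THEN conjunct1] and d = G.cocycle_cochain[OF z(2), THEN conjunct2]
  have "cech_refine n (p ` \<W>) (\<lambda>V. p (\<rho> (q V))) (pull n \<U> c) =
      cech_mult H n (p ` \<W>) (cech_refine n (p ` \<W>) (\<lambda>V. p (\<sigma> (q V))) (pull n \<V> d)) (pull n \<W> b)"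
    unfolding pull_refine_eq[OF U W(1,2) c, symmetric] pull_refine_eq[OF V W(1,3) d, symmetric] eq
    by (rule pull_mult[OF W(1) G.refine_closed[OF V W(1,3) d] G.coboundaries_closed[OF W(1,4)]])
  then show ?thesis
    unfolding zw cech_pull_pair cech_rel_def mem_Collect_eq prod.case
    by (intro conjI exI bexI pull_cocycle[OF U z(1)] pull_cocycle[OF V z(2)])
      (rule cover_p[OF W(1)] pull_refine(1)[OF U W(1,2) c] pull_refine(1)[OF V W(1,3) d]
        pull_coboundaries[OF W(1,4)] | assumption)+
qed

end

section \<open>Isomorphisms on Cech cohomology\<close>

locale cech_iso =
  A: cech_transport T G T' H p q \<theta> + B: cech_transport T' H T G q p \<theta>'
  for T :: "'a topology" and G :: "'a set \<Rightarrow> ('a \<Rightarrow> 'c, 'm) monoid_scheme"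
    and T' :: "'b topology" and H :: "'b set \<Rightarrow> ('b \<Rightarrow> 'd, 'n) monoid_scheme"
    and p q \<theta> \<theta>' +
  assumes inverse_left: "\<And>U s. openin T U \<Longrightarrow> s \<in> carrier (G U) \<Longrightarrow> \<theta>' (p U) (\<theta> U s) = s"
    and inverse_right: "\<And>V t. openin T' V \<Longrightarrow> t \<in> carrier (H V) \<Longrightarrow> \<theta> (q V) (\<theta>' V t) = t"
begin

abbreviation fwd where "fwd n \<equiv> cech_pull p q \<theta> n"
abbreviation bwd where "bwd n \<equiv> cech_pull q p \<theta>' n"

lemma bwd_fwd:
  assumes U: "open_cover T \<U>" and c: "c \<in> cech_cochains G n \<U>"
  shows "bwd n (fwd n (\<U>, c)) = (\<U>, c)"
proof -
  have qp: "q ` p ` \<U> = \<U>" using A.q_p U by (force simp: open_cover_def image_image)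
  note PU = A.cover_p[OF U]
  have "B.pull n (p ` \<U>) (A.pull n \<U> c) = c"
  proof (rule cech_cochains_eqI[OF _ c])
    show "B.pull n (p ` \<U>) (A.pull n \<U> c) \<in> cech_cochains G n \<U>"
      using B.pull_closed[OF PU A.pull_closed[OF U c]] by (simp add: qp)
    fix Us assume Us: "Us \<in> cech_index n \<U>"
    have "B.pull n (p ` \<U>) (A.pull n \<U> c) (map q (map p Us)) = \<theta>' (p (\<Inter>(set Us))) (\<theta> (\<Inter>(set Us)) (c Us))"
      unfolding B.pull_apply[OF PU A.index_p[OF U Us]] A.index_Inter[OF U Us] A.pull_apply[OF U Us] ..
    then show "B.pull n (p ` \<U>) (A.pull n \<U> c) Us = c Us"
      unfolding A.index_q_p[OF U Us] inverse_left[OF open_cech_index[OF U Us] cech_cochains_mem[OF c Us]] .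
  qed
  then show ?thesis by (simp only: cech_pull_pair qp)
qed

lemma bwd_fwd_cocycle: "z \<in> cech_cocycles T G n \<Longrightarrow> bwd n (fwd n z) = z"
  using bwd_fwd A.G.cocycle_cochain by (cases z) blast

lemma fwd_cocycle: "z \<in> cech_cocycles T G n \<Longrightarrow> fwd n z \<in> cech_cocycles T' H n"
  using A.pull_cocycle A.G.cocycle_cochain by (cases z) (simp add: cech_pull_pair)

end

context cech_iso
begin

text \<open>The situation is symmetric in the two directions, so every fact about \<open>fwd\<close>
  below also becomes available for \<open>bwd\<close>.\<close>

sublocale inv: cech_iso T' H T G q p \<theta>' \<theta>
  by unfold_locales (use inverse_left inverse_right in auto)

text \<open>Classes are sets of cocycles, and the induced map on cohomology is the image under
  \<open>fwd\<close>. That the image is a full class uses the inverse: a cocycle related to the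
  image is pulled back, lies in the original class, and is mapped to itself again.\<close>

lemma fwd_class:
  assumes U: "open_cover T \<U>" and c: "c \<in> cech_cochains G n \<U>"
  shows "fwd n ` cech_class T G n (\<U>, c) = cech_class T' H n (fwd n (\<U>, c))"
proof (intro equalityI subsetI)
  fix w assume "w \<in> fwd n ` cech_class T G n (\<U>, c)"
  then show "w \<in> cech_class T' H n (fwd n (\<U>, c))" using A.pull_rel by (auto simp: cech_class_def)
next
  fix w assume "w \<in> cech_class T' H n (fwd n (\<U>, c))"
  then have w: "(fwd n (\<U>, c), w) \<in> cech_rel T' H n" by (simp add: cech_class_def)
  have "(bwd n (fwd n (\<U>, c)), bwd n w) \<in> cech_rel T G n" by (rule B.pull_rel[OF w])
  then have "bwd n w \<in> cech_class T G n (\<U>, c)" by (simp add: bwd_fwd[OF U c] cech_class_def)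
  moreover have "fwd n (bwd n w) = w" using inv.bwd_fwd_cocycle cech_rel_cocycles[OF w] by blast
  ultimately show "w \<in> fwd n ` cech_class T G n (\<U>, c)" by (metis imageI)
qed

lemma group_carrier_subset: "X \<in> carrier (cech_group T G n) \<Longrightarrow> X \<subseteq> cech_cocycles T G n"
  using cech_rel_cocycles by (fastforce simp: cech_group_def quotient_def)

lemma fwd_carrier:
  assumes "X \<in> carrier (cech_group T G n)"
  shows "fwd n ` X \<in> carrier (cech_group T' H n)" "bwd n ` fwd n ` X = X"
proof -
  obtain \<U> c where z: "(\<U>, c) \<in> cech_cocycles T G n" "X = cech_class T G n (\<U>, c)"
    using assms by (auto simp: cech_group_def quotient_def cech_class_def)
  have "fwd n ` X = cech_class T' H n (fwd n (\<U>, c))" unfolding z(2) using fwd_class A.G.cocycle_cochain[OF z(1)] by blast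
  then show "fwd n ` X \<in> carrier (cech_group T' H n)"
    using fwd_cocycle[OF z(1)] by (auto simp: cech_group_def cech_class_def intro: quotientI)
  have "bwd n (fwd n x) = x" if "x \<in> X" for x using bwd_fwd_cocycle group_carrier_subset[OF assms] that by blast
  then show "bwd n ` fwd n ` X = X" by (force simp: image_image)
qed

lemma fwd_one: "fwd n ` \<one>\<^bsub>cech_group T G n\<^esub> = \<one>\<^bsub>cech_group T' H n\<^esub>"
proof -
  have U: "open_cover T {topspace T}" by (simp add: open_cover_def)
  show ?thesis
    using fwd_class[OF U A.G.one_closed[OF U]] A.pull_one[OF U] by (simp add: cech_group_def cech_pull_pair A.p_top)
qed

text \<open>Products in the limit are formed from representatives on one common cover. If two
  representatives have images on the same cover, they must already have lived on the same cover;
  this is used for products below.\<close>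

lemma same_cover:
  assumes "open_cover T \<U>" "open_cover T \<V>" "p ` \<U> = p ` \<V>"
  shows "\<U> = \<V>"
proof -
  have "q ` p ` \<W> = \<W>" if "open_cover T \<W>" for \<W>
    using A.q_p that by (force simp: open_cover_def image_image)
  then show ?thesis using assms by metis
qed

text \<open>The product is a union over all pairs of representatives on a common cover, so the two
  families of pairs have to be matched exactly; no independence of representatives enters.\<close>

lemma fwd_mult:
  assumes X: "X \<in> carrier (cech_group T G n)" and Y: "Y \<in> carrier (cech_group T G n)"
  shows "fwd n ` (X \<otimes>\<^bsub>cech_group T G n\<^esub> Y) = fwd n ` X \<otimes>\<^bsub>cech_group T' H n\<^esub> fwd n ` Y"
proof -
  have cX: "open_cover T \<U> \<and> c \<in> cech_cochains G n \<U>" if "(\<U>, c) \<in> X \<or> (\<U>, c) \<in> Y" for \<U> c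
    using A.G.cocycle_cochain[of \<U> c n] group_carrier_subset[OF X] group_carrier_subset[OF Y] that by blast
  have cl: "fwd n ` cech_class T G n (\<U>, cech_mult G n \<U> c d) =
      cech_class T' H n (p ` \<U>, cech_mult H n (p ` \<U>) (A.pull n \<U> c) (A.pull n \<U> d))"
    if "(\<U>, c) \<in> X" "(\<U>, d) \<in> Y" for \<U> c d
  proof -
    have m: "open_cover T \<U>" "c \<in> cech_cochains G n \<U>" "d \<in> cech_cochains G n \<U>" using cX that by blast+
    show ?thesis
      unfolding fwd_class[OF m(1) A.G.mult_closed[OF m]] cech_pull_pair A.pull_mult[OF m] ..
  qed
  have "{cech_class T' H n (\<V>, cech_mult H n \<V> c d) | \<V> c d. (\<V>, c) \<in> fwd n ` X \<and> (\<V>, d) \<in> fwd n ` Y} =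
      (`) (fwd n) ` {cech_class T G n (\<U>, cech_mult G n \<U> c d) | \<U> c d. (\<U>, c) \<in> X \<and> (\<U>, d) \<in> Y}" (is "?L = ?R")
  proof (intro equalityI subsetI)
    fix K assume "K \<in> ?L"
    then obtain \<V> c' d' where K: "K = cech_class T' H n (\<V>, cech_mult H n \<V> c' d')"
      "(\<V>, c') \<in> fwd n ` X" "(\<V>, d') \<in> fwd n ` Y" by blast
    obtain \<U> c where c: "(\<U>, c) \<in> X" "\<V> = p ` \<U>" "c' = A.pull n \<U> c" using K(2) by (auto simp: cech_pull_pair)
    obtain \<U>' d where d: "(\<U>', d) \<in> Y" "\<V> = p ` \<U>'" "d' = A.pull n \<U>' d" using K(3) by (auto simp: cech_pull_pair)
    have "\<U>' = \<U>" by (rule same_cover) (use cX c d in blast)+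
    then have "K = fwd n ` cech_class T G n (\<U>, cech_mult G n \<U> c d)"
      using cl[of \<U> c d] K(1) c d by simp
    then show "K \<in> ?R" using c(1) d(1) \<open>\<U>' = \<U>\<close> by blast
  next
    fix K assume "K \<in> ?R"
    then obtain \<U> c d where K: "K = fwd n ` cech_class T G n (\<U>, cech_mult G n \<U> c d)" "(\<U>, c) \<in> X" "(\<U>, d) \<in> Y" by blast
    have "(p ` \<U>, A.pull n \<U> c) \<in> fwd n ` X" "(p ` \<U>, A.pull n \<U> d) \<in> fwd n ` Y"
      using K(2,3) cech_pull_pair by (metis imageI)+
    then show "K \<in> ?L" unfolding K(1) cl[OF K(2,3)] by blast
  qed
  then show ?thesis by (simp add: cech_group_def image_Union)
qed

text \<open>The monoids \<open>G U\<close> and \<open>H V\<close> know addition only, so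
  multiplication by a fixed scalar enters through operations \<open>a\<close> and \<open>b\<close>
  that \<theta> intertwines.\<close>

lemma fwd_smult:
  assumes X: "X \<in> carrier (cech_group T G n)"
    and a: "\<And>U s. openin T U \<Longrightarrow> s \<in> carrier (G U) \<Longrightarrow> a U s \<in> carrier (G U)"
    and b: "\<And>U s. openin T U \<Longrightarrow> s \<in> carrier (G U) \<Longrightarrow> \<theta> U (a U s) = b (p U) (\<theta> U s)"
  shows "fwd n ` \<Union>{cech_class T G n (\<U>, \<lambda>Us\<in>cech_index n \<U>. a (\<Inter>(set Us)) (c Us)) | \<U> c. (\<U>, c) \<in> X} =
    \<Union>{cech_class T' H n (\<V>, \<lambda>Vs\<in>cech_index n \<V>. b (\<Inter>(set Vs)) (c Vs)) | \<V> c. (\<V>, c) \<in> fwd n ` X}"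
proof -
  have cl: "fwd n ` cech_class T G n (\<U>, \<lambda>Us\<in>cech_index n \<U>. a (\<Inter>(set Us)) (c Us)) =
      cech_class T' H n (p ` \<U>, \<lambda>Vs\<in>cech_index n (p ` \<U>). b (\<Inter>(set Vs)) (A.pull n \<U> c Vs))"
    if z: "(\<U>, c) \<in> X" for \<U> c
  proof -
    have U: "open_cover T \<U>" and c: "c \<in> cech_cochains G n \<U>"
      using A.G.cocycle_cochain[of \<U> c n] group_carrier_subset[OF X] z by blast+
    note m = open_cech_index[OF U] and s = cech_cochains_mem[OF c]
    have "(\<lambda>Us\<in>cech_index n \<U>. a (\<Inter>(set Us)) (c Us)) \<in> cech_cochains G n \<U>"
      unfolding cech_cochains_def by (rule PiE_I) (use a m s in auto)
    note fwd_class[OF U this]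
    moreover have "A.pull n \<U> (\<lambda>Us\<in>cech_index n \<U>. a (\<Inter>(set Us)) (c Us)) =
        (\<lambda>Vs\<in>cech_index n (p ` \<U>). b (\<Inter>(set Vs)) (A.pull n \<U> c Vs))"
    proof (rule A.pull_eqI[OF U])
      fix Us assume Us: "Us \<in> cech_index n \<U>"
      show "\<theta> (\<Inter>(set Us)) ((\<lambda>Us\<in>cech_index n \<U>. a (\<Inter>(set Us)) (c Us)) Us) =
          (\<lambda>Vs\<in>cech_index n (p ` \<U>). b (\<Inter>(set Vs)) (A.pull n \<U> c Vs)) (map p Us)"
        unfolding restrict_apply'[OF Us] restrict_apply'[OF A.index_p[OF U Us]] A.index_Inter[OF U Us] A.pull_apply[OF U Us]
        by (rule b[OF m[OF Us] s[OF Us]])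
    qed simp
    ultimately show ?thesis by (simp only: cech_pull_pair)
  qed
  have "{cech_class T' H n (\<V>, \<lambda>Vs\<in>cech_index n \<V>. b (\<Inter>(set Vs)) (c Vs)) | \<V> c. (\<V>, c) \<in> fwd n ` X} =
      (`) (fwd n) ` {cech_class T G n (\<U>, \<lambda>Us\<in>cech_index n \<U>. a (\<Inter>(set Us)) (c Us)) | \<U> c. (\<U>, c) \<in> X}" (is "?L = ?R")
  proof (intro equalityI subsetI)
    fix K assume "K \<in> ?L"
    then obtain \<V> c' where K: "K = cech_class T' H n (\<V>, \<lambda>Vs\<in>cech_index n \<V>. b (\<Inter>(set Vs)) (c' Vs))"
      "(\<V>, c') \<in> fwd n ` X" by blast
    obtain \<U> c where c: "(\<U>, c) \<in> X" "\<V> = p ` \<U>" "c' = A.pull n \<U> c" using K(2) by (auto simp: cech_pull_pair)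
    then show "K \<in> ?R" unfolding K(1) c(2,3) cl[OF c(1), symmetric] by blast
  next
    fix K assume "K \<in> ?R"
    then obtain \<U> c where K: "K = fwd n ` cech_class T G n (\<U>, \<lambda>Us\<in>cech_index n \<U>. a (\<Inter>(set Us)) (c Us))" "(\<U>, c) \<in> X" by blast
    have "(p ` \<U>, A.pull n \<U> c) \<in> fwd n ` X" using K(2) cech_pull_pair by (metis imageI)
    then show "K \<in> ?L" unfolding K(1) cl[OF K(2)] by blast
  qed
  then show ?thesis by (simp add: image_Union)
qed

end

text \<open>Preservation of zero in both directions keeps finite support and makes the degreewise
  map commute with the inclusions of the graded pieces.\<close>

lemma graded_isoI:
  fixes h :: "nat \<Rightarrow> 'v \<Rightarrow> 'w" and k :: "nat \<Rightarrow> 'w \<Rightarrow> 'v"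
  assumes h: "\<And>n v. v \<in> carrier (H n) \<Longrightarrow> h n v \<in> carrier (K n)"
    and k: "\<And>n w. w \<in> carrier (K n) \<Longrightarrow> k n w \<in> carrier (H n)"
    and kh: "\<And>n v. v \<in> carrier (H n) \<Longrightarrow> k n (h n v) = v" and hk: "\<And>n w. w \<in> carrier (K n) \<Longrightarrow> h n (k n w) = w"
    and zero: "\<And>n. h n \<zero>\<^bsub>H n\<^esub> = \<zero>\<^bsub>K n\<^esub>" and kz: "\<And>n. k n \<zero>\<^bsub>K n\<^esub> = \<zero>\<^bsub>H n\<^esub>"
    and add: "\<And>n v w. v \<in> carrier (H n) \<Longrightarrow> w \<in> carrier (H n) \<Longrightarrow> h n (v \<oplus>\<^bsub>H n\<^esub> w) = h n v \<oplus>\<^bsub>K n\<^esub> h n w"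
    and smult: "\<And>n z v. v \<in> carrier (H n) \<Longrightarrow> h n (z \<odot>\<^bsub>H n\<^esub> v) = z \<odot>\<^bsub>K n\<^esub> h n v"
  shows "(\<lambda>x n. h n (x n)) \<in> graded_iso H K"
proof -
  have incl: "(\<lambda>n. h n (graded_incl H m v n)) = graded_incl K m (h m v)" for m v
    by (auto simp: graded_incl_def zero)
  have bij: "bij_betw (\<lambda>x n. h n (x n)) (carrier (graded_sum H)) (carrier (graded_sum K))"
  proof (rule bij_betw_byWitness[where f' = "\<lambda>x n. k n (x n)"])
    show "(\<lambda>x n. h n (x n)) ` carrier (graded_sum H) \<subseteq> carrier (graded_sum K)"
    proof
      fix y assume "y \<in> (\<lambda>x n. h n (x n)) ` carrier (graded_sum H)"
      then obtain x where x: "y = (\<lambda>n. h n (x n))" "\<And>n. x n \<in> carrier (H n)" "finite {n. x n \<noteq> \<zero>\<^bsub>H n\<^esub>}"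
        by (auto simp: graded_sum_def)
      have "{n. y n \<noteq> \<zero>\<^bsub>K n\<^esub>} \<subseteq> {n. x n \<noteq> \<zero>\<^bsub>H n\<^esub>}" using zero by (auto simp: x(1))
      then show "y \<in> carrier (graded_sum K)" using x h finite_subset by (auto simp: graded_sum_def)
    qed
    show "(\<lambda>x n. k n (x n)) ` carrier (graded_sum K) \<subseteq> carrier (graded_sum H)"
    proof
      fix y assume "y \<in> (\<lambda>x n. k n (x n)) ` carrier (graded_sum K)"
      then obtain x where x: "y = (\<lambda>n. k n (x n))" "\<And>n. x n \<in> carrier (K n)" "finite {n. x n \<noteq> \<zero>\<^bsub>K n\<^esub>}"
        by (auto simp: graded_sum_def)
      have "{n. y n \<noteq> \<zero>\<^bsub>H n\<^esub>} \<subseteq> {n. x n \<noteq> \<zero>\<^bsub>K n\<^esub>}" using kz by (auto simp: x(1))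
      then show "y \<in> carrier (graded_sum H)" using x k finite_subset by (auto simp: graded_sum_def)
    qed
  qed (auto simp: graded_sum_def kh hk)
  have "(\<lambda>x n. h n (x n)) ` graded_incl H m ` carrier (H m) = graded_incl K m ` carrier (K m)" for m
  proof -
    have "h m ` carrier (H m) = carrier (K m)"
    proof (intro equalityI subsetI)
      fix w assume "w \<in> carrier (K m)"
      then show "w \<in> h m ` carrier (H m)" using hk k by (metis imageI)
    qed (use h in auto)
    then have "graded_incl K m ` carrier (K m) = (\<lambda>v. graded_incl K m (h m v)) ` carrier (H m)"
      by (simp add: image_image[symmetric])
    then show ?thesis by (simp add: image_image incl)
  qed
  then show ?thesis
    using bij add smult by (auto simp: graded_iso_def graded_sum_def)
qed

section \<open>The isomorphism of graded cohomology induced by a global flat lift\<close>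

theorem theorem1:
  fixes M :: "('a, 'e::{real_inner,banach}) mfd"
    and \<omega> :: "'a form2"
    and P :: "'a \<Rightarrow> 'a tvec set"
    and \<Phi> :: "'a \<Rightarrow> 'a"
    and L :: "('l, 'f::{real_inner,banach}, 'a) lbundle"
    and h :: "'l \<Rightarrow> 'l \<Rightarrow> complex"
    and D :: "('a, 'l) conn"
  assumes "symplectic_manifold M \<omega>"
    and "polarization M \<omega> P"
    and "symplectomorphism M \<omega> \<Phi>"
    and "prequantum_line_bundle M \<omega> L h D"
    and "carrier (cech_group (mtop M) (locally_constant_units (mtop M)) 1) =
           {\<one>\<^bsub>cech_group (mtop M) (locally_constant_units (mtop M)) 1\<^esub>}"
  shows "induces_isomorphism M L P D \<Phi>"
proof -
  have SM: "smooth_manifold M" using assms(1) by (simp add: symplectic_manifold_def)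
  have M: "smooth_atlas M" by (rule smooth_manifold_imp_atlas[OF SM])
  have L: "complex_line_bundle M L" and D: "connection M L D" and \<omega>: "has_curvature M L D \<omega>"
    using assms(4) by (auto simp: prequantum_line_bundle_def)
  have \<Phi>: "diffeo M M \<Phi>" using assms(3) by (simp add: symplectomorphism_def)
  have symp: "\<omega> (\<Phi> x) (tangent_map M M \<Phi> x v) (tangent_map M M \<Phi> x w) = \<omega> x v w"
    if "x \<in> points M" "v \<in> tangent_space M x" "w \<in> tangent_space M x" for x v w
    using assms(3) that by (simp add: symplectomorphism_def)
  have loc: "\<exists>U F. openin (mtop M) U \<and> x \<in> U \<and> flat_lift M L D \<Phi> U F" if x: "x \<in> points M" for x
  proof (rule flat_lift_exists[OF M L D \<Phi> \<omega> _ x])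
    show "\<omega> (\<Phi> y) (tangent_map M M \<Phi> y v) (tangent_map M M \<Phi> y w) = \<omega> y v w"
      if "y \<in> points M" "v \<in> tangent_space M y" "w \<in> tangent_space M y" for y v w
      by (rule symp[OF that])
  qed (intro exI conjI)
  obtain F where F: "flat_lift M L D \<Phi> (points M) F"
    by (rule flat_lift_glue[OF M L D \<Phi> assms(5)]) (rule loc, assumption, rule that)
  have P: "P x \<subseteq> tangent_space M x" "(\<lambda>f. 0) \<in> P x"
    "\<And>v w a b. v \<in> P x \<Longrightarrow> w \<in> P x \<Longrightarrow> (\<lambda>f. a * v f + b * w f) \<in> P x" if "x \<in> points M" for x
    using assms(2)[unfolded polarization_def, THEN conjunct1, THEN bspec, OF that] by blast+
  have Pa: "(\<lambda>f. a * v f) \<in> P x" if "x \<in> points M" "v \<in> P x" for x v a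
    using P(3)[OF that(1) that(2) that(2), of a 0] by simp
  let ?P = "pullback_polarization M \<Phi> P" and ?T = "mtop M"
  let ?G = "\<lambda>U. add_monoid (cov_const_sections M L P D U)" and ?H = "\<lambda>U. add_monoid (cov_const_sections M L ?P D U)"
  \<comment> \<open>\<open>sect_push\<close> is indexed by the set over which its result lives;
    ?\<theta>' reindexes it by the set over which its argument lives, as \<open>cech_iso\<close>
    expects.\<close>
  let ?p = "preim M \<Phi>" and ?q = "(`) \<Phi>" and ?\<theta> = "sect_pull M L \<Phi> F" and ?\<theta>' = "\<lambda>V. sect_push M \<Phi> F (\<Phi> ` V)"
  note cc = cov_const_sections_iff[THEN iffD1, THEN conjunct1]
  have sub: "U \<subseteq> points M" if "openin ?T U" for U using that openin_subset by blast
  have G: "cech_presheaf ?T ?G"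
  proof (rule cech_presheaf.intro)
    fix U assume U: "openin ?T U"
    show "comm_group (?G U)" by (rule abelian_group.a_comm_group[OF cov_const_abelian_group[OF M L D U]])
  next
    fix U V s assume "openin ?T U" "openin ?T V" "V \<subseteq> U" "s \<in> carrier (?G U)"
    then show "restrict s V \<in> carrier (?G V)"
      using cov_const_restrict[OF M L D SM Pa P(2)] by simp
  qed
  have H: "cech_presheaf ?T ?H"
  proof (rule cech_presheaf.intro)
    fix U assume U: "openin ?T U"
    show "comm_group (?H U)" by (rule abelian_group.a_comm_group[OF cov_const_abelian_group[OF M L D U]])
  next
    fix U V s assume U: "openin ?T U" and V: "openin ?T V" "V \<subseteq> U" and "s \<in> carrier (?H U)"
    then have s: "s \<in> carrier (cov_const_sections M L ?P D U)" by simp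
    \<comment> \<open>The pointwise conditions for restricting covariantly constant sections are at
      hand for \<open>P\<close>. For the pulled-back polarization the section is pushed forward,
      restricted there and pulled back again.\<close>
    have "restrict (sect_push M \<Phi> F (\<Phi> ` U) s) (\<Phi> ` V) \<in> carrier (cov_const_sections M L P D (\<Phi> ` V))"
      by (rule cov_const_restrict[OF M L D SM Pa P(2) openin_image[OF M \<Phi> U] openin_image[OF M \<Phi> V(1)] _
            sect_push_cov_const[OF M L D \<Phi> F P(1) U s]]) (use V in auto)
    then have "sect_push M \<Phi> F (\<Phi> ` V) (restrict s V) \<in> carrier (cov_const_sections M L P D (\<Phi> ` V))"
      by (simp add: sect_push_restrict[OF M L D \<Phi> V(2) sub[OF U]])
    from sect_pull_cov_const[OF M L D \<Phi> F P(1) openin_image[OF M \<Phi> V(1)] this]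
    show "restrict s V \<in> carrier (?H V)"
      by (simp add: preim_image[OF M \<Phi> sub[OF V(1)]]
          pull_push[OF M L D \<Phi> F P(1) V(1) section_restrict[OF M L cc[OF s] U V]])
  qed
  interpret I: cech_iso ?T ?G ?T ?H ?p ?q ?\<theta> ?\<theta>'
  proof (intro cech_iso.intro cech_transport.intro cech_transport_axioms.intro cech_iso_axioms.intro G H)
    fix U assume U: "openin ?T U"
    show "openin ?T (?p U)" by (rule openin_preim[OF M \<Phi> U])
    show "openin ?T (?q U)" by (rule openin_image[OF M \<Phi> U])
    show "?q (?p U) = U" by (rule image_preim[OF M \<Phi> sub[OF U]])
    show "?p (?q U) = U" by (rule preim_image[OF M \<Phi> sub[OF U]])
    show "?\<theta> U \<in> hom (?G U) (?H (?p U))"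
      by (rule homI) (auto simp: sect_pull_cov_const[OF M L D \<Phi> F P(1) U]
          intro!: sect_pull_linear(1)[OF M L D \<Phi> F P(1) U] dest: cc)
    show "?\<theta>' U \<in> hom (?H U) (?G (?q U))"
      by (rule homI) (auto simp: sect_push_cov_const[OF M L D \<Phi> F P(1) U]
          intro!: sect_push_linear(1)[OF M L D \<Phi> F P(1) U] dest: cc)
    show "?\<theta>' (?p U) (?\<theta> U s) = s" if "s \<in> carrier (?G U)" for s
      using push_pull[OF M L D \<Phi> F P(1) U cc, of s] that by (simp add: image_preim[OF M \<Phi> sub[OF U]])
    show "?\<theta> (?q U) (?\<theta>' U t) = t" if "t \<in> carrier (?H U)" for t
      using pull_push[OF M L D \<Phi> F P(1) U cc, of t] that by simp
  next
    show "?p (topspace ?T) = topspace ?T" using diffeo_in_points[OF M \<Phi>] by (auto simp: preim_def)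
    show "?q (topspace ?T) = topspace ?T" using \<Phi> by (simp add: diffeo_def bij_betw_def)
  next
    fix \<U> :: "'a set set" assume ne: "\<U> \<noteq> {}" and o: "\<And>U. U \<in> \<U> \<Longrightarrow> openin ?T U"
    show "?p (\<Inter>\<U>) = \<Inter>(?p ` \<U>)" using ne by (auto simp: preim_def)
    \<comment> \<open>Images commute with intersections because \<Phi> is injective: a point in all
      the images has the same preimage in every member.\<close>
    show "?q (\<Inter>\<U>) = \<Inter>(?q ` \<U>)"
    proof (intro equalityI subsetI)
      fix y assume y: "y \<in> \<Inter>(?q ` \<U>)"
      obtain U0 where U0: "U0 \<in> \<U>" using ne by blast
      obtain x where x: "x \<in> U0" "y = \<Phi> x" using y U0 by blast
      have "x \<in> U" if U: "U \<in> \<U>" for U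
      proof -
        obtain x' where x': "x' \<in> U" "y = \<Phi> x'" using y U by blast
        have "x \<in> points M" "x' \<in> points M" using sub[OF o] x(1) x'(1) U U0 by blast+
        then have "x = x'" using diffeo_inv_left[OF M \<Phi>] x(2) x'(2) by metis
        then show ?thesis using x'(1) by simp
      qed
      then show "y \<in> ?q (\<Inter>\<U>)" using x(2) by blast
    qed blast
  next
    fix U V :: "'a set" and s assume UV: "openin ?T U" "openin ?T V" "V \<subseteq> U"
    show "?\<theta> V (restrict s V) = restrict (?\<theta> U s) (?p V)" by (rule sect_pull_restrict[OF M L D \<Phi> F P(1) UV(3)])
    show "?\<theta>' V (restrict s V) = restrict (?\<theta>' U s) (?q V)"
      by (rule sect_push_restrict[OF M L D \<Phi> UV(3) sub[OF UV(1)], symmetric])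
  qed (auto simp: preim_def)
  let ?Q = "sheaf_quantization M L P D" and ?Q' = "sheaf_quantization M L ?P D"
  have ops: "carrier (sheaf_quantization M L P D n) = carrier (cech_group ?T (\<lambda>U. add_monoid (cov_const_sections M L P D U)) n)"
    "zero (sheaf_quantization M L P D n) = one (cech_group ?T (\<lambda>U. add_monoid (cov_const_sections M L P D U)) n)"
    "add (sheaf_quantization M L P D n) = monoid.mult (cech_group ?T (\<lambda>U. add_monoid (cov_const_sections M L P D U)) n)"
    "smult (sheaf_quantization M L P D n) = (\<lambda>z A. \<Union>{cech_class ?T (\<lambda>U. add_monoid (cov_const_sections M L P D U)) n
        (\<U>, \<lambda>Us\<in>cech_index n \<U>. z \<odot>\<^bsub>cov_const_sections M L P D (\<Inter>(set Us))\<^esub> c Us) | \<U> c. (\<U>, c) \<in> A})" for n P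
    by (simp_all add: sheaf_quantization_def cech_module_def Let_def)
  have sm: "(`) (cech_pull ?p ?q ?\<theta> n) (z \<odot>\<^bsub>?Q n\<^esub> X) = z \<odot>\<^bsub>?Q' n\<^esub> (`) (cech_pull ?p ?q ?\<theta> n) X"
    if X: "X \<in> carrier (?Q n)" for n z X
    unfolding ops(4)
  proof (rule I.fwd_smult[OF X[unfolded ops(1)], where a = "\<lambda>U s. z \<odot>\<^bsub>cov_const_sections M L P D U\<^esub> s"
        and b = "\<lambda>U s. z \<odot>\<^bsub>cov_const_sections M L ?P D U\<^esub> s"])
    fix U s assume U: "openin ?T U" and "s \<in> carrier (?G U)"
    then have s: "s \<in> carrier (cov_const_sections M L P D U)" by simp
    show "z \<odot>\<^bsub>cov_const_sections M L P D U\<^esub> s \<in> carrier (?G U)"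
      using cov_const_smult_closed[OF M L D U cc[OF s], of P z] s by (simp add: cov_const_sections_iff)
    show "?\<theta> U (z \<odot>\<^bsub>cov_const_sections M L P D U\<^esub> s) = z \<odot>\<^bsub>cov_const_sections M L ?P D (?p U)\<^esub> ?\<theta> U s"
      using sect_pull_linear(2)[OF M L D \<Phi> F P(1) U cc[OF s] cc[OF s]] by simp
  qed
  have iso: "(\<lambda>x n. (`) (cech_pull ?p ?q ?\<theta> n) (x n)) \<in> graded_iso ?Q ?Q'"
    by (rule graded_isoI[where k = "\<lambda>n. (`) (cech_pull ?q ?p ?\<theta>' n)"])
      (erule sm | simp only: ops(1-3) I.fwd_carrier I.inv.fwd_carrier I.fwd_one I.inv.fwd_one I.fwd_mult)+
  \<comment> \<open>A class concentrated in degree \<open>m\<close> stays concentrated there, since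
    the zero classes in the other degrees are sent to zero classes.\<close>
  have incl: "(\<lambda>n. (`) (cech_pull ?p ?q ?\<theta> n) (graded_incl ?Q m v n)) = graded_incl ?Q' m (cech_pull ?p ?q ?\<theta> m ` v)"
    for m v
    unfolding graded_incl_def ops(2) fun_upd_def
    by (rule ext) (simp only: I.fwd_one split: if_split, simp)
  have on_classes: "(\<lambda>m. (`) (cech_pull ?p ?q ?\<theta> m) (quantization_class M L P D n z m)) =
      quantization_class M L ?P D n (cochain_pull M L \<Phi> F n z)"
    if z: "z \<in> cech_cocycles ?T ?G n" for n z
  proof -
    obtain \<U> c where Uc: "z = (\<U>, c)" by force
    have "open_cover ?T \<U>" "c \<in> cech_cochains ?G n \<U>" using z by (auto simp: Uc cech_cocycles_def)
    then show ?thesis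
      unfolding quantization_class_def incl cochain_pull_eq Uc by (simp only: I.fwd_class)
  qed
  show ?thesis
    unfolding induces_isomorphism_def
    by (intro exI[of _ F] conjI bexI[OF _ iso] allI ballI flat_lift_bundle_lift[OF M L D \<Phi> F]
        flat_lift_same_connection[OF M L D \<Phi> F]) (rule on_classes)
qed

end
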